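(* Let $p=p_n$ be a sequence of dimensions with $n>p+1$ for all $n\ge 3$ and $n-p\to\infty$ as $n\to\infty$. Consider any one of the three likelihood ratio tests (I), (II), (III) described in the context, with its statistic $\Lambda_n$, degrees of freedom $f$ and Bartlett factor $\rho$. Under its null hypothesis $H_0$, as $n\to\infty$: (i) $\displaystyle \sup_{\alpha\in(0,1)}\bigl|\Pr\{-2\log\Lambda_n>\chi^2_f(\alpha)\}-\alpha\bigr|\to 0$ if and only if $p/n^{d_1}\to 0$; (ii) $\displaystyle \sup_{\alpha\in(0,1)}\bigl|\Pr\{-2\rho\log\Lambda_n>\chi^2_f(\alpha)\}-\alpha\bigr|\to 0$ if and only if $p/n^{d_2}\to 0$; where $d_1=2/3,\ d_2=4/5$ for test (I); $d_1=1/2,\ d_2=2/3$ for test (II); and $d_1=1/2,\ d_2=2/3$ for test (III).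
   Context: $x_1,\dots,x_n\in\mathbb{R}^p$ are i.i.d. $\mathcal N_p(\mu,\Sigma)$, where $p$ may depend on $n$. Put $\bar x=n^{-1}\sum_{i=1}^n x_i$ and $A=\sum_{i=1}^n(x_i-\bar x)(x_i-\bar x)^{T}$; $|\cdot|$ is the determinant, $\mathrm{tr}$ the trace, $I_p$ the identity matrix. $\chi^2_f(\alpha)$ denotes the upper $\alpha$-quantile of the chi-squared distribution with $f$ degrees of freedom, i.e. $\Pr\{\chi^2_f>\chi^2_f(\alpha)\}=\alpha$. Test (I) (mean vector): $H_0:\mu=0$ ($\Sigma$ unspecified); $\Lambda_n=|A|^{n/2}\,|A+n\bar x\bar x^{T}|^{-n/2}$; $f=p$; $\rho=1-(1+p/2)/n$. Test (II) (sphericity): $H_0:\Sigma=\lambda I_p$ with $\lambda>0$ unspecified ($\mu$ unspecified); $\Lambda_n=|A|^{(n-1)/2}\{\mathrm{tr}(A)/p\}^{-p(n-1)/2}$; $f=(p-1)(p+2)/2$; $\rho=1-\{6(n-1)p\}^{-1}(2p^2+p+2)$. (Here $p\ge2$, so that $f\ge1$.) Test (III) (joint mean and covariance): $H_0:\mu=0$ and $\Sigma=I_p$; $\Lambda_n=(e/n)^{np/2}|A|^{n/2}\exp\{-\mathrm{tr}(A)/2-n\bar x^{T}\bar x/2\}$; $f=p(p+3)/2$; $\rho=1-\{6n(p+3)\}^{-1}(2p^2+9p+11)$. *)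

theory Defs
  imports
    "HOL-Probability.Probability"
    "Jordan_Normal_Form.Determinant"
    "Jordan_Normal_Form.Gauss_Jordan_Elimination"
begin

hide_const (open) Determinants.det Finite_Cartesian_Product.mat Finite_Cartesian_Product.vec
unbundle no vec_syntax
unbundle no inner_syntax

section \<open>The chi-squared distribution and its upper quantiles\<close>

definition chi_square_density :: "real \<Rightarrow> real \<Rightarrow> real" where
  "chi_square_density f x =
     (if x \<le> 0 then 0
      else x powr (f / 2 - 1) * exp (- x / 2) / (2 powr (f / 2) * Gamma (f / 2)))"

definition chi_square :: "real \<Rightarrow> real measure" where
  "chi_square f = density lborel (\<lambda>x. ennreal (chi_square_density f x))"

definition chi_square_upper_quantile :: "real \<Rightarrow> real \<Rightarrow> real" where
  "chi_square_upper_quantile f \<alpha> = (THE x. measure (chi_square f) {x<..} = \<alpha>)"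

lemma chi_square_density_nonneg: "f > 0 \<Longrightarrow> chi_square_density f x \<ge> 0"
  by (auto simp: chi_square_density_def intro!: divide_nonneg_nonneg mult_nonneg_nonneg less_imp_le[OF Gamma_real_pos])

lemma chi_square_density_pos: "f > 0 \<Longrightarrow> x > 0 \<Longrightarrow> chi_square_density f x > 0"
  by (auto simp: chi_square_density_def intro!: divide_pos_pos mult_pos_pos Gamma_real_pos)

lemma borel_measurable_chi_square_density [measurable]: "chi_square_density f \<in> borel_measurable borel"
  unfolding chi_square_density_def by measurable

lemma prob_space_chi_square:
  assumes "f > 0" shows "prob_space (chi_square f)"
proof
  define s where "s = f / 2"
  have s: "s > 0" using assms by (simp add: s_def)
  have G: "Gamma s > 0" using s by (rule Gamma_real_pos)
  have "emeasure (chi_square f) (space (chi_square f)) = (\<integral>\<^sup>+x. ennreal (chi_square_density f x) \<partial>lborel)"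
    unfolding chi_square_def by (subst emeasure_density) (auto intro!: nn_integral_cong)
  also have "\<dots> = ennreal 2 * (\<integral>\<^sup>+x. ennreal (chi_square_density f (0 + 2 * x)) \<partial>lborel)"
    by (subst nn_integral_real_affine[where c = 2 and t = 0]) auto
  also have "(\<integral>\<^sup>+x. ennreal (chi_square_density f (0 + 2 * x)) \<partial>lborel)
      = (\<integral>\<^sup>+x. ennreal (1 / (2 * Gamma s)) * ennreal (indicator {0..} x * x powr (s - 1) / exp x) \<partial>lborel)"
  proof (rule nn_integral_cong)
    fix x :: real
    have "chi_square_density f (0 + 2 * x) = 1 / (2 * Gamma s) * (indicator {0..} x * x powr (s - 1) / exp x)"
    proof (cases "x > 0")
      case True
      have "(2 * x) powr (s - 1) = 2 powr s / 2 * x powr (s - 1)"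
        using True by (simp add: powr_mult powr_diff)
      then show ?thesis using True G
        by (simp add: chi_square_density_def s_def[symmetric] exp_minus field_simps)
    next
      case False
      then show ?thesis by (auto simp: chi_square_density_def indicator_def)
    qed
    then show "ennreal (chi_square_density f (0 + 2 * x)) =
        ennreal (1 / (2 * Gamma s)) * ennreal (indicator {0..} x * x powr (s - 1) / exp x)"
      using G by (metis ennreal_mult' divide_nonneg_pos zero_le_one mult_pos_pos zero_less_numeral)
  qed
  also have "\<dots> = ennreal (1 / (2 * Gamma s)) * ennreal (Gamma s)"
    by (subst nn_integral_cmult) (auto simp: Gamma_conv_nn_integral_real[OF s])
  also have "ennreal 2 * (ennreal (1 / (2 * Gamma s)) * ennreal (Gamma s)) = 1"
  proof -
    have "ennreal (1 / (2 * Gamma s)) * ennreal (Gamma s) = ennreal (1 / 2)"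
      using G by (subst ennreal_mult[symmetric]) auto
    moreover have "ennreal 2 * ennreal (1 / 2) = 1"
      by (subst ennreal_mult[symmetric]) auto
    ultimately show ?thesis by simp
  qed
  finally show "emeasure (chi_square f) (space (chi_square f)) = 1" .
qed

lemma chi_square_upper_quantile:
  assumes f: "f > 0" and \<alpha>: "0 < \<alpha>" "\<alpha> < 1"
  shows "measure (chi_square f) {chi_square_upper_quantile f \<alpha><..} = \<alpha>"
proof -
  interpret prob_space "chi_square f" by (rule prob_space_chi_square[OF f])
  interpret real_distribution "chi_square f"
    by (rule real_distribution.intro[OF prob_space_axioms])
       (auto simp: real_distribution_axioms_def chi_square_def)
  let ?N = "chi_square f"
  have sing: "measure ?N {x} = 0" for x
  proof -
    have "emeasure ?N {x} = 0"
      unfolding chi_square_def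
      by (subst emeasure_density) (auto intro!: nn_integral_null_set[of "{x}" lborel, simplified] simp: mult.commute)
    then show ?thesis by (simp add: measure_def)
  qed
  have compl: "measure ?N {x<..} = 1 - cdf ?N x" for x
  proof -
    have "measure ?N {x<..} = measure ?N (space ?N - {..x})"
      by (rule arg_cong[where f = "measure ?N"]) (auto simp: chi_square_def)
    also have "\<dots> = 1 - measure ?N {..x}"
      by (rule prob_compl) (auto simp: chi_square_def)
    finally show ?thesis by (simp add: cdf_def)
  qed
  have cont: "isCont (cdf ?N) x" for x
    using isCont_cdf sing by blast
  have ex: "\<exists>x. cdf ?N x = 1 - \<alpha>"
  proof -
    from cdf_lim_at_bot have "\<forall>\<^sub>F x in at_bot. cdf ?N x < 1 - \<alpha>"
      using \<alpha> by (intro order_tendstoD(2)) auto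
    then obtain a where a: "cdf ?N a < 1 - \<alpha>"
      using eventually_happens'[OF trivial_limit_at_bot_linorder] by blast
    from cdf_lim_at_top_prob have "\<forall>\<^sub>F x in at_top. cdf ?N x > 1 - \<alpha>"
      using \<alpha> by (intro order_tendstoD(1)) auto
    then obtain b where b: "cdf ?N b > 1 - \<alpha>"
      using eventually_happens'[OF trivial_limit_at_top_linorder] by blast
    have "a \<le> b" using a b cdf_nondecreasing[of b a] by (cases "a \<le> b") auto
    then show ?thesis using IVT[of "cdf ?N" a "1 - \<alpha>" b] a b cont by auto
  qed
  have zero: "cdf ?N x = 0" if "x \<le> 0" for x
  proof -
    have "emeasure ?N {..x} = (\<integral>\<^sup>+y. ennreal (chi_square_density f y) * indicator {..x} y \<partial>lborel)"
      unfolding chi_square_def by (subst emeasure_density) auto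
    also have "\<dots> = (\<integral>\<^sup>+(y::real). 0 \<partial>lborel)"
      using that by (intro nn_integral_cong) (auto simp: chi_square_density_def indicator_def)
    finally have "emeasure ?N {..x} = 0" by simp
    then show ?thesis by (simp add: cdf_def measure_def)
  qed
  have strict: "cdf ?N x < cdf ?N y" if "0 < x" "x < y" for x y
  proof -
    have "emeasure ?N {x<..y} \<noteq> 0"
    proof
      assume "emeasure ?N {x<..y} = 0"
      then have "AE z in lborel. ennreal (chi_square_density f z) * indicator {x<..y} z = 0"
        unfolding chi_square_def by (subst (asm) emeasure_density) (auto simp: nn_integral_0_iff_AE)
      then have "AE z in lborel. z \<notin> {x<..y}"
      proof eventually_elim
        case (elim z)
        show ?case
        proof
          assume z: "z \<in> {x<..y}"
          with chi_square_density_pos[OF f, of z] that elim show False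
            by (auto simp: indicator_def)
        qed
      qed
      then have "emeasure lborel {x<..y} = 0"
        by (subst AE_iff_measurable[symmetric, where P = "\<lambda>z. z \<notin> {x<..y}"]) auto
      with that show False by simp
    qed
    then have "measure ?N {x<..y} > 0"
      by (simp add: emeasure_eq_measure zero_less_measure_iff)
    with cdf_diff_eq[of x y] that show ?thesis by simp
  qed
  from ex obtain x where x: "cdf ?N x = 1 - \<alpha>" by blast
  have "measure ?N {THE x. measure ?N {x<..} = \<alpha> <..} = \<alpha>"
  proof (rule theI)
    show "measure ?N {x<..} = \<alpha>" by (simp add: compl x)
    fix y assume "measure ?N {y<..} = \<alpha>"
    then have y: "cdf ?N y = 1 - \<alpha>" by (simp add: compl)
    have "x > 0" "y > 0" using zero[of x] zero[of y] x y \<alpha> by fastforce+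
    then show "y = x" using strict[of x y] strict[of y x] x y by (cases x y rule: linorder_cases) auto
  qed
  then show ?thesis by (simp add: chi_square_upper_quantile_def)
qed

section \<open>Samples from the non-degenerate multivariate normal distribution\<close>

definition positive_definite_mat :: "nat \<Rightarrow> real mat \<Rightarrow> bool" where
  "positive_definite_mat p S \<longleftrightarrow>
     S \<in> carrier_mat p p \<and> transpose_mat S = S \<and>
     (\<forall>v \<in> carrier_vec p. v \<noteq> 0\<^sub>v p \<longrightarrow> v \<bullet> (S *\<^sub>v v) > 0)"

text \<open>
  Since the dimension varies, a point of $p$-dimensional space is a function on the index set
  \<open>{..<p}\<close>, Lebesgue measure is the product measure \<open>\<Pi>\<^sub>M j\<in>{..<p}. lborel\<close>, and
  \<open>vec p x\<close> is the corresponding vector. \<open>mat_inverse S\<close> is \<open>Some\<close> of the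
  inverse whenever \<open>S\<close> is invertible.
\<close>

definition mvn_density :: "nat \<Rightarrow> real vec \<Rightarrow> real mat \<Rightarrow> (nat \<Rightarrow> real) \<Rightarrow> real" where
  "mvn_density p \<mu> S x =
     exp (- ((vec p x - \<mu>) \<bullet> (the (mat_inverse S) *\<^sub>v (vec p x - \<mu>))) / 2)
       / sqrt ((2 * pi) ^ p * det S)"

definition mvn_sample ::
  "'w measure \<Rightarrow> nat \<Rightarrow> nat \<Rightarrow> real vec \<Rightarrow> real mat \<Rightarrow> (nat \<Rightarrow> 'w \<Rightarrow> nat \<Rightarrow> real) \<Rightarrow> bool" where
  "mvn_sample M n p \<mu> S X \<longleftrightarrow>
     prob_space M \<and>
     prob_space.indep_vars M (\<lambda>_. \<Pi>\<^sub>M j\<in>{..<p}. borel) X {1..n} \<and>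
     (\<forall>i\<in>{1..n}. distributed M (\<Pi>\<^sub>M j\<in>{..<p}. lborel) (X i) (\<lambda>x. ennreal (mvn_density p \<mu> S x)))"

section \<open>The likelihood ratio tests\<close>

text \<open>Below \<open>x i j\<close> is the \<open>j\<close>-th coordinate (\<open>j < p\<close>) of the \<open>i\<close>-th observation (\<open>1 \<le> i \<le> n\<close>).\<close>

definition sample_mean :: "nat \<Rightarrow> nat \<Rightarrow> (nat \<Rightarrow> nat \<Rightarrow> real) \<Rightarrow> real vec" where
  "sample_mean n p x = vec p (\<lambda>j. (\<Sum>i=1..n. x i j) / real n)"

definition outer_prod :: "real vec \<Rightarrow> real vec \<Rightarrow> real mat" where
  "outer_prod u v = mat (dim_vec u) (dim_vec v) (\<lambda>(j, k). u $ j * v $ k)"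

definition scatter_mat :: "nat \<Rightarrow> nat \<Rightarrow> (nat \<Rightarrow> nat \<Rightarrow> real) \<Rightarrow> real mat" where
  "scatter_mat n p x =
     mat p p (\<lambda>(j, k). \<Sum>i=1..n.
       outer_prod (vec p (x i) - sample_mean n p x) (vec p (x i) - sample_mean n p x) $$ (j, k))"

definition trace_mat :: "real mat \<Rightarrow> real" where
  "trace_mat S = (\<Sum>j<dim_row S. S $$ (j, j))"

text \<open>
  The sample enters \<open>lrt_stat\<close> through \<open>det A\<close>, which is almost surely positive for
  \<open>n > p\<close>; the conventions \<open>0 powr a = 0\<close> and \<open>ln 0 = 0\<close> matter on a null set only.
\<close>

datatype lrt = Mean_Test | Sphericity_Test | Mean_Cov_Test

fun lrt_null :: "lrt \<Rightarrow> nat \<Rightarrow> real vec \<Rightarrow> real mat \<Rightarrow> bool" where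
  "lrt_null Mean_Test p \<mu> S \<longleftrightarrow> \<mu> = 0\<^sub>v p \<and> positive_definite_mat p S"
| "lrt_null Sphericity_Test p \<mu> S \<longleftrightarrow> \<mu> \<in> carrier_vec p \<and> (\<exists>c>0. S = c \<cdot>\<^sub>m 1\<^sub>m p)"
| "lrt_null Mean_Cov_Test p \<mu> S \<longleftrightarrow> \<mu> = 0\<^sub>v p \<and> S = 1\<^sub>m p"

fun lrt_stat :: "lrt \<Rightarrow> nat \<Rightarrow> nat \<Rightarrow> (nat \<Rightarrow> nat \<Rightarrow> real) \<Rightarrow> real" where
  "lrt_stat Mean_Test n p x =
     (let A = scatter_mat n p x; m = sample_mean n p x in
       det A powr (real n / 2) * det (A + real n \<cdot>\<^sub>m outer_prod m m) powr (- real n / 2))"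
| "lrt_stat Sphericity_Test n p x =
     (let A = scatter_mat n p x in
       det A powr ((real n - 1) / 2)
         * (trace_mat A / real p) powr (- (real p * (real n - 1)) / 2))"
| "lrt_stat Mean_Cov_Test n p x =
     (let A = scatter_mat n p x; m = sample_mean n p x in
       (exp 1 / real n) powr (real n * real p / 2) * det A powr (real n / 2)
         * exp (- trace_mat A / 2 - real n * (m \<bullet> m) / 2))"

fun lrt_df :: "lrt \<Rightarrow> nat \<Rightarrow> real" where
  "lrt_df Mean_Test p = real p"
| "lrt_df Sphericity_Test p = (real p - 1) * (real p + 2) / 2"
| "lrt_df Mean_Cov_Test p = real p * (real p + 3) / 2"

fun bartlett_factor :: "lrt \<Rightarrow> nat \<Rightarrow> nat \<Rightarrow> real" where
  "bartlett_factor Mean_Test n p = 1 - (1 + real p / 2) / real n"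
| "bartlett_factor Sphericity_Test n p =
     1 - (2 * real p ^ 2 + real p + 2) / (6 * (real n - 1) * real p)"
| "bartlett_factor Mean_Cov_Test n p =
     1 - (2 * real p ^ 2 + 9 * real p + 11) / (6 * real n * (real p + 3))"

fun wilks_exponent :: "lrt \<Rightarrow> real" where
  "wilks_exponent Mean_Test = 2 / 3"
| "wilks_exponent Sphericity_Test = 1 / 2"
| "wilks_exponent Mean_Cov_Test = 1 / 2"

fun bartlett_exponent :: "lrt \<Rightarrow> real" where
  "bartlett_exponent Mean_Test = 4 / 5"
| "bartlett_exponent Sphericity_Test = 2 / 3"
| "bartlett_exponent Mean_Cov_Test = 2 / 3"

end

theory Submission
 imports Defs
begin

text \<open>Under the null hypothesis each statistic is distribution-free: whitening, Householder reflections and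
  the Bartlett decomposition of a Gaussian matrix express \<open>- 2 ln \<Lambda>\<^sub>n\<close> through independent chi-squared
  variables \<open>x\<^sub>j\<close> with \<open>n - p + j\<close> degrees of freedom, \<open>j < p\<close>, and one more variable \<open>w\<close>. Size-biasing the
  chi-squared law gives every positive and negative moment needed, and hence the mean up to an error
  negligible against \<open>sqrt f\<close>, together with variance bounds. If the supremum tends to zero, a comparison of
  truncated means forces the shift of the mean from \<open>f\<close> to be \<open>o(sqrt f)\<close>, which is the growth condition on
  \<open>p\<close>. Conversely the statistic is coupled with a chi-squared variable: by means of second moments when \<open>p\<close> is
  large, and for each fixed \<open>p\<close> by the central limit theorem and Skorohod's representation; an
  anticoncentration bound turns closeness in probability into uniform closeness of the tails.\<close>

text \<open>The exponents come from comparing the shift of the mean with the standard deviation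
  \<open>sqrt (2 f)\<close>. For test (I) and \<open>p\<close> small against \<open>n\<close> the
  mean exceeds \<open>p\<close> by about \<open>p^2 / (2 n)\<close>; against \<open>sqrt p\<close>
  this asks for \<open>p^3 / n^2\<close> to vanish. Bartlett's factor cancels that term and leaves
  about \<open>p^3 / (12 n^2)\<close>, whence \<open>p^5 / n^4\<close>. For (II) and (III) the scale
  is \<open>p\<close> and the shift about \<open>p^3 / (6 n)\<close>, or
  \<open>p^4 / (36 n^2)\<close> after correction, whence \<open>p^2 / n\<close> and
  \<open>p^3 / n^2\<close>. Necessity uses no limit law: a lower bound for the mean and a second
  moment bound suffice, and both must hold even when \<open>p\<close> is close to \<open>n\<close>.
  In (II) and (III) the variable \<open>w\<close> is short of about \<open>p\<close> degrees of
  freedom, which come from the fluctuations of the \<open>ln x_j\<close>. For large \<open>p\<close>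
  only their mean matters on the scale \<open>sqrt f\<close>; for bounded \<open>p\<close> their law
  has to be identified. A sequence of dimensions may alternate between the two regimes, so both are
  combined at the end.\<close>

abbreviation (input) LIM0 :: "(nat => real) => real => bool" (infixr "~~>" 60) where
 "X ~~> L == X \<longlonglongrightarrow> L"

abbreviation (input) eventually_seq :: "(nat => bool) => bool" (binder "EV " 10) where
 "eventually_seq P == eventually P sequentially"

section \<open>Lebesgue and standard Gaussian measures on spaces of functions\<close>

definition leb :: "'i set => ('i => real) measure" where
 "leb I = PiM I (%_. lborel)"

text \<open>The index set varies: \<open>{1..n} \<times> {..<p}\<close> for a sample, single rows or
  columns when an array is split, and all of \<open>nat\<close> as the source of an infinite i.i.d.
  sequence.\<close>

definition gauss :: "'i set => ('i => real) measure" where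
 "gauss I = PiM I (%_. std_normal_distribution)"

lemma sets_leb [measurable_cong, simp]: "sets (leb I) = sets (PiM I (%_. borel))"
 unfolding leb_def by (rule sets_PiM_cong) auto

lemma sets_gauss [measurable_cong, simp]: "sets (gauss I) = sets (PiM I (%_. borel))"
 unfolding gauss_def by (rule sets_PiM_cong) auto

lemma space_leb [simp]: "space (leb I) = extensional I"
 unfolding leb_def by (simp add: space_PiM PiE_UNIV_domain PiE_def)

lemma space_gauss [simp]: "space (gauss I) = extensional I"
 unfolding gauss_def by (simp add: space_PiM PiE_UNIV_domain PiE_def)

interpretation lborel_prod: product_sigma_finite "%_. lborel :: real measure"
 by standard

interpretation normal_prod: product_prob_space "%_. std_normal_distribution" UNIV
 by (rule product_prob_spaceI) (rule prob_space_normal_density, simp)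

lemma prob_space_std_normal: "prob_space std_normal_distribution"
 by (rule prob_space_normal_density) simp

lemma prob_space_gauss: "prob_space (gauss I)"
 unfolding gauss_def by (rule prob_space_PiM) (rule prob_space_std_normal)

lemma sigma_finite_leb: "finite I ==> sigma_finite_measure (leb I)"
 unfolding leb_def by (rule lborel_prod.sigma_finite)

lemma gauss_density:
 assumes "finite I"
 shows "gauss I = density (leb I) (%x. ennreal ((1 / sqrt (2 * pi)) ^ card I * exp (- (\<Sum>i\<in>I. (x i)\<^sup>2) / 2)))"
proof -
 have prod: "ennreal ((1 / sqrt (2 * pi)) ^ card I * exp (- (\<Sum>i\<in>I. (x i)\<^sup>2) / 2))
  = (\<Prod>i\<in>I. ennreal (std_normal_density (x i)))" for x :: "'a => real"
 proof -
  have "(\<Prod>i\<in>I. std_normal_density (x i)) = (1 / sqrt (2 * pi)) ^ card I * exp (- (\<Sum>i\<in>I. (x i)\<^sup>2) / 2)"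
  using assms by (simp add: std_normal_density_def prod.distrib exp_sum[symmetric] sum_negf sum_divide_distrib power_one_over prod_dividef)
  then show ?thesis by (simp add: prod_ennreal)
 qed
 have "density (leb I) (%x. ennreal ((1 / sqrt (2 * pi)) ^ card I * exp (- (\<Sum>i\<in>I. (x i)\<^sup>2) / 2))) = gauss I"
  unfolding gauss_def
 proof (rule normal_prod.PiM_eqI)
  fix A :: "'a => real set" assume A: "!!i. i : I ==> A i : sets std_normal_distribution"
  then have A': "!!i. i : I ==> A i : sets borel" by simp
  have PA: "Pi\<^sub>E I A : sets (PiM I (%_. borel))" using A' assms by (intro sets_PiM_I_finite) auto
  have ind: "indicator (Pi\<^sub>E I A) x = (\<Prod>i\<in>I. indicator (A i) (x i) :: ennreal)" if "x : extensional I" for x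
  using that assms by (auto simp: indicator_def PiE_iff prod_zero_iff)
  have "emeasure (density (leb I) (%x. ennreal ((1 / sqrt (2 * pi)) ^ card I * exp (- (\<Sum>i\<in>I. (x i)\<^sup>2) / 2)))) (Pi\<^sub>E I A)
  = (\<integral>\<^sup>+x. ennreal ((1 / sqrt (2 * pi)) ^ card I * exp (- (\<Sum>i\<in>I. (x i)\<^sup>2) / 2)) * indicator (Pi\<^sub>E I A) x \<partial>leb I)"
  using assms PA by (subst emeasure_density) auto
  also have "... = (\<integral>\<^sup>+x. (\<Prod>i\<in>I. ennreal (std_normal_density (x i)) * indicator (A i) (x i)) \<partial>PiM I (%_. lborel))"
  unfolding prod leb_def[symmetric] by (intro nn_integral_cong) (simp add: ind prod.distrib)
  also have "... = (\<Prod>i\<in>I. \<integral>\<^sup>+x. ennreal (std_normal_density x) * indicator (A i) x \<partial>lborel)"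
  using assms A' by (subst lborel_prod.product_nn_integral_prod) auto
  also have "... = (\<Prod>i\<in>I. emeasure std_normal_distribution (A i))"
  using A' by (intro prod.cong refl) (simp add: emeasure_density)
  finally show "emeasure (density (leb I) (%x. ennreal ((1 / sqrt (2 * pi)) ^ card I * exp (- (\<Sum>i\<in>I. (x i)\<^sup>2) / 2)))) (Pi\<^sub>E I A)
  = (\<Prod>i\<in>I. emeasure std_normal_distribution (A i))" .
 qed (use assms in \<open>simp_all add: sets_gauss[unfolded gauss_def]\<close>)
 then show ?thesis by simp
qed

text \<open>The component measures may differ from index to index; this is what later lets
  independent copies of one space drive chi-squared coordinates with different degrees of
  freedom.\<close>

lemma distr_PiM_componentwise:
 assumes "finite I" "product_sigma_finite M" "product_sigma_finite N"
  and f: "!!i. i : I ==> f i : measurable (M i) (N i)" "!!i. i : I ==> distr (M i) (N i) (f i) = N i"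
 shows "distr (PiM I M) (PiM I N) (%x. \<lambda>i\<in>I. f i (x i)) = PiM I N"
proof (rule product_sigma_finite.PiM_eqI[OF assms(3,1)])
 have m: "(%x. \<lambda>i\<in>I. f i (x i)) : measurable (PiM I M) (PiM I N)"
  using f(1) by (intro measurable_restrict) (auto intro: measurable_compose[OF measurable_component_singleton])
 fix A assume A: "!!i. i : I ==> A i : sets (N i)"
 have "emeasure (distr (PiM I M) (PiM I N) (%x. \<lambda>i\<in>I. f i (x i))) (Pi\<^sub>E I A)
  = emeasure (PiM I M) (Pi\<^sub>E I (%i. f i -` A i \<inter> space (M i)))"
  using A assms(1) by (subst emeasure_distr[OF m])
  (auto intro!: arg_cong2[where f = emeasure] simp: space_PiM PiE_iff extensional_def Pi_iff)
 also have "... = (\<Prod>i\<in>I. emeasure (M i) (f i -` A i \<inter> space (M i)))"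
  using A f assms(1) by (intro product_sigma_finite.emeasure_PiM[OF assms(2)]) auto
 also have "... = (\<Prod>i\<in>I. emeasure (N i) (A i))"
  using A f by (intro prod.cong refl) (metis emeasure_distr)
 finally show "emeasure (distr (PiM I M) (PiM I N) (%x. \<lambda>i\<in>I. f i (x i))) (Pi\<^sub>E I A) = ..." .
qed simp

section \<open>Uniqueness of translation-invariant measures\<close>

text \<open>Restricted to \<open>I\<close> so that sums stay in the extensional function space
  carried by the product measures.\<close>

definition vadd :: "'i set => ('i => real) => ('i => real) => 'i => real" where
 "vadd I x y = (\<lambda>i\<in>I. x i + y i)"

lemma measurable_vadd [measurable]:
 assumes [measurable]: "f : measurable M (PiM I (%_. borel))" "g : measurable M (PiM I (%_. borel))"
 shows "(%x. vadd I (f x) (g x)) : measurable M (PiM I (%_. borel))"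
 unfolding vadd_def by measurable

lemma vadd_extensional [simp]: "vadd I x y : extensional I"
 by (simp add: vadd_def)

lemma leb_affine:
 assumes "finite I" and s: "!!i. i : I ==> \<bar>s i\<bar> = 1"
 shows "distr (leb I) (leb I) (%x. \<lambda>i\<in>I. a i + s i * x i) = leb I"
 unfolding leb_def
proof (rule distr_PiM_componentwise[OF assms(1)])
 fix i assume "i : I"
 then have "lborel = density (distr lborel borel (%x. a i + s i * x)) (%_. ennreal \<bar>s i\<bar>)"
  using s by (intro lborel_real_affine) fastforce
 then show "distr lborel lborel (%x. a i + s i * x) = lborel"
  using s[OF \<open>i \<in> I\<close>] by (simp add: density_1 cong: distr_cong)
qed (auto intro: lborel_prod.product_sigma_finite_axioms)

lemma leb_translate:
 assumes "finite I" shows "distr (leb I) (leb I) (%x. vadd I x a) = leb I"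
 using leb_affine[OF assms, of "%_. 1" a] by (simp add: vadd_def add.commute)

lemma leb_reflect:
 assumes "finite I" shows "distr (leb I) (leb I) (%x. \<lambda>i\<in>I. a i - x i) = leb I"
 using leb_affine[OF assms, of "%_. -1" a] by simp

lemma nn_integral_distr_eq:
 assumes "distr M N f = N'" "f : measurable M N" "g : borel_measurable N"
 shows "(\<integral>\<^sup>+x. g (f x) \<partial>M) = (\<integral>\<^sup>+x. g x \<partial>N')"
 using nn_integral_distr[of f M N g] assms(2,3) unfolding assms(1)[symmetric] by simp

text \<open>Uniqueness of Haar measure. Integrating \<open>f x * g (x + y)\<close> in both orders,
  with one translation in each measure and a reflection of Lebesgue measure, exchanges the roles of
  the two measures. The cross-multiplied form avoids division in \<open>ennreal\<close>.\<close>

lemma translation_invariant_proportional: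
 assumes I: "finite I" and \<nu>: "sets \<nu> = sets (PiM I (%_. borel))" "sigma_finite_measure \<nu>"
  and inv: "!!a. a : extensional I ==> distr \<nu> \<nu> (%x. vadd I x a) = \<nu>"
  and f [measurable]: "f : borel_measurable (PiM I (%_. borel))"
  and g [measurable]: "g : borel_measurable (PiM I (%_. borel))"
 shows "(\<integral>\<^sup>+x. f x \<partial>\<nu>) * (\<integral>\<^sup>+x. g x \<partial>leb I) = (\<integral>\<^sup>+x. g x \<partial>\<nu>) * (\<integral>\<^sup>+x. f x \<partial>leb I)"
proof -
 interpret \<nu>: sigma_finite_measure \<nu> by fact
 interpret L: sigma_finite_measure "leb I" by (rule sigma_finite_leb[OF I])
 interpret P: pair_sigma_finite \<nu> "leb I" ..
 note \<nu>(1)[measurable_cong]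
 have sp: "space \<nu> = extensional I"
  using sets_eq_imp_space_eq[OF \<nu>(1)] by (simp add: space_PiM PiE_UNIV_domain PiE_def)
 have "(\<integral>\<^sup>+x. f x \<partial>\<nu>) * (\<integral>\<^sup>+x. g x \<partial>leb I) = (\<integral>\<^sup>+x. f x * (\<integral>\<^sup>+y. g y \<partial>leb I) \<partial>\<nu>)"
  by (subst nn_integral_multc) auto
 also have "... = (\<integral>\<^sup>+x. \<integral>\<^sup>+y. f x * g (vadd I y x) \<partial>leb I \<partial>\<nu>)"
 proof (rule nn_integral_cong)
  fix x assume "x : space \<nu>"
  have "(\<integral>\<^sup>+y. g (vadd I y x) \<partial>leb I) = (\<integral>\<^sup>+y. g y \<partial>leb I)"
  using leb_translate[OF I, of x] by (rule nn_integral_distr_eq) (unfold vadd_def, measurable)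
  moreover have "(%y. g (vadd I y x)) : borel_measurable (leb I)" unfolding vadd_def by measurable
  ultimately show "f x * (\<integral>\<^sup>+y. g y \<partial>leb I) = (\<integral>\<^sup>+y. f x * g (vadd I y x) \<partial>leb I)"
  by (simp add: nn_integral_cmult)
 qed
 also have "... = (\<integral>\<^sup>+y. \<integral>\<^sup>+x. f x * g (vadd I y x) \<partial>\<nu> \<partial>leb I)"
  by (rule P.Fubini'[symmetric]) measurable
 \<comment> \<open>Translating \<open>x\<close> by \<open>- y\<close> under \<open>\<nu>\<close>
   frees \<open>g\<close> from \<open>y\<close>; afterwards only \<open>f\<close> depends on both
   variables.\<close>
 also have "... = (\<integral>\<^sup>+y. \<integral>\<^sup>+x. f (vadd I x (\<lambda>i\<in>I. - y i)) * g x \<partial>\<nu> \<partial>leb I)"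
 proof (rule nn_integral_cong)
  fix y :: "'a => real" assume y: "y : space (leb I)"
  have "(\<integral>\<^sup>+x. f (vadd I x (\<lambda>i\<in>I. - y i)) * g (vadd I y (vadd I x (\<lambda>i\<in>I. - y i))) \<partial>\<nu>)
  = (\<integral>\<^sup>+x. f x * g (vadd I y x) \<partial>\<nu>)"
  using inv[of "\<lambda>i\<in>I. - y i"] by (intro nn_integral_distr_eq[where f="%x. vadd I x (\<lambda>i\<in>I. - y i)"]) (simp, (unfold vadd_def, measurable)+)
  moreover have "vadd I y (vadd I x (\<lambda>i\<in>I. - y i)) = x" if "x : space \<nu>" for x
  using that by (auto simp: vadd_def sp extensional_def fun_eq_iff)
  ultimately show "(\<integral>\<^sup>+x. f x * g (vadd I y x) \<partial>\<nu>) = (\<integral>\<^sup>+x. f (vadd I x (\<lambda>i\<in>I. - y i)) * g x \<partial>\<nu>)"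
  by (simp cong: nn_integral_cong)
 qed
 also have "... = (\<integral>\<^sup>+x. \<integral>\<^sup>+y. f (vadd I x (\<lambda>i\<in>I. - y i)) * g x \<partial>leb I \<partial>\<nu>)"
  by (rule P.Fubini') measurable
 also have "... = (\<integral>\<^sup>+x. g x * (\<integral>\<^sup>+y. f y \<partial>leb I) \<partial>\<nu>)"
 proof (rule nn_integral_cong)
  fix x
  have *: "vadd I x (\<lambda>i\<in>I. - y i) = (\<lambda>i\<in>I. x i - y i)" for y by (auto simp: vadd_def)
  have "(\<integral>\<^sup>+y. f (\<lambda>i\<in>I. x i - y i) \<partial>leb I) = (\<integral>\<^sup>+y. f y \<partial>leb I)"
  using leb_reflect[OF I, of x] by (rule nn_integral_distr_eq) measurable
  then show "(\<integral>\<^sup>+y. f (vadd I x (\<lambda>i\<in>I. - y i)) * g x \<partial>leb I) = g x * (\<integral>\<^sup>+y. f y \<partial>leb I)"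
  unfolding * by (subst nn_integral_multc) (auto simp: mult.commute)
 qed
 also have "... = (\<integral>\<^sup>+x. g x \<partial>\<nu>) * (\<integral>\<^sup>+x. f x \<partial>leb I)"
  by (subst nn_integral_multc) auto
 finally show ?thesis .
qed

text \<open>The image of Lebesgue measure under an additive bijection is again
  translation-invariant, so it is a multiple of Lebesgue measure. The multiple, a Jacobian, is never
  computed: the second function \<open>g\<close> eliminates it.\<close>

lemma linear_image_proportional:
 assumes I: "finite I"
  and T [measurable]: "T : measurable (PiM I (%_. borel)) (PiM I (%_. borel))"
  and T' [measurable]: "T' : measurable (PiM I (%_. borel)) (PiM I (%_. borel))"
  and add: "!!x y. x : extensional I ==> y : extensional I ==> T (vadd I x y) = vadd I (T x) (T y)"
  and inv: "!!x. x : extensional I ==> T' (T x) = x" "!!x. x : extensional I ==> T (T' x) = x"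
  and f [measurable]: "f : borel_measurable (PiM I (%_. borel))"
  and g [measurable]: "g : borel_measurable (PiM I (%_. borel))"
 shows "(\<integral>\<^sup>+x. f (T x) \<partial>leb I) * (\<integral>\<^sup>+x. g x \<partial>leb I) = (\<integral>\<^sup>+x. g (T x) \<partial>leb I) * (\<integral>\<^sup>+x. f x \<partial>leb I)"
proof -
 let ?\<nu> = "distr (leb I) (leb I) T"
 have ext: "T x : extensional I" "T' x : extensional I" if "x : extensional I" for x
  using measurable_space[OF T] measurable_space[OF T'] that by (simp_all add: space_PiM PiE_UNIV_domain PiE_def)
 have [measurable]: "T : measurable (leb I) (leb I)" "T' : measurable (leb I) (leb I)"
  by measurable
 \<comment> \<open>Sigma-finiteness is inherited backwards: mapping the image on by
   \<open>T'\<close> gives Lebesgue measure back.\<close>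
 have sf: "sigma_finite_measure ?\<nu>"
 proof (rule sigma_finite_measure_distr[where f = T' and N = "leb I"])
  have "distr ?\<nu> (leb I) T' = distr (leb I) (leb I) (%x. x)"
  by (subst distr_distr, simp, simp, rule distr_cong) (auto simp: inv)
  then show "sigma_finite_measure (distr ?\<nu> (leb I) T')"
  by (simp add: distr_id sigma_finite_leb[OF I])
 qed simp
 have inv': "distr ?\<nu> ?\<nu> (%x. vadd I x a) = ?\<nu>" if a: "a : extensional I" for a
 proof -
  have m: "(%x. vadd I x b) : measurable (leb I) (leb I)" for b unfolding vadd_def by measurable
  have "distr ?\<nu> ?\<nu> (%x. vadd I x a) = distr (leb I) (leb I) (%x. vadd I (T x) a)"
  using m by (subst distr_distr) (auto simp: comp_def intro!: distr_cong)
  also have "... = distr (leb I) (leb I) (%x. T (vadd I x (T' a)))"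
  using a by (intro distr_cong refl) (simp add: add ext inv)
  also have "... = distr (distr (leb I) (leb I) (%x. vadd I x (T' a))) (leb I) T"
  using m by (subst distr_distr) (auto simp: comp_def)
  finally show ?thesis by (simp add: leb_translate[OF I])
 qed
 show ?thesis
  using translation_invariant_proportional[OF I _ sf inv' f g] by (simp add: nn_integral_distr)
qed

text \<open>Total mass 1 of \<open>gauss\<close> evaluates the kernel integral; in particular it is
  neither 0 nor infinite, which is what allows cancelling it in \<open>ennreal\<close>.\<close>

lemma nn_integral_gaussian_kernel:
 assumes "finite I"
 shows "ennreal ((1 / sqrt (2 * pi)) ^ card I) * (\<integral>\<^sup>+x. ennreal (exp (- (\<Sum>i\<in>I. (x i)\<^sup>2) / 2)) \<partial>leb I) = 1"
proof -
 have [simp]: "extensional I : sets (PiM I (%_. borel :: real measure))"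
  using sets.top[of "PiM I (%_. borel :: real measure)"] by (simp add: space_PiM PiE_UNIV_domain PiE_def)
 have "1 = emeasure (gauss I) (space (gauss I))"
  using prob_space.emeasure_space_1[OF prob_space_gauss] by metis
 also have "... = (\<integral>\<^sup>+x. ennreal ((1 / sqrt (2 * pi)) ^ card I * exp (- (\<Sum>i\<in>I. (x i)\<^sup>2) / 2)) * indicator (space (gauss I)) x \<partial>leb I)"
  unfolding gauss_density[OF assms] using assms by (subst emeasure_density) (auto simp: space_PiM)
 also have "... = (\<integral>\<^sup>+x. ennreal ((1 / sqrt (2 * pi)) ^ card I) * ennreal (exp (- (\<Sum>i\<in>I. (x i)\<^sup>2) / 2)) \<partial>leb I)"
  by (intro nn_integral_cong) (simp add: ennreal_mult)
 also have "... = ennreal ((1 / sqrt (2 * pi)) ^ card I) * (\<integral>\<^sup>+x. ennreal (exp (- (\<Sum>i\<in>I. (x i)\<^sup>2) / 2)) \<partial>leb I)"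
  using assms by (subst nn_integral_cmult) auto
 finally show ?thesis by simp
qed

lemma nn_integral_gauss:
 assumes "finite I" and f [measurable]: "f : borel_measurable (PiM I (%_. borel))"
 shows "(\<integral>\<^sup>+x. f x \<partial>gauss I) = ennreal ((1 / sqrt (2 * pi)) ^ card I) * (\<integral>\<^sup>+x. ennreal (exp (- (\<Sum>i\<in>I. (x i)\<^sup>2) / 2)) * f x \<partial>leb I)"
 unfolding gauss_density[OF assms(1)] using assms(1)
 by (subst nn_integral_density, simp, simp, subst nn_integral_cmult[symmetric]) (auto simp: ennreal_mult mult.assoc)

lemma ennreal_cancel_right:
 fixes a b c :: ennreal
 assumes "a * c = b * c" "c ~= 0" "c ~= \<infinity>"
 shows "a = b"
 using assms by (metis ennreal_mult_cancel_left mult.commute infinity_ennreal_def)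

lemma gaussian_kernel_integral_nontrivial:
 assumes "finite I"
 shows "(\<integral>\<^sup>+x. ennreal (exp (- (\<Sum>i\<in>I. (x i)\<^sup>2) / 2)) \<partial>leb I) ~= 0"
  "(\<integral>\<^sup>+x. ennreal (exp (- (\<Sum>i\<in>I. (x i)\<^sup>2) / 2)) \<partial>leb I) ~= \<infinity>"
proof -
 have c: "ennreal ((1 / sqrt (2 * pi)) ^ card I) ~= 0" by simp
 from nn_integral_gaussian_kernel[OF assms] c
 show "(\<integral>\<^sup>+x. ennreal (exp (- (\<Sum>i\<in>I. (x i)\<^sup>2) / 2)) \<partial>leb I) ~= 0"
  "(\<integral>\<^sup>+x. ennreal (exp (- (\<Sum>i\<in>I. (x i)\<^sup>2) / 2)) \<partial>leb I) ~= \<infinity>"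
  by (auto simp: ennreal_mult_eq_top_iff ennreal_mult_top)
qed

text \<open>The kernel is a function of the squared length, hence unchanged by \<open>T\<close>.
  Comparing \<open>g * f\<close> with \<open>g\<close> alone, the unknown Jacobian cancels.
  Requiring \<open>T\<close> to be an involution covers reflections, the only isometries used below,
  and makes \<open>T\<close> its own inverse.\<close>

lemma nn_integral_gauss_isometry:
 assumes I: "finite I"
  and T [measurable]: "T : measurable (PiM I (%_. borel)) (PiM I (%_. borel))"
  and add: "!!x y. x : extensional I ==> y : extensional I ==> T (vadd I x y) = vadd I (T x) (T y)"
  and inv: "!!x. x : extensional I ==> T (T x) = x"
  and iso: "!!x. x : extensional I ==> (\<Sum>i\<in>I. (T x i)\<^sup>2) = (\<Sum>i\<in>I. (x i)\<^sup>2)"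
  and f [measurable]: "f : borel_measurable (PiM I (%_. borel))"
 shows "(\<integral>\<^sup>+x. f (T x) \<partial>gauss I) = (\<integral>\<^sup>+x. f x \<partial>gauss I)"
proof -
 define g :: "('a => real) => ennreal" where "g x = ennreal (exp (- (\<Sum>i\<in>I. (x i)\<^sup>2) / 2))" for x
 have g [measurable]: "g : borel_measurable (PiM I (%_. borel))" unfolding g_def using I by measurable
 have gT: "g (T x) = g x" if "x : space (leb I)" for x using iso that by (simp add: g_def)
 have gi: "(\<integral>\<^sup>+x. g (T x) \<partial>leb I) = (\<integral>\<^sup>+x. g x \<partial>leb I)"
  by (rule nn_integral_cong) (rule gT)
 have "(\<integral>\<^sup>+x. g (T x) * f (T x) \<partial>leb I) * (\<integral>\<^sup>+x. g x \<partial>leb I) = (\<integral>\<^sup>+x. g (T x) \<partial>leb I) * (\<integral>\<^sup>+x. g x * f x \<partial>leb I)"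
  by (rule linear_image_proportional[OF I T T add inv inv]) auto
 also have "(\<integral>\<^sup>+x. g (T x) * f (T x) \<partial>leb I) = (\<integral>\<^sup>+x. g x * f (T x) \<partial>leb I)"
  by (rule nn_integral_cong) (simp add: gT)
 finally have "(\<integral>\<^sup>+x. g x * f (T x) \<partial>leb I) * (\<integral>\<^sup>+x. g x \<partial>leb I) = (\<integral>\<^sup>+x. g x * f x \<partial>leb I) * (\<integral>\<^sup>+x. g x \<partial>leb I)"
  unfolding gi by (simp only: mult.commute)
 then have "(\<integral>\<^sup>+x. g x * f (T x) \<partial>leb I) = (\<integral>\<^sup>+x. g x * f x \<partial>leb I)"
  by (rule ennreal_cancel_right) (use gaussian_kernel_integral_nontrivial[OF I] in \<open>simp_all add: g_def\<close>)
 then show ?thesis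
  by (subst (1 2) nn_integral_gauss[OF I]) (auto simp: g_def)
qed

text \<open>Only the shape of the density of \<open>X\<close> matters: its normalising constant, and the Jacobian of
  \<open>T\<close>, are recovered from the fact that both laws are probability measures.\<close>

lemma distr_whitening:
 assumes I: "finite I"
  and T [measurable]: "T : measurable (PiM I (%_. borel)) (PiM I (%_. borel))"
  and T' [measurable]: "T' : measurable (PiM I (%_. borel)) (PiM I (%_. borel))"
  and add: "!!x y. x : extensional I ==> y : extensional I ==> T (vadd I x y) = vadd I (T x) (T y)"
  and inv: "!!x. x : extensional I ==> T' (T x) = x" "!!x. x : extensional I ==> T (T' x) = x"
  and \<mu>: "\<mu> : extensional I"
  and M: "prob_space M" and X: "distributed M (PiM I (%_. lborel)) X d"
  and d: "!!z. z : extensional I ==> d (vadd I (T z) \<mu>) = ennreal (c * exp (- (\<Sum>i\<in>I. (z i)\<^sup>2) / 2))" "c >= 0"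
 shows "distr M (gauss I) (%om. T' (vadd I (X om) (\<lambda>i\<in>I. - \<mu> i))) = gauss I"
proof (rule measure_eqI)
 define W where "W x = T' (vadd I x (\<lambda>i\<in>I. - \<mu> i))" for x
 have W [measurable]: "W : measurable (PiM I (%_. borel)) (PiM I (%_. borel))"
  unfolding W_def[abs_def] vadd_def by measurable
 have Xm [measurable]: "X : measurable M (PiM I (%_. borel))"
  using distributed_measurable[OF X] by (simp add: measurable_cong_sets[OF refl sets_leb[unfolded leb_def]])
 have dm [measurable]: "d : borel_measurable (PiM I (%_. borel))"
  using distributed_borel_measurable[OF X] by (simp add: measurable_cong_sets[OF sets_leb[unfolded leb_def] refl])
 have extT: "T x : extensional I" if "x : extensional I" for x
  using measurable_space[OF T] that by (simp add: space_PiM PiE_UNIV_domain PiE_def)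
 define g :: "('a => real) => ennreal" where "g x = ennreal (exp (- (\<Sum>i\<in>I. (x i)\<^sup>2) / 2))" for x
 have g [measurable]: "g : borel_measurable (PiM I (%_. borel))" unfolding g_def using I by measurable
 define J where "J = (\<integral>\<^sup>+x. g (T x) \<partial>leb I)"
 define K where "K = (\<integral>\<^sup>+x. g x \<partial>leb I)"
 define a where "a = ennreal ((1 / sqrt (2 * pi)) ^ card I)"
 have K: "K ~= 0" "K ~= \<infinity>" using gaussian_kernel_integral_nontrivial[OF I] by (auto simp: K_def g_def)
 have aK: "a * K = 1" using nn_integral_gaussian_kernel[OF I] by (simp add: a_def K_def g_def)
 have WT: "W (vadd I (T z) \<mu>) = z" if "z : extensional I" for z
 proof -
  have "vadd I (vadd I (T z) \<mu>) (\<lambda>i\<in>I. - \<mu> i) = T z"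
  using extT[OF that] by (auto simp: vadd_def extensional_def fun_eq_iff)
  then show ?thesis using inv(1)[OF that] by (simp add: W_def)
 qed
 \<comment> \<open>\<open>J / K\<close> is the unknown factor of the change of variables by
   \<open>T\<close> and \<open>c\<close> the unknown constant of the density. The test function
   \<open>F = 1\<close> then ties the two together, leaving \<open>c K K\<close> as the only
   constant.\<close>
 have key: "ennreal c * (\<integral>\<^sup>+x. g x * F x \<partial>leb I) * K = J * (\<integral>\<^sup>+om. F (W (X om)) \<partial>M)"
  if F [measurable]: "F : borel_measurable (PiM I (%_. borel))" for F :: "('a => real) => ennreal"
 proof -
  have "ennreal c * (\<integral>\<^sup>+x. g x * F x \<partial>leb I) = (\<integral>\<^sup>+x. d (vadd I (T x) \<mu>) * F (W (vadd I (T x) \<mu>)) \<partial>leb I)"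
  by (subst nn_integral_cmult[symmetric])
  (auto intro!: nn_integral_cong simp: g_def d WT ennreal_mult mult.assoc)
  moreover have "(\<integral>\<^sup>+x. d (vadd I (T x) \<mu>) * F (W (vadd I (T x) \<mu>)) \<partial>leb I) * K
  = J * (\<integral>\<^sup>+x. d (vadd I x \<mu>) * F (W (vadd I x \<mu>)) \<partial>leb I)"
  unfolding J_def K_def by (rule linear_image_proportional[OF I T T' add inv]) (unfold vadd_def, measurable)
  moreover have "(\<integral>\<^sup>+x. d (vadd I x \<mu>) * F (W (vadd I x \<mu>)) \<partial>leb I) = (\<integral>\<^sup>+x. d x * F (W x) \<partial>leb I)"
  using leb_translate[OF I, of \<mu>] by (rule nn_integral_distr_eq) (unfold vadd_def, measurable)
  moreover have "(\<integral>\<^sup>+x. d x * F (W x) \<partial>leb I) = (\<integral>\<^sup>+om. F (W (X om)) \<partial>M)"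
  unfolding leb_def by (rule distributed_nn_integral[OF X])
  (simp add: measurable_cong_sets[OF sets_leb[unfolded leb_def] refl])
  ultimately show ?thesis by metis
 qed
 have J: "J = ennreal c * K * K"
  using key[of "%_. 1"] prob_space.emeasure_space_1[OF M] by (simp add: K_def mult.assoc)
 \<comment> \<open>If the constant vanished, the density would vanish everywhere, since
   \<open>T\<close> followed by the shift is onto; its total mass is 1.\<close>
 have J0: "ennreal c * K * K ~= 0"
 proof
  assume *: "ennreal c * K * K = 0"
  then have "c = 0" using K d(2) by (auto simp: ennreal_eq_0_iff)
  then have "d (vadd I (T z) \<mu>) = 0" if "z : extensional I" for z using d(1)[OF that] by simp
  moreover have "vadd I (T (W x)) \<mu> = x" if "x : extensional I" for x
  using that by (auto simp: W_def inv vadd_def extensional_def fun_eq_iff)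
  moreover have "W x : extensional I" if "x : extensional I" for x
  using measurable_space[OF W] that by (simp add: space_PiM PiE_UNIV_domain PiE_def)
  ultimately have "d x = 0" if "x : space (leb I)" for x using that by (metis space_leb)
  then have "(\<integral>\<^sup>+x. d x \<partial>leb I) = 0" by (subst nn_integral_cong[where v = "%_. 0"]) auto
  moreover have "(\<integral>\<^sup>+x. d x * 1 \<partial>leb I) = (\<integral>\<^sup>+om. 1 \<partial>M)"
  unfolding leb_def by (rule distributed_nn_integral[OF X]) simp
  ultimately show False using prob_space.emeasure_space_1[OF M] by simp
 qed
 have J1: "ennreal c * K * K ~= \<infinity>"
  using K by (simp add: ennreal_mult_eq_top_iff)
 show "sets (distr M (gauss I) (%om. T' (vadd I (X om) (\<lambda>i\<in>I. - \<mu> i)))) = sets (gauss I)" by simp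
 fix A assume "A : sets (distr M (gauss I) (%om. T' (vadd I (X om) (\<lambda>i\<in>I. - \<mu> i))))"
 then have A [measurable]: "A : sets (PiM I (%_. borel))" by simp
 have "(\<integral>\<^sup>+om. indicator A (W (X om)) \<partial>M) * (ennreal c * K * K) = (\<integral>\<^sup>+x. indicator A x \<partial>gauss I) * (ennreal c * K * K)"
 proof -
  have "(\<integral>\<^sup>+x. indicator A x \<partial>gauss I) * (ennreal c * K * K)
  = a * (\<integral>\<^sup>+x. g x * indicator A x \<partial>leb I) * (ennreal c * K * K)"
  by (subst nn_integral_gauss[OF I]) (simp_all add: a_def g_def)
  also have "... = (a * K) * (ennreal c * (\<integral>\<^sup>+x. g x * indicator A x \<partial>leb I) * K)"
  by (simp only: ac_simps)
  also have "... = J * (\<integral>\<^sup>+om. indicator A (W (X om)) \<partial>M)"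
  unfolding aK mult_1_left by (rule key) simp
  also have "... = (\<integral>\<^sup>+om. indicator A (W (X om)) \<partial>M) * (ennreal c * K * K)"
  unfolding J by (rule mult.commute)
  finally show ?thesis by simp
 qed
 then have eq: "(\<integral>\<^sup>+om. indicator A (W (X om)) \<partial>M) = (\<integral>\<^sup>+x. indicator A x \<partial>gauss I)"
  by (rule ennreal_cancel_right[OF _ J0 J1])
 have WX: "(%om. W (X om)) : measurable M (gauss I)" by measurable
 have "emeasure (distr M (gauss I) (%om. W (X om))) A = (\<integral>\<^sup>+x. indicator A x \<partial>distr M (gauss I) (%om. W (X om)))"
  by (rule nn_integral_indicator[symmetric]) simp
 also have "... = (\<integral>\<^sup>+om. indicator A (W (X om)) \<partial>M)"
  using WX by (rule nn_integral_distr) simp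
 also have "... = emeasure (gauss I) A" unfolding eq by (rule nn_integral_indicator) simp
 finally show "emeasure (distr M (gauss I) (%om. T' (vadd I (X om) (\<lambda>i\<in>I. - \<mu> i)))) A = emeasure (gauss I) A"
  by (simp add: W_def)
qed

section \<open>Sums of squares\<close>

text \<open>The point mass at 0 makes zero degrees of freedom legitimate. It occurs as the empty sum
  of squares, for instance as the law of the off-diagonal part when \<open>p = 1\<close>.\<close>

definition chi2 :: "nat => real measure" where
 "chi2 k = (if k = 0 then return borel 0 else chi_square (real k))"

lemma sets_chi2 [measurable_cong, simp]: "sets (chi2 k) = sets borel"
 by (simp add: chi2_def chi_square_def)

lemma space_chi2 [simp]: "space (chi2 k) = UNIV"
 using sets_eq_imp_space_eq[OF sets_chi2] by simp

lemma prob_space_chi2: "prob_space (chi2 k)"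
 by (auto simp: chi2_def intro: prob_space_chi_square prob_space_return)

lemma borel_measurable_sq_sum [measurable]:
 "(%x. \<Sum>i\<in>I. (x i)\<^sup>2) : borel_measurable (PiM I (%_. borel :: real measure))"
 by measurable

lemma emeasure_leb_box:
 assumes "finite I" "!!i. i : I ==> A i : sets borel"
 shows "emeasure (leb I) (Pi\<^sub>E I A) = (\<Prod>i\<in>I. emeasure lborel (A i))"
 unfolding leb_def using assms by (intro lborel_prod.emeasure_PiM) auto

text \<open>Here the proportionality factor is found by taking the unit cube as reference function:
  its preimage is a box of known volume.\<close>

lemma nn_integral_leb_scale:
 assumes I: "finite I" and t: "t > 0" and f [measurable]: "f : borel_measurable (PiM I (%_. borel))"
 shows "(\<integral>\<^sup>+x. f (\<lambda>i\<in>I. t * x i) \<partial>leb I) = ennreal ((1 / t) ^ card I) * (\<integral>\<^sup>+x. f x \<partial>leb I)"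
proof -
 let ?Q = "Pi\<^sub>E I (%_. {0..1::real})" and ?R = "Pi\<^sub>E I (%_. {0..1/t})"
 have Q [measurable]: "?Q : sets (PiM I (%_. borel))" and R [measurable]: "?R : sets (PiM I (%_. borel))"
  using I by (auto intro!: sets_PiM_I_finite)
 have "(\<integral>\<^sup>+x. f (\<lambda>i\<in>I. t * x i) \<partial>leb I) * (\<integral>\<^sup>+x. indicator ?Q x \<partial>leb I)
  = (\<integral>\<^sup>+x. indicator ?Q (\<lambda>i\<in>I. t * x i) \<partial>leb I) * (\<integral>\<^sup>+x. f x \<partial>leb I)"
 proof (rule linear_image_proportional[where T' = "%x. \<lambda>i\<in>I. (1 / t) * x i", OF I _ _ _ _ _ f])
  show "(%x. \<lambda>i\<in>I. t * x i) : Pi\<^sub>M I (%_. borel) \<rightarrow>\<^sub>M Pi\<^sub>M I (%_. borel)"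
  "(%x. \<lambda>i\<in>I. (1 / t) * x i) : Pi\<^sub>M I (%_. borel) \<rightarrow>\<^sub>M Pi\<^sub>M I (%_. borel)"
  by measurable
 qed (use t in \<open>auto simp: vadd_def extensional_def fun_eq_iff algebra_simps\<close>)
 also have "(\<integral>\<^sup>+x. indicator ?Q x \<partial>leb I) = 1"
  using I by (simp add: emeasure_leb_box)
 also have "(\<integral>\<^sup>+x. indicator ?Q (\<lambda>i\<in>I. t * x i) \<partial>leb I) = (\<integral>\<^sup>+x. indicator ?R x \<partial>leb I)"
 proof (intro nn_integral_cong)
  fix x assume "x : space (leb I)"
  moreover have "t * u : {0..1} \<longleftrightarrow> u : {0..1/t}" for u
  using t by (simp add: zero_le_mult_iff pos_le_divide_eq mult.commute)
  ultimately show "indicator ?Q (\<lambda>i\<in>I. t * x i) = (indicator ?R x :: ennreal)"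
  by (simp add: indicator_def PiE_iff)
 qed
 also have "... = ennreal ((1 / t) ^ card I)"
  using I t by (simp add: emeasure_leb_box prod_ennreal ennreal_power[symmetric])
 finally show ?thesis by (simp only: mult_1_right)
qed

text \<open>The ball of squared radius \<open>s\<close> is the unit ball scaled by
  \<open>sqrt s\<close>, so its volume is a multiple of \<open>s powr (card I / 2)\<close>;
  differentiating gives the density. The volume of the unit ball stays an unevaluated constant
  \<open>C\<close>, of which only finiteness matters.\<close>

lemma distr_leb_sq_sum:
 assumes I: "finite I" "I ~= {}"
 obtains C where "C < \<infinity>"
  "distr (leb I) borel (%x. \<Sum>i\<in>I. (x i)\<^sup>2)
  = density lborel (%s. C * ennreal (if s <= 0 then 0 else s powr (card I / 2 - 1)))"
proof -
 let ?r = "%x :: 'a => real. \<Sum>i\<in>I. (x i)\<^sup>2"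
 let ?B = "{x : extensional I. ?r x <= 1}"
 define n where "n = real (card I)"
 have n: "n > 0" using I by (simp add: n_def card_gt_0_iff)
 have ext [simp]: "extensional I : sets (PiM I (%_. borel :: real measure))"
  using sets.top[of "PiM I (%_. borel :: real measure)"] by (simp add: space_PiM PiE_UNIV_domain PiE_def)
 have B_eq: "{x : extensional I. ?r x <= s} = ?r -` {..s} \<inter> space (PiM I (%_. borel))" for s
  by (auto simp: space_PiM PiE_UNIV_domain PiE_def)
 have B [measurable]: "{x : extensional I. ?r x <= s} : sets (PiM I (%_. borel))" for s
  unfolding B_eq by (rule measurable_sets[OF borel_measurable_sq_sum]) simp
 define C where "C = emeasure (leb I) ?B"
 \<comment> \<open>The unit ball lies in a cube of finite volume.\<close>
 have "C <= emeasure (leb I) (Pi\<^sub>E I (%_. {-1..1}))"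
  unfolding C_def
 proof (rule emeasure_mono)
  show "?B \<subseteq> Pi\<^sub>E I (%_. {-1..1})"
  proof (rule subsetI, rule PiE_I)
  fix x i assume "x : ?B" "i : I"
  then have "?r x <= 1" by simp
  moreover have "(x i)\<^sup>2 <= ?r x" using I \<open>i \<in> I\<close> by (intro member_le_sum) auto
  ultimately have "(x i)\<^sup>2 <= 1" by simp
  then have "\<bar>x i\<bar> <= 1" by (simp add: abs_square_le_1)
  then show "x i : {-1..1}" by auto
  qed (simp add: extensional_def)
  show "Pi\<^sub>E I (%_. {-1..1}) : sets (leb I)" using I by (auto intro!: sets_PiM_I_finite)
 qed
 also have "... < \<infinity>" using I by (simp add: emeasure_leb_box power_less_top_ennreal)
 finally have C: "C < \<infinity>" .
 define D where "D = density lborel (%s. C * ennreal (n / 2) * ennreal (if s <= 0 then 0 else s powr (n / 2 - 1)))"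
 have D_atMost: "emeasure D {..s} = C * ennreal (if s <= 0 then 0 else s powr (n / 2))" for s
 proof (cases "s <= 0")
  case True
  have "emeasure D {..s} = (\<integral>\<^sup>+x. C * ennreal (n / 2) * ennreal (if x <= 0 then 0 else x powr (n / 2 - 1)) * indicator {..s} x \<partial>lborel)"
  unfolding D_def by (subst emeasure_density) auto
  also have "... = (\<integral>\<^sup>+(x::real). 0 \<partial>lborel)"
  using True by (intro nn_integral_cong) (auto simp: indicator_def)
  finally show ?thesis using True by simp
 next
  case False
  have hi: "((%x. if x : {0..s} then x powr (n / 2 - 1) else 0) has_integral (s powr (n / 2) / (n / 2))) UNIV"
  using has_integral_powr_from_0[of "n / 2 - 1" s] n False by (subst has_integral_restrict_UNIV) auto
  have "emeasure D {..s} = (\<integral>\<^sup>+x. C * ennreal (n / 2) * (ennreal (if x <= 0 then 0 else x powr (n / 2 - 1)) * indicator {..s} x) \<partial>lborel)"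
  unfolding D_def by (subst emeasure_density) (auto simp: mult.assoc)
  also have "... = C * ennreal (n / 2) * (\<integral>\<^sup>+x. ennreal (if x <= 0 then 0 else x powr (n / 2 - 1)) * indicator {..s} x \<partial>lborel)"
  by (subst nn_integral_cmult) auto
  also have "(\<integral>\<^sup>+x. ennreal (if x <= 0 then 0 else x powr (n / 2 - 1)) * indicator {..s} x \<partial>lborel)
  = (\<integral>\<^sup>+x. ennreal (if x : {0..s} then x powr (n / 2 - 1) else 0) \<partial>lborel)"
  by (intro nn_integral_cong) (auto simp: indicator_def)
  also have "... = ennreal (s powr (n / 2) / (n / 2))"
  by (rule nn_integral_has_integral_lborel[OF _ _ hi]) auto
  also have "C * ennreal (n / 2) * ennreal (s powr (n / 2) / (n / 2)) = C * ennreal (s powr (n / 2))"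
  using n by (simp add: mult.assoc ennreal_mult[symmetric])
  finally show ?thesis using False by simp
 qed
 have L_atMost: "emeasure (distr (leb I) borel ?r) {..s} = C * ennreal (if s <= 0 then 0 else s powr (n / 2))" for s
 proof -
  have "emeasure (distr (leb I) borel ?r) {..s} = emeasure (leb I) {x : extensional I. ?r x <= s}"
  by (subst emeasure_distr) (auto intro!: arg_cong2[where f = emeasure])
  also have "... = C * ennreal (if s <= 0 then 0 else s powr (n / 2))"
  proof (cases "s <= 0")
  case True
  obtain j where j: "j : I" using I by auto
  have "emeasure (leb I) {x : extensional I. ?r x <= s} <= emeasure (leb I) (Pi\<^sub>E I (%_. {0}))"
  proof (rule emeasure_mono)
  show "{x : extensional I. ?r x <= s} \<subseteq> Pi\<^sub>E I (%_. {0})"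
  proof
  fix x assume x: "x : {x : extensional I. ?r x <= s}"
  then have "?r x = 0" using True sum_nonneg[of I "%i. (x i)\<^sup>2"] by auto
  then have "\<forall>i\<in>I. x i = 0" using I by (subst (asm) sum_nonneg_eq_0_iff) auto
  then show "x : Pi\<^sub>E I (%_. {0})" using x by (intro PiE_I) (auto simp: extensional_def)
  qed
  show "Pi\<^sub>E I (%_. {0}) : sets (leb I)" unfolding sets_leb by (rule sets_PiM_I_finite[OF I(1)]) simp
  qed
  also have "... = (\<Prod>i\<in>I. emeasure lborel {0::real})" by (rule emeasure_leb_box[OF I(1)]) simp
  also have "... = 0" using I by (simp add: card_gt_0_iff)
  finally show ?thesis using True by simp
  next
  case False
  then have s: "s > 0" by simp
  have "emeasure (leb I) {x : extensional I. ?r x <= s} = (\<integral>\<^sup>+x. indicator {x : extensional I. ?r x <= s} x \<partial>leb I)"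
  by simp
  also have "... = (\<integral>\<^sup>+x. indicator ?B (\<lambda>i\<in>I. (1 / sqrt s) * x i) \<partial>leb I)"
  proof (intro nn_integral_cong)
  fix x assume "x : space (leb I)"
  moreover have "(\<Sum>i\<in>I. ((1 / sqrt s) * x i)\<^sup>2) = ?r x / s"
  using s by (simp add: power_mult_distrib sum_divide_distrib power_divide)
  ultimately show "indicator {x : extensional I. ?r x <= s} x = (indicator ?B (\<lambda>i\<in>I. (1 / sqrt s) * x i) :: ennreal)"
  using s by (auto simp: indicator_def divide_le_eq_1)
  qed
  also have "... = ennreal ((1 / (1 / sqrt s)) ^ card I) * (\<integral>\<^sup>+x. indicator ?B x \<partial>leb I)"
  using s I by (intro nn_integral_leb_scale) auto
  also have "(\<integral>\<^sup>+x. indicator ?B x \<partial>leb I) = C" by (simp add: C_def)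
  also have "(1 / (1 / sqrt s)) ^ card I = s powr (n / 2)"
  using s by (simp add: powr_half_sqrt[symmetric] n_def powr_realpow[symmetric] powr_powr)
  finally show ?thesis using False by (simp add: mult.commute)
  qed
  finally show ?thesis .
 qed
 have "distr (leb I) borel ?r = D"
 proof (rule measure_eqI_generator_eq[where E = "range atMost" and \<Omega> = UNIV and A = "%i. {..real i}"])
  show "Int_stable (range atMost :: real set set)" by (auto simp: Int_stable_def)
  show "emeasure (distr (leb I) borel ?r) X = emeasure D X" if "X : range atMost" for X
  using that L_atMost D_atMost by auto
  show "sets (distr (leb I) borel ?r) = sigma_sets UNIV (range atMost)" "sets D = sigma_sets UNIV (range atMost)"
  by (simp_all add: D_def borel_eq_atMost)
  show "(\<Union>i. {..real i}) = UNIV" using real_arch_simple by auto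
  show "emeasure (distr (leb I) borel ?r) {..real i} ~= \<infinity>" for i
  using C by (auto simp: L_atMost ennreal_mult_eq_top_iff)
 qed auto
 moreover have "C * ennreal (n / 2) < \<infinity>" using C by (simp add: ennreal_mult_less_top)
 ultimately show ?thesis using that[of "C * ennreal (n / 2)"] unfolding D_def n_def by blast
qed

text \<open>The Gaussian density is a function of the sum of squares, so it multiplies the radial
  law by \<open>exp (- s / 2)\<close>. All constants collapse into one number \<open>K\<close>, and
  \<open>K = 1\<close> because both sides are probability measures.\<close>

theorem distr_gauss_sq_sum:
 assumes I: "finite I"
 shows "distr (gauss I) borel (%x. \<Sum>i\<in>I. (x i)\<^sup>2) = chi2 (card I)"
proof (cases "I = {}")
 case True
 have "distr (gauss ({} :: 'a set)) borel (%x. 0) = return borel (0::real)"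
  using prob_space.emeasure_space_1[OF prob_space_gauss[of "{} :: 'a set"]]
  by (intro measure_eqI) (auto simp: emeasure_distr indicator_def)
 then show ?thesis using True by (simp add: chi2_def)
next
 case False
 let ?r = "%x :: 'a => real. \<Sum>i\<in>I. (x i)\<^sup>2"
 obtain C where C: "C < \<infinity>" "distr (leb I) borel ?r
  = density lborel (%s. C * ennreal (if s <= 0 then 0 else s powr (card I / 2 - 1)))"
  by (rule distr_leb_sq_sum[OF I False])
 define n where "n = real (card I)"
 have n: "n > 0" using False I by (simp add: n_def card_gt_0_iff)
 define b where "b = 2 powr (n / 2) * Gamma (n / 2)"
 have b: "b > 0" using n by (auto simp: b_def intro!: Gamma_real_pos)
 define K where "K = ennreal ((1 / sqrt (2 * pi)) ^ card I) * C * ennreal b"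
 have dens: "C * ennreal (if s <= 0 then 0 else s powr (n / 2 - 1)) * ennreal (exp (- s / 2))
  = C * ennreal b * ennreal (chi_square_density n s)" for s
 proof -
  have "(if s <= 0 then 0 else s powr (n / 2 - 1)) * exp (- s / 2) = b * chi_square_density n s"
  using b by (simp add: chi_square_density_def b_def[symmetric])
  moreover have "0 <= chi_square_density n s" using n by (rule chi_square_density_nonneg)
  ultimately have "ennreal (if s <= 0 then 0 else s powr (n / 2 - 1)) * ennreal (exp (- s / 2)) = ennreal b * ennreal (chi_square_density n s)"
  using b by (simp add: ennreal_mult[symmetric])
  then show ?thesis by (simp only: mult.assoc)
 qed
 have eq: "emeasure (distr (gauss I) borel ?r) A = K * emeasure (chi_square n) A" if A [measurable]: "A : sets borel" for A
 proof -
  have "emeasure (distr (gauss I) borel ?r) A = (\<integral>\<^sup>+x. indicator A (?r x) \<partial>gauss I)"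
  by (subst nn_integral_indicator[symmetric], simp, subst nn_integral_distr) auto
  also have "... = ennreal ((1 / sqrt (2 * pi)) ^ card I) * (\<integral>\<^sup>+x. ennreal (exp (- (?r x) / 2)) * indicator A (?r x) \<partial>leb I)"
  by (rule nn_integral_gauss[OF I]) measurable
  also have "(\<integral>\<^sup>+x. ennreal (exp (- (?r x) / 2)) * indicator A (?r x) \<partial>leb I)
  = (\<integral>\<^sup>+s. ennreal (exp (- s / 2)) * indicator A s \<partial>distr (leb I) borel ?r)"
  by (subst nn_integral_distr) auto
  also have "... = (\<integral>\<^sup>+s. C * ennreal b * (ennreal (chi_square_density n s) * indicator A s) \<partial>lborel)"
  unfolding C(2) by (subst nn_integral_density) (auto simp: n_def[symmetric] dens[symmetric] mult.assoc[symmetric] intro!: nn_integral_cong)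
  also have "... = C * ennreal b * emeasure (chi_square n) A"
  unfolding chi_square_def by (subst nn_integral_cmult) (auto simp: emeasure_density)
  finally show ?thesis by (simp add: K_def mult.assoc)
 qed
 have "emeasure (distr (gauss I) borel ?r) UNIV = 1"
  using prob_space.emeasure_space_1[OF prob_space_gauss[of I]] by (subst emeasure_distr) auto
 moreover have "emeasure (chi_square n) UNIV = 1"
  using prob_space.emeasure_space_1[OF prob_space_chi_square[OF n]] by (simp add: chi_square_def)
 ultimately have "K = 1" using eq[of UNIV] by simp
 then have "distr (gauss I) borel ?r = chi_square n"
  using eq by (intro measure_eqI) (auto simp: chi_square_def)
 then show ?thesis using False I by (simp add: chi2_def n_def)
qed

lemma nn_integral_gauss_sq_sum:
 assumes "finite I" and [measurable]: "f : borel_measurable borel"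
 shows "(\<integral>\<^sup>+x. f (\<Sum>i\<in>I. (x i)\<^sup>2) \<partial>gauss I) = (\<integral>\<^sup>+s. f s \<partial>chi2 (card I))"
 by (subst distr_gauss_sq_sum[OF assms(1), symmetric], subst nn_integral_distr) auto

lemma nn_integral_gauss_split:
 assumes "I \<inter> J = {}" "finite I" "finite J"
  and f [measurable]: "f : borel_measurable (PiM (I \<union> J) (%_. borel))"
 shows "(\<integral>\<^sup>+x. f x \<partial>gauss (I \<union> J)) = (\<integral>\<^sup>+x. \<integral>\<^sup>+y. f (merge I J (x, y)) \<partial>gauss J \<partial>gauss I)"
 unfolding gauss_def
 by (rule normal_prod.product_nn_integral_fold[OF assms(1-3)])
  (simp add: measurable_cong_sets[OF sets_gauss[unfolded gauss_def] refl])

text \<open>No convolution of densities: the coordinates of one Gaussian vector are split into two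
  blocks.\<close>

lemma nn_integral_chi2_add:
 assumes [measurable]: "f : borel_measurable borel"
 shows "(\<integral>\<^sup>+x. \<integral>\<^sup>+y. f (x + y) \<partial>chi2 b \<partial>chi2 a) = (\<integral>\<^sup>+s. f s \<partial>chi2 (a + b))"
proof -
 let ?I = "{..<a}" and ?J = "{a..<a + b}"
 have IJ: "?I \<inter> ?J = {}" "?I \<union> ?J = {..<a + b}" by auto
 have *: "(SUM i<a + b. (merge ?I ?J (x, y) i)\<^sup>2) = (\<Sum>i\<in>?I. (x i)\<^sup>2) + (\<Sum>i\<in>?J. (y i)\<^sup>2)" for x y :: "nat => real"
  unfolding IJ(2)[symmetric] by (subst sum.union_disjoint) (auto simp: IJ merge_def)
 have "(\<integral>\<^sup>+s. f s \<partial>chi2 (a + b)) = (\<integral>\<^sup>+x. f (SUM i<a + b. (x i)\<^sup>2) \<partial>gauss {..<a + b})"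
  using nn_integral_gauss_sq_sum[of "{..<a + b}" f] by simp
 also have "... = (\<integral>\<^sup>+x. \<integral>\<^sup>+y. f ((\<Sum>i\<in>?I. (x i)\<^sup>2) + (\<Sum>i\<in>?J. (y i)\<^sup>2)) \<partial>gauss ?J \<partial>gauss ?I)"
  unfolding IJ(2)[symmetric] by (subst nn_integral_gauss_split) (auto simp: IJ *)
 also have "... = (\<integral>\<^sup>+x. \<integral>\<^sup>+y. f ((\<Sum>i\<in>?I. (x i)\<^sup>2) + y) \<partial>chi2 b \<partial>gauss ?I)"
  using nn_integral_gauss_sq_sum[of ?J "%y. f (_ + y)"] by (intro nn_integral_cong) auto
 also have "... = (\<integral>\<^sup>+x. \<integral>\<^sup>+y. f (x + y) \<partial>chi2 b \<partial>chi2 a)"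
 proof -
  interpret prob_space "chi2 b" by (rule prob_space_chi2)
  show ?thesis
  using nn_integral_gauss_sq_sum[of ?I "%x. \<integral>\<^sup>+y. f (x + y) \<partial>chi2 b"] by simp
 qed
 finally show ?thesis by simp
qed

lemma AE_chi2_pos: "k > 0 ==> AE x in chi2 k. x > 0"
 unfolding chi2_def chi_square_def by (simp add: AE_density chi_square_density_def)

lemma AE_chi2_nonneg: "AE x in chi2 k. x >= 0"
proof (cases "k = 0")
 case True then show ?thesis unfolding chi2_def by (simp add: AE_return)
next
 case False then show ?thesis using AE_chi2_pos[of k] by (auto elim: eventually_mono)
qed

text \<open>All moments of chi-squared variables used below come from this identity, which lowers the
  degrees of freedom by two at the cost of one factor.\<close>

lemma nn_integral_chi2_size_bias:
 assumes k: "k > 0" and f [measurable]: "f : borel_measurable borel"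
 shows "(\<integral>\<^sup>+x. ennreal x * f x \<partial>chi2 k) = of_nat k * (\<integral>\<^sup>+x. f x \<partial>chi2 (k + 2))"
proof -
 have "ennreal (chi_square_density (real k) x) * ennreal x = ennreal (real k) * ennreal (chi_square_density (real (k + 2)) x)" for x
 proof (cases "x > 0")
  case True
  have "Gamma (real (k + 2) / 2) = (real k / 2) * Gamma (real k / 2)"
  using Gamma_plus1[of "real k / 2"] k nonpos_Ints_nonpos[of "real k / 2"] by (auto simp: add_divide_distrib add.commute dest: nonpos_Ints_nonpos)
  moreover have "2 powr (real (k + 2) / 2) = 2 * 2 powr (real k / 2)"
  by (simp add: add_divide_distrib powr_add)
  moreover have "x powr (real (k + 2) / 2 - 1) = x powr (real k / 2 - 1) * x"
  using True by (simp add: add_divide_distrib powr_diff)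
  ultimately have "chi_square_density (real (k + 2)) x
  = (x powr (real k / 2 - 1) * x) * exp (- x / 2) / ((2 * 2 powr (real k / 2)) * ((real k / 2) * Gamma (real k / 2)))"
  using True by (simp only: chi_square_density_def not_le[symmetric] if_False)
  then have "chi_square_density (real k) x * x = real k * chi_square_density (real (k + 2)) x"
  using True k by (simp add: chi_square_density_def)
  then show ?thesis using True k
  by (simp add: ennreal_mult[symmetric] chi_square_density_nonneg)
 next
  case False then show ?thesis by (simp add: chi_square_density_def)
 qed
 then show ?thesis
  using k unfolding chi2_def chi_square_def
  by (simp add: nn_integral_density nn_integral_cmult[symmetric] mult.assoc[symmetric] ennreal_of_nat_eq_real_of_nat)
qed

section \<open>Householder reflections\<close>

text \<open>Off \<open>I\<close> the coordinate is the constant \<open>undefined\<close> on the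
  whole space; with this, measurability proofs carry no side condition on indices.\<close>

lemma measurable_component_any [measurable (raw)]:
 "(%x. x i) : borel_measurable (PiM I (%_. borel :: real measure))"
proof (cases "i : I")
 case False
 then have "(%x. x i) : borel_measurable (PiM I (%_. borel :: real measure))
  \<longleftrightarrow> (%x. undefined :: real) : borel_measurable (PiM I (%_. borel :: real measure))"
  by (intro measurable_cong) (auto simp: space_PiM PiE_def extensional_def)
 then show ?thesis by simp
qed measurable

definition ip :: "'i set => ('i => real) => ('i => real) => real" where
 "ip I x y = (\<Sum>i\<in>I. x i * y i)"

text \<open>Reflection in the hyperplane orthogonal to \<open>a\<close>. For
  \<open>ip I a a = 0\<close> division by zero turns it into the restriction to \<open>I\<close>,
  which is what is wanted when the vector to be moved is already in place.\<close>

definition householder :: "'i set => ('i => real) => ('i => real) => 'i => real" where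
 "householder I a x = (\<lambda>i\<in>I. x i - 2 * ip I a x / ip I a a * a i)"

lemma ip_cong: "(!!i. i : I ==> x i = x' i) ==> (!!i. i : I ==> y i = y' i) ==> ip I x y = ip I x' y'"
 by (simp add: ip_def)

lemma householder_cong: "(!!i. i : I ==> x i = x' i) ==> householder I a x = householder I a x'"
 using ip_cong[of I a a x x'] by (auto simp: householder_def fun_eq_iff)

lemma ip_lincomb:
 "ip I x (%i. y i - c * z i) = ip I x y - c * ip I x z"
 "ip I (%i. y i - c * z i) x = ip I y x - c * ip I z x"
 by (simp_all add: ip_def sum_subtractf[symmetric] sum_distrib_left algebra_simps)

lemma ip_commute: "ip I x y = ip I y x"
 by (simp add: ip_def mult.commute)

lemma ip_self_eq_0: "finite I ==> ip I a a = 0 \<longleftrightarrow> (\<forall>i\<in>I. a i = 0)"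
 by (simp add: ip_def sum_nonneg_eq_0_iff)

lemma ip_householder: "ip I (householder I a x) (householder I a y) = ip I x y"
proof -
 have "ip I (householder I a x) (householder I a y)
  = ip I (%i. x i - 2 * ip I a x / ip I a a * a i) (%i. y i - 2 * ip I a y / ip I a a * a i)"
  by (rule ip_cong) (simp_all add: householder_def)
 also have "... = ip I x y"
  unfolding ip_lincomb by (cases "ip I a a = 0") (simp_all add: ip_commute[of I x a] ip_commute[of I y a] field_simps)
 finally show ?thesis .
qed

lemma householder_involution:
 assumes "x : extensional I"
 shows "householder I a (householder I a x) = x"
proof -
 have "ip I a (householder I a x) = ip I a (%i. x i - 2 * ip I a x / ip I a a * a i)"
  by (rule ip_cong) (simp_all add: householder_def)
 also have "... = (if ip I a a = 0 then ip I a x else - ip I a x)"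
  unfolding ip_lincomb by simp
 finally have *: "ip I a (householder I a x) = (if ip I a a = 0 then ip I a x else - ip I a x)" .
 have "householder I a (householder I a x) i = x i" if "i : I" for i
  using that unfolding householder_def[of I a "householder I a x"] *
  by (auto simp: householder_def)
 moreover have "householder I a (householder I a x) i = x i" if "i \<notin> I" for i
  using that assms by (simp add: householder_def extensional_def)
 ultimately show ?thesis by (auto simp: fun_eq_iff)
qed

lemma householder_vadd: "householder I a (vadd I x y) = vadd I (householder I a x) (householder I a y)"
proof -
 have "ip I a (vadd I x y) = ip I a x + ip I a y"
  by (simp add: ip_def vadd_def sum.distrib[symmetric] algebra_simps cong: sum.cong)
 then show ?thesis by (auto simp: householder_def vadd_def fun_eq_iff add_divide_distrib algebra_simps)
qed

text \<open>Reflection in the bisector of \<open>v\<close> and the vector of length \<open>r\<close>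
  on the axis \<open>i0\<close>. Since both have the same length,
  \<open>ip I a a = 2 * ip I a v\<close>, so exactly \<open>a\<close> is subtracted from
  \<open>v\<close>.\<close>

lemma householder_maps:
 assumes I: "finite I" "i0 : I" and r: "r = sqrt (ip I v v)" and a: "a = (%i. v i - (if i = i0 then r else 0))"
  and i: "i : I"
 shows "householder I a v i = (if i = i0 then r else 0)"
proof -
 have nn: "ip I v v >= 0" by (auto simp: ip_def intro!: sum_nonneg)
 have r2: "r * r = ip I v v" using nn by (simp add: r)
 define E where "E = (%i. if i = i0 then r else 0)"
 have aE: "a = (%i. v i - 1 * E i)" by (simp add: a E_def)
 have e: "ip I x E = x i0 * r" for x
 proof -
  have "ip I x E = (\<Sum>i\<in>I. if i = i0 then x i * r else 0)"
  unfolding ip_def E_def by (rule sum.cong) auto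
  then show ?thesis using I by simp
 qed
 have av: "ip I a v = r * r - r * v i0"
  unfolding aE ip_lincomb(2) ip_commute[of I E v] e r2 by simp
 have "ip I a a = ip I a v - 1 * ip I a E"
  by (subst (2) aE) (rule ip_lincomb(1))
 then have aa: "ip I a a = 2 * (r * r - r * v i0)"
  unfolding e av by (simp add: a algebra_simps)
 show ?thesis
 proof (cases "ip I a a = 0")
  case True
  then have "a i = 0" using ip_self_eq_0[OF I(1)] i by auto
  then show ?thesis using i by (simp add: householder_def a split: if_splits)
 next
  case False
  then have "2 * ip I a v / ip I a a = 1" by (simp add: av aa)
  then show ?thesis using i by (simp add: householder_def a)
 qed
qed

text \<open>One reflection applied to every column along the row index, that is, multiplication of
  the array from the left by an orthogonal matrix: inner products between columns survive. The
  companion below multiplies from the right.\<close>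

definition reflect_rows :: "'i set => 'j set => ('i => real) => ('i \<times> 'j => real) => 'i \<times> 'j => real" where
 "reflect_rows R J a Z = (\<lambda>(i, j)\<in>R \<times> J. householder R a (%i. Z (i, j)) i)"

definition reflect_cols :: "'i set => 'j set => ('j => real) => ('i \<times> 'j => real) => 'i \<times> 'j => real" where
 "reflect_cols R J a Z = (\<lambda>(i, j)\<in>R \<times> J. householder J a (%j. Z (i, j)) j)"

lemma reflect_rows_eq: "i : R ==> j : J ==> reflect_rows R J a Z (i, j) = householder R a (%i. Z (i, j)) i"
 by (simp add: reflect_rows_def)

lemma reflect_cols_eq: "i : R ==> j : J ==> reflect_cols R J a Z (i, j) = householder J a (%j. Z (i, j)) j"
 by (simp add: reflect_cols_def)

lemma ip_reflect_rows:
 assumes "j : J" "k : J"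
 shows "ip R (%i. reflect_rows R J a Z (i, j)) (%i. reflect_rows R J a Z (i, k)) = ip R (%i. Z (i, j)) (%i. Z (i, k))"
proof -
 have "ip R (%i. reflect_rows R J a Z (i, j)) (%i. reflect_rows R J a Z (i, k))
  = ip R (householder R a (%i. Z (i, j))) (householder R a (%i. Z (i, k)))"
  using assms by (intro ip_cong) (simp_all add: reflect_rows_eq)
 then show ?thesis by (simp add: ip_householder)
qed

lemma ip_reflect_cols:
 assumes "i : R"
 shows "ip J (%j. reflect_cols R J a Z (i, j)) (%j. reflect_cols R J a Z (i, j)) = ip J (%j. Z (i, j)) (%j. Z (i, j))"
proof -
 have "ip J (%j. reflect_cols R J a Z (i, j)) (%j. reflect_cols R J a Z (i, j))
  = ip J (householder J a (%j. Z (i, j))) (householder J a (%j. Z (i, j)))"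
  using assms by (intro ip_cong) (simp_all add: reflect_cols_eq)
 then show ?thesis by (simp add: ip_householder)
qed

lemma measurable_reflect [measurable]:
 "reflect_rows R J a : measurable (PiM (R \<times> J) (%_. borel)) (PiM (R \<times> J) (%_. borel))"
 "reflect_cols R J b : measurable (PiM (R \<times> J) (%_. borel)) (PiM (R \<times> J) (%_. borel))"
proof -
 have "(%Z. (%(i, j). householder R a (%i. Z (i, j)) i) ij) : borel_measurable (PiM (R \<times> J) (%_. borel))"
  "(%Z. (%(i, j). householder J b (%j. Z (i, j)) j) ij) : borel_measurable (PiM (R \<times> J) (%_. borel))"
  if "ij : R \<times> J" for ij
  using that by (auto simp: householder_def ip_def)
 then show "reflect_rows R J a : measurable (PiM (R \<times> J) (%_. borel)) (PiM (R \<times> J) (%_. borel))"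
  "reflect_cols R J b : measurable (PiM (R \<times> J) (%_. borel)) (PiM (R \<times> J) (%_. borel))"
  unfolding reflect_rows_def[abs_def] reflect_cols_def[abs_def] by (intro measurable_restrict; simp)+
qed

lemma nn_integral_reflect_rows:
 assumes "finite R" "finite J" "f : borel_measurable (PiM (R \<times> J) (%_. borel))"
 shows "(\<integral>\<^sup>+Z. f (reflect_rows R J a Z) \<partial>gauss (R \<times> J)) = (\<integral>\<^sup>+Z. f Z \<partial>gauss (R \<times> J))"
proof (rule nn_integral_gauss_isometry)
 fix x y :: "'a \<times> 'b => real" assume x: "x : extensional (R \<times> J)"
 show "reflect_rows R J a (vadd (R \<times> J) x y) = vadd (R \<times> J) (reflect_rows R J a x) (reflect_rows R J a y)"
 proof (rule ext, clarify)
  fix i j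
  have "householder R a (%i. vadd (R \<times> J) x y (i, j)) = householder R a (vadd R (%i. x (i, j)) (%i. y (i, j)))"
  if "j : J" using that by (intro householder_cong) (simp add: vadd_def)
  then show "reflect_rows R J a (vadd (R \<times> J) x y) (i, j) = vadd (R \<times> J) (reflect_rows R J a x) (reflect_rows R J a y) (i, j)"
  by (auto simp: reflect_rows_def vadd_def[of "R \<times> J"] householder_vadd) (simp add: vadd_def)
 qed
 show "reflect_rows R J a (reflect_rows R J a x) = x"
 proof (rule ext, clarify)
  fix i j
  show "reflect_rows R J a (reflect_rows R J a x) (i, j) = x (i, j)"
  proof (cases "i : R & j : J")
  case True
  have "householder R a (%i. reflect_rows R J a x (i, j)) = householder R a (householder R a (\<lambda>i\<in>R. x (i, j)))"
  using True by (intro householder_cong) (auto simp: reflect_rows_eq intro: fun_cong[OF householder_cong])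
  then show ?thesis using True by (simp add: reflect_rows_eq householder_involution)
  next
  case False then show ?thesis using x by (auto simp: reflect_rows_def extensional_def)
  qed
 qed
 show "(\<Sum>i\<in>R \<times> J. (reflect_rows R J a x i)\<^sup>2) = (\<Sum>i\<in>R \<times> J. (x i)\<^sup>2)"
 proof -
  have "(\<Sum>i\<in>R \<times> J. (z i)\<^sup>2) = (\<Sum>j\<in>J. ip R (%i. z (i, j)) (%i. z (i, j)))" for z :: "'a \<times> 'b => real"
  by (subst sum.cartesian_product') (subst sum.swap, simp add: ip_def power2_eq_square)
  then show ?thesis by (simp add: ip_reflect_rows cong: sum.cong)
 qed
qed (use assms in auto)

lemma nn_integral_reflect_cols:
 assumes "finite R" "finite J" "f : borel_measurable (PiM (R \<times> J) (%_. borel))"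
 shows "(\<integral>\<^sup>+Z. f (reflect_cols R J a Z) \<partial>gauss (R \<times> J)) = (\<integral>\<^sup>+Z. f Z \<partial>gauss (R \<times> J))"
proof (rule nn_integral_gauss_isometry)
 fix x y :: "'a \<times> 'b => real" assume x: "x : extensional (R \<times> J)"
 show "reflect_cols R J a (vadd (R \<times> J) x y) = vadd (R \<times> J) (reflect_cols R J a x) (reflect_cols R J a y)"
 proof (rule ext, clarify)
  fix i j
  have "householder J a (%j. vadd (R \<times> J) x y (i, j)) = householder J a (vadd J (%j. x (i, j)) (%j. y (i, j)))"
  if "i : R" using that by (intro householder_cong) (simp add: vadd_def)
  then show "reflect_cols R J a (vadd (R \<times> J) x y) (i, j) = vadd (R \<times> J) (reflect_cols R J a x) (reflect_cols R J a y) (i, j)"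
  by (auto simp: reflect_cols_def vadd_def[of "R \<times> J"] householder_vadd) (simp add: vadd_def)
 qed
 show "reflect_cols R J a (reflect_cols R J a x) = x"
 proof (rule ext, clarify)
  fix i j
  show "reflect_cols R J a (reflect_cols R J a x) (i, j) = x (i, j)"
  proof (cases "i : R & j : J")
  case True
  have "householder J a (%j. reflect_cols R J a x (i, j)) = householder J a (householder J a (\<lambda>j\<in>J. x (i, j)))"
  using True by (intro householder_cong) (auto simp: reflect_cols_eq intro: fun_cong[OF householder_cong])
  then show ?thesis using True by (simp add: reflect_cols_eq householder_involution)
  next
  case False then show ?thesis using x by (auto simp: reflect_cols_def extensional_def)
  qed
 qed
 show "(\<Sum>i\<in>R \<times> J. (reflect_cols R J a x i)\<^sup>2) = (\<Sum>i\<in>R \<times> J. (x i)\<^sup>2)"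
 proof -
  have "(\<Sum>i\<in>R \<times> J. (z i)\<^sup>2) = (\<Sum>i\<in>R. ip J (%j. z (i, j)) (%j. z (i, j)))" for z :: "'a \<times> 'b => real"
  by (subst sum.cartesian_product') (simp add: ip_def power2_eq_square)
  then show ?thesis by (simp add: ip_reflect_cols cong: sum.cong)
 qed
qed (use assms in auto)

section \<open>Gram matrices of Gaussian arrays\<close>

text \<open>\<open>s = 0\<close> gives the matrix of inner products of the columns. A positive
  \<open>s\<close> in the corner stands for one more observation of squared length \<open>s\<close>
  that has been rotated onto the first axis.\<close>

definition gram :: "'i set => nat => real => ('i \<times> nat => real) => real mat" where
 "gram R p s Z = mat p p (%(j, k). ip R (%i. Z (i, j)) (%i. Z (i, k)) + (if j = 0 & k = 0 then s else 0))"

definition gram_trace :: "'i set => nat => ('i \<times> nat => real) => real" where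
 "gram_trace R p Z = (SUM j<p. ip R (%i. Z (i, j)) (%i. Z (i, j)))"

lemma gram_cong:
 "(!!j k. j < p ==> k < p ==> ip R (%i. Z (i, j)) (%i. Z (i, k)) = ip R' (%i. Z' (i, j)) (%i. Z' (i, k)))
  ==> gram R p s Z = gram R' p s Z'"
 by (auto simp: gram_def)

lemma gram_trace_cong:
 "(!!j. j < p ==> ip R (%i. Z (i, j)) (%i. Z (i, j)) = ip R' (%i. Z' (i, j)) (%i. Z' (i, j)))
  ==> gram_trace R p Z = gram_trace R' p Z'"
 by (auto simp: gram_trace_def)

lemma measurable_det [measurable]:
 assumes "!!j k. j < p ==> k < p ==> (%x. f x j k) : borel_measurable M"
 shows "(%x. det (mat p p (%(j, k). f x j k :: real))) : borel_measurable M"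
proof -
 have "det (mat p p (%(j, k). f x j k)) = (\<Sum>\<pi> | \<pi> permutes {0..<p}. signof \<pi> * (\<Prod>i = 0..<p. f x i (\<pi> i)))" for x
  by (subst det_def') (auto intro!: sum.cong prod.cong simp: permutes_in_image)
 moreover have "\<pi> i < p" if "\<pi> permutes {0..<p}" "i : {0..<p}" for \<pi> i
  using permutes_in_image[OF that(1), of i] that(2) by simp
 ultimately show ?thesis
  using assms by (auto intro!: borel_measurable_sum borel_measurable_prod borel_measurable_times)
qed

lemma measurable_gram [measurable]:
 "(%Z. det (gram R p s Z)) : borel_measurable (PiM I (%_. borel))"
 "(%Z. gram_trace R p Z) : borel_measurable (PiM I (%_. borel))"
 unfolding gram_def gram_trace_def ip_def by measurable

text \<open>A Cholesky step: when the last column lives in row \<open>m\<close> only, the Gram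
  matrix is a product of two block triangular matrices, each contributing a factor \<open>r\<close>.
  The condition \<open>p > 0\<close> keeps the corner shift inside the leading block.\<close>

lemma det_gram_peel:
 assumes R: "finite R" "m \<notin> R" and p: "p > 0"
  and Z: "!!i. i : R ==> Z (i, p) = 0" "Z (m, p) = r"
 shows "det (gram (insert m R) (Suc p) s Z) = r\<^sup>2 * det (gram R p s Z)"
proof -
 define H where "H = gram R p s Z"
 define z where "z = mat p 1 (%(j, _). Z (m, j))"
 define r1 where "r1 = mat 1 1 (%_. r)"
 have c: "H : carrier_mat p p" "z : carrier_mat p 1" "r1 : carrier_mat 1 1"
  by (simp_all add: H_def gram_def z_def r1_def)
 have "gram (insert m R) (Suc p) s Z = four_block_mat (H + z * transpose_mat z) (z * r1) (r1 * transpose_mat z) (r1 * r1)"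
  (is "_ = ?G")
 proof (rule eq_matI)
  show "dim_row (gram (insert m R) (Suc p) s Z) = dim_row ?G" "dim_col (gram (insert m R) (Suc p) s Z) = dim_col ?G"
  using c by (simp_all add: gram_def)
  fix j k assume "j < dim_row ?G" "k < dim_col ?G"
  then have jk: "j < Suc p" "k < Suc p" using c by simp_all
  have "ip (insert m R) (%i. Z (i, j)) (%i. Z (i, k)) = Z (m, j) * Z (m, k) + ip R (%i. Z (i, j)) (%i. Z (i, k))"
  using R by (simp add: ip_def)
  moreover have "ip R (%i. Z (i, p)) x = 0" "ip R x (%i. Z (i, p)) = 0" for x
  using Z by (simp_all add: ip_def)
  ultimately show "gram (insert m R) (Suc p) s Z $$ (j, k) = ?G $$ (j, k)"
  using jk p Z by (cases "j < p"; cases "k < p") (auto simp: gram_def H_def z_def r1_def scalar_prod_def less_Suc_eq)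
 qed
 also have "... = four_block_mat H z (0\<^sub>m 1 p) r1 * four_block_mat (1\<^sub>m p) (0\<^sub>m p 1) (transpose_mat z) r1"
  using c by (subst mult_four_block_mat[where ?nr1.0 = p and ?n1.0 = p and ?n2.0 = 1 and ?nr2.0 = 1 and ?nc1.0 = p and ?nc2.0 = 1]) auto
 also have "det ... = det (four_block_mat H z (0\<^sub>m 1 p) r1) * det (four_block_mat (1\<^sub>m p) (0\<^sub>m p 1) (transpose_mat z) r1)"
  using c by (intro det_mult[where n = "p + 1"]) auto
 also have "det (four_block_mat H z (0\<^sub>m 1 p) r1) = det H * r"
  using c by (subst det_four_block_mat_lower_left_zero[where n = p and m = 1]) (auto simp: det_single r1_def)
 also have "det (four_block_mat (1\<^sub>m p) (0\<^sub>m p 1) (transpose_mat z) r1) = r"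
  using c by (subst det_four_block_mat_upper_right_zero[where n = p and m = 1]) (auto simp: det_single r1_def)
 finally show ?thesis by (simp add: H_def power2_eq_square)
qed

text \<open>Squared diagonal entries in the Bartlett decomposition of a Gaussian array with
  \<open>q + p\<close> rows and \<open>p\<close> columns. Peeling starts with the last column and
  each step uses up one row, which leaves \<open>q + 1 + j\<close> degrees of freedom to column
  \<open>j\<close>.\<close>

definition bdiag :: "nat => nat => (nat => real) measure" where
 "bdiag p q = PiM {..<p} (%j. chi2 (q + 1 + j))"

interpretation chi_prod: product_prob_space "%j::nat. chi2 (q + 1 + j)" UNIV for q
 by (rule product_prob_spaceI) (rule prob_space_chi2)

lemma sets_bdiag [measurable_cong, simp]: "sets (bdiag p q) = sets (PiM {..<p} (%_. borel))"
 unfolding bdiag_def by (rule sets_PiM_cong) auto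

lemma prob_space_bdiag: "prob_space (bdiag p q)"
 unfolding bdiag_def by (rule prob_space_PiM) (rule prob_space_chi2)

lemma nn_integral_bdiag_Suc:
 assumes f: "f : borel_measurable (PiM {..<Suc p} (%_. borel))"
 shows "(\<integral>\<^sup>+x. f x \<partial>bdiag (Suc p) q) = (\<integral>\<^sup>+x. \<integral>\<^sup>+c. f (x(p := c)) \<partial>chi2 (q + 1 + p) \<partial>bdiag p q)"
 unfolding bdiag_def lessThan_Suc
 by (rule chi_prod.product_nn_integral_insert)
  (use f in \<open>simp_all add: measurable_cong_sets[OF sets_bdiag[unfolded bdiag_def] refl] lessThan_Suc[symmetric]\<close>)

text \<open>The reflection that carries the last column \<open>v\<close> to a multiple of the last
  unit vector is determined by \<open>v\<close> alone and is applied to the other columns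
  \<open>Z\<close>. Their last row then drops out of the determinant and survives in the trace as
  off-diagonal squares.\<close>

lemma gram_peel_column:
 fixes v Z :: "nat \<times> nat => real" and m p :: nat
 assumes p: "p > 0"
 defines "R \<equiv> {1..Suc m}" and "r \<equiv> sqrt (\<Sum>ij\<in>{1..Suc m} \<times> {p}. (v ij)\<^sup>2)"
 defines "a \<equiv> (%i. v (i, p) - (if i = Suc m then r else 0))"
 defines "Y \<equiv> merge (R \<times> {p}) (R \<times> {..<p}) (v, Z)" and "Z' \<equiv> reflect_rows R {..<p} a Z"
 shows "det (gram R (Suc p) s Y) = r\<^sup>2 * det (gram {1..m} p s Z')"
  and "gram_trace R (Suc p) Y = r\<^sup>2 + ((SUM j<p. (Z' (Suc m, j))\<^sup>2) + gram_trace {1..m} p Z')"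
proof -
 define W where "W = (%(i, j). if j = p then (if i = Suc m then r else 0) else Z' (i, j))"
 have "(\<Sum>ij\<in>{1..Suc m} \<times> {p}. (v ij)\<^sup>2) = ip R (%i. v (i, p)) (%i. v (i, p))"
  by (subst sum.cartesian_product') (simp add: ip_def R_def power2_eq_square)
 then have r: "r = sqrt (ip R (%i. v (i, p)) (%i. v (i, p)))" by (simp add: r_def)
 have W: "householder R a (%i. Y (i, j)) i = W (i, j)" if "i : R" "j < Suc p" for i j
 proof (cases "j = p")
  case True
  have "householder R a (%i. Y (i, j)) = householder R a (%i. v (i, p))"
  using True by (intro householder_cong) (simp add: Y_def merge_def)
  moreover have "householder R a (%i. v (i, p)) i = (if i = Suc m then r else 0)"
  using that(1) by (intro householder_maps[OF _ _ r a_def[THEN meta_eq_to_obj_eq]]) (simp_all add: R_def)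
  ultimately show ?thesis using True by (simp add: W_def)
 next
  case False
  have "householder R a (%i. Y (i, j)) = householder R a (%i. Z (i, j))"
  using False that by (intro householder_cong) (simp add: Y_def merge_def)
  then show ?thesis using False that by (simp add: W_def Z'_def reflect_rows_eq)
 qed
 have ipW: "ip R (%i. Y (i, j)) (%i. Y (i, k)) = ip R (%i. W (i, j)) (%i. W (i, k))" if "j < Suc p" "k < Suc p" for j k
 proof -
  have "ip R (%i. W (i, j)) (%i. W (i, k)) = ip R (householder R a (%i. Y (i, j))) (householder R a (%i. Y (i, k)))"
  using that by (intro ip_cong) (simp_all add: W)
  then show ?thesis by (simp add: ip_householder)
 qed
 have Rins: "R = insert (Suc m) {1..m}" by (auto simp: R_def)
 have "det (gram R (Suc p) s Y) = det (gram R (Suc p) s W)"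
  using gram_cong[of "Suc p" R Y R W s] ipW by simp
 also have "... = r\<^sup>2 * det (gram {1..m} p s W)"
  unfolding Rins using p by (intro det_gram_peel) (auto simp: W_def)
 also have "gram {1..m} p s W = gram {1..m} p s Z'"
  by (intro gram_cong) (simp add: W_def)
 finally show "det (gram R (Suc p) s Y) = r\<^sup>2 * det (gram {1..m} p s Z')" .
 have "gram_trace R (Suc p) Y = gram_trace R (Suc p) W"
  using gram_trace_cong[of "Suc p" R Y R W] ipW by simp
 also have "... = (SUM j<p. ip R (%i. Z' (i, j)) (%i. Z' (i, j))) + r\<^sup>2"
 proof -
  have "ip R (%i. W (i, p)) (%i. W (i, p)) = r\<^sup>2"
  unfolding Rins ip_def by (simp add: W_def power2_eq_square)
  then show ?thesis by (simp add: gram_trace_def) (simp add: W_def)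
 qed
 also have "(SUM j<p. ip R (%i. Z' (i, j)) (%i. Z' (i, j))) = (SUM j<p. (Z' (Suc m, j))\<^sup>2) + gram_trace {1..m} p Z'"
  unfolding Rins ip_def gram_trace_def by (simp add: sum.distrib power2_eq_square)
 finally show "gram_trace R (Suc p) Y = r\<^sup>2 + ((SUM j<p. (Z' (Suc m, j))\<^sup>2) + gram_trace {1..m} p Z')" by simp
qed

lemma nn_integral_gauss_split_rows:
 fixes p :: nat
 assumes "m \<notin> R" "finite R" and [measurable]: "f : borel_measurable (PiM (insert m R \<times> {..<p}) (%_. borel))"
 shows "(\<integral>\<^sup>+Z. f Z \<partial>gauss (insert m R \<times> {..<p}))
  = (\<integral>\<^sup>+y. \<integral>\<^sup>+Z. f (merge ({m} \<times> {..<p}) (R \<times> {..<p}) (y, Z)) \<partial>gauss (R \<times> {..<p}) \<partial>gauss ({m} \<times> {..<p}))"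
proof -
 have *: "insert m R \<times> {..<p} = {m} \<times> {..<p} \<union> R \<times> {..<p}" by auto
 show ?thesis
  using nn_integral_gauss_split[of "{m} \<times> {..<p}" "R \<times> {..<p}" f, folded *] assms by (auto simp: disjoint_iff)
qed

text \<open>Bartlett's decomposition, phrased with an arbitrary test function so that the joint law
  of the three quantities is carried along. \<open>x\<close> holds the squared diagonal entries and
  \<open>w\<close> the sum of the squared off-diagonal ones, hence \<open>\<Sum>{..<p}\<close>
  degrees of freedom. The corner shift meets only the column that is peeled at the end, so it is
  added to \<open>x 0\<close> alone.\<close>

theorem nn_integral_wishart:
 assumes "p > 0" and F: "F : borel_measurable (borel \<Otimes>\<^sub>M borel \<Otimes>\<^sub>M borel)"
 shows "(\<integral>\<^sup>+Z. F (det (gram {1..q + p} p 0 Z), det (gram {1..q + p} p s Z), gram_trace {1..q + p} p Z)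
  \<partial>gauss ({1..q + p} \<times> {..<p}))
  = (\<integral>\<^sup>+w. \<integral>\<^sup>+x. F (\<Prod>j<p. x j, (x 0 + s) * (\<Prod>j\<in>{1..<p}. x j), (SUM j<p. x j) + w)
  \<partial>bdiag p q \<partial>chi2 (\<Sum>{..<p}))"
 using assms
proof (induction p arbitrary: F rule: nat_induct_non_zero)
 case 1
 note [measurable] = 1
 let ?R = "{1..q + 1}" and ?I = "{1..q + 1} \<times> {..<1::nat}"
 have one: "det (gram ?R 1 s Z) = (\<Sum>ij\<in>?I. (Z ij)\<^sup>2) + s" "gram_trace ?R 1 Z = (\<Sum>ij\<in>?I. (Z ij)\<^sup>2)" for Z s
  by (subst sum.cartesian_product', simp add: gram_def gram_trace_def det_single ip_def power2_eq_square)+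
 have "(\<integral>\<^sup>+Z. F (det (gram ?R 1 0 Z), det (gram ?R 1 s Z), gram_trace ?R 1 Z) \<partial>gauss ?I)
  = (\<integral>\<^sup>+Z. (%u. F (u, u + s, u)) (\<Sum>ij\<in>?I. (Z ij)\<^sup>2) \<partial>gauss ?I)"
  unfolding one by simp
 also have "... = (\<integral>\<^sup>+u. F (u, u + s, u) \<partial>chi2 (q + 1))"
  by (subst nn_integral_gauss_sq_sum) auto
 also have "... = (\<integral>\<^sup>+x. F (x 0, x 0 + s, x 0) \<partial>bdiag 1 q)"
 proof -
  have "(%u. F (u, u + s, u)) : borel_measurable (chi2 k)" for k by measurable
  then show ?thesis
  using chi_prod.product_nn_integral_singleton[of "%u. F (u, u + s, u)" q 0]
  by (simp add: bdiag_def lessThan_Suc)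
 qed
 also have "... = (\<integral>\<^sup>+w. \<integral>\<^sup>+x. F (\<Prod>j<1. x j, (x 0 + s) * (\<Prod>j\<in>{1..<1}. x j), (SUM j<1. x j) + w)
  \<partial>bdiag 1 q \<partial>chi2 (\<Sum>{..<1}))"
 proof -
  interpret prob_space "bdiag (Suc 0) q" by (rule prob_space_bdiag)
  have "0 : {..<1::nat}" by simp
  then show ?thesis
  by (simp add: chi2_def) (subst nn_integral_return, auto)
 qed
 finally show ?case .
next
 case (Suc p)
 note Fm [measurable] = Suc.prems
 note p [simp] = Suc.hyps
 have p0 [simp, measurable]: "0 : {..<p}" by simp
 define m where "m = q + p"
 let ?R = "{1..Suc m}" and ?Rm = "{1..m}"
 let ?C = "?R \<times> {p}" and ?B = "?R \<times> {..<p}" and ?Brow = "{Suc m} \<times> {..<p}" and ?Bin = "?Rm \<times> {..<p}"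
 define G where "G = (%Z. F (det (gram ?R (Suc p) 0 Z), det (gram ?R (Suc p) s Z), gram_trace ?R (Suc p) Z))"
 define H where "H = (%c Z. F (c * det (gram ?Rm p 0 Z), c * det (gram ?Rm p s Z),
  c + ((SUM j<p. (Z (Suc m, j))\<^sup>2) + gram_trace ?Rm p Z)))"
 define K where "K = (%c w. \<integral>\<^sup>+x. F (c * (\<Prod>j<p. x j), c * ((x 0 + s) * (\<Prod>j\<in>{1..<p}. x j)),
  c + ((SUM j<p. x j) + w)) \<partial>bdiag p q)"
 have Gm [measurable]: "G : borel_measurable (PiM I (%_. borel))" for I unfolding G_def by measurable
 have Hm [measurable]: "H c : borel_measurable (PiM I (%_. borel))" for I c unfolding H_def by measurable
 interpret D: prob_space "bdiag p q" by (rule prob_space_bdiag)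
 have Km [measurable]: "case_prod K : borel_measurable (borel \<Otimes>\<^sub>M borel)"
  unfolding K_def by measurable
 \<comment> \<open>For a fixed last column the reflection is fixed too and preserves the law of the
   remaining columns; splitting the integral in this way takes the place of conditioning.\<close>
 have peel: "(\<integral>\<^sup>+Z. G (merge ?C ?B (v, Z)) \<partial>gauss ?B) = (\<integral>\<^sup>+Z. H (\<Sum>ij\<in>?C. (v ij)\<^sup>2) Z \<partial>gauss ?B)" for v
 proof -
  define c where "c = (\<Sum>ij\<in>?C. (v ij)\<^sup>2)"
  have c: "c >= 0" unfolding c_def by (intro sum_nonneg) auto
  define a where "a = (%i. v (i, p) - (if i = Suc m then sqrt c else 0))"
  have "G (merge ?C ?B (v, Z)) = H c (reflect_rows ?R {..<p} a Z)" for Z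
  using gram_peel_column[OF p, where m = m and v = v and Z = Z] c
  unfolding G_def H_def a_def c_def[symmetric] by simp
  then show ?thesis
  unfolding c_def[symmetric] by (simp only:) (rule nn_integral_reflect_rows, auto)
 qed
 have rows: "(\<integral>\<^sup>+Z. H c Z \<partial>gauss ?B) = (\<integral>\<^sup>+w. K c w \<partial>chi2 (\<Sum>{..<Suc p}))" for c
 proof -
  have ins: "?R = insert (Suc m) ?Rm" by auto
  have Hmerge: "H c (merge ?Brow ?Bin (y, Z)) = F (c * det (gram ?Rm p 0 Z), c * det (gram ?Rm p s Z),
  c + ((\<Sum>ij\<in>?Brow. (y ij)\<^sup>2) + gram_trace ?Rm p Z))" for y Z
  proof -
  have "gram ?Rm p s (merge ?Brow ?Bin (y, Z)) = gram ?Rm p s Z" for s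
  by (intro gram_cong ip_cong) (simp_all add: merge_def)
  moreover have "gram_trace ?Rm p (merge ?Brow ?Bin (y, Z)) = gram_trace ?Rm p Z"
  by (intro gram_trace_cong ip_cong) (simp_all add: merge_def)
  moreover have "(SUM j<p. (merge ?Brow ?Bin (y, Z) (Suc m, j))\<^sup>2) = (\<Sum>ij\<in>?Brow. (y ij)\<^sup>2)"
  by (subst sum.cartesian_product') (simp add: merge_def)
  ultimately show ?thesis by (simp add: H_def)
  qed
  have "(\<integral>\<^sup>+Z. H c Z \<partial>gauss ?B) = (\<integral>\<^sup>+y. \<integral>\<^sup>+Z. H c (merge ?Brow ?Bin (y, Z)) \<partial>gauss ?Bin \<partial>gauss ?Brow)"
  unfolding ins by (rule nn_integral_gauss_split_rows) (auto simp: ins[symmetric])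
  also have "... = (\<integral>\<^sup>+y. \<integral>\<^sup>+w. K c ((\<Sum>ij\<in>?Brow. (y ij)\<^sup>2) + w) \<partial>chi2 (\<Sum>{..<p}) \<partial>gauss ?Brow)"
  proof (rule nn_integral_cong)
  fix y :: "nat \<times> nat => real"
  define u where "u = (\<Sum>ij\<in>?Brow. (y ij)\<^sup>2)"
  have "(%(d, e, t). F (c * d, c * e, c + (u + t))) : borel_measurable (borel \<Otimes>\<^sub>M borel \<Otimes>\<^sub>M borel)"
  by measurable
  from Suc.IH[OF this] show "(\<integral>\<^sup>+Z. H c (merge ?Brow ?Bin (y, Z)) \<partial>gauss ?Bin)
  = (\<integral>\<^sup>+w. K c ((\<Sum>ij\<in>?Brow. (y ij)\<^sup>2) + w) \<partial>chi2 (\<Sum>{..<p}))"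
  unfolding Hmerge u_def[symmetric] by (simp only: prod.case K_def m_def add.left_commute[of u])
  qed
  \<comment> \<open>The discarded row supplies \<open>p\<close> further squares, which complete
    \<open>\<Sum>{..<p}\<close> to \<open>\<Sum>{..<Suc p}\<close> degrees of freedom.\<close>
  also have "... = (\<integral>\<^sup>+u. \<integral>\<^sup>+w. K c (u + w) \<partial>chi2 (\<Sum>{..<p}) \<partial>chi2 p)"
  proof -
  interpret prob_space "chi2 (\<Sum>{..<p})" by (rule prob_space_chi2)
  show ?thesis
  using nn_integral_gauss_sq_sum[of ?Brow "%u. \<integral>\<^sup>+w. K c (u + w) \<partial>chi2 (\<Sum>{..<p})"] by simp
  qed
  also have "... = (\<integral>\<^sup>+w. K c w \<partial>chi2 (\<Sum>{..<Suc p}))"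
  by (subst nn_integral_chi2_add) (auto simp: add.commute)
  finally show ?thesis .
 qed
 interpret X: prob_space "chi2 (\<Sum>{..<Suc p})" by (rule prob_space_chi2)
 interpret Y: prob_space "chi2 (Suc m)" by (rule prob_space_chi2)
 interpret XY: pair_sigma_finite "chi2 (\<Sum>{..<Suc p})" "chi2 (Suc m)" ..
 interpret DY: pair_sigma_finite "bdiag p q" "chi2 (Suc m)" ..
 have split: "?R \<times> {..<Suc p} = ?C \<union> ?B" by auto
 have "(\<integral>\<^sup>+Z. G Z \<partial>gauss (?R \<times> {..<Suc p})) = (\<integral>\<^sup>+v. \<integral>\<^sup>+Z. G (merge ?C ?B (v, Z)) \<partial>gauss ?B \<partial>gauss ?C)"
  unfolding split by (rule nn_integral_gauss_split) auto
 also have "... = (\<integral>\<^sup>+v. (%c. \<integral>\<^sup>+w. K c w \<partial>chi2 (\<Sum>{..<Suc p})) (\<Sum>ij\<in>?C. (v ij)\<^sup>2) \<partial>gauss ?C)"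
  unfolding peel rows ..
 also have "... = (\<integral>\<^sup>+c. \<integral>\<^sup>+w. K c w \<partial>chi2 (\<Sum>{..<Suc p}) \<partial>chi2 (Suc m))"
 proof -
  have "(%c. \<integral>\<^sup>+w. K c w \<partial>chi2 (\<Sum>{..<Suc p})) : borel_measurable borel" by measurable
  then show ?thesis using nn_integral_gauss_sq_sum[of ?C] by simp
 qed
 also have "... = (\<integral>\<^sup>+w. \<integral>\<^sup>+c. K c w \<partial>chi2 (Suc m) \<partial>chi2 (\<Sum>{..<Suc p}))"
  by (rule XY.Fubini') measurable
 also have "... = (\<integral>\<^sup>+w. \<integral>\<^sup>+x. F (\<Prod>j<Suc p. x j, (x 0 + s) * (\<Prod>j\<in>{1..<Suc p}. x j), (SUM j<Suc p. x j) + w)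
  \<partial>bdiag (Suc p) q \<partial>chi2 (\<Sum>{..<Suc p}))"
 proof (rule nn_integral_cong)
  fix w
  let ?f = "%x. F (\<Prod>j<Suc p. x j, (x 0 + s) * (\<Prod>j\<in>{1..<Suc p}. x j), (SUM j<Suc p. x j) + w)"
  have upd: "?f (x(p := c)) = F (c * (\<Prod>j<p. x j), c * ((x 0 + s) * (\<Prod>j\<in>{1..<p}. x j)), c + ((SUM j<p. x j) + w))" for x c
  proof -
  have "(\<Prod>j<p. (x(p := c)) j) = (\<Prod>j<p. x j)" "(\<Prod>j\<in>{1..<p}. (x(p := c)) j) = (\<Prod>j\<in>{1..<p}. x j)"
  "(SUM j<p. (x(p := c)) j) = (SUM j<p. x j)"
  by (intro prod.cong sum.cong; simp)+
  moreover have "(\<Prod>j\<in>{1..<Suc p}. (x(p := c)) j) = (\<Prod>j\<in>{1..<p}. (x(p := c)) j) * c"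
  using p by (subst prod.atLeastLessThan_Suc) (simp_all add: Suc_le_eq)
  moreover have "(x(p := c)) 0 = x 0" by (metis p fun_upd_other less_irrefl)
  ultimately show ?thesis unfolding prod.lessThan_Suc sum.lessThan_Suc by (simp add: mult_ac add_ac)
  qed
  have "(\<integral>\<^sup>+c. K c w \<partial>chi2 (Suc m)) = (\<integral>\<^sup>+x. \<integral>\<^sup>+c. ?f (x(p := c)) \<partial>chi2 (Suc m) \<partial>bdiag p q)"
  unfolding K_def upd by (rule DY.Fubini') measurable
  also have "... = (\<integral>\<^sup>+x. ?f x \<partial>bdiag (Suc p) q)"
  by (subst nn_integral_bdiag_Suc) (auto simp: m_def)
  finally show "(\<integral>\<^sup>+c. K c w \<partial>chi2 (Suc m)) = (\<integral>\<^sup>+x. ?f x \<partial>bdiag (Suc p) q)" .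
 qed
 finally show ?case by (simp add: G_def m_def)
qed

section \<open>Sample mean and scatter matrix of a Gaussian array\<close>

text \<open>Reflection vector that takes the all-ones vector to \<open>sqrt n\<close> times the last
  unit vector. It does the work of a Helmert matrix: afterwards row \<open>n\<close> carries the
  sample mean and the other rows carry the scatter.\<close>

definition centering :: "nat => nat => real" where
 "centering n = (%i. 1 - (if i = n then sqrt (real n) else 0))"

lemma sum_eq_reflected_last_row:
 assumes n: "n > 0" and j: "j < p"
 shows "(\<Sum>i=1..n. Z (i, j)) = sqrt (real n) * reflect_rows {1..n} {..<p} (centering n) Z (n, j)"
proof -
 let ?R = "{1..n}" and ?a = "centering n"
 have r: "sqrt (real n) = sqrt (ip ?R (%_. 1) (%_. 1))" by (simp add: ip_def)
 have one: "householder ?R ?a (%_. 1) i = (if i = n then sqrt (real n) else 0)" if "i : ?R" for i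
  using that n by (intro householder_maps[OF _ _ r]) (auto simp: centering_def)
 have "(\<Sum>i=1..n. Z (i, j)) = ip ?R (%_. 1) (%i. Z (i, j))" by (simp add: ip_def)
 also have "... = ip ?R (householder ?R ?a (%_. 1)) (householder ?R ?a (%i. Z (i, j)))"
  by (rule ip_householder[symmetric])
 also have "... = (\<Sum>i\<in>?R. if i = n then sqrt (real n) * reflect_rows ?R {..<p} ?a Z (n, j) else 0)"
  unfolding ip_def using j by (intro sum.cong refl) (simp only: one, auto simp: reflect_rows_eq)
 also have "... = sqrt (real n) * reflect_rows ?R {..<p} ?a Z (n, j)" using n by simp
 finally show ?thesis .
qed

lemma sample_mean_reflect:
 assumes "n > 0"
 shows "sample_mean n p (%i j. Z (i, j))
  = vec p (%j. reflect_rows {1..n} {..<p} (centering n) Z (n, j) / sqrt (real n))"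
proof (rule eq_vecI)
 fix j assume "j < dim_vec (vec p (%j. reflect_rows {1..n} {..<p} (centering n) Z (n, j) / sqrt (real n)))"
 then have j: "j < p" by simp
 have "sqrt (real n) * w / real n = w / sqrt (real n)" for w
  using assms by (simp add: real_sqrt_divide[symmetric] divide_simps)
 then show "sample_mean n p (%i j. Z (i, j)) $ j
  = vec p (%j. reflect_rows {1..n} {..<p} (centering n) Z (n, j) / sqrt (real n)) $ j"
  unfolding sample_mean_def index_vec[OF j] sum_eq_reflected_last_row[OF assms j] .
qed (simp add: sample_mean_def)

text \<open>Inner products of columns are unchanged by the reflection, and subtracting
  \<open>n\<close> times the product of the means removes precisely the last row.\<close>

lemma scatter_mat_reflect:
 assumes n: "n = Suc m"
 shows "scatter_mat n p (%i j. Z (i, j)) = gram {1..m} p 0 (reflect_rows {1..n} {..<p} (centering n) Z)"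
proof (rule eq_matI)
 let ?W = "reflect_rows {1..n} {..<p} (centering n) Z" and ?m = "sample_mean n p (%i j. Z (i, j))"
 fix j k assume "j < dim_row (gram {1..m} p 0 ?W)" "k < dim_col (gram {1..m} p 0 ?W)"
 then have jk: "j < p" "k < p" by (simp_all add: gram_def)
 have dim: "dim_vec ?m = p" by (simp add: sample_mean_def)
 have mean: "?m $ l = ?W (n, l) / sqrt (real n)" if "l < p" for l
  using that n by (subst sample_mean_reflect) simp_all
 have tot: "(\<Sum>i=1..n. Z (i, l)) = sqrt (real n) * ?W (n, l)" if "l < p" for l
  using that n by (intro sum_eq_reflected_last_row) simp_all
 have "scatter_mat n p (%i j. Z (i, j)) $$ (j, k) = (\<Sum>i=1..n. (Z (i, j) - ?m $ j) * (Z (i, k) - ?m $ k))"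
  using jk by (simp add: scatter_mat_def outer_prod_def dim)
 also have "... = ip {1..n} (%i. Z (i, j)) (%i. Z (i, k)) - ?m $ k * (\<Sum>i=1..n. Z (i, j)) - ?m $ j * (\<Sum>i=1..n. Z (i, k)) + real n * (?m $ j * ?m $ k)"
  by (simp add: ip_def algebra_simps sum.distrib sum_subtractf sum_distrib_left sum_distrib_right)
 also have "... = ip {1..n} (%i. Z (i, j)) (%i. Z (i, k)) - ?W (n, j) * ?W (n, k)"
  using n unfolding mean[OF jk(1)] mean[OF jk(2)] tot[OF jk(1)] tot[OF jk(2)] by simp
 also have "ip {1..n} (%i. Z (i, j)) (%i. Z (i, k)) = ip {1..n} (%i. ?W (i, j)) (%i. ?W (i, k))"
  using jk by (simp add: ip_reflect_rows)
 also have "... = ?W (n, j) * ?W (n, k) + ip {1..m} (%i. ?W (i, j)) (%i. ?W (i, k))"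
  by (simp add: n ip_def)
 finally show "scatter_mat n p (%i j. Z (i, j)) $$ (j, k) = gram {1..m} p 0 ?W $$ (j, k)"
  using jk by (simp add: gram_def)
qed (simp_all add: gram_def scatter_mat_def)

lemma trace_gram: "trace_mat (gram R p 0 Z) = gram_trace R p Z"
 by (simp add: trace_mat_def gram_trace_def gram_def)

lemma gram_merge_last_row:
 "gram {1..m} p s (merge ({Suc m} \<times> {..<p}) ({1..m} \<times> {..<p}) (y, Z)) = gram {1..m} p s Z"
 "gram_trace {1..m} p (merge ({Suc m} \<times> {..<p}) ({1..m} \<times> {..<p}) (y, Z)) = gram_trace {1..m} p Z"
 by (intro gram_cong gram_trace_cong ip_cong; simp add: merge_def)+

text \<open>After centering, the mean is the last row and the scatter matrix uses only the rows
  before it. Independence of the two is therefore the product structure of \<open>gauss\<close>, and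
  \<open>u\<close>, the squared length of the last row, has law \<open>chi2 p\<close>.\<close>

lemma nn_integral_scatter_trace_mean:
 assumes p: "p > 0" and n: "n = Suc (q + p)"
  and F [measurable]: "F : borel_measurable (borel \<Otimes>\<^sub>M borel \<Otimes>\<^sub>M borel)"
 shows "(\<integral>\<^sup>+Z. (let A = scatter_mat n p (%i j. Z (i, j)); m = sample_mean n p (%i j. Z (i, j)) in
  F (det A, trace_mat A, real n * (m \<bullet> m))) \<partial>gauss ({1..n} \<times> {..<p}))
  = (\<integral>\<^sup>+u. \<integral>\<^sup>+w. \<integral>\<^sup>+x. F (\<Prod>j<p. x j, (SUM j<p. x j) + w, u) \<partial>bdiag p q \<partial>chi2 (\<Sum>{..<p}) \<partial>chi2 p)"
proof -
 define m where "m = q + p"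
 have n': "n = Suc m" and ins: "{1..n} = insert (Suc m) {1..m}" using n by (auto simp: m_def)
 let ?row = "{Suc m} \<times> {..<p}" and ?rest = "{1..m} \<times> {..<p}"
 define G where "G = (%Z. F (det (gram {1..m} p 0 Z), gram_trace {1..m} p Z, SUM j<p. (Z (Suc m, j))\<^sup>2))"
 have [measurable]: "G : borel_measurable (PiM I (%_. borel))" for I unfolding G_def by measurable
 interpret D: prob_space "bdiag p q" by (rule prob_space_bdiag)
 interpret X: prob_space "chi2 (\<Sum>{..<p})" by (rule prob_space_chi2)
 have "(let A = scatter_mat n p (%i j. Z (i, j)); m = sample_mean n p (%i j. Z (i, j)) in F (det A, trace_mat A, real n * (m \<bullet> m)))
  = G (reflect_rows {1..n} {..<p} (centering n) Z)" for Z
 proof -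
  have "real n * (sample_mean n p (%i j. Z (i, j)) \<bullet> sample_mean n p (%i j. Z (i, j)))
  = (SUM j<p. (reflect_rows {1..n} {..<p} (centering n) Z (Suc m, j))\<^sup>2)"
  using n' by (subst (1 2) sample_mean_reflect)
  (simp_all add: scalar_prod_def lessThan_atLeast0 sum_distrib_left power2_eq_square)
  then show ?thesis
  by (simp add: Let_def G_def scatter_mat_reflect[OF n'] trace_gram)
 qed
 then have "(\<integral>\<^sup>+Z. (let A = scatter_mat n p (%i j. Z (i, j)); m = sample_mean n p (%i j. Z (i, j)) in
  F (det A, trace_mat A, real n * (m \<bullet> m))) \<partial>gauss ({1..n} \<times> {..<p})) = (\<integral>\<^sup>+Z. G Z \<partial>gauss ({1..n} \<times> {..<p}))"
  by (simp only:) (rule nn_integral_reflect_rows, auto)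
 also have "... = (\<integral>\<^sup>+y. \<integral>\<^sup>+Z. G (merge ?row ?rest (y, Z)) \<partial>gauss ?rest \<partial>gauss ?row)"
  unfolding ins by (rule nn_integral_gauss_split_rows) auto
 also have "... = (\<integral>\<^sup>+y. (%u. \<integral>\<^sup>+w. \<integral>\<^sup>+x. F (\<Prod>j<p. x j, (SUM j<p. x j) + w, u) \<partial>bdiag p q \<partial>chi2 (\<Sum>{..<p}))
  (\<Sum>ij\<in>?row. (y ij)\<^sup>2) \<partial>gauss ?row)"
 proof (rule nn_integral_cong)
  fix y :: "nat \<times> nat => real"
  define u where "u = (\<Sum>ij\<in>?row. (y ij)\<^sup>2)"
  have "(SUM j<p. (merge ?row ?rest (y, Z) (Suc m, j))\<^sup>2) = u" for Z
  unfolding u_def by (subst sum.cartesian_product') (simp add: merge_def)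
  then have G: "G (merge ?row ?rest (y, Z)) = F (det (gram {1..m} p 0 Z), gram_trace {1..m} p Z, u)" for Z
  unfolding G_def gram_merge_last_row by simp
  have "(%(d, e, t). F (d, t, u)) : borel_measurable (borel \<Otimes>\<^sub>M (borel :: real measure) \<Otimes>\<^sub>M borel)"
  by measurable
  from nn_integral_wishart[OF p this, of q 0]
  show "(\<integral>\<^sup>+Z. G (merge ?row ?rest (y, Z)) \<partial>gauss ?rest) = (%u. \<integral>\<^sup>+w. \<integral>\<^sup>+x. F (\<Prod>j<p. x j, (SUM j<p. x j) + w, u) \<partial>bdiag p q \<partial>chi2 (\<Sum>{..<p}))
  (\<Sum>ij\<in>?row. (y ij)\<^sup>2)"
  unfolding G u_def[symmetric] by (simp add: m_def)
 qed
 also have "... = (\<integral>\<^sup>+u. \<integral>\<^sup>+w. \<integral>\<^sup>+x. F (\<Prod>j<p. x j, (SUM j<p. x j) + w, u) \<partial>bdiag p q \<partial>chi2 (\<Sum>{..<p}) \<partial>chi2 p)"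
 proof -
  have "(%u. \<integral>\<^sup>+w. \<integral>\<^sup>+x. F (\<Prod>j<p. x j, (SUM j<p. x j) + w, u) \<partial>bdiag p q \<partial>chi2 (\<Sum>{..<p})) : borel_measurable borel"
  by measurable
  from nn_integral_gauss_sq_sum[OF _ this, of ?row] show ?thesis by simp
 qed
 finally show ?thesis .
qed

lemma index_mult_mat_sum:
 assumes "A : carrier_mat p p" "B : carrier_mat p p" "j < p" "k < p"
 shows "(A * B) $$ (j, k) = (SUM l<p. A $$ (j, l) * B $$ (l, k))"
 using assms by (simp add: scalar_prod_def lessThan_atLeast0)

text \<open>The reflection is a symmetric matrix \<open>H\<close> with \<open>H * H = 1\<close>, by
  which the Gram matrix is conjugated; hence the determinant picks up
  \<open>(det H)^2 = 1\<close>.\<close>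

lemma det_gram_reflect_cols:
 assumes Y: "!!i j. i : R ==> j < p ==> Y' (i, j) = householder {..<p} a (%j. Y (i, j)) j"
 shows "det (gram R p 0 Y') = det (gram R p 0 Y)"
proof -
 define c where "c = 2 / ip {..<p} a a"
 define H where "H = mat p p (%(j, k). (if j = k then 1 else 0) - c * (a j * a k))"
 have H: "H : carrier_mat p p" and G: "gram R p 0 Y : carrier_mat p p" by (simp_all add: H_def gram_def)
 have c2: "c * c * ip {..<p} a a = 2 * c" by (simp add: c_def)
 have hh: "householder {..<p} a x j = (SUM k<p. H $$ (j, k) * x k)" if "j < p" for x j
 proof -
  have "(SUM k<p. H $$ (j, k) * x k) = (SUM k<p. (if j = k then x k else 0) - c * a j * (a k * x k))"
  using that by (intro sum.cong) (auto simp: H_def algebra_simps)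
  also have "... = x j - c * a j * ip {..<p} a x"
  unfolding sum_subtractf sum_distrib_left[symmetric] ip_def using that by simp
  finally show ?thesis using that by (simp add: householder_def c_def mult_ac)
 qed
 have "H * H = 1\<^sub>m p"
 proof (rule eq_matI)
  fix j k assume jk: "j < dim_row (1\<^sub>m p :: real mat)" "k < dim_col (1\<^sub>m p :: real mat)"
  have "(H * H) $$ (j, k) = (SUM l<p. H $$ (j, l) * H $$ (l, k))"
  using jk H by (simp add: scalar_prod_def lessThan_atLeast0)
  also have "... = (SUM l<p. (if j = l then (if l = k then 1 else 0) - c * (a l * a k) else 0) - (if l = k then c * (a j * a k) else 0)
  + c * c * (a j * a k) * (a l * a l))"
  using jk by (intro sum.cong) (auto simp: H_def algebra_simps)
  also have "... = (if j = k then 1 else 0) - 2 * c * (a j * a k) + (c * c * ip {..<p} a a) * (a j * a k)"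
  unfolding sum.distrib sum_subtractf sum_distrib_left[symmetric] ip_def using jk by (simp add: algebra_simps)
  also have "... = 1\<^sub>m p $$ (j, k)" unfolding c2 using jk by simp
  finally show "(H * H) $$ (j, k) = 1\<^sub>m p $$ (j, k)" .
 qed (simp_all add: H_def)
 then have dH: "det H * det H = 1" using det_mult[OF H H] by simp
 have sym: "H $$ (l, k) = H $$ (k, l)" if "l < p" "k < p" for k l using that by (simp add: H_def mult.commute)
 have "gram R p 0 Y' = H * gram R p 0 Y * H"
 proof (rule eq_matI)
  fix j k assume "j < dim_row (H * gram R p 0 Y * H)" "k < dim_col (H * gram R p 0 Y * H)"
  then have jk: "j < p" "k < p" using H by simp_all
  have "(H * gram R p 0 Y * H) $$ (j, k) = (SUM m<p. (SUM l<p. H $$ (j, l) * ip R (%i. Y (i, l)) (%i. Y (i, m))) * H $$ (m, k))"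
  unfolding index_mult_mat_sum[OF mult_carrier_mat[OF H G] H jk]
  using jk by (intro sum.cong refl, subst index_mult_mat_sum[OF H G]) (auto simp: gram_def)
  also have "... = (SUM m<p. SUM l<p. \<Sum>i\<in>R. (H $$ (j, l) * Y (i, l)) * (H $$ (k, m) * Y (i, m)))"
  unfolding sum_distrib_right ip_def sum_distrib_left
  using jk by (intro sum.cong refl) (simp add: sym algebra_simps)
  also have "... = (\<Sum>i\<in>R. SUM m<p. SUM l<p. (H $$ (j, l) * Y (i, l)) * (H $$ (k, m) * Y (i, m)))"
  by (subst (2) sum.swap, subst sum.swap, rule refl)
  also have "... = (\<Sum>i\<in>R. (SUM l<p. H $$ (j, l) * Y (i, l)) * (SUM m<p. H $$ (k, m) * Y (i, m)))"
  unfolding sum_product by (intro sum.cong refl sum.swap)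
  also have "... = ip R (%i. Y' (i, j)) (%i. Y' (i, k))"
  unfolding ip_def using jk by (intro sum.cong refl) (simp add: Y hh)
  finally show "gram R p 0 Y' $$ (j, k) = (H * gram R p 0 Y * H) $$ (j, k)"
  using jk by (simp add: gram_def)
 qed (simp_all add: H_def gram_def)
 then have "det (gram R p 0 Y') = det H * det (gram R p 0 Y) * det H"
  using H G by (simp add: det_mult[of _ p])
 then show ?thesis using dH by (simp add: algebra_simps)
qed

text \<open>Adding back the mean term restores the last row to the Gram matrix. For a fixed last row
  a column reflection rotates it onto the first axis, where it becomes a corner shift by its squared
  length, while the law of the other rows is preserved. The shifted form of
  \<open>nn_integral_wishart\<close> then applies.\<close>

lemma nn_integral_scatter_det_pair:
 assumes p: "p > 0" and n: "n = Suc (q + p)"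
  and F [measurable]: "F : borel_measurable (borel \<Otimes>\<^sub>M borel)"
 shows "(\<integral>\<^sup>+Z. (let A = scatter_mat n p (%i j. Z (i, j)); m = sample_mean n p (%i j. Z (i, j)) in
  F (det A, det (A + real n \<cdot>\<^sub>m outer_prod m m))) \<partial>gauss ({1..n} \<times> {..<p}))
  = (\<integral>\<^sup>+w. \<integral>\<^sup>+x. F (\<Prod>j<p. x j, (x 0 + w) * (\<Prod>j\<in>{1..<p}. x j)) \<partial>bdiag p q \<partial>chi2 p)"
proof -
 define m where "m = q + p"
 have n': "n = Suc m" and ins: "{1..n} = insert (Suc m) {1..m}" using n by (auto simp: m_def)
 let ?row = "{Suc m} \<times> {..<p}" and ?rest = "{1..m} \<times> {..<p}"
 define G where "G = (%Z. F (det (gram {1..m} p 0 Z), det (gram {1..Suc m} p 0 Z)))"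
 have [measurable]: "G : borel_measurable (PiM I (%_. borel))" for I unfolding G_def by measurable
 have p0 [simp, measurable]: "0 : {..<p}" using p by simp
 interpret D: prob_space "bdiag p q" by (rule prob_space_bdiag)
 interpret X: prob_space "chi2 (\<Sum>{..<p})" by (rule prob_space_chi2)
 have "(let A = scatter_mat n p (%i j. Z (i, j)); m = sample_mean n p (%i j. Z (i, j)) in
  F (det A, det (A + real n \<cdot>\<^sub>m outer_prod m m)))
  = G (reflect_rows {1..n} {..<p} (centering n) Z)" for Z
 proof -
  let ?W = "reflect_rows {1..n} {..<p} (centering n) Z" and ?m = "sample_mean n p (%i j. Z (i, j))"
  have "gram {1..m} p 0 ?W + real n \<cdot>\<^sub>m outer_prod ?m ?m = gram {1..Suc m} p 0 ?W"
  using n' by (subst (1 2) sample_mean_reflect, simp, simp)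
  (intro eq_matI; simp add: gram_def outer_prod_def ip_def)
  then show ?thesis by (simp add: Let_def G_def scatter_mat_reflect[OF n'])
 qed
 then have "(\<integral>\<^sup>+Z. (let A = scatter_mat n p (%i j. Z (i, j)); m = sample_mean n p (%i j. Z (i, j)) in
  F (det A, det (A + real n \<cdot>\<^sub>m outer_prod m m))) \<partial>gauss ({1..n} \<times> {..<p})) = (\<integral>\<^sup>+Z. G Z \<partial>gauss ({1..n} \<times> {..<p}))"
  by (simp only:) (rule nn_integral_reflect_rows, auto)
 also have "... = (\<integral>\<^sup>+y. \<integral>\<^sup>+Z. G (merge ?row ?rest (y, Z)) \<partial>gauss ?rest \<partial>gauss ?row)"
  unfolding ins by (rule nn_integral_gauss_split_rows) auto
 also have "... = (\<integral>\<^sup>+y. (%w. \<integral>\<^sup>+x. F (\<Prod>j<p. x j, (x 0 + w) * (\<Prod>j\<in>{1..<p}. x j)) \<partial>bdiag p q)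
  (\<Sum>ij\<in>?row. (y ij)\<^sup>2) \<partial>gauss ?row)"
 proof (rule nn_integral_cong)
  fix y :: "nat \<times> nat => real"
  define u where "u = (\<Sum>ij\<in>?row. (y ij)\<^sup>2)"
  have u: "u >= 0" unfolding u_def by (intro sum_nonneg) auto
  have "u = ip {..<p} (%j. y (Suc m, j)) (%j. y (Suc m, j))"
  unfolding u_def by (subst sum.cartesian_product') (simp add: ip_def power2_eq_square)
  then have r: "sqrt u = sqrt (ip {..<p} (%j. y (Suc m, j)) (%j. y (Suc m, j)))" by simp
  define a where "a = (%j. y (Suc m, j) - (if j = 0 then sqrt u else 0))"
  define G' where "G' = (%Z. F (det (gram {1..m} p 0 Z), det (gram {1..m} p u Z)))"
  have [measurable]: "G' : borel_measurable (PiM I (%_. borel))" for I unfolding G'_def by measurable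
  have "G (merge ?row ?rest (y, Z)) = G' (reflect_cols {1..m} {..<p} a Z)" for Z
  proof -
  let ?Y = "merge ?row ?rest (y, Z)" and ?Z = "reflect_cols {1..m} {..<p} a Z"
  \<comment> \<open>The array after the column reflection, with its last row replaced by its known
    value \<open>(sqrt u, 0, ..., 0)\<close>.\<close>
  define Y' where "Y' = (%(i, j). if i = Suc m then (if j = 0 then sqrt u else 0) else ?Z (i, j))"
  have "Y' (i, j) = householder {..<p} a (%j. ?Y (i, j)) j" if "i : {1..Suc m}" "j < p" for i j
  proof (cases "i = Suc m")
  case True
  have "householder {..<p} a (%j. ?Y (i, j)) = householder {..<p} a (%j. y (Suc m, j))"
  using True by (intro householder_cong) (simp add: merge_def)
  moreover have "householder {..<p} a (%j. y (Suc m, j)) j = (if j = 0 then sqrt u else 0)"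
  using that by (intro householder_maps[OF _ _ r a_def]) simp_all
  ultimately show ?thesis using True by (simp add: Y'_def)
  next
  case False
  have "householder {..<p} a (%j. ?Y (i, j)) = householder {..<p} a (%j. Z (i, j))"
  using False that by (intro householder_cong) (auto simp: merge_def)
  then show ?thesis using False that by (simp add: Y'_def reflect_cols_eq)
  qed
  then have "det (gram {1..Suc m} p 0 ?Y) = det (gram {1..Suc m} p 0 Y')"
  by (rule det_gram_reflect_cols[symmetric])
  also have "gram {1..Suc m} p 0 Y' = gram {1..m} p u ?Z"
  proof -
  have "ip {1..Suc m} (%i. Y' (i, j)) (%i. Y' (i, k)) = ip {1..m} (%i. ?Z (i, j)) (%i. ?Z (i, k)) + (if j = 0 & k = 0 then u else 0)" for j k
  proof -
  have "ip {1..m} (%i. Y' (i, j)) (%i. Y' (i, k)) = ip {1..m} (%i. ?Z (i, j)) (%i. ?Z (i, k))"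
  by (rule ip_cong) (simp_all add: Y'_def)
  moreover have "Y' (Suc m, j) * Y' (Suc m, k) = (if j = 0 & k = 0 then u else 0)"
  using u by (simp add: Y'_def)
  ultimately show ?thesis by (simp add: ip_def)
  qed
  then show ?thesis by (simp add: gram_def)
  qed
  finally have 1: "det (gram {1..Suc m} p 0 ?Y) = det (gram {1..m} p u ?Z)" .
  have 2: "det (gram {1..m} p 0 ?Z) = det (gram {1..m} p 0 Z)"
  by (rule det_gram_reflect_cols) (simp add: reflect_cols_eq)
  show ?thesis unfolding G_def G'_def gram_merge_last_row 1 2 ..
  qed
  then have "(\<integral>\<^sup>+Z. G (merge ?row ?rest (y, Z)) \<partial>gauss ?rest) = (\<integral>\<^sup>+Z. G' Z \<partial>gauss ?rest)"
  by (simp only:) (rule nn_integral_reflect_cols, auto)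
  also have "... = (\<integral>\<^sup>+w. \<integral>\<^sup>+x. F (\<Prod>j<p. x j, (x 0 + u) * (\<Prod>j\<in>{1..<p}. x j)) \<partial>bdiag p q \<partial>chi2 (\<Sum>{..<p}))"
  proof -
  have "(%(d, e, t). F (d, e)) : borel_measurable (borel \<Otimes>\<^sub>M borel \<Otimes>\<^sub>M (borel :: real measure))"
  by measurable
  from nn_integral_wishart[OF p this, of q u] show ?thesis by (simp add: G'_def m_def)
  qed
  also have "... = (\<integral>\<^sup>+x. F (\<Prod>j<p. x j, (x 0 + u) * (\<Prod>j\<in>{1..<p}. x j)) \<partial>bdiag p q)"
  using X.emeasure_space_1 by simp
  finally show "(\<integral>\<^sup>+Z. G (merge ?row ?rest (y, Z)) \<partial>gauss ?rest)
  = (%w. \<integral>\<^sup>+x. F (\<Prod>j<p. x j, (x 0 + w) * (\<Prod>j\<in>{1..<p}. x j)) \<partial>bdiag p q) (\<Sum>ij\<in>?row. (y ij)\<^sup>2)"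
  by (simp add: u_def)
 qed
 also have "... = (\<integral>\<^sup>+w. \<integral>\<^sup>+x. F (\<Prod>j<p. x j, (x 0 + w) * (\<Prod>j\<in>{1..<p}. x j)) \<partial>bdiag p q \<partial>chi2 p)"
 proof -
  have "(%w. \<integral>\<^sup>+x. F (\<Prod>j<p. x j, (x 0 + w) * (\<Prod>j\<in>{1..<p}. x j)) \<partial>bdiag p q) : borel_measurable borel"
  by measurable
  from nn_integral_gauss_sq_sum[OF _ this, of ?row] show ?thesis by simp
 qed
 finally show ?thesis .
qed

section \<open>Reduction of a normal sample to a standard Gaussian array\<close>

interpretation gauss_prod: product_prob_space "%_. gauss J" UNIV for J :: "'j set"
 by (rule product_prob_spaceI) (rule prob_space_gauss)

lemma measurable_uncurry [measurable]:
 "(%om. \<lambda>(i, j)\<in>I \<times> J. om i j :: real) : measurable (PiM I (%_. gauss J)) (PiM (I \<times> J) (%_. borel))"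
proof (rule measurable_restrict)
 fix ij assume "ij : I \<times> J"
 then obtain i j where ij: "ij = (i, j)" "i : I" by auto
 have "(%om. om i) : measurable (PiM I (%_. gauss J)) (PiM J (%_. borel))"
  using measurable_component_singleton[OF ij(2), of "%_. gauss J"] by (simp add: measurable_cong_sets[OF refl sets_gauss])
 then have "(%om. om i j) : borel_measurable (PiM I (%_. gauss J))"
  by (rule measurable_compose) (rule measurable_component_any)
 then show "(%om. case ij of (i, j) => om i j) : borel_measurable (PiM I (%_. gauss J))"
  by (simp add: ij)
qed

lemma distr_gauss_uncurry:
 assumes I: "finite I" and J: "finite J"
 shows "distr (PiM I (%_. gauss J)) (gauss (I \<times> J)) (%om. \<lambda>(i, j)\<in>I \<times> J. om i j) = gauss (I \<times> J)"
proof -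
 let ?u = "%om. \<lambda>(i, j)\<in>I \<times> J. om i j :: real"
 have "distr (PiM I (%_. gauss J)) (gauss (I \<times> J)) ?u = PiM (I \<times> J) (%_. std_normal_distribution)"
 proof (rule normal_prod.PiM_eqI)
  show "finite (I \<times> J)" using I J by simp
  show "sets (distr (PiM I (%_. gauss J)) (gauss (I \<times> J)) ?u) = sets (PiM (I \<times> J) (%_. std_normal_distribution))"
  by (simp add: gauss_def)
  fix A :: "'a \<times> 'b => real set" assume A: "!!i. i : I \<times> J ==> A i : sets std_normal_distribution"
  then have AJ: "Pi\<^sub>E J (%j. A (i, j)) : sets (gauss J)" if "i : I" for i
  using that J by (auto intro!: sets_PiM_I_finite)
  have "Pi\<^sub>E (I \<times> J) A : sets (PiM (I \<times> J) (%_. borel))"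
  using A I J by (intro sets_PiM_I_finite) auto
  then have "emeasure (distr (PiM I (%_. gauss J)) (gauss (I \<times> J)) ?u) (Pi\<^sub>E (I \<times> J) A)
  = emeasure (PiM I (%_. gauss J)) (?u -` Pi\<^sub>E (I \<times> J) A \<inter> space (PiM I (%_. gauss J)))"
  by (subst emeasure_distr) auto
  also have "?u -` Pi\<^sub>E (I \<times> J) A \<inter> space (PiM I (%_. gauss J)) = Pi\<^sub>E I (%i. Pi\<^sub>E J (%j. A (i, j)))"
  by (auto simp: space_PiM PiE_iff extensional_def)
  also have "emeasure (PiM I (%_. gauss J)) ... = (\<Prod>i\<in>I. emeasure (gauss J) (Pi\<^sub>E J (%j. A (i, j))))"
  using AJ I by (intro gauss_prod.emeasure_PiM) auto
  also have "... = (\<Prod>i\<in>I. \<Prod>j\<in>J. emeasure std_normal_distribution (A (i, j)))"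
  using A J unfolding gauss_def by (intro prod.cong refl normal_prod.emeasure_PiM) auto
  also have "... = (\<Prod>ij\<in>I \<times> J. emeasure std_normal_distribution (A ij))"
  by (simp add: prod.cartesian_product)
  finally show "emeasure (distr (PiM I (%_. gauss J)) (gauss (I \<times> J)) ?u) (Pi\<^sub>E (I \<times> J) A)
  = (\<Prod>ij\<in>I \<times> J. emeasure std_normal_distribution (A ij))" .
 qed
 then show ?thesis by (simp add: gauss_def)
qed

definition mat_apply :: "nat => real mat => (nat => real) => nat => real" where
 "mat_apply p L z = (\<lambda>j\<in>{..<p}. SUM k<p. L $$ (j, k) * z k)"

lemma measurable_mat_apply [measurable]: "mat_apply p L : measurable (PiM {..<p} (%_. borel)) (PiM {..<p} (%_. borel))"
 unfolding mat_apply_def[abs_def] by measurable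

lemma mat_apply_inverse:
 assumes L: "L : carrier_mat p p" "L' : carrier_mat p p" "L' * L = 1\<^sub>m p" and z: "z : extensional {..<p}"
 shows "mat_apply p L' (mat_apply p L z) = z"
proof (rule ext)
 fix j
 show "mat_apply p L' (mat_apply p L z) j = z j"
 proof (cases "j < p")
  case True
  have "mat_apply p L' (mat_apply p L z) j = (SUM k<p. SUM l<p. L' $$ (j, k) * L $$ (k, l) * z l)"
  using True by (simp add: mat_apply_def sum_distrib_left mult.assoc)
  also have "... = (SUM l<p. (L' * L) $$ (j, l) * z l)"
  using True by (subst sum.swap) (simp add: index_mult_mat_sum[OF L(2,1)] sum_distrib_right del: index_mult_mat)
  also have "... = (SUM l<p. if j = l then z l else 0)"
  using True unfolding L(3) by (intro sum.cong) auto
  finally show ?thesis using True by simp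
 next
  case False then show ?thesis using z by (simp add: mat_apply_def extensional_def)
 qed
qed

lemma vec_mat_apply: "L : carrier_mat p p ==> vec p (mat_apply p L z) = L *\<^sub>v vec p z"
 by (rule eq_vecI) (auto simp: mat_apply_def scalar_prod_def lessThan_atLeast0 intro!: sum.cong)

text \<open>The Gaussian array is built on the given probability space, and \<open>X i\<close>
  equals \<open>\<mu>\<close> plus \<open>L\<close> times its row everywhere, not just almost
  everywhere. Events about the sample are then literally events about
  \<open>\<zeta>\<close>.\<close>

lemma whitened_sample:
 assumes S: "mvn_sample M n p \<mu> S X" and n: "n > 0" and \<mu>: "\<mu> : carrier_vec p"
  and L: "L : carrier_mat p p" "L' : carrier_mat p p" "L * L' = 1\<^sub>m p" "L' * L = 1\<^sub>m p"
  and quad: "\<forall>z \<in> carrier_vec p. (L *\<^sub>v z) \<bullet> (the (mat_inverse S) *\<^sub>v (L *\<^sub>v z)) = z \<bullet> z"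
 obtains \<zeta> where "\<zeta> : measurable M (gauss ({1..n} \<times> {..<p}))"
  "distr M (gauss ({1..n} \<times> {..<p})) \<zeta> = gauss ({1..n} \<times> {..<p})"
  "\<forall>om\<in>space M. \<forall>i\<in>{1..n}. \<forall>j<p. X i om j = \<mu> $ j + (SUM k<p. L $$ (j, k) * \<zeta> om (i, k))"
proof -
 let ?J = "{..<p}" and ?I = "{1..n}"
 from S have M: "prob_space M" and ind: "prob_space.indep_vars M (%_. \<Pi>\<^sub>M j\<in>?J. borel) X ?I"
  and X: "!!i. i : ?I ==> distributed M (\<Pi>\<^sub>M j\<in>?J. lborel) (X i) (%x. ennreal (mvn_density p \<mu> S x))"
  by (auto simp: mvn_sample_def)
 interpret prob_space M by (rule M)
 define m where "m = (\<lambda>j\<in>?J. \<mu> $ j)"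
 define W where "W x = mat_apply p L' (vadd ?J x (\<lambda>j\<in>?J. - m j))" for x
 have W [measurable]: "W : measurable (PiM ?J (%_. borel)) (PiM ?J (%_. borel))"
  unfolding W_def[abs_def] vadd_def by measurable
 have rv: "X i : measurable M (PiM ?J (%_. borel))" if "i : ?I" for i
  using ind that by (simp add: indep_vars_def2)
 \<comment> \<open>The sign of \<open>det S\<close> is not among the hypotheses, whereas
   \<open>distr_whitening\<close> asks for a nonnegative constant. Since \<open>ennreal\<close> cuts
   off negative values, the constant may be replaced by its positive part.\<close>
 have max0: "ennreal (K * e) = ennreal (max 0 K * e)" if "e >= 0" for K e
  using that by (cases "K >= 0") (auto simp: max_def ennreal_neg mult_nonpos_nonneg)
 have law: "distr M (gauss ?J) (%om. W (X i om)) = gauss ?J" if "i : ?I" for i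
  unfolding W_def
 proof (rule distr_whitening[where T = "mat_apply p L" and c = "max 0 (1 / sqrt ((2 * pi) ^ p * det S))", OF _ _ _ _ _ _ _ M X[OF that]])
  fix z :: "nat => real" assume "z : extensional ?J"
  have "vec p (vadd ?J (mat_apply p L z) m) - \<mu> = L *\<^sub>v vec p z"
  unfolding vec_mat_apply[OF L(1), symmetric] using \<mu> by (intro eq_vecI) (auto simp: vadd_def m_def)
  then have "mvn_density p \<mu> S (vadd ?J (mat_apply p L z) m) = 1 / sqrt ((2 * pi) ^ p * det S) * exp (- (vec p z \<bullet> vec p z) / 2)"
  by (simp add: mvn_density_def quad)
  also have "vec p z \<bullet> vec p z = (\<Sum>i\<in>?J. (z i)\<^sup>2)"
  by (simp add: scalar_prod_def lessThan_atLeast0 power2_eq_square)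
  finally have d: "mvn_density p \<mu> S (vadd ?J (mat_apply p L z) m) = 1 / sqrt ((2 * pi) ^ p * det S) * exp (- (\<Sum>i\<in>?J. (z i)\<^sup>2) / 2)" .
  show "ennreal (mvn_density p \<mu> S (vadd ?J (mat_apply p L z) m))
  = ennreal (max 0 (1 / sqrt ((2 * pi) ^ p * det S)) * exp (- (\<Sum>i\<in>?J. (z i)\<^sup>2) / 2))"
  unfolding d by (rule max0) simp
 next
  fix x y :: "nat => real"
  show "mat_apply p L (vadd ?J x y) = vadd ?J (mat_apply p L x) (mat_apply p L y)"
  by (auto simp: mat_apply_def vadd_def fun_eq_iff sum.distrib[symmetric] distrib_left)
 next
  show "!!x. x : extensional ?J ==> mat_apply p L' (mat_apply p L x) = x"
  by (rule mat_apply_inverse[OF L(1,2,4)])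
  show "!!x. x : extensional ?J ==> mat_apply p L (mat_apply p L' x) = x"
  by (rule mat_apply_inverse[OF L(2,1,3)])
 qed (auto simp: m_def extensional_def)
 have law': "distr M (PiM ?J (%_. borel)) (%om. W (X i om)) = gauss ?J" if "i : ?I" for i
  using law[OF that] by (metis distr_cong sets_gauss)
 have "indep_vars (%_. PiM ?J (%_. borel)) (%i om. W (X i om)) ?I"
  by (rule indep_vars_compose2[OF ind]) (rule W)
 then have "distr M (PiM ?I (%_. PiM ?J (%_. borel))) (%om. \<lambda>i\<in>?I. W (X i om))
  = PiM ?I (%i. distr M (PiM ?J (%_. borel)) (%om. W (X i om)))"
  using n rv by (subst (asm) indep_vars_iff_distr_eq_PiM') auto
 also have "... = PiM ?I (%_. gauss ?J)" by (intro PiM_cong refl law')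
 finally have j0: "distr M (PiM ?I (%_. PiM ?J (%_. borel))) (%om. \<lambda>i\<in>?I. W (X i om)) = PiM ?I (%_. gauss ?J)" .
 have se: "sets (PiM ?I (%_. gauss ?J)) = sets (PiM ?I (%_. PiM ?J (%_. borel)))"
  by (intro sets_PiM_cong) auto
 have joint: "distr M (PiM ?I (%_. gauss ?J)) (%om. \<lambda>i\<in>?I. W (X i om)) = PiM ?I (%_. gauss ?J)"
  unfolding distr_cong[OF refl se refl] by (rule j0)
 have m1: "(%om. \<lambda>i\<in>?I. W (X i om)) : measurable M (PiM ?I (%_. gauss ?J))"
 proof (rule measurable_restrict)
  fix i assume "i : ?I"
  then have "(%om. W (X i om)) : measurable M (PiM ?J (%_. borel))" by (rule measurable_compose[OF rv W])
  then show "(%om. W (X i om)) : measurable M (gauss ?J)" by (simp add: measurable_cong_sets[OF refl sets_gauss])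
 qed
 have m2: "(%om. \<lambda>(i, j)\<in>?I \<times> ?J. om i j) : measurable (PiM ?I (%_. gauss ?J)) (gauss (?I \<times> ?J))"
  using measurable_uncurry[of ?I ?J] by (simp add: measurable_cong_sets[OF refl sets_gauss])
 define \<zeta> where "\<zeta> = (%om. \<lambda>(i, j)\<in>?I \<times> ?J. W (X i om) j)"
 have \<zeta>: "\<zeta> = (%om. \<lambda>(i, j)\<in>?I \<times> ?J. om i j) \<circ> (%om. \<lambda>i\<in>?I. W (X i om))"
  by (auto simp: \<zeta>_def fun_eq_iff)
 show thesis
 proof (rule that)
  show "\<zeta> : measurable M (gauss (?I \<times> ?J))" unfolding \<zeta> by (rule measurable_comp[OF m1 m2])
  show "distr M (gauss (?I \<times> ?J)) \<zeta> = gauss (?I \<times> ?J)"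
  unfolding \<zeta> distr_distr[OF m2 m1, symmetric] joint by (rule distr_gauss_uncurry) auto
  show "\<forall>om\<in>space M. \<forall>i\<in>?I. \<forall>j<p. X i om j = \<mu> $ j + (SUM k<p. L $$ (j, k) * \<zeta> om (i, k))"
  proof (intro ballI allI impI)
  fix om i j assume *: "om : space M" "i : ?I" "j < p"
  have Xe: "X i om : extensional ?J"
  using measurable_space[OF rv[OF *(2)] *(1)] by (simp add: space_PiM PiE_def)
  have "mat_apply p L (W (X i om)) = vadd ?J (X i om) (\<lambda>j\<in>?J. - m j)"
  unfolding W_def by (rule mat_apply_inverse[OF L(2,1,3)]) simp
  from fun_cong[OF this, of j] show "X i om j = \<mu> $ j + (SUM k<p. L $$ (j, k) * \<zeta> om (i, k))"
  using * by (simp add: mat_apply_def vadd_def m_def \<zeta>_def)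
  qed
 qed
qed

text \<open>Gram-Schmidt without projections. The covectors of the vectors found so far are stacked
  into a square matrix padded with zero rows; its kernel contains a vector orthogonal to all of
  them, which is then normalised.\<close>

lemma positive_definite_orthonormal:
 fixes Q :: "real mat"
 assumes Q: "positive_definite_mat p Q" and k: "k <= p"
 shows "\<exists>l. (\<forall>i<k. l i : carrier_vec p) & (\<forall>i<k. \<forall>j<k. l i \<bullet> (Q *\<^sub>v l j) = (if i = j then 1 else 0))"
 using k
proof (induction k)
 case (Suc k)
 then obtain l where "\<forall>i<k. l i : carrier_vec p" "\<forall>i<k. \<forall>j<k. l i \<bullet> (Q *\<^sub>v l j) = (if i = j then 1 else 0)"
  using Suc_leD[OF Suc.prems] by blast
 then have l: "!!i. i < k ==> l i : carrier_vec p"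
  "!!i j. i < k ==> j < k ==> l i \<bullet> (Q *\<^sub>v l j) = (if i = j then 1 else 0)" by blast+
 from Q have Qc: "Q : carrier_mat p p" and Qt: "transpose_mat Q = Q"
  and pos: "!!v. v : carrier_vec p ==> v ~= 0\<^sub>v p ==> v \<bullet> (Q *\<^sub>v v) > 0"
  by (auto simp: positive_definite_mat_def)
 have sym: "u \<bullet> (Q *\<^sub>v v) = (Q *\<^sub>v u) \<bullet> v" if "u : carrier_vec p" "v : carrier_vec p" for u v
  using transpose_vec_mult_scalar[OF Qc that(2,1)] Qt by simp
 define A where "A = mat p p (%(i, j). if i < k then (Q *\<^sub>v l i) $ j else 0)"
 have A: "A : carrier_mat p p" by (simp add: A_def)
 \<comment> \<open>Row \<open>k\<close> of \<open>A\<close> is one of the zero rows, because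
   \<open>k < p\<close>; hence \<open>A\<close> is singular.\<close>
 have "transpose_mat A *\<^sub>v unit_vec p k = 0\<^sub>v p"
  using Suc.prems by (intro eq_vecI) (auto simp: A_def)
 moreover have "unit_vec p k ~= (0\<^sub>v p :: real vec)" using Suc.prems by simp
 ultimately have "det (transpose_mat A) = 0"
  using A by (subst det_0_iff_vec_prod_zero_field[where n = p]) (auto intro!: exI[of _ "unit_vec p k"])
 then have "det A = 0" using det_transpose[OF A] by simp
 then obtain v where v: "v : carrier_vec p" "v ~= 0\<^sub>v p" "A *\<^sub>v v = 0\<^sub>v p"
  using det_0_iff_vec_prod_zero_field[OF A] by blast
 have orth: "(Q *\<^sub>v l i) \<bullet> v = 0" if "i < k" for i
 proof -
  have "row A i = Q *\<^sub>v l i" using that Suc.prems Qc by (intro eq_vecI) (auto simp: A_def)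
  moreover have "(A *\<^sub>v v) $ i = 0" using v(3) that Suc.prems by simp
  ultimately show ?thesis using that Suc.prems A by simp
 qed
 define c where "c = v \<bullet> (Q *\<^sub>v v)"
 have c: "c > 0" using pos v by (simp add: c_def)
 define w where "w = (1 / sqrt c) \<cdot>\<^sub>v v"
 have w: "w : carrier_vec p" using v by (simp add: w_def)
 have Qw: "Q *\<^sub>v w = (1 / sqrt c) \<cdot>\<^sub>v (Q *\<^sub>v v)" using Qc v by (simp add: w_def mult_mat_vec)
 have ww: "w \<bullet> (Q *\<^sub>v w) = 1" unfolding Qw using Qc v c by (simp add: w_def c_def[symmetric])
 have lw: "l i \<bullet> (Q *\<^sub>v w) = 0" "w \<bullet> (Q *\<^sub>v l i) = 0" if "i < k" for i
 proof -
  have "(Q *\<^sub>v l i) \<bullet> w = 0" using orth[OF that] v Qc l(1)[OF that] by (simp add: w_def)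
  then show "l i \<bullet> (Q *\<^sub>v w) = 0" "w \<bullet> (Q *\<^sub>v l i) = 0"
  using sym[OF l(1)[OF that] w] w Qc l(1)[OF that] by (simp_all add: comm_scalar_prod[where n = p])
 qed
 define l' where "l' = l(k := w)"
 have "l' i : carrier_vec p" if "i < Suc k" for i using that l w by (auto simp: l'_def less_Suc_eq)
 moreover have "l' i \<bullet> (Q *\<^sub>v l' j) = (if i = j then 1 else 0)" if "i < Suc k" "j < Suc k" for i j
  using that l ww lw by (auto simp: l'_def less_Suc_eq)
 ultimately show ?case by blast
qed simp

text \<open>With \<open>Q\<close> the inverse of \<open>S\<close>, the columns of \<open>L\<close>
  form a basis orthonormal for \<open>Q\<close>, so that \<open>transpose_mat L * Q * L = 1\<close>.
  This whitens without a square root of \<open>S\<close>, and \<open>transpose_mat L * Q\<close> is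
  the inverse of \<open>L\<close>.\<close>

lemma positive_definite_whitening:
 assumes S: "positive_definite_mat p S"
 shows "\<exists>L L'. L : carrier_mat p p & L' : carrier_mat p p & L * L' = 1\<^sub>m p & L' * L = 1\<^sub>m p
  & (\<forall>z \<in> carrier_vec p. (L *\<^sub>v z) \<bullet> (the (mat_inverse S) *\<^sub>v (L *\<^sub>v z)) = z \<bullet> z)"
proof -
 from S have Sc: "S : carrier_mat p p" and St: "transpose_mat S = S"
  and Spos: "!!v. v : carrier_vec p ==> v ~= 0\<^sub>v p ==> v \<bullet> (S *\<^sub>v v) > 0"
  by (auto simp: positive_definite_mat_def)
 have "det S ~= 0"
 proof
  assume "det S = 0"
  then obtain v where "v : carrier_vec p" "v ~= 0\<^sub>v p" "S *\<^sub>v v = 0\<^sub>v p"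
  using det_0_iff_vec_prod_zero_field[OF Sc] by blast
  with Spos[of v] show False by simp
 qed
 then have "mat_inverse S ~= None"
  using mat_inverse(1)[OF Sc, of undefined] det_non_zero_imp_unit[OF Sc, of undefined] by blast
 then obtain Q where Q: "mat_inverse S = Some Q" by auto
 from mat_inverse(2)[OF Sc Q] have SQ: "S * Q = 1\<^sub>m p" and QS: "Q * S = 1\<^sub>m p" and Qc: "Q : carrier_mat p p" by auto
 have Qt: "transpose_mat Q = Q"
 proof -
  have "transpose_mat Q = transpose_mat Q * (S * Q)" using Qc SQ by simp
  also have "... = (transpose_mat Q * transpose_mat S) * Q" using Qc Sc St by simp
  also have "transpose_mat Q * transpose_mat S = transpose_mat (S * Q)" using Qc Sc by (simp add: transpose_mult)
  finally show ?thesis using SQ Qc by simp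
 qed
 have Qpd: "positive_definite_mat p Q"
  unfolding positive_definite_mat_def
 proof (intro conjI ballI impI Qc Qt)
  fix v :: "real vec" assume v: "v : carrier_vec p" "v ~= 0\<^sub>v p"
  have SQv: "S *\<^sub>v (Q *\<^sub>v v) = v" using v Sc Qc SQ by (simp add: assoc_mult_mat_vec[symmetric])
  have "S *\<^sub>v 0\<^sub>v p = 0\<^sub>v p" using Sc by (intro eq_vecI) auto
  then have "Q *\<^sub>v v ~= 0\<^sub>v p" using SQv v by metis
  then have "(Q *\<^sub>v v) \<bullet> (S *\<^sub>v (Q *\<^sub>v v)) > 0" using Spos[of "Q *\<^sub>v v"] v Qc by simp
  then show "v \<bullet> (Q *\<^sub>v v) > 0" unfolding SQv using v Qc by (simp add: comm_scalar_prod[where n = p])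
 qed
 obtain l where l: "!!i. i < p ==> l i : carrier_vec p"
  "!!i j. i < p ==> j < p ==> l i \<bullet> (Q *\<^sub>v l j) = (if i = j then 1 else 0)"
  using positive_definite_orthonormal[OF Qpd, of p] by auto
 define L where "L = mat p p (%(j, k). l k $ j)"
 define L' where "L' = transpose_mat L * Q"
 have Lc: "L : carrier_mat p p" by (simp add: L_def)
 then have L'c: "L' : carrier_mat p p" unfolding L'_def using Qc by (intro mult_carrier_mat[of _ _ p]) auto
 have colL: "col L k = l k" if "k < p" for k using that l(1)[OF that] by (intro eq_vecI) (auto simp: L_def)
 have L'L: "L' * L = 1\<^sub>m p"
 proof (rule eq_matI)
  fix i j assume ij: "i < dim_row (1\<^sub>m p :: real mat)" "j < dim_col (1\<^sub>m p :: real mat)"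
  have "L' * L = transpose_mat L * (Q * L)" unfolding L'_def using Lc Qc by simp
  then have "(L' * L) $$ (i, j) = row (transpose_mat L) i \<bullet> col (Q * L) j" using ij Lc Qc by simp
  also have "col (Q * L) j = Q *\<^sub>v l j" using ij Lc Qc by (simp add: col_mult2[OF Qc Lc] colL)
  also have "row (transpose_mat L) i = l i" using ij Lc by (simp add: colL)
  finally show "(L' * L) $$ (i, j) = 1\<^sub>m p $$ (i, j)" using ij l(2) by simp
 qed (use Lc L'c in auto)
 have LL': "L * L' = 1\<^sub>m p" by (rule mat_mult_left_right_inverse[OF L'c Lc L'L])
 have quad: "(L *\<^sub>v z) \<bullet> (the (mat_inverse S) *\<^sub>v (L *\<^sub>v z)) = z \<bullet> z" if z: "z : carrier_vec p" for z
 proof -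
  have "z = (L' * L) *\<^sub>v z" using L'L z by simp
  also have "... = transpose_mat L *\<^sub>v (Q *\<^sub>v (L *\<^sub>v z))"
  unfolding L'_def using Lc Qc z by (simp add: assoc_mult_mat_vec[of _ p p _ p])
  finally have "z \<bullet> z = z \<bullet> (transpose_mat L *\<^sub>v (Q *\<^sub>v (L *\<^sub>v z)))" by simp
  also have "... = (L *\<^sub>v z) \<bullet> (Q *\<^sub>v (L *\<^sub>v z))"
  using transpose_vec_mult_scalar[of "transpose_mat L" p p "Q *\<^sub>v (L *\<^sub>v z)" z] Lc Qc z by simp
  finally show ?thesis by (simp add: Q)
 qed
 show ?thesis using Lc L'c LL' L'L quad by blast
qed

lemma smult_mat_mult_vec:
 fixes A :: "real mat"
 shows "A : carrier_mat n m ==> v : carrier_vec m ==> (a \<cdot>\<^sub>m A) *\<^sub>v v = a \<cdot>\<^sub>v (A *\<^sub>v v)"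
 by (intro eq_vecI) (auto simp: scalar_prod_def sum_distrib_left mult.assoc)

text \<open>For a scalar covariance the whitening is itself taken scalar, so that scatter matrix and
  trace simply scale by \<open>c\<close>.\<close>

lemma scalar_whitening:
 fixes c :: real and p :: nat
 assumes c: "c > 0"
 defines "L \<equiv> sqrt c \<cdot>\<^sub>m 1\<^sub>m p" and "L' \<equiv> (1 / sqrt c) \<cdot>\<^sub>m 1\<^sub>m p"
 shows "L : carrier_mat p p" "L' : carrier_mat p p" "L * L' = 1\<^sub>m p" "L' * L = 1\<^sub>m p"
  "\<forall>z \<in> carrier_vec p. (L *\<^sub>v z) \<bullet> (the (mat_inverse (c \<cdot>\<^sub>m 1\<^sub>m p)) *\<^sub>v (L *\<^sub>v z)) = z \<bullet> z"
proof -
 show carr: "L : carrier_mat p p" "L' : carrier_mat p p" by (simp_all add: L_def L'_def)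
 show "L * L' = 1\<^sub>m p" "L' * L = 1\<^sub>m p"
  using c unfolding L_def L'_def
  by (auto simp: mult_smult_assoc_mat[of _ p p _ p] mult_smult_distrib[of _ p p _ p] intro!: eq_matI)
 let ?S = "c \<cdot>\<^sub>m 1\<^sub>m p"
 have Sc: "?S : carrier_mat p p" by simp
 have "det ?S ~= 0" using c by (simp add: det_smult)
 then have "mat_inverse ?S ~= None"
  using mat_inverse(1)[OF Sc, of undefined] det_non_zero_imp_unit[OF Sc, of undefined] by blast
 then obtain Q where Q: "mat_inverse ?S = Some Q" by auto
 from mat_inverse(2)[OF Sc Q] have "?S * Q = 1\<^sub>m p" and Qc: "Q : carrier_mat p p" by auto
 then have cQ: "c \<cdot>\<^sub>m Q = 1\<^sub>m p" by (simp add: mult_smult_assoc_mat[of _ p p _ p])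
 show "\<forall>z \<in> carrier_vec p. (L *\<^sub>v z) \<bullet> (the (mat_inverse ?S) *\<^sub>v (L *\<^sub>v z)) = z \<bullet> z"
 proof
 fix z :: "real vec" assume z: "z : carrier_vec p"
 have Lz: "L *\<^sub>v z = sqrt c \<cdot>\<^sub>v z" unfolding L_def using z by (simp add: smult_mat_mult_vec[of _ p p])
 have "(L *\<^sub>v z) \<bullet> (Q *\<^sub>v (L *\<^sub>v z)) = z \<bullet> (c \<cdot>\<^sub>v (Q *\<^sub>v z))"
  unfolding Lz using z Qc c by (simp add: mult_mat_vec mult.assoc[symmetric])
 also have "c \<cdot>\<^sub>v (Q *\<^sub>v z) = (c \<cdot>\<^sub>m Q) *\<^sub>v z" using z Qc by (simp add: smult_mat_mult_vec[of _ p p])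
 also have "... = z" using cQ z by simp
 finally show "(L *\<^sub>v z) \<bullet> (the (mat_inverse ?S) *\<^sub>v (L *\<^sub>v z)) = z \<bullet> z" by (simp add: Q)
 qed
qed

section \<open>The null distributions of the three statistics\<close>

text \<open>Degrees of freedom of the one variable \<open>w\<close> that accompanies the Bartlett
  diagonal: the squared length of the scaled mean, the off-diagonal squares, or both
  together.\<close>

fun ref_df :: "lrt => nat => nat" where
 "ref_df Mean_Test p = p"
| "ref_df Sphericity_Test p = \<Sum>{..<p}"
| "ref_df Mean_Cov_Test p = p + \<Sum>{..<p}"

definition ref_space :: "lrt => nat => nat => (real \<times> (nat => real)) measure" where
 "ref_space T n p = chi2 (ref_df T p) \<Otimes>\<^sub>M bdiag p (n - 1 - p)"

fun ref_stat :: "lrt => nat => nat => real \<times> (nat => real) => real" where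
 "ref_stat Mean_Test n p (w, x) = real n * (ln (x 0 + w) - ln (x 0))"
| "ref_stat Sphericity_Test n p (w, x) =
  (real n - 1) * (real p * ln (((SUM j<p. x j) + w) / real p) - (SUM j<p. ln (x j)))"
| "ref_stat Mean_Cov_Test n p (w, x) =
  (SUM j<p. x j) + w - real n * real p + real n * real p * ln (real n) - real n * (SUM j<p. ln (x j))"

lemma prob_space_reference: "prob_space (ref_space T n p)"
proof -
 interpret A: prob_space "chi2 (ref_df T p)" by (rule prob_space_chi2)
 interpret B: prob_space "bdiag p (n - 1 - p)" by (rule prob_space_bdiag)
 interpret pair_prob_space "chi2 (ref_df T p)" "bdiag p (n - 1 - p)" ..
 show ?thesis unfolding ref_space_def by (rule prob_space_axioms)
qed

lemma sets_ref_space [measurable_cong, simp]: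
 "sets (ref_space T n p) = sets (borel \<Otimes>\<^sub>M PiM {..<p} (%_. borel))"
 unfolding ref_space_def by (rule sets_pair_measure_cong) auto

lemma measurable_ref_stat [measurable]:
 "ref_stat T n p : borel_measurable (borel \<Otimes>\<^sub>M PiM {..<p} (%_. borel))"
proof -
 have [measurable (raw)]: "(%y. snd y i) : borel_measurable (borel \<Otimes>\<^sub>M PiM {..<p} (%_. borel :: real measure))" for i
  by (rule measurable_compose[OF measurable_snd measurable_component_any])
 have "(%y. ref_stat T n p (fst y, snd y)) : borel_measurable (borel \<Otimes>\<^sub>M PiM {..<p} (%_. borel))"
  by (cases T) (simp_all only: ref_stat.simps, measurable)
 then show ?thesis by simp
qed

lemma space_bdiag [simp]: "space (bdiag p q) = space (PiM {..<p} (%_. borel :: real measure))"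
 by (rule sets_eq_imp_space_eq) simp

lemma AE_bdiag_pos: "AE x in bdiag p q. \<forall>j<p. x j > 0"
proof -
 have "AE x in bdiag p q. x j > 0" if "j < p" for j
  unfolding bdiag_def
  using that by (intro AE_PiM_component) (auto intro: prob_space_chi2 AE_chi2_pos)
 then show ?thesis by (auto simp: AE_all_countable intro: AE_finite_allI)
qed

lemma nn_integral_cong_bartlett:
 assumes "!!w x. w >= 0 ==> (!!j. j < p ==> x j > 0) ==> f w x = g w x"
 shows "(\<integral>\<^sup>+w. \<integral>\<^sup>+x. f w x \<partial>bdiag p q \<partial>chi2 k) = (\<integral>\<^sup>+w. \<integral>\<^sup>+x. g w x \<partial>bdiag p q \<partial>chi2 k)"
 by (rule nn_integral_cong_AE, rule AE_mp[OF AE_chi2_nonneg], rule AE_I2, rule impI,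
  rule nn_integral_cong_AE, rule AE_mp[OF AE_bdiag_pos], rule AE_I2) (auto intro: assms)

lemma emeasure_ref_space:
 assumes [measurable]: "A : sets (borel \<Otimes>\<^sub>M PiM {..<p} (%_. borel))"
 shows "emeasure (ref_space T n p) A
  = (\<integral>\<^sup>+w. \<integral>\<^sup>+x. indicator A (w, x) \<partial>bdiag p (n - 1 - p) \<partial>chi2 (ref_df T p))"
proof -
 interpret B: prob_space "bdiag p (n - 1 - p)" by (rule prob_space_bdiag)
 have "emeasure (ref_space T n p) A = (\<integral>\<^sup>+y. indicator A y \<partial>ref_space T n p)" by simp
 also have "... = (\<integral>\<^sup>+w. \<integral>\<^sup>+x. indicator A (w, x) \<partial>bdiag p (n - 1 - p) \<partial>chi2 (ref_df T p))"
  unfolding ref_space_def by (subst B.nn_integral_fst[symmetric]) auto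
 finally show ?thesis .
qed

lemma emeasure_ref_tail:
 "emeasure (ref_space T n p) {y : space (ref_space T n p). r * ref_stat T n p y > t}
  = (\<integral>\<^sup>+w. \<integral>\<^sup>+x. indicator {t<..} (r * ref_stat T n p (w, x)) \<partial>bdiag p (n - 1 - p) \<partial>chi2 (ref_df T p))"
proof -
 have sp: "space (ref_space T n p) = space (borel \<Otimes>\<^sub>M PiM {..<p} (%_. borel))"
  by (rule sets_eq_imp_space_eq) simp
 have "{y : space (borel \<Otimes>\<^sub>M PiM {..<p} (%_. borel)). r * ref_stat T n p y > t} : sets (borel \<Otimes>\<^sub>M PiM {..<p} (%_. borel))"
  by measurable
 from emeasure_ref_space[OF this, of T n] show ?thesis
  unfolding sp by (simp only:) (intro nn_integral_cong, auto simp: indicator_def space_pair_measure)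
qed

lemma measure_sample_eq:
 assumes \<zeta>: "\<zeta> : measurable M (gauss K)" "distr M (gauss K) \<zeta> = gauss K"
  and eq: "!!om. om : space M ==> P om \<longleftrightarrow> \<zeta> om : A"
  and A: "A : sets (gauss K)"
  and int: "(\<integral>\<^sup>+Z. indicator A Z \<partial>gauss K) = emeasure N B"
 shows "measure M {om : space M. P om} = measure N B"
proof -
 have "{om : space M. P om} = \<zeta> -` A \<inter> space M" using eq by auto
 then have "emeasure M {om : space M. P om} = emeasure (distr M (gauss K) \<zeta>) A"
  using \<zeta>(1) A by (simp add: emeasure_distr)
 also have "... = emeasure N B" using A int by (simp add: \<zeta>(2))
 finally show ?thesis by (simp add: measure_def)
qed

lemma scatter_mat_scale:
 assumes "!!i j. i : {1..n} ==> j < p ==> x i j = m j + c * z i j" "n > 0"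
 shows "scatter_mat n p x = c\<^sup>2 \<cdot>\<^sub>m scatter_mat n p z"
proof -
 have mean: "sample_mean n p x $ j = m j + c * sample_mean n p z $ j" if "j < p" for j
  using that assms by (simp add: sample_mean_def sum.distrib sum_distrib_left[symmetric] add_divide_distrib)
 have dim: "dim_vec (sample_mean n p y) = p" for y by (simp add: sample_mean_def)
 show ?thesis
 proof (rule eq_matI)
  fix j k assume "j < dim_row (c\<^sup>2 \<cdot>\<^sub>m scatter_mat n p z)" "k < dim_col (c\<^sup>2 \<cdot>\<^sub>m scatter_mat n p z)"
  then have jk: "j < p" "k < p" by (simp_all add: scatter_mat_def)
  have "scatter_mat n p x $$ (j, k) = (\<Sum>i=1..n. (x i j - sample_mean n p x $ j) * (x i k - sample_mean n p x $ k))"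
  using jk by (simp add: scatter_mat_def outer_prod_def dim)
  also have "... = (\<Sum>i=1..n. c\<^sup>2 * ((z i j - sample_mean n p z $ j) * (z i k - sample_mean n p z $ k)))"
  using jk assms(1) by (intro sum.cong refl) (simp add: mean power2_eq_square algebra_simps)
  finally show "scatter_mat n p x $$ (j, k) = (c\<^sup>2 \<cdot>\<^sub>m scatter_mat n p z) $$ (j, k)"
  using jk by (simp add: scatter_mat_def outer_prod_def dim sum_distrib_left)
 qed (simp_all add: scatter_mat_def)
qed

lemma
 assumes x: "!!i j. i : {1..n} ==> j < p ==> x i j = (SUM k<p. L $$ (j, k) * z i k)"
  and L: "L : carrier_mat p p"
 shows scatter_mat_linear: "scatter_mat n p x = L * scatter_mat n p z * transpose_mat L"
  and outer_mean_linear: "outer_prod (sample_mean n p x) (sample_mean n p x)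
  = L * outer_prod (sample_mean n p z) (sample_mean n p z) * transpose_mat L"
proof -
 have dim: "dim_vec (sample_mean n p y) = p" for y by (simp add: sample_mean_def)
 have mean: "sample_mean n p x $ j = (SUM k<p. L $$ (j, k) * sample_mean n p z $ k)" if "j < p" for j
 proof -
  have "(\<Sum>i=1..n. x i j) = (SUM k<p. L $$ (j, k) * (\<Sum>i=1..n. z i k))"
  using that x by (simp add: sum_distrib_left) (rule sum.swap)
  then have "sample_mean n p x $ j = (SUM k<p. L $$ (j, k) * (\<Sum>i=1..n. z i k)) / real n"
  using that by (simp add: sample_mean_def)
  also have "... = (SUM k<p. L $$ (j, k) * sample_mean n p z $ k)"
  by (subst sum_divide_distrib, intro sum.cong refl) (simp add: sample_mean_def)
  finally show ?thesis .
 qed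
 have entry: "(L * B * transpose_mat L) $$ (j, k) = (SUM l<p. SUM m<p. L $$ (j, l) * L $$ (k, m) * B $$ (l, m))"
  if B: "B : carrier_mat p p" and jk: "j < p" "k < p" for B j k
 proof -
  have "(L * B * transpose_mat L) $$ (j, k) = (SUM m<p. (SUM l<p. L $$ (j, l) * B $$ (l, m)) * L $$ (k, m))"
  using index_mult_mat_sum[OF mult_carrier_mat[OF L B] transpose_carrier_mat[THEN iffD2, OF L] jk] L jk
  by (simp add: index_mult_mat_sum[OF L B] del: index_mult_mat)
  then show ?thesis
  by (simp add: sum_distrib_right) (subst sum.swap, simp add: mult_ac)
 qed
 have carr: "scatter_mat n p z : carrier_mat p p"
  "outer_prod (sample_mean n p z) (sample_mean n p z) : carrier_mat p p"
  by (simp_all add: scatter_mat_def outer_prod_def dim)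
 show "scatter_mat n p x = L * scatter_mat n p z * transpose_mat L"
 proof (rule eq_matI)
  fix j k assume "j < dim_row (L * scatter_mat n p z * transpose_mat L)" "k < dim_col (L * scatter_mat n p z * transpose_mat L)"
  then have jk: "j < p" "k < p" using L by simp_all
  have diff: "x i j - sample_mean n p x $ j = (SUM l<p. L $$ (j, l) * (z i l - sample_mean n p z $ l))"
  if "i : {1..n}" "j < p" for i j
  unfolding x[OF that] mean[OF that(2)] sum_subtractf[symmetric] by (intro sum.cong refl) (simp add: right_diff_distrib)
  have "scatter_mat n p x $$ (j, k) = (\<Sum>i=1..n. (x i j - sample_mean n p x $ j) * (x i k - sample_mean n p x $ k))"
  using jk by (simp add: scatter_mat_def outer_prod_def dim)
  also have "... = (\<Sum>i=1..n. SUM l<p. SUM m<p. L $$ (j, l) * L $$ (k, m) * ((z i l - sample_mean n p z $ l) * (z i m - sample_mean n p z $ m)))"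
  using jk by (intro sum.cong refl) (simp add: diff sum_product mult_ac)
  also have "... = (SUM l<p. SUM m<p. \<Sum>i=1..n. L $$ (j, l) * L $$ (k, m) * ((z i l - sample_mean n p z $ l) * (z i m - sample_mean n p z $ m)))"
  by (subst sum.swap, rule sum.cong[OF refl], rule sum.swap)
  also have "... = (SUM l<p. SUM m<p. L $$ (j, l) * L $$ (k, m) * scatter_mat n p z $$ (l, m))"
  by (intro sum.cong refl) (simp add: scatter_mat_def outer_prod_def dim sum_distrib_left)
  finally show "scatter_mat n p x $$ (j, k) = (L * scatter_mat n p z * transpose_mat L) $$ (j, k)"
  by (simp only: entry[OF carr(1) jk])
 qed (use L in \<open>simp_all add: scatter_mat_def\<close>)
 show "outer_prod (sample_mean n p x) (sample_mean n p x)
  = L * outer_prod (sample_mean n p z) (sample_mean n p z) * transpose_mat L"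
 proof (rule eq_matI)
  fix j k assume "j < dim_row (L * outer_prod (sample_mean n p z) (sample_mean n p z) * transpose_mat L)"
  "k < dim_col (L * outer_prod (sample_mean n p z) (sample_mean n p z) * transpose_mat L)"
  then have jk: "j < p" "k < p" using L by simp_all
  have "outer_prod (sample_mean n p x) (sample_mean n p x) $$ (j, k) = sample_mean n p x $ j * sample_mean n p x $ k"
  using jk by (simp add: outer_prod_def dim)
  also have "... = (SUM l<p. SUM m<p. L $$ (j, l) * L $$ (k, m) * outer_prod (sample_mean n p z) (sample_mean n p z) $$ (l, m))"
  using jk by (simp add: mean sum_product mult_ac outer_prod_def dim)
  finally show "outer_prod (sample_mean n p x) (sample_mean n p x) $$ (j, k)
  = (L * outer_prod (sample_mean n p z) (sample_mean n p z) * transpose_mat L) $$ (j, k)"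
  by (simp only: entry[OF carr(2) jk])
 qed (use L in \<open>simp_all add: outer_prod_def dim\<close>)
qed

lemma measurable_sample [measurable]:
 "(%Z. det (scatter_mat n p (%i j. Z (i, j)))) : borel_measurable (PiM I (%_. borel))"
 "(%Z. trace_mat (scatter_mat n p (%i j. Z (i, j)))) : borel_measurable (PiM I (%_. borel))"
 "(%Z. sample_mean n p (%i j. Z (i, j)) \<bullet> sample_mean n p (%i j. Z (i, j))) : borel_measurable (PiM I (%_. borel))"
 "(%Z. det (scatter_mat n p (%i j. Z (i, j)) + real n \<cdot>\<^sub>m outer_prod (sample_mean n p (%i j. Z (i, j))) (sample_mean n p (%i j. Z (i, j)))))
  \<in> borel_measurable (PiM I (%_. borel))"
proof -
 let ?m = "%Z j. (\<Sum>i=1..n. Z (i, j)) / real n :: real"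
 have sc: "scatter_mat n p (%i j. Z (i, j)) = mat p p (%(j, k). \<Sum>i=1..n. (Z (i, j) - ?m Z j) * (Z (i, k) - ?m Z k))" for Z
  by (auto simp: scatter_mat_def outer_prod_def sample_mean_def)
 have sc2: "scatter_mat n p (%i j. Z (i, j)) + real n \<cdot>\<^sub>m outer_prod (sample_mean n p (%i j. Z (i, j))) (sample_mean n p (%i j. Z (i, j)))
  = mat p p (%(j, k). (\<Sum>i=1..n. (Z (i, j) - ?m Z j) * (Z (i, k) - ?m Z k)) + real n * (?m Z j * ?m Z k))" for Z
  unfolding sc by (auto simp: outer_prod_def sample_mean_def)
 show "(%Z. det (scatter_mat n p (%i j. Z (i, j)))) : borel_measurable (PiM I (%_. borel))"
  unfolding sc by measurable
 show "(%Z. trace_mat (scatter_mat n p (%i j. Z (i, j)))) : borel_measurable (PiM I (%_. borel))"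
  unfolding sc trace_mat_def by simp
 show "(%Z. sample_mean n p (%i j. Z (i, j)) \<bullet> sample_mean n p (%i j. Z (i, j))) : borel_measurable (PiM I (%_. borel))"
  unfolding sample_mean_def scalar_prod_def by simp
 show "(%Z. det (scatter_mat n p (%i j. Z (i, j)) + real n \<cdot>\<^sub>m outer_prod (sample_mean n p (%i j. Z (i, j))) (sample_mean n p (%i j. Z (i, j)))))
  \<in> borel_measurable (PiM I (%_. borel))"
  unfolding sc2 by measurable
qed

lemma ref_tail_Mean:
 assumes S: "mvn_sample M n p \<mu> S X" and null: "lrt_null Mean_Test p \<mu> S" and p: "p > 0" and n: "n > p"
 shows "measure M {om : space M. - 2 * r * ln (lrt_stat Mean_Test n p (%i. X i om)) > t}
  = measure (ref_space Mean_Test n p) {y : space (ref_space Mean_Test n p). r * ref_stat Mean_Test n p y > t}"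
proof -
 define q where "q = n - 1 - p"
 have nq: "n = Suc (q + p)" using n by (simp add: q_def)
 have n0: "n > 0" using n by simp
 from null have \<mu>: "\<mu> = 0\<^sub>v p" and PD: "positive_definite_mat p S" by auto
 then have mc: "\<mu> : carrier_vec p" by simp
 obtain L L' where L: "L : carrier_mat p p" "L' : carrier_mat p p" "L * L' = 1\<^sub>m p" "L' * L = 1\<^sub>m p"
  "\<forall>z \<in> carrier_vec p. (L *\<^sub>v z) \<bullet> (the (mat_inverse S) *\<^sub>v (L *\<^sub>v z)) = z \<bullet> z"
  using positive_definite_whitening[OF PD] by auto
 obtain \<zeta> where \<zeta>: "\<zeta> : measurable M (gauss ({1..n} \<times> {..<p}))"
  "distr M (gauss ({1..n} \<times> {..<p})) \<zeta> = gauss ({1..n} \<times> {..<p})"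
  "\<forall>om\<in>space M. \<forall>i\<in>{1..n}. \<forall>j<p. X i om j = \<mu> $ j + (SUM k<p. L $$ (j, k) * \<zeta> om (i, k))"
  by (rule whitened_sample[OF S n0 mc L])
 define b where "b = (det L)\<^sup>2"
 have "det L * det L' = 1" using det_mult[OF L(1,2)] L(3) by simp
 then have b: "b > 0" unfolding b_def by (metis mult_zero_left zero_less_power2 zero_neq_one)
 \<comment> \<open>\<open>b = (det L)^2\<close> multiplies both determinants. It is carried along
   until the integral has been rewritten in the Bartlett variables, whose almost sure positivity
   allows it to cancel.\<close>
 define \<Phi> where "\<Phi> = (%(d1, d2). - 2 * r * ln ((b * d1) powr (real n / 2) * (b * d2) powr (- real n / 2)))"
 have [measurable]: "\<Phi> : borel_measurable (borel \<Otimes>\<^sub>M borel)" unfolding \<Phi>_def by measurable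
 define D where "D = (%Z. (det (scatter_mat n p (%i j. Z (i, j))),
  det (scatter_mat n p (%i j. Z (i, j)) + real n \<cdot>\<^sub>m outer_prod (sample_mean n p (%i j. Z (i, j))) (sample_mean n p (%i j. Z (i, j))))))"
 have [measurable]: "D : PiM I (%_. borel) \<rightarrow>\<^sub>M borel \<Otimes>\<^sub>M borel" for I unfolding D_def by measurable
 let ?K = "{1..n} \<times> {..<p}"
 define A where "A = {Z : space (PiM ?K (%_. borel)). \<Phi> (D Z) > t}"
 have A: "A : sets (PiM ?K (%_. borel))" unfolding A_def by measurable
 have stat: "- 2 * r * ln (lrt_stat Mean_Test n p (%i. X i om)) = \<Phi> (D (\<zeta> om))" if om: "om : space M" for om
 proof -
  let ?z = "%i j. \<zeta> om (i, j)"
  have x: "X i om j = (SUM k<p. L $$ (j, k) * ?z i k)" if "i : {1..n}" "j < p" for i j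
  using \<zeta>(3) om that by (simp add: \<mu>)
  have carr: "scatter_mat n p ?z : carrier_mat p p"
  "real n \<cdot>\<^sub>m outer_prod (sample_mean n p ?z) (sample_mean n p ?z) : carrier_mat p p"
  "outer_prod (sample_mean n p ?z) (sample_mean n p ?z) : carrier_mat p p"
  by (simp_all add: scatter_mat_def outer_prod_def sample_mean_def)
  have Lt: "transpose_mat L : carrier_mat p p" using L(1) by simp
  have dets: "det (L * B * transpose_mat L) = b * det B" if "B : carrier_mat p p" for B
  using that L(1) by (simp add: det_mult[of _ p] det_transpose[of _ p] b_def power2_eq_square)
  have sl: "scatter_mat n p (%i. X i om) = L * scatter_mat n p ?z * transpose_mat L"
  by (rule scatter_mat_linear[OF _ L(1)]) (rule x)
  have ol: "outer_prod (sample_mean n p (%i. X i om)) (sample_mean n p (%i. X i om))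
  = L * outer_prod (sample_mean n p ?z) (sample_mean n p ?z) * transpose_mat L"
  by (rule outer_mean_linear[OF _ L(1)]) (rule x)
  have "scatter_mat n p (%i. X i om) + real n \<cdot>\<^sub>m outer_prod (sample_mean n p (%i. X i om)) (sample_mean n p (%i. X i om))
  = L * (scatter_mat n p ?z + real n \<cdot>\<^sub>m outer_prod (sample_mean n p ?z) (sample_mean n p ?z)) * transpose_mat L"
  unfolding sl ol
  using carr L(1) Lt
  by (simp add: mult_add_distrib_mat[OF L(1) carr(1,2)] add_mult_distrib_mat[of _ p p _ _ p] mult_smult_distrib[OF L(1) carr(3)]
  mult_smult_assoc_mat[of _ p p _ p])
  then show ?thesis
  using carr by (simp add: Let_def \<Phi>_def D_def sl dets)
 qed
 have "(\<integral>\<^sup>+Z. indicator A Z \<partial>gauss ?K) = (\<integral>\<^sup>+Z. (let A = scatter_mat n p (%i j. Z (i, j)); m = sample_mean n p (%i j. Z (i, j)) in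
  (%y. indicator {t<..} (\<Phi> y)) (det A, det (A + real n \<cdot>\<^sub>m outer_prod m m))) \<partial>gauss ?K)"
  by (rule nn_integral_cong) (auto simp: A_def D_def Let_def indicator_def space_PiM PiE_def)
 also have "... = (\<integral>\<^sup>+w. \<integral>\<^sup>+x. indicator {t<..} (\<Phi> (\<Prod>j<p. x j, (x 0 + w) * (\<Prod>j\<in>{1..<p}. x j))) \<partial>bdiag p q \<partial>chi2 p)"
  by (rule nn_integral_scatter_det_pair[OF p nq]) measurable
 also have "... = (\<integral>\<^sup>+w. \<integral>\<^sup>+x. indicator {t<..} (r * ref_stat Mean_Test n p (w, x)) \<partial>bdiag p q \<partial>chi2 p)"
 proof (rule nn_integral_cong_bartlett)
  fix w :: real and x :: "nat => real" assume w: "w >= 0" and x: "!!j. j < p ==> x j > 0"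
  define P where "P = b * (\<Prod>j\<in>{1..<p}. x j)"
  have P: "P > 0" unfolding P_def using b x by (intro mult_pos_pos prod_pos) auto
  have x0: "x 0 > 0" using x p by simp
  have "{..<p} = insert 0 {1..<p}" using p by auto
  then have "(\<Prod>j<p. x j) = x 0 * (\<Prod>j\<in>{1..<p}. x j)" by simp
  then have "\<Phi> (\<Prod>j<p. x j, (x 0 + w) * (\<Prod>j\<in>{1..<p}. x j)) = - 2 * r * ln ((P * x 0) powr (real n / 2) * (P * (x 0 + w)) powr (- real n / 2))"
  by (simp add: \<Phi>_def P_def mult_ac)
  also have "... = r * ref_stat Mean_Test n p (w, x)"
  using P x0 w by (simp add: ln_mult ln_powr) (simp add: field_simps)
  finally show "indicator {t<..} (\<Phi> (\<Prod>j<p. x j, (x 0 + w) * (\<Prod>j\<in>{1..<p}. x j)))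
  = (indicator {t<..} (r * ref_stat Mean_Test n p (w, x)) :: ennreal)" by simp
 qed
 also have "... = emeasure (ref_space Mean_Test n p) {y : space (ref_space Mean_Test n p). r * ref_stat Mean_Test n p y > t}"
  unfolding emeasure_ref_tail q_def[symmetric] by simp
 finally have int: "(\<integral>\<^sup>+Z. indicator A Z \<partial>gauss ?K) = emeasure (ref_space Mean_Test n p) {y : space (ref_space Mean_Test n p). r * ref_stat Mean_Test n p y > t}" .
 show ?thesis
 proof (rule measure_sample_eq[OF \<zeta>(1,2) _ _ int])
  fix om assume om: "om : space M"
  then have "\<zeta> om : space (PiM ?K (%_. borel))" using measurable_space[OF \<zeta>(1)] by (simp add: space_PiM PiE_def)
  then show "- 2 * r * ln (lrt_stat Mean_Test n p (%i. X i om)) > t \<longleftrightarrow> \<zeta> om : A"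
  unfolding stat[OF om] by (simp add: A_def)
 qed (use A in simp)
qed

lemma scalar_sample:
 assumes S: "mvn_sample M n p \<mu> (c \<cdot>\<^sub>m 1\<^sub>m p) X" and c: "c > 0" and \<mu>: "\<mu> : carrier_vec p" and n: "n > 0"
 obtains \<zeta> where "\<zeta> : measurable M (gauss ({1..n} \<times> {..<p}))"
  "distr M (gauss ({1..n} \<times> {..<p})) \<zeta> = gauss ({1..n} \<times> {..<p})"
  "\<forall>om\<in>space M. \<forall>i\<in>{1..n}. \<forall>j<p. X i om j = \<mu> $ j + sqrt c * \<zeta> om (i, j)"
proof -
 obtain \<zeta> where \<zeta>: "\<zeta> : measurable M (gauss ({1..n} \<times> {..<p}))"
  "distr M (gauss ({1..n} \<times> {..<p})) \<zeta> = gauss ({1..n} \<times> {..<p})"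
  "\<forall>om\<in>space M. \<forall>i\<in>{1..n}. \<forall>j<p. X i om j = \<mu> $ j + (SUM k<p. (sqrt c \<cdot>\<^sub>m 1\<^sub>m p) $$ (j, k) * \<zeta> om (i, k))"
  by (rule whitened_sample[OF S n \<mu> scalar_whitening[OF c]])
 have "(SUM k<p. (sqrt c \<cdot>\<^sub>m 1\<^sub>m p) $$ (j, k) * z k) = sqrt c * z j" if "j < p" for j and z :: "nat => real"
 proof -
  have "(SUM k<p. (sqrt c \<cdot>\<^sub>m 1\<^sub>m p) $$ (j, k) * z k) = (SUM k<p. if j = k then sqrt c * z k else 0)"
  using that by (intro sum.cong) auto
  then show ?thesis using that by simp
 qed
 with \<zeta> show thesis by (intro that[of \<zeta>]) auto
qed

lemma ln_powr_mult_powr: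
 "a > 0 ==> b > 0 ==> ln (a powr u * b powr v) = u * ln a + v * ln (b :: real)"
 by (simp add: ln_mult ln_powr)

lemma ref_tail_Sphericity:
 assumes S: "mvn_sample M n p \<mu> S X" and null: "lrt_null Sphericity_Test p \<mu> S" and p: "p > 0" and n: "n > p"
 shows "measure M {om : space M. - 2 * r * ln (lrt_stat Sphericity_Test n p (%i. X i om)) > t}
  = measure (ref_space Sphericity_Test n p) {y : space (ref_space Sphericity_Test n p). r * ref_stat Sphericity_Test n p y > t}"
proof -
 define q where "q = n - 1 - p"
 have nq: "n = Suc (q + p)" using n by (simp add: q_def)
 have n0: "n > 0" using n by simp
 from null obtain c where c: "c > 0" and Sc: "S = c \<cdot>\<^sub>m 1\<^sub>m p" and \<mu>: "\<mu> : carrier_vec p" by auto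
 let ?K = "{1..n} \<times> {..<p}"
 obtain \<zeta> where \<zeta>: "\<zeta> : measurable M (gauss ?K)" "distr M (gauss ?K) \<zeta> = gauss ?K"
  "\<forall>om\<in>space M. \<forall>i\<in>{1..n}. \<forall>j<p. X i om j = \<mu> $ j + sqrt c * \<zeta> om (i, j)"
  by (rule scalar_sample[OF S[unfolded Sc] c \<mu> n0])
 define \<Phi> where "\<Phi> = (%d s. - 2 * r * ln ((c ^ p * d) powr ((real n - 1) / 2) * (c * s / real p) powr (- (real p * (real n - 1)) / 2)))"
 have [measurable]: "case_prod \<Phi> : borel_measurable (borel \<Otimes>\<^sub>M borel)" unfolding \<Phi>_def by measurable
 define D where "D = (%Z. \<Phi> (det (scatter_mat n p (%i j. Z (i, j)))) (trace_mat (scatter_mat n p (%i j. Z (i, j)))))"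
 have [measurable]: "D : borel_measurable (PiM I (%_. borel))" for I unfolding D_def by measurable
 define A where "A = {Z : space (PiM ?K (%_. borel)). D Z > t}"
 have A: "A : sets (PiM ?K (%_. borel))" unfolding A_def by measurable
 interpret X: prob_space "chi2 p" by (rule prob_space_chi2)
 have stat: "- 2 * r * ln (lrt_stat Sphericity_Test n p (%i. X i om)) = D (\<zeta> om)" if om: "om : space M" for om
 proof -
  let ?z = "%i j. \<zeta> om (i, j)"
  have "scatter_mat n p (%i. X i om) = (sqrt c)\<^sup>2 \<cdot>\<^sub>m scatter_mat n p ?z"
  by (rule scatter_mat_scale[where m = "%j. \<mu> $ j"]) (use \<zeta>(3) om n0 in auto)
  then have sc: "scatter_mat n p (%i. X i om) = c \<cdot>\<^sub>m scatter_mat n p ?z" using c by simp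
  have "trace_mat (c \<cdot>\<^sub>m scatter_mat n p ?z) = c * trace_mat (scatter_mat n p ?z)"
  unfolding trace_mat_def sum_distrib_left by (rule sum.cong) (simp_all add: scatter_mat_def)
  moreover have "dim_col (scatter_mat n p ?z) = p" by (simp add: scatter_mat_def)
  ultimately show ?thesis by (simp add: Let_def sc D_def \<Phi>_def)
 qed
 have "(\<integral>\<^sup>+Z. indicator A Z \<partial>gauss ?K) = (\<integral>\<^sup>+Z. (let A = scatter_mat n p (%i j. Z (i, j)); m = sample_mean n p (%i j. Z (i, j)) in
  (%(d, s, u). indicator {t<..} (\<Phi> d s)) (det A, trace_mat A, real n * (m \<bullet> m))) \<partial>gauss ?K)"
  by (rule nn_integral_cong) (auto simp: A_def D_def Let_def indicator_def space_PiM PiE_def)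
 also have "... = (\<integral>\<^sup>+u. \<integral>\<^sup>+w. \<integral>\<^sup>+x. (%(d, s, u). indicator {t<..} (\<Phi> d s)) (\<Prod>j<p. x j, (SUM j<p. x j) + w, u) \<partial>bdiag p q \<partial>chi2 (\<Sum>{..<p}) \<partial>chi2 p)"
  by (rule nn_integral_scatter_trace_mean[OF p nq]) measurable
 also have "... = (\<integral>\<^sup>+w. \<integral>\<^sup>+x. indicator {t<..} (\<Phi> (\<Prod>j<p. x j) ((SUM j<p. x j) + w)) \<partial>bdiag p q \<partial>chi2 (\<Sum>{..<p}))"
  using X.emeasure_space_1 by simp
 also have "... = (\<integral>\<^sup>+w. \<integral>\<^sup>+x. indicator {t<..} (r * ref_stat Sphericity_Test n p (w, x)) \<partial>bdiag p q \<partial>chi2 (\<Sum>{..<p}))"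
 proof (rule nn_integral_cong_bartlett)
  fix w :: real and x :: "nat => real" assume w: "w >= 0" and x: "!!j. j < p ==> x j > 0"
  define P where "P = (\<Prod>j<p. x j)"
  define s where "s = (SUM j<p. x j) + w"
  have P: "P > 0" unfolding P_def using x by (intro prod_pos) auto
  have "(SUM j<p. x j) > 0" using x p by (intro sum_pos) auto
  then have s: "s > 0" using w by (simp add: s_def)
  have lnP: "ln P = (SUM j<p. ln (x j))" unfolding P_def by (intro ln_prod) (use x in \<open>auto simp: less_le\<close>)
  have l1: "ln (c ^ p * P) = real p * ln c + ln P" using c P by (simp add: ln_mult ln_realpow)
  have l2: "ln (c * s / real p) = ln c + ln (s / real p)" using c s p by (simp add: ln_mult ln_div)
  have pos: "c ^ p * P > 0" "c * s / real p > 0" using c P s p by simp_all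
  have "ln ((c ^ p * P) powr ((real n - 1) / 2) * (c * s / real p) powr (- (real p * (real n - 1)) / 2))
  = (real n - 1) / 2 * ln (c ^ p * P) + - (real p * (real n - 1)) / 2 * ln (c * s / real p)"
  by (rule ln_powr_mult_powr[OF pos])
  also have "... = (real n - 1) / 2 * (SUM j<p. ln (x j)) - (real p * (real n - 1)) / 2 * ln (s / real p)"
  unfolding l1 l2 lnP by (simp add: field_simps)
  finally have "\<Phi> P s = - 2 * r * ((real n - 1) / 2 * (SUM j<p. ln (x j)) - (real p * (real n - 1)) / 2 * ln (s / real p))"
  by (simp add: \<Phi>_def)
  also have "... = r * ref_stat Sphericity_Test n p (w, x)"
  by (simp add: s_def field_simps)
  finally show "indicator {t<..} (\<Phi> (\<Prod>j<p. x j) ((SUM j<p. x j) + w))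
  = (indicator {t<..} (r * ref_stat Sphericity_Test n p (w, x)) :: ennreal)" by (simp add: P_def s_def)
 qed
 also have "... = emeasure (ref_space Sphericity_Test n p) {y : space (ref_space Sphericity_Test n p). r * ref_stat Sphericity_Test n p y > t}"
  unfolding emeasure_ref_tail q_def[symmetric] by simp
 finally have int: "(\<integral>\<^sup>+Z. indicator A Z \<partial>gauss ?K) = emeasure (ref_space Sphericity_Test n p) {y : space (ref_space Sphericity_Test n p). r * ref_stat Sphericity_Test n p y > t}" .
 show ?thesis
 proof (rule measure_sample_eq[OF \<zeta>(1,2) _ _ int])
  fix om assume om: "om : space M"
  then have "\<zeta> om : space (PiM ?K (%_. borel))" using measurable_space[OF \<zeta>(1)] by (simp add: space_PiM PiE_def)
  then show "- 2 * r * ln (lrt_stat Sphericity_Test n p (%i. X i om)) > t \<longleftrightarrow> \<zeta> om : A"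
  unfolding stat[OF om] by (simp add: A_def)
 qed (use A in simp)
qed

lemma ref_tail_Mean_Cov:
 assumes S: "mvn_sample M n p \<mu> S X" and null: "lrt_null Mean_Cov_Test p \<mu> S" and p: "p > 0" and n: "n > p"
 shows "measure M {om : space M. - 2 * r * ln (lrt_stat Mean_Cov_Test n p (%i. X i om)) > t}
  = measure (ref_space Mean_Cov_Test n p) {y : space (ref_space Mean_Cov_Test n p). r * ref_stat Mean_Cov_Test n p y > t}"
proof -
 define q where "q = n - 1 - p"
 have nq: "n = Suc (q + p)" using n by (simp add: q_def)
 have n0: "n > 0" using n by simp
 from null have \<mu>: "\<mu> = 0\<^sub>v p" and Sc: "S = 1 \<cdot>\<^sub>m 1\<^sub>m p" by auto
 then have mc: "\<mu> : carrier_vec p" by simp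
 have c1: "(0::real) < 1" by simp
 let ?K = "{1..n} \<times> {..<p}"
 obtain \<zeta> where \<zeta>: "\<zeta> : measurable M (gauss ?K)" "distr M (gauss ?K) \<zeta> = gauss ?K"
  "\<forall>om\<in>space M. \<forall>i\<in>{1..n}. \<forall>j<p. X i om j = \<mu> $ j + sqrt 1 * \<zeta> om (i, j)"
  by (rule scalar_sample[OF S[unfolded Sc] c1 mc n0])
 define \<Phi> where "\<Phi> = (%d s. - 2 * r * ln ((exp 1 / real n) powr (real n * real p / 2) * d powr (real n / 2) * exp (- s / 2)))"
 have [measurable]: "case_prod \<Phi> : borel_measurable (borel \<Otimes>\<^sub>M borel)" unfolding \<Phi>_def by measurable
 define D where "D = (%Z. \<Phi> (det (scatter_mat n p (%i j. Z (i, j)))) (trace_mat (scatter_mat n p (%i j. Z (i, j)))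
  + real n * (sample_mean n p (%i j. Z (i, j)) \<bullet> sample_mean n p (%i j. Z (i, j)))))"
 have [measurable]: "D : borel_measurable (PiM I (%_. borel))" for I unfolding D_def by measurable
 define A where "A = {Z : space (PiM ?K (%_. borel)). D Z > t}"
 have A: "A : sets (PiM ?K (%_. borel))" unfolding A_def by measurable
 interpret B: prob_space "bdiag p q" by (rule prob_space_bdiag)
 have stat: "- 2 * r * ln (lrt_stat Mean_Cov_Test n p (%i. X i om)) = D (\<zeta> om)" if om: "om : space M" for om
 proof -
  let ?z = "%i j. \<zeta> om (i, j)"
  have x: "X i om j = ?z i j" if "i : {1..n}" "j < p" for i j
  using \<zeta>(3) om that by (simp add: \<mu>)
  have mean: "sample_mean n p (%i. X i om) = sample_mean n p ?z"
  unfolding sample_mean_def by (intro eq_vecI) (auto simp: x)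
  have "scatter_mat n p (%i. X i om) = 1\<^sup>2 \<cdot>\<^sub>m scatter_mat n p ?z"
  by (rule scatter_mat_scale[where m = "%_. 0"]) (use x n0 in auto)
  then have sc: "scatter_mat n p (%i. X i om) = scatter_mat n p ?z" by (auto intro!: eq_matI)
  have e: "- a / 2 - b / 2 = - (a + b) / 2" for a b :: real by simp
  show ?thesis by (simp only: lrt_stat.simps Let_def sc mean D_def \<Phi>_def e)
 qed
 have "(\<integral>\<^sup>+Z. indicator A Z \<partial>gauss ?K) = (\<integral>\<^sup>+Z. (let A = scatter_mat n p (%i j. Z (i, j)); m = sample_mean n p (%i j. Z (i, j)) in
  (%(d, s, u). indicator {t<..} (\<Phi> d (s + u))) (det A, trace_mat A, real n * (m \<bullet> m))) \<partial>gauss ?K)"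
  by (rule nn_integral_cong) (auto simp: A_def D_def Let_def indicator_def space_PiM PiE_def)
 also have "... = (\<integral>\<^sup>+u. \<integral>\<^sup>+w. \<integral>\<^sup>+x. (%(d, s, u). indicator {t<..} (\<Phi> d (s + u))) (\<Prod>j<p. x j, (SUM j<p. x j) + w, u) \<partial>bdiag p q \<partial>chi2 (\<Sum>{..<p}) \<partial>chi2 p)"
  by (rule nn_integral_scatter_trace_mean[OF p nq]) measurable
 \<comment> \<open>Trace and mean enter through their sum only, so the two chi-squared variables
   merge into one.\<close>
 also have "... = (\<integral>\<^sup>+u. \<integral>\<^sup>+w. (%v. \<integral>\<^sup>+x. indicator {t<..} (\<Phi> (\<Prod>j<p. x j) ((SUM j<p. x j) + v)) \<partial>bdiag p q) (u + w) \<partial>chi2 (\<Sum>{..<p}) \<partial>chi2 p)"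
  by (simp add: add_ac)
 also have "... = (\<integral>\<^sup>+v. \<integral>\<^sup>+x. indicator {t<..} (\<Phi> (\<Prod>j<p. x j) ((SUM j<p. x j) + v)) \<partial>bdiag p q \<partial>chi2 (p + \<Sum>{..<p}))"
  by (rule nn_integral_chi2_add) measurable
 also have "... = (\<integral>\<^sup>+w. \<integral>\<^sup>+x. indicator {t<..} (r * ref_stat Mean_Cov_Test n p (w, x)) \<partial>bdiag p q \<partial>chi2 (p + \<Sum>{..<p}))"
 proof (rule nn_integral_cong_bartlett)
  fix w :: real and x :: "nat => real" assume w: "w >= 0" and x: "!!j. j < p ==> x j > 0"
  define P where "P = (\<Prod>j<p. x j)"
  define s where "s = (SUM j<p. x j) + w"
  have P: "P > 0" unfolding P_def using x by (intro prod_pos) auto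
  have lnP: "ln P = (SUM j<p. ln (x j))" unfolding P_def by (intro ln_prod) (use x in \<open>auto simp: less_le\<close>)
  have e: "ln (exp 1 / real n) = 1 - ln (real n)" using n0 by (simp add: ln_div)
  have "ln ((exp 1 / real n) powr (real n * real p / 2) * P powr (real n / 2) * exp (- s / 2))
  = real n * real p / 2 * (1 - ln (real n)) + real n / 2 * ln P + - s / 2"
  using P n0 by (subst ln_mult, simp, simp, subst ln_mult, simp, simp) (simp add: ln_powr e)
  then have "\<Phi> P s = - 2 * r * (real n * real p / 2 * (1 - ln (real n)) + real n / 2 * (SUM j<p. ln (x j)) + - s / 2)"
  by (simp add: \<Phi>_def lnP)
  also have "... = r * ref_stat Mean_Cov_Test n p (w, x)"
  by (simp add: s_def field_simps)
  finally show "indicator {t<..} (\<Phi> (\<Prod>j<p. x j) ((SUM j<p. x j) + w))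
  = (indicator {t<..} (r * ref_stat Mean_Cov_Test n p (w, x)) :: ennreal)" by (simp add: P_def s_def)
 qed
 also have "... = emeasure (ref_space Mean_Cov_Test n p) {y : space (ref_space Mean_Cov_Test n p). r * ref_stat Mean_Cov_Test n p y > t}"
  unfolding emeasure_ref_tail q_def[symmetric] by simp
 finally have int: "(\<integral>\<^sup>+Z. indicator A Z \<partial>gauss ?K) = emeasure (ref_space Mean_Cov_Test n p) {y : space (ref_space Mean_Cov_Test n p). r * ref_stat Mean_Cov_Test n p y > t}" .
 show ?thesis
 proof (rule measure_sample_eq[OF \<zeta>(1,2) _ _ int])
  fix om assume om: "om : space M"
  then have "\<zeta> om : space (PiM ?K (%_. borel))" using measurable_space[OF \<zeta>(1)] by (simp add: space_PiM PiE_def)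
  then show "- 2 * r * ln (lrt_stat Mean_Cov_Test n p (%i. X i om)) > t \<longleftrightarrow> \<zeta> om : A"
  unfolding stat[OF om] by (simp add: A_def)
 qed (use A in simp)
qed

theorem ref_tail:
 assumes "mvn_sample M n p \<mu> S X" "lrt_null T p \<mu> S" "p > 0" "n > p"
 shows "measure M {om : space M. - 2 * r * ln (lrt_stat T n p (%i. X i om)) > t}
  = measure (ref_space T n p) {y : space (ref_space T n p). r * ref_stat T n p y > t}"
proof (cases T)
 case Mean_Test
 show ?thesis unfolding Mean_Test by (rule ref_tail_Mean[OF assms(1) assms(2)[unfolded Mean_Test] assms(3,4)])
next
 case Sphericity_Test
 show ?thesis unfolding Sphericity_Test
  by (rule ref_tail_Sphericity[OF assms(1) assms(2)[unfolded Sphericity_Test] assms(3,4)])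
next
 case Mean_Cov_Test
 show ?thesis unfolding Mean_Cov_Test
  by (rule ref_tail_Mean_Cov[OF assms(1) assms(2)[unfolded Mean_Cov_Test] assms(3,4)])
qed

section \<open>Moments of chi-squared variables\<close>

lemma integral_chi2_size_bias:
 assumes k: "k > 0" and f: "has_bochner_integral (chi2 (k + 2)) f v" and nn: "!!x. x >= 0 ==> f x >= 0"
 shows "has_bochner_integral (chi2 k) (%x. x * f x) (real k * v)"
proof -
 have fm [measurable]: "f : borel_measurable borel" using borel_measurable_has_bochner_integral[OF f] by simp
 have AE: "AE x in chi2 j. f x >= 0" for j using AE_chi2_nonneg[of j] by eventually_elim (rule nn)
 have v: "v >= 0" using f integral_nonneg_AE[OF AE] by (auto simp: has_bochner_integral_iff)
 have nv: "(\<integral>\<^sup>+x. ennreal (f x) \<partial>chi2 (k + 2)) = ennreal v"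
  using f AE by (metis has_bochner_integral_iff nn_integral_eq_integral)
 have "(\<integral>\<^sup>+x. ennreal (x * f x) \<partial>chi2 k) = (\<integral>\<^sup>+x. ennreal x * ennreal (f x) \<partial>chi2 k)"
  using AE_chi2_nonneg[of k] by (intro nn_integral_cong_AE) (auto elim!: eventually_mono simp: ennreal_mult nn)
 also have "... = of_nat k * (\<integral>\<^sup>+x. ennreal (f x) \<partial>chi2 (k + 2))"
  by (rule nn_integral_chi2_size_bias[OF k]) measurable
 also have "... = ennreal (real k * v)"
  unfolding nv using v by (simp add: ennreal_mult ennreal_of_nat_eq_real_of_nat)
 finally show ?thesis
  using v AE_chi2_nonneg[of k] by (intro has_bochner_integral_nn_integral) (auto elim!: eventually_mono simp: nn)
qed

text \<open>The size-bias identity read backwards, with \<open>f x / x\<close> as its function: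
  division by \<open>x\<close> lowers the degrees of freedom by two and costs the factor
  \<open>1 / (k - 2)\<close>.\<close>

lemma integral_chi2_size_bias_inverse:
 assumes k: "k > 2" and f: "has_bochner_integral (chi2 (k - 2)) f v" and nn: "!!x. x >= 0 ==> f x >= 0"
 shows "has_bochner_integral (chi2 k) (%x. f x / x) (v / (real k - 2))"
proof -
 have k2: "k - 2 > 0" "k - 2 + 2 = k" using k by auto
 have fm [measurable]: "f : borel_measurable borel" using borel_measurable_has_bochner_integral[OF f] by simp
 have AE: "AE x in chi2 j. f x >= 0" for j using AE_chi2_nonneg[of j] by eventually_elim (rule nn)
 have v: "v >= 0" using f integral_nonneg_AE[OF AE] by (auto simp: has_bochner_integral_iff)
 have nv: "(\<integral>\<^sup>+x. ennreal (f x) \<partial>chi2 (k - 2)) = ennreal v"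
  using f AE by (metis has_bochner_integral_iff nn_integral_eq_integral)
 have "ennreal v = (\<integral>\<^sup>+x. ennreal x * ennreal (f x / x) \<partial>chi2 (k - 2))"
  unfolding nv[symmetric] using AE_chi2_pos[OF k2(1)]
  by (intro nn_integral_cong_AE) (auto elim!: eventually_mono simp: ennreal_mult[symmetric] nn)
 also have "... = of_nat (k - 2) * (\<integral>\<^sup>+x. ennreal (f x / x) \<partial>chi2 k)"
  using nn_integral_chi2_size_bias[OF k2(1), of "%x. ennreal (f x / x)"] unfolding k2(2) by simp
 finally have *: "ennreal v = (\<integral>\<^sup>+x. ennreal (f x / x) \<partial>chi2 k) * ennreal (real k - 2)"
  using k by (simp add: mult.commute ennreal_of_nat_eq_real_of_nat of_nat_diff)
 also have "ennreal v = ennreal (v / (real k - 2)) * ennreal (real k - 2)"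
  using k v by (simp add: ennreal_mult[symmetric])
 finally have "(\<integral>\<^sup>+x. ennreal (f x / x) \<partial>chi2 k) = ennreal (v / (real k - 2))"
  by (rule ennreal_cancel_right[OF sym]) (use k in \<open>simp_all add: ennreal_eq_0_iff\<close>)
 then show ?thesis
  using v k AE_chi2_nonneg[of k] by (intro has_bochner_integral_nn_integral) (auto elim!: eventually_mono simp: nn)
qed

lemma hbi_chi2_const: "has_bochner_integral (chi2 k) (%_. c) (c::real)"
proof -
 interpret prob_space "chi2 k" by (rule prob_space_chi2)
 show ?thesis using prob_space by (simp add: has_bochner_integral_iff)
qed

lemma hbi_chi2_powers:
 assumes k: "k > 0"
 shows "has_bochner_integral (chi2 k) (%x. x) (real k)"
  "has_bochner_integral (chi2 k) (%x. x ^ 2) (real k * (real k + 2))"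
  "has_bochner_integral (chi2 k) (%x. x ^ 3) (real k * ((real k + 2) * (real k + 4)))"
  "has_bochner_integral (chi2 k) (%x. x ^ 4) (real k * ((real k + 2) * ((real k + 4) * (real k + 6))))"
proof -
 have 1: "has_bochner_integral (chi2 k) (%x. x) (real k)" if "k > 0" for k
  using integral_chi2_size_bias[OF that hbi_chi2_const[of _ 1]] by simp
 have 2: "has_bochner_integral (chi2 k) (%x. x ^ 2) (real k * (real k + 2))" if "k > 0" for k
  using integral_chi2_size_bias[OF that 1] by (simp add: power2_eq_square add_ac)
 have 3: "has_bochner_integral (chi2 k) (%x. x ^ 3) (real k * ((real k + 2) * (real k + 4)))" if "k > 0" for k
  using integral_chi2_size_bias[OF that 2] by (simp add: eval_nat_numeral add_ac)
 have 4: "has_bochner_integral (chi2 k) (%x. x ^ 4) (real k * ((real k + 2) * ((real k + 4) * (real k + 6))))" if "k > 0" for k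
  using integral_chi2_size_bias[OF that 3] by (simp add: eval_nat_numeral add_ac)
 show "has_bochner_integral (chi2 k) (%x. x) (real k)"
  "has_bochner_integral (chi2 k) (%x. x ^ 2) (real k * (real k + 2))"
  "has_bochner_integral (chi2 k) (%x. x ^ 3) (real k * ((real k + 2) * (real k + 4)))"
  "has_bochner_integral (chi2 k) (%x. x ^ 4) (real k * ((real k + 2) * ((real k + 4) * (real k + 6))))"
  using 1 2 3 4 k by blast+
qed

lemma hbi_chi2_inverse:
 assumes k: "k > 2"
 shows "has_bochner_integral (chi2 k) (%x. 1 / x) (1 / (real k - 2))"
 using integral_chi2_size_bias_inverse[OF k hbi_chi2_const[of _ 1]] by simp

lemma hbi_chi2_inverse_square:
 assumes k: "k > 4"
 shows "has_bochner_integral (chi2 k) (%x. 1 / x ^ 2) (1 / ((real k - 2) * (real k - 4)))"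
proof -
 have "has_bochner_integral (chi2 (k - 2)) (%x. 1 / x) (1 / (real (k - 2) - 2))"
  using k by (intro hbi_chi2_inverse) simp
 from integral_chi2_size_bias_inverse[OF _ this] show ?thesis
  using k by (simp add: power2_eq_square of_nat_diff mult.commute)
qed

lemma nonneg_of_sign_derivative:
 fixes f f' :: "real => real"
 assumes f: "!!y. y > 0 ==> (f has_real_derivative f' y) (at y)" and f1: "f 1 = 0"
  and s: "!!y. y >= 1 ==> f' y >= 0" "!!y. 0 < y ==> y <= 1 ==> f' y <= 0" and y: "y > 0"
 shows "f y >= 0"
proof (cases "y >= 1")
 case True
 have "f 1 <= f y"
  proof (rule DERIV_nonneg_imp_nondecreasing[of 1 y f, OF True])
  fix x assume "1 <= x" "x <= y"
  then show "\<exists>z. DERIV f x :> z & z >= 0" using f[of x] s(1)[of x] by (intro exI[of _ "f' x"]) auto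
 qed
 then show ?thesis using f1 by simp
next
 case False
 have "f y >= f 1"
  proof (rule DERIV_nonpos_imp_nonincreasing[of y 1 f])
  fix x assume "y <= x" "x <= 1"
  then show "\<exists>z. DERIV f x :> z & z <= 0" using f[of x] s(2)[of x] y by (intro exI[of _ "f' x"]) auto
 qed (use False in simp)
 then show ?thesis using f1 by simp
qed

text \<open>The difference has derivative \<open>(y - 1) ^ 3 / y\<close>, which has the sign of
  \<open>y - 1\<close>.\<close>

lemma ln_le_cubic:
 fixes y :: real
 assumes "y > 0"
 shows "ln y <= (y - 1) - (y - 1)\<^sup>2 / 2 + (y - 1) ^ 3 / 3"
proof -
 let ?f = "%y::real. (y - 1) - (y - 1)\<^sup>2 / 2 + (y - 1) ^ 3 / 3 - ln y"
 have "0 <= ?f y"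
 proof (rule nonneg_of_sign_derivative[where f = ?f and f' = "%y. (y - 1) ^ 3 / y", OF _ _ _ _ assms])
  fix x :: real assume x: "x > 0"
  have "(?f has_real_derivative 1 - (x - 1) + (x - 1)\<^sup>2 - 1 / x) (at x)"
  using x by (auto intro!: derivative_eq_intros simp: diff_divide_distrib)
  moreover have "1 - (x - 1) + (x - 1)\<^sup>2 - 1 / x = (x - 1) ^ 3 / x"
  using x by (simp add: divide_simps) (simp add: eval_nat_numeral algebra_simps)
  ultimately show "(?f has_real_derivative (x - 1) ^ 3 / x) (at x)" by simp
 qed (auto simp: divide_nonpos_pos zero_le_power_eq power_le_zero_eq)
 then show ?thesis by simp
qed

text \<open>The fourth-order correction is chosen as a Laurent polynomial in \<open>y\<close> with
  lowest power \<open>-2\<close>, so that its chi-squared expectation is known exactly, and such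
  that the derivative of the difference is \<open>(y - 1) ^ 3\<close> times a nonnegative factor on
  the whole half line.\<close>

lemma ln_ge_cubic:
 fixes y :: real
 assumes "y > 0"
 shows "(y - 1) - (y - 1)\<^sup>2 / 2 + (y - 1) ^ 3 / 3 - ((y - 1) ^ 4 + (y - 1) ^ 4 / y\<^sup>2) / 4 <= ln y"
proof -
 let ?f = "%y::real. ln y - (y ^ 3 / 3 - 3 * y\<^sup>2 / 2 + 3 * y - 11 / 6) + (y ^ 4 - 4 * y ^ 3 + 7 * y\<^sup>2 - 8 * y + 7 - 4 * inverse y + (inverse y)\<^sup>2) / 4"
 let ?d = "%y::real. (y - 1) ^ 3 * (1 - 1 / y + 1 / (2 * y\<^sup>2) + 1 / (2 * y ^ 3))"
 have pos: "1 - 1 / x + 1 / (2 * x\<^sup>2) + 1 / (2 * x ^ 3) >= 0" if "x > 0" for x :: real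
 proof -
  define s where "s = 1 / x"
  have "1 - s + s\<^sup>2 / 2 = ((1 - s)\<^sup>2 + 1) / 2" by (simp add: power2_eq_square algebra_simps)
  then have "1 - 1 / x + 1 / (2 * x\<^sup>2) = ((1 - 1 / x)\<^sup>2 + 1) / 2"
  by (simp add: s_def power_divide)
  then have "1 - 1 / x + 1 / (2 * x\<^sup>2) >= 0" by (simp only:) simp
  moreover have "1 / (2 * x ^ 3) >= 0" using that by simp
  ultimately show ?thesis by linarith
 qed
 have "0 <= ?f y"
 proof (rule nonneg_of_sign_derivative[where f = ?f and f' = ?d, OF _ _ _ _ assms])
  fix x :: real assume x: "x > 0"
  have "(?f has_real_derivative
  inverse x - x\<^sup>2 + 3 * x - 3 + (4 * x ^ 3 - 12 * x\<^sup>2 + 14 * x - 8 + 4 * (inverse x)\<^sup>2 - 2 * (inverse x) ^ 3) / 4) (at x)"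
  using x by (auto intro!: derivative_eq_intros simp: eval_nat_numeral) (simp_all add: field_simps)
  moreover have "inverse x - x\<^sup>2 + 3 * x - 3 + (4 * x ^ 3 - 12 * x\<^sup>2 + 14 * x - 8 + 4 * (inverse x)\<^sup>2 - 2 * (inverse x) ^ 3) / 4 = ?d x"
  using x by (simp add: field_simps) (simp add: eval_nat_numeral algebra_simps)
  ultimately show "(?f has_real_derivative ?d x) (at x)" by simp
 next
  fix x :: real
  show "1 <= x ==> ?d x >= 0" using pos[of x] by (intro mult_nonneg_nonneg) auto
  show "0 < x ==> x <= 1 ==> ?d x <= 0" using pos[of x] by (intro mult_nonpos_nonneg) (auto simp: power_le_zero_eq)
 qed simp
 moreover have "(y - 1) - (y - 1)\<^sup>2 / 2 + (y - 1) ^ 3 / 3 - ((y - 1) ^ 4 + (y - 1) ^ 4 / y\<^sup>2) / 4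
  = (y ^ 3 / 3 - 3 * y\<^sup>2 / 2 + 3 * y - 11 / 6) - (y ^ 4 - 4 * y ^ 3 + 7 * y\<^sup>2 - 8 * y + 7 - 4 * inverse y + (inverse y)\<^sup>2) / 4"
  using assms by (simp add: field_simps) (simp add: eval_nat_numeral algebra_simps)
 ultimately show ?thesis by simp
qed

lemma ln_ge_one_minus_inverse: "y > 0 ==> ln y >= 1 - 1 / (y :: real)"
 using ln_le_minus_one[of "1 / y"] by (simp add: ln_div)

lemma hbi_chi2_laurent:
 assumes k: "k > 4"
 shows "has_bochner_integral (chi2 k)
  (%x. a0 + a1 * x + a2 * x ^ 2 + a3 * x ^ 3 + a4 * x ^ 4 + b1 * (1 / x) + b2 * (1 / x ^ 2))
  (a0 + a1 * real k + a2 * (real k * (real k + 2)) + a3 * (real k * ((real k + 2) * (real k + 4)))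
  + a4 * (real k * ((real k + 2) * ((real k + 4) * (real k + 6))))
  + b1 * (1 / (real k - 2)) + b2 * (1 / ((real k - 2) * (real k - 4))))"
 using k
 by (intro has_bochner_integral_add has_bochner_integral_mult_right hbi_chi2_const
  hbi_chi2_powers hbi_chi2_inverse hbi_chi2_inverse_square) auto

text \<open>Reduces each of the following moments to an identity of rational functions in
  \<open>k\<close>. Powers go down to \<open>-2\<close>, and that is where \<open>k > 4\<close>
  comes from.\<close>

lemma hbi_chi2_laurentI:
 assumes k: "k > 4" and f [measurable]: "f : borel_measurable borel"
  and eq: "!!x. x > 0 ==> f x = a0 + a1 * x + a2 * x ^ 2 + a3 * x ^ 3 + a4 * x ^ 4 + b1 * (1 / x) + b2 * (1 / x ^ 2)"
  and v: "v = a0 + a1 * real k + a2 * (real k * (real k + 2)) + a3 * (real k * ((real k + 2) * (real k + 4)))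
  + a4 * (real k * ((real k + 2) * ((real k + 4) * (real k + 6))))
  + b1 * (1 / (real k - 2)) + b2 * (1 / ((real k - 2) * (real k - 4)))"
 shows "has_bochner_integral (chi2 k) f v"
proof -
 have "AE x in chi2 k. f x = a0 + a1 * x + a2 * x ^ 2 + a3 * x ^ 3 + a4 * x ^ 4 + b1 * (1 / x) + b2 * (1 / x ^ 2)"
  using AE_chi2_pos[of k] k by (auto elim!: eventually_mono simp: eq)
 then show ?thesis unfolding v
  by (intro has_bochner_integral_cong_AE[THEN iffD2, OF _ _ _ hbi_chi2_laurent[OF k]]) measurable
qed

lemma chi2_variance:
 assumes k: "k > 0"
 shows "has_bochner_integral (chi2 k) (%x. (x - real k)\<^sup>2) (2 * real k)"
proof -
 have "has_bochner_integral (chi2 k) (%x. x ^ 2 + (- 2 * real k) * x + (real k)\<^sup>2) (real k * (real k + 2) + (- 2 * real k) * real k + (real k)\<^sup>2)"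
  using k by (intro has_bochner_integral_add has_bochner_integral_mult_right hbi_chi2_const
  hbi_chi2_powers) auto
 then show ?thesis by (simp add: power2_diff power2_eq_square algebra_simps)
qed

context
 fixes k :: nat and K :: real
 assumes k: "k > 4"
 defines "K \<equiv> real k"
begin

lemma K5: "K >= 5" using k by (simp add: K_def)

lemma chi2_inverse_variance:
 "has_bochner_integral (chi2 k) (%x. (K / x - 1)\<^sup>2) ((2 * K + 8) / ((K - 2) * (K - 4)))"
 using K5 by (intro hbi_chi2_laurentI[OF k, where ?a0.0 = 1 and ?a1.0 = 0 and ?a2.0 = 0 and ?a3.0 = 0 and ?a4.0 = 0 and ?b1.0 = "- 2 * K" and ?b2.0 = "K\<^sup>2"])
  (simp_all add: K_def[symmetric] divide_simps power2_eq_square, simp_all add: algebra_simps)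

lemma chi2_centered_moments:
 "has_bochner_integral (chi2 k) (%x. x / K - 1) 0"
 "has_bochner_integral (chi2 k) (%x. (x / K - 1) ^ 2) (2 / K)"
 "has_bochner_integral (chi2 k) (%x. (x / K - 1) ^ 3) (8 / K ^ 2)"
 "has_bochner_integral (chi2 k) (%x. (x / K - 1) ^ 4) (12 / K ^ 2 + 48 / K ^ 3)"
proof -
 show "has_bochner_integral (chi2 k) (%x. x / K - 1) 0"
  using K5 by (intro hbi_chi2_laurentI[OF k, where ?a0.0 = "-1" and ?a1.0 = "1 / K" and ?a2.0 = 0 and ?a3.0 = 0 and ?a4.0 = 0 and ?b1.0 = 0 and ?b2.0 = 0])
  (simp_all add: K_def[symmetric])
 show "has_bochner_integral (chi2 k) (%x. (x / K - 1) ^ 2) (2 / K)"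
  using K5 by (intro hbi_chi2_laurentI[OF k, where ?a0.0 = 1 and ?a1.0 = "- 2 / K" and ?a2.0 = "1 / K^2" and ?a3.0 = 0 and ?a4.0 = 0 and ?b1.0 = 0 and ?b2.0 = 0])
  (simp_all add: K_def[symmetric] divide_simps power2_eq_square, simp_all add: algebra_simps)
 show "has_bochner_integral (chi2 k) (%x. (x / K - 1) ^ 3) (8 / K ^ 2)"
  using K5 by (intro hbi_chi2_laurentI[OF k, where ?a0.0 = "-1" and ?a1.0 = "3 / K" and ?a2.0 = "- 3 / K^2" and ?a3.0 = "1 / K^3" and ?a4.0 = 0 and ?b1.0 = 0 and ?b2.0 = 0])
  (simp_all add: K_def[symmetric] divide_simps power2_eq_square power3_eq_cube, simp_all add: algebra_simps)
 show "has_bochner_integral (chi2 k) (%x. (x / K - 1) ^ 4) (12 / K ^ 2 + 48 / K ^ 3)"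
  using K5 by (intro hbi_chi2_laurentI[OF k, where ?a0.0 = 1 and ?a1.0 = "- 4 / K" and ?a2.0 = "6 / K^2" and ?a3.0 = "- 4 / K^3" and ?a4.0 = "1 / K^4" and ?b1.0 = 0 and ?b2.0 = 0])
  (simp_all add: K_def[symmetric] divide_simps power2_eq_square power3_eq_cube power4_eq_xxxx, simp_all add: algebra_simps)
qed

lemma chi2_fourth_moment_ratio:
 "has_bochner_integral (chi2 k) (%x. (x / K - 1) ^ 4 / (x / K)\<^sup>2) ((12 * K + 16) / (K * (K - 2) * (K - 4)))"
 using K5 by (intro hbi_chi2_laurentI[OF k, where ?a0.0 = 6 and ?a1.0 = "- 4 / K" and ?a2.0 = "1 / K^2" and ?a3.0 = 0 and ?a4.0 = 0 and ?b1.0 = "- 4 * K" and ?b2.0 = "K^2"])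
  (simp_all add: K_def[symmetric] divide_simps power2_eq_square power4_eq_xxxx, simp_all add: algebra_simps)

lemma rational_bounds:
 "(12 * K + 16) / (K * (K - 2) * (K - 4)) <= 127 / K\<^sup>2"
 "(2 * K + 8) / ((K - 2) * (K - 4)) <= 30 / K"
 "12 / K ^ 2 + 48 / K ^ 3 <= 22 / K\<^sup>2"
proof -
 \<comment> \<open>The constant \<open>3 / 25\<close> is sharp at \<open>K = 5\<close>: the
   difference of the sides is \<open>(22 K - 40) (K - 5) / 25\<close>.\<close>
 have 1: "(K - 2) * (K - 4) >= 3 * K\<^sup>2 / 25"
 proof -
  have "(22 * K - 40) * (K - 5) >= 0" using K5 by (intro mult_nonneg_nonneg) auto
  then show ?thesis by (simp add: algebra_simps power2_eq_square)
 qed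
 have "(2 * K + 8) / ((K - 2) * (K - 4)) <= (18 * K / 5) / (3 * K\<^sup>2 / 25)"
  using 1 K5 by (intro frac_le) auto
 also have "... = 30 / K" using K5 by (simp add: power2_eq_square)
 finally show "(2 * K + 8) / ((K - 2) * (K - 4)) <= 30 / K" .
 have "(12 * K + 16) / (K * (K - 2) * (K - 4)) <= (76 * K / 5) / (K * (3 * K\<^sup>2 / 25))"
  using 1 K5 unfolding mult.assoc by (intro frac_le mult_left_mono) auto
 also have "... = (380 / 3) / K\<^sup>2" using K5 by (simp add: power2_eq_square)
 also have "... <= 127 / K\<^sup>2" by (intro divide_right_mono) auto
 finally show "(12 * K + 16) / (K * (K - 2) * (K - 4)) <= 127 / K\<^sup>2" .
 show "12 / K ^ 2 + 48 / K ^ 3 <= 22 / K\<^sup>2"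
  using K5 by (simp add: field_simps power2_eq_square power3_eq_cube)
qed

lemma measurable_chi2_ln [measurable]: "(%x. ln (x / K)) : borel_measurable borel" by measurable

lemma chi2_log_integrable: "integrable (chi2 k) (%x. ln (x / K))"
proof (rule Bochner_Integration.integrable_bound)
 show "integrable (chi2 k) (%x. (1 / K) * x + K * (1 / x))"
  using hbi_chi2_powers(1)[of k] hbi_chi2_inverse[of k] k
  by (intro Bochner_Integration.integrable_add integrable_mult_right) (auto simp: has_bochner_integral_iff)
 show "AE x in chi2 k. norm (ln (x / K)) <= norm ((1 / K) * x + K * (1 / x))"
  using AE_chi2_pos[of k] k
 proof (auto elim!: eventually_mono)
  fix x :: real assume x: "x > 0"
  then have y: "x / K > 0" using K5 by simp
  then have "ln (x / K) <= x / K - 1" "ln (x / K) >= 1 - 1 / (x / K)"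
  by (rule ln_le_minus_one ln_ge_one_minus_inverse)+
  moreover have "K / x > 0" using x K5 by simp
  ultimately have "\<bar>ln (x / K)\<bar> <= x / K + K / x" using y by (simp add: abs_if)
  then show "\<bar>ln (x / K)\<bar> <= \<bar>x / K + K / x\<bar>" by linarith
 qed
qed simp

text \<open>In the expansion around 1 the linear term averages to 0, the quadratic one to
  \<open>- 1 / K\<close> and the cubic one to \<open>8 / (3 K^2)\<close>. An explicit error of order
  \<open>K^-2\<close> is required, since these means are later multiplied by a number comparable
  with \<open>K\<close> and summed over \<open>p\<close> coordinates.\<close>

lemma chi2_log_mean:
 "(\<integral>x. ln (x / K) \<partial>chi2 k) <= 0"
 "(\<integral>x. ln (x / K) \<partial>chi2 k) <= - 1 / K + 8 / (3 * K\<^sup>2)"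
 "(\<integral>x. ln (x / K) \<partial>chi2 k) >= - 1 / K - 38 / K\<^sup>2"
proof -
 note m = chi2_centered_moments and r = chi2_fourth_moment_ratio
 have combine: "x - (d + c) / 4 <= x + e - (B + A) / 4" if "0 <= e" "A <= c" "B <= d" for A B x c d e :: real
 proof -
  have "(B + A) / 4 <= (d + c) / 4" using that by (intro divide_right_mono add_mono) auto
  with that(1) show ?thesis by linarith
 qed
 have pos: "AE x in chi2 k. x / K > 0" using AE_chi2_pos[of k] k K5 by (auto elim!: eventually_mono)
 have i: "integrable (chi2 k) f" "integral\<^sup>L (chi2 k) f = v" if "has_bochner_integral (chi2 k) f v" for f :: "real => real" and v
  using that by (auto simp: has_bochner_integral_iff)
 have "(\<integral>x. ln (x / K) \<partial>chi2 k) <= (\<integral>x. x / K - 1 \<partial>chi2 k)"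
  using pos by (intro integral_mono_AE chi2_log_integrable i(1)[OF m(1)]) (auto elim!: eventually_mono intro: ln_le_minus_one)
 then show "(\<integral>x. ln (x / K) \<partial>chi2 k) <= 0" using i(2)[OF m(1)] by simp
 have U: "has_bochner_integral (chi2 k) (%x. (x / K - 1) + (- 1 / 2) * (x / K - 1) ^ 2 + (1 / 3) * (x / K - 1) ^ 3) (0 + (- 1 / 2) * (2 / K) + (1 / 3) * (8 / K ^ 2))"
  by (intro has_bochner_integral_add has_bochner_integral_mult_right m)
 have "(\<integral>x. ln (x / K) \<partial>chi2 k) <= (\<integral>x. (x / K - 1) + (- 1 / 2) * (x / K - 1) ^ 2 + (1 / 3) * (x / K - 1) ^ 3 \<partial>chi2 k)"
  using pos by (intro integral_mono_AE chi2_log_integrable i(1)[OF U]) (auto elim!: eventually_mono dest!: ln_le_cubic)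
 then show "(\<integral>x. ln (x / K) \<partial>chi2 k) <= - 1 / K + 8 / (3 * K\<^sup>2)" using i(2)[OF U] by simp
 have L: "has_bochner_integral (chi2 k) (%x. (x / K - 1) + (- 1 / 2) * (x / K - 1) ^ 2 + (1 / 3) * (x / K - 1) ^ 3 + (- 1 / 4) * ((x / K - 1) ^ 4 + (x / K - 1) ^ 4 / (x / K)\<^sup>2))
  (0 + (- 1 / 2) * (2 / K) + (1 / 3) * (8 / K ^ 2) + (- 1 / 4) * ((12 / K ^ 2 + 48 / K ^ 3) + (12 * K + 16) / (K * (K - 2) * (K - 4))))"
  by (intro has_bochner_integral_add has_bochner_integral_mult_right m r)
 have "(\<integral>x. ln (x / K) \<partial>chi2 k) >= (\<integral>x. (x / K - 1) + (- 1 / 2) * (x / K - 1) ^ 2 + (1 / 3) * (x / K - 1) ^ 3 + (- 1 / 4) * ((x / K - 1) ^ 4 + (x / K - 1) ^ 4 / (x / K)\<^sup>2) \<partial>chi2 k)"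
  using pos by (intro integral_mono_AE chi2_log_integrable i(1)[OF L]) (auto elim!: eventually_mono dest!: ln_ge_cubic)
 then have lb: "(\<integral>x. ln (x / K) \<partial>chi2 k) >= - 1 / K + 8 / (3 * K\<^sup>2) - ((12 / K ^ 2 + 48 / K ^ 3) + (12 * K + 16) / (K * (K - 2) * (K - 4))) / 4"
  using i(2)[OF L] by simp
 note combine[OF _ rational_bounds(1,3), of "8 / (3 * K\<^sup>2)" "- 1 / K"]
 then have "- 1 / K + 8 / (3 * K\<^sup>2) - ((12 / K ^ 2 + 48 / K ^ 3) + (12 * K + 16) / (K * (K - 2) * (K - 4))) / 4
  >= - 1 / K - (22 / K\<^sup>2 + 127 / K\<^sup>2) / 4" by simp
 moreover have "(22 / K\<^sup>2 + 127 / K\<^sup>2) / 4 <= 38 / K\<^sup>2" using K5 by (simp add: divide_simps)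
 ultimately show "(\<integral>x. ln (x / K) \<partial>chi2 k) >= - 1 / K - 38 / K\<^sup>2" using lb by linarith
qed

text \<open>\<open>y - 1 - ln y\<close> lies between 0 and \<open>(y - 1)^2 / y\<close>, so it is of
  the size of a squared deviation and its second moment is of order \<open>K^-2\<close>, one order
  better than that of \<open>ln y\<close>.\<close>

lemma chi2_entropy_square:
 "integrable (chi2 k) (%x. (x / K - 1 - ln (x / K))\<^sup>2)"
 "(\<integral>x. (x / K - 1 - ln (x / K))\<^sup>2 \<partial>chi2 k) <= 127 / K\<^sup>2"
proof -
 note r = chi2_fourth_moment_ratio
 have ineq: "(x / K - 1 - ln (x / K))\<^sup>2 <= (x / K - 1) ^ 4 / (x / K)\<^sup>2" if "x > 0" for x
 proof -
  define y where "y = x / K"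
  have y: "y > 0" using that K5 by (simp add: y_def)
  have "0 <= y - 1 - ln y" using ln_le_minus_one[OF y] by simp
  moreover have "y - 1 - ln y <= (y - 1)\<^sup>2 / y"
  using ln_ge_one_minus_inverse[OF y] y by (simp add: field_simps power2_eq_square)
  ultimately have "(y - 1 - ln y)\<^sup>2 <= ((y - 1)\<^sup>2 / y)\<^sup>2" by (rule power_mono[rotated])
  also have "... = (y - 1) ^ 4 / y\<^sup>2" by (simp add: power_divide power_mult[symmetric])
  finally show ?thesis by (simp add: y_def)
 qed
 show int: "integrable (chi2 k) (%x. (x / K - 1 - ln (x / K))\<^sup>2)"
 proof (rule Bochner_Integration.integrable_bound)
  show "integrable (chi2 k) (%x. (x / K - 1) ^ 4 / (x / K)\<^sup>2)" using r by (simp add: has_bochner_integral_iff)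
  show "AE x in chi2 k. norm ((x / K - 1 - ln (x / K))\<^sup>2) <= norm ((x / K - 1) ^ 4 / (x / K)\<^sup>2)"
  using AE_chi2_pos[of k] k by (auto elim!: eventually_mono intro!: order_trans[OF ineq])
 qed simp
 have "(\<integral>x. (x / K - 1 - ln (x / K))\<^sup>2 \<partial>chi2 k) <= (\<integral>x. (x / K - 1) ^ 4 / (x / K)\<^sup>2 \<partial>chi2 k)"
  using AE_chi2_pos[of k] k r
  by (intro integral_mono_AE int) (auto elim!: eventually_mono intro: ineq simp: has_bochner_integral_iff)
 then show "(\<integral>x. (x / K - 1 - ln (x / K))\<^sup>2 \<partial>chi2 k) <= 127 / K\<^sup>2"
  using r rational_bounds(1) by (simp add: has_bochner_integral_iff)
qed

lemma chi2_log_square: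
 "integrable (chi2 k) (%x. (ln (x / K))\<^sup>2)"
 "(\<integral>x. (ln (x / K))\<^sup>2 \<partial>chi2 k) <= 55 / K"
proof -
 have b: "integrable (chi2 k) (%x. 2 * (x / K - 1) ^ 2 + 2 * (x / K - 1 - ln (x / K))\<^sup>2)"
  using chi2_centered_moments(2) chi2_entropy_square(1) by (auto simp: has_bochner_integral_iff)
 have ineq: "(ln (x / K))\<^sup>2 <= 2 * (x / K - 1) ^ 2 + 2 * (x / K - 1 - ln (x / K))\<^sup>2" for x
 proof -
  have "0 <= (2 * (x / K - 1) - ln (x / K))\<^sup>2" by simp
  then show ?thesis by (simp add: power2_eq_square algebra_simps)
 qed
 show int: "integrable (chi2 k) (%x. (ln (x / K))\<^sup>2)"
  by (rule Bochner_Integration.integrable_bound[OF b]) (auto intro!: order_trans[OF ineq])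
 have "(\<integral>x. (ln (x / K))\<^sup>2 \<partial>chi2 k) <= (\<integral>x. 2 * (x / K - 1) ^ 2 + 2 * (x / K - 1 - ln (x / K))\<^sup>2 \<partial>chi2 k)"
  by (intro integral_mono int b ineq)
 also have "... = 2 * (2 / K) + 2 * (\<integral>x. (x / K - 1 - ln (x / K))\<^sup>2 \<partial>chi2 k)"
  using chi2_centered_moments(2) chi2_entropy_square(1) by (simp add: has_bochner_integral_iff)
 also have "... <= 4 / K + 254 / K\<^sup>2" using chi2_entropy_square(2) by simp
 also have "... <= 55 / K" using K5 by (simp add: field_simps power2_eq_square)
 finally show "(\<integral>x. (ln (x / K))\<^sup>2 \<partial>chi2 k) <= 55 / K" .
qed

end

section \<open>Kolmogorov distance to a chi-squared law\<close>

lemma chi2_eq_chi_square: "k > 0 ==> chi2 k = chi_square (real k)"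
 by (simp add: chi2_def)

lemma measure_chi2_le:
 assumes k: "k > 0" and A [measurable]: "A : sets borel" and g [measurable]: "g : borel_measurable borel"
  and le: "!!y. y > 0 ==> y : A ==> chi_square_density (real k) y <= g y" and nn: "!!y. g y >= 0"
  and int: "(\<integral>\<^sup>+y. ennreal (g y) \<partial>lborel) <= ennreal b" and b: "b >= 0"
 shows "measure (chi2 k) A <= b"
proof -
 interpret prob_space "chi2 k" by (rule prob_space_chi2)
 have "emeasure (chi2 k) A = (\<integral>\<^sup>+y. ennreal (chi_square_density (real k) y) * indicator A y \<partial>lborel)"
  unfolding chi2_eq_chi_square[OF k] chi_square_def by (subst emeasure_density) auto
 also have "... <= (\<integral>\<^sup>+y. ennreal (g y) \<partial>lborel)"
 proof (rule nn_integral_mono)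
  fix y
  show "ennreal (chi_square_density (real k) y) * indicator A y <= ennreal (g y)"
  using le[of y] nn[of y] by (cases "y > 0") (auto simp: indicator_def chi_square_density_def intro!: ennreal_leI)
 qed
 also have "... <= ennreal b" by (rule int)
 finally show ?thesis using b by (simp add: emeasure_eq_measure)
qed

lemma nn_integral_const_interval:
 assumes "h >= 0" "c >= 0"
 shows "(\<integral>\<^sup>+y. ennreal (c * indicator {x<..x + h} y) \<partial>lborel) = ennreal (c * h)"
proof -
 have "(\<integral>\<^sup>+y. ennreal (c * indicator {x<..x + h} y) \<partial>lborel) = (\<integral>\<^sup>+y. ennreal c * indicator {x<..x + h} y \<partial>lborel)"
  by (intro nn_integral_cong) (auto simp: indicator_def)
 also have "... = ennreal c * ennreal h" using assms by (subst nn_integral_cmult_indicator) auto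
 finally show ?thesis using assms by (simp add: ennreal_mult)
qed

text \<open>For at least three degrees of freedom the density on \<open>[m, m + sqrt m]\<close>, with \<open>m\<close> the mode,
  is comparable to its maximum, so the maximum is at most a constant over \<open>sqrt m\<close>.\<close>

lemma chi_square_density_le:
 assumes k: "k >= 3" and y: "y > 0"
 shows "chi_square_density (real k) y <= 4 / sqrt (real k)"
proof -
 define m where "m = real k - 2"
 define c where "c = 2 powr (real k / 2) * Gamma (real k / 2)"
 have m: "m >= 1" using k by (simp add: m_def)
 have c: "c > 0" using k by (auto simp: c_def intro!: Gamma_real_pos)
 have d: "chi_square_density (real k) z = exp (m / 2 * ln z - z / 2) / c" if "z > 0" for z
 proof -
  have 1: "chi_square_density (real k) z = z powr (real k / 2 - 1) * exp (- z / 2) / c"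
  using that by (simp add: chi_square_density_def c_def)
  have 2: "real k / 2 - 1 = m / 2" by (simp add: m_def diff_divide_distrib)
  have 3: "z powr (m / 2) = exp (m / 2 * ln z)" using that by (simp add: powr_def)
  have 4: "exp (m / 2 * ln z) * exp (- z / 2) = exp (m / 2 * ln z - z / 2)"
  by (simp add: exp_add[symmetric])
  show ?thesis unfolding 1 2 3 4 ..
 qed
 \<comment> \<open>\<open>ln y <= y - 1\<close> at \<open>y = z / m\<close> shows that the density
   is largest at \<open>m\<close>.\<close>
 have max: "chi_square_density (real k) z <= exp (m / 2 * ln m - m / 2) / c" if z: "z > 0" for z
 proof -
  have "ln (z / m) <= z / m - 1" using z m by (intro ln_le_minus_one) auto
  then have "m / 2 * (ln z - ln m) <= m / 2 * (z / m - 1)" using z m by (intro mult_left_mono) (auto simp: ln_div)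
  moreover have "m / 2 * (z / m - 1) = z / 2 - m / 2" using m by (simp add: field_simps)
  ultimately have "m / 2 * ln z - z / 2 <= m / 2 * ln m - m / 2" by (simp add: right_diff_distrib)
  then show ?thesis unfolding d[OF z] using c by (intro divide_right_mono) auto
 qed
 define D where "D = exp (m / 2 * ln m - m / 2) / c"
 have D: "D > 0" using c by (simp add: D_def)
 \<comment> \<open>At \<open>z = m (1 + t)\<close> with \<open>m t^2 <= 1\<close> the logarithm of
   the density lies at most \<open>1 / 2\<close> below its maximum, because
   \<open>ln (1 + t) >= t - t^2\<close>.\<close>
 have low: "chi_square_density (real k) z >= D * exp (- 1 / 2)" if z: "z : {m<..m + sqrt m}" for z
 proof -
  define t where "t = (z - m) / m"
  have sm: "sqrt m <= m" using m real_sqrt_le_iff[of m "m\<^sup>2"] by (simp add: power2_eq_square)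
  have t: "t >= 0" "t <= 1" using z m sm by (auto simp: t_def field_simps)
  have "m * t\<^sup>2 <= 1"
  proof -
  have "(z - m)\<^sup>2 <= (sqrt m)\<^sup>2" using z by (intro power_mono) auto
  then have "(z - m)\<^sup>2 <= m" using m by simp
  moreover have "m * t\<^sup>2 = (z - m)\<^sup>2 / m" using m by (simp add: t_def power2_eq_square)
  ultimately show ?thesis using m by simp
  qed
  moreover have "ln (1 + t) >= t - t\<^sup>2" using t by (rule ln_one_plus_pos_lower_bound)
  then have "m / 2 * (ln (1 + t) - t) >= m / 2 * (- t\<^sup>2)" using m by (intro mult_left_mono) auto
  moreover have zt: "z = m * (1 + t)" using m by (simp add: t_def field_simps)
  have "ln z = ln m + ln (1 + t)" unfolding zt using m t by (simp add: ln_mult)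
  then have "m / 2 * ln z - z / 2 = m / 2 * ln m - m / 2 + m / 2 * (ln (1 + t) - t)"
  unfolding zt by (simp add: algebra_simps)
  ultimately have "m / 2 * ln z - z / 2 >= (m / 2 * ln m - m / 2) + - 1 / 2" by linarith
  then have "exp (m / 2 * ln z - z / 2) >= exp ((m / 2 * ln m - m / 2) + - 1 / 2)" by simp
  then have "exp ((m / 2 * ln m - m / 2) + - 1 / 2) / c <= exp (m / 2 * ln z - z / 2) / c"
  using c by (intro divide_right_mono) auto
  moreover have "z > 0" using z m by auto
  ultimately show ?thesis unfolding D_def d[OF \<open>z > 0\<close>] exp_add by simp
 qed
 have "ennreal (D * exp (- 1 / 2) * sqrt m) = (\<integral>\<^sup>+z. ennreal (D * exp (- 1 / 2) * indicator {m<..m + sqrt m} z) \<partial>lborel)"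
  using D m by (intro nn_integral_const_interval[symmetric]) auto
 also have "... <= (\<integral>\<^sup>+z. ennreal (chi_square_density (real k) z) * indicator UNIV z \<partial>lborel)"
  using low k by (intro nn_integral_mono) (auto simp: indicator_def chi_square_density_nonneg intro!: ennreal_leI)
 also have "... = emeasure (chi_square (real k)) UNIV"
  unfolding chi_square_def by (subst emeasure_density) auto
 also have "... = 1"
  using prob_space.emeasure_space_1[OF prob_space_chi_square[of "real k"]] k by (simp add: chi_square_def)
 finally have 1: "D * exp (- 1 / 2) * sqrt m <= 1" by simp
 have e: "exp (- 1 / 2 :: real) >= 1 / 2" using exp_ge_add_one_self[of "- 1 / 2 :: real"] by simp
 have "sqrt (real k) <= sqrt (3 * m)" using k by (simp add: m_def)
 also have "... <= 2 * sqrt m" using m by (simp add: real_sqrt_mult real_le_lsqrt)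
 finally have sk: "sqrt (real k) <= 2 * sqrt m" .
 have "D * (1 / 2) * (sqrt (real k) / 2) <= D * exp (- 1 / 2) * sqrt m"
  using D e sk m by (intro mult_mono) auto
 with 1 have "D <= 4 / sqrt (real k)" using k by (simp add: field_simps)
 then show ?thesis using max[OF y] by (simp add: D_def)
qed

lemma powr_minus_half:
 assumes "y > 0" shows "y powr (- 1 / 2) = 1 / sqrt (y :: real)"
 using powr_minus[of y "1 / 2"] powr_half_sqrt[of y] assms by (simp add: inverse_eq_divide)

text \<open>With one degree of freedom the density is unbounded at 0, so a constant bound is
  impossible; \<open>y powr (- 1 / 2)\<close> is an integrable majorant that also covers two degrees
  of freedom.\<close>

lemma chi_square_density_le_small:
 assumes k: "k = 1 \<or> k = 2" and y: "y > 0"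
 shows "chi_square_density (real k) y <= y powr (- 1 / 2)"
 using k
proof
 assume k: "k = 1"
 have "2 powr (1 / 2) * Gamma (1 / 2 :: real) = sqrt (2 * pi)"
  by (simp add: Gamma_one_half_real powr_half_sqrt real_sqrt_mult)
 moreover have "sqrt (2 * pi) >= 1" using pi_gt3 by simp
 moreover have "y powr (- 1 / 2) * exp (- y / 2) <= y powr (- 1 / 2) * 1"
  using y by (intro mult_left_mono) auto
 ultimately have "y powr (- 1 / 2) * exp (- y / 2) / (2 powr (1 / 2) * Gamma (1 / 2)) <= y powr (- 1 / 2) / 1"
  by (intro frac_le) auto
 then show ?thesis using k y by (simp add: chi_square_density_def)
next
 assume k: "k = 2"
 have s: "sqrt y > 0" using y by simp
 have "sqrt y <= 1 + y"
 proof -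
  have "0 <= (sqrt y - 1)\<^sup>2" by simp
  then have "2 * sqrt y <= 1 + y" using y by (simp add: power2_diff)
  then show ?thesis using s by linarith
 qed
 moreover have "1 + y / 2 <= exp (y / 2)" by (rule exp_ge_add_one_self)
 ultimately have "sqrt y <= 2 * exp (y / 2)" using y by linarith
 then have "exp (- y / 2) / 2 <= 1 / sqrt y" using s by (simp add: exp_minus field_simps)
 moreover have "y powr (- 1 / 2) = 1 / sqrt y" by (rule powr_minus_half) (use y in simp)
 ultimately show ?thesis using k y by (simp add: chi_square_density_def)
qed

text \<open>The window is measured in units of \<open>sqrt k\<close>, the order of the standard
  deviation, which makes the bound uniform in \<open>k\<close>. The linear term comes from the
  bounded density for \<open>k >= 3\<close>, the square root from the singularity at 0 for
  \<open>k <= 2\<close>.\<close>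

lemma chi2_anticoncentration:
 assumes k: "k > 0" and et: "et > 0"
 shows "measure (chi2 k) {x<..x + et * sqrt (real k)} <= 4 * et + 5 * sqrt et"
proof (cases "k >= 3")
 case True
 let ?h = "et * sqrt (real k)"
 have "measure (chi2 k) {x<..x + ?h} <= 4 * et"
 proof (rule measure_chi2_le[OF k, where g = "%y. 4 / sqrt (real k) * indicator {x<..x + ?h} y"])
  fix y :: real assume "y > 0" "y : {x<..x + ?h}"
  then show "chi_square_density (real k) y <= 4 / sqrt (real k) * indicator {x<..x + ?h} y"
  using chi_square_density_le[OF True] by simp
 next
  have "(\<integral>\<^sup>+y. ennreal (4 / sqrt (real k) * indicator {x<..x + ?h} y) \<partial>lborel) = ennreal (4 / sqrt (real k) * ?h)"
  using et by (intro nn_integral_const_interval) auto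
  then show "(\<integral>\<^sup>+y. ennreal (4 / sqrt (real k) * indicator {x<..x + ?h} y) \<partial>lborel) <= ennreal (4 * et)"
  using k by simp
 qed (use et in auto)
 moreover have "sqrt et >= 0" using et by simp
 ultimately show ?thesis by linarith
next
 case False
 then have k2: "k = 1 \<or> k = 2" using k by auto
 define h where "h = et * sqrt (real k)"
 have h: "h > 0" using et k by (simp add: h_def)
 \<comment> \<open>The majorant is \<open>y powr (- 1 / 2)\<close> on \<open>[0, h]\<close> plus the
   constant \<open>1 / sqrt h\<close> on the window; the two parts integrate to
   \<open>2 sqrt h\<close> and \<open>sqrt h\<close>.\<close>
 have "measure (chi2 k) {x<..x + h} <= 3 * sqrt h"
 proof (rule measure_chi2_le[OF k, where g = "%y. (if y : {0..h} then y powr (- 1 / 2) else 0) + 1 / sqrt h * indicator {x<..x + h} y"])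
  fix y :: real assume y: "y > 0" "y : {x<..x + h}"
  have "y powr (- 1 / 2) <= (if y : {0..h} then y powr (- 1 / 2) else 0) + 1 / sqrt h"
  proof (cases "y <= h")
  case True then show ?thesis using y h by simp
  next
  case False
  then have "sqrt h <= sqrt y" by simp
  moreover have "y powr (- 1 / 2) = 1 / sqrt y" by (rule powr_minus_half) (use y in simp)
  ultimately show ?thesis using h False by (simp add: frac_le)
  qed
  then show "chi_square_density (real k) y <= (if y : {0..h} then y powr (- 1 / 2) else 0) + 1 / sqrt h * indicator {x<..x + h} y"
  using chi_square_density_le_small[OF k2 y(1)] y(2) by simp
 next
  have hi: "((%y. if y : {0..h} then y powr (- 1 / 2) else 0) has_integral (2 * sqrt h)) UNIV"
  using has_integral_powr_from_0[of "- 1 / 2" h] h unfolding has_integral_restrict_UNIV by (simp add: powr_half_sqrt mult.commute)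
  have "(\<integral>\<^sup>+y. ennreal ((if y : {0..h} then y powr (- 1 / 2) else 0) + 1 / sqrt h * indicator {x<..x + h} y) \<partial>lborel)
  = (\<integral>\<^sup>+y. ennreal (if y : {0..h} then y powr (- 1 / 2) else 0) + ennreal (1 / sqrt h * indicator {x<..x + h} y) \<partial>lborel)"
  using h by (intro nn_integral_cong ennreal_plus) auto
  also have "... = (\<integral>\<^sup>+y. ennreal (if y : {0..h} then y powr (- 1 / 2) else 0) \<partial>lborel)
  + (\<integral>\<^sup>+y. ennreal (1 / sqrt h * indicator {x<..x + h} y) \<partial>lborel)"
  by (rule nn_integral_add) auto
  also have "(\<integral>\<^sup>+y. ennreal (if y : {0..h} then y powr (- 1 / 2) else 0) \<partial>lborel) = ennreal (2 * sqrt h)"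
  by (rule nn_integral_has_integral_lborel[OF _ _ hi]) auto
  also have "(\<integral>\<^sup>+y. ennreal (1 / sqrt h * indicator {x<..x + h} y) \<partial>lborel) = ennreal (1 / sqrt h * h)"
  using h by (intro nn_integral_const_interval) auto
  also have "1 / sqrt h * h = sqrt h" using h by (simp add: real_div_sqrt)
  finally show "(\<integral>\<^sup>+y. ennreal ((if y : {0..h} then y powr (- 1 / 2) else 0) + 1 / sqrt h * indicator {x<..x + h} y) \<partial>lborel) <= ennreal (3 * sqrt h)"
  using h by (simp add: ennreal_plus[symmetric] del: ennreal_plus)
 qed (use h in auto)
 \<comment> \<open>From \<open>sqrt k <= 2\<close> follows \<open>h <= 2 et\<close>, and
   \<open>25 / 9\<close> is a convenient square above 2; hence
   \<open>5 = 3 * (5 / 3)\<close>.\<close>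
 also have "3 * sqrt h <= 5 * sqrt et"
 proof -
  have "sqrt (real k) <= sqrt 4" using k2 by (intro real_sqrt_le_mono) auto
  then have "h <= et * 2" using et unfolding h_def by (intro mult_left_mono) auto
  then have "h <= et * (25 / 9)" using et by linarith
  then have "sqrt h <= sqrt (et * (25 / 9))" by simp
  also have "... = sqrt et * (5 / 3)"
  proof -
  have "sqrt (25 / 9) = 5 / 3" by (rule real_sqrt_unique) (simp_all add: power2_eq_square)
  then show ?thesis by (simp only: real_sqrt_mult)
  qed
  finally show ?thesis by simp
 qed
 finally show ?thesis using et by (simp add: h_def)
qed

section \<open>Kolmogorov distance to a chi-squared law: couplings and tails\<close>

definition ks_chi2 :: "'a measure => ('a => real) => nat => real" where
 "ks_chi2 M Y k = (SUP \<alpha>\<in>{0<..<1}. \<bar>measure M {om : space M. Y om > chi_square_upper_quantile (real k) \<alpha>} - \<alpha>\<bar>)"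

lemma (in prob_space) ks_chi2_bdd:
 "bdd_above ((%\<alpha>. \<bar>prob {om : space M. Y om > chi_square_upper_quantile (real k) \<alpha>} - \<alpha>\<bar>) ` {0<..<1})"
proof (rule bdd_aboveI2[where M = 1])
 fix \<alpha> :: real assume "\<alpha> : {0<..<1}"
 then show "\<bar>prob {om : space M. Y om > chi_square_upper_quantile (real k) \<alpha>} - \<alpha>\<bar> <= 1"
  using prob_le_1[of "{om : space M. Y om > chi_square_upper_quantile (real k) \<alpha>}"]
  measure_nonneg[of M "{om : space M. Y om > chi_square_upper_quantile (real k) \<alpha>}"]
  unfolding greaterThanLessThan_iff by (intro abs_leI) linarith+
qed

lemma (in prob_space) ks_chi2_nonneg: "ks_chi2 M Y k >= 0"
proof -
 have "\<bar>prob {om : space M. Y om > chi_square_upper_quantile (real k) (1 / 2)} - 1 / 2\<bar> <= ks_chi2 M Y k"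
  unfolding ks_chi2_def by (rule cSUP_upper[OF _ ks_chi2_bdd]) simp
 then show ?thesis by (rule order_trans[OF abs_ge_zero])
qed

text \<open>If \<open>Y\<close> and \<open>Q\<close> differ by less than \<open>h\<close>, their
  tail events differ only when \<open>Q\<close> falls into a window of length \<open>h\<close> next
  to the threshold. Anticoncentration bounds that probability for all thresholds at once.\<close>

lemma (in prob_space) ks_chi2_coupling:
 assumes [measurable]: "Y : borel_measurable M" "Q : borel_measurable M" and Q: "distr M borel Q = chi2 k" and k: "k > 0"
  and et: "et > 0"
 shows "ks_chi2 M Y k <= prob {om : space M. \<bar>Y om - Q om\<bar> >= et * sqrt (real k)} + (4 * et + 5 * sqrt et)"
 unfolding ks_chi2_def
proof (rule cSUP_least)
 fix \<alpha> :: real assume "\<alpha> : {0<..<1}"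
 then have \<alpha>: "0 < \<alpha>" "\<alpha> < 1" by auto
 let ?x = "chi_square_upper_quantile (real k) \<alpha>" and ?h = "et * sqrt (real k)"
 let ?E = "{om : space M. \<bar>Y om - Q om\<bar> >= ?h}"
 have law: "prob {om : space M. Q om : A} = measure (chi2 k) A" if [measurable]: "A : sets borel" for A
  unfolding Q[symmetric] by (subst measure_distr) (auto intro!: arg_cong[where f = prob])
 have three: "prob ((A \<union> B) \<union> E) <= prob A + prob B + prob E"
  if "A : events" "B : events" "E : events" for A B E
 proof -
  have "prob ((A \<union> B) \<union> E) <= prob (A \<union> B) + prob E" using that by (intro measure_Un_le) auto
  moreover have "prob (A \<union> B) <= prob A + prob B" using that by (intro measure_Un_le) auto
  ultimately show ?thesis by linarith
 qed
 have \<alpha>Q: "prob {om : space M. Q om > ?x} = \<alpha>"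
  using law[of "{?x<..}"] chi_square_upper_quantile[of "real k" \<alpha>] \<alpha> k by (simp add: chi2_eq_chi_square)
 have anti: "prob {om : space M. Q om : {z<..z + ?h}} <= 4 * et + 5 * sqrt et" for z
  unfolding law[OF greaterThanAtMost_borel] by (rule chi2_anticoncentration[OF k et])
 have "prob {om : space M. Y om > ?x} <= prob (({om : space M. Q om > ?x} \<union> {om : space M. Q om : {?x - ?h<..(?x - ?h) + ?h}}) \<union> ?E)"
  by (rule finite_measure_mono) auto
 also have "... <= prob {om : space M. Q om > ?x} + prob {om : space M. Q om : {?x - ?h<..(?x - ?h) + ?h}} + prob ?E"
  by (rule three) measurable
 also have "... <= \<alpha> + (4 * et + 5 * sqrt et) + prob ?E"
  by (rule add_mono[OF add_mono[OF eq_refl[OF \<alpha>Q] anti] order_refl])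
 finally have 1: "prob {om : space M. Y om > ?x} <= \<alpha> + (4 * et + 5 * sqrt et) + prob ?E" .
 have "\<alpha> <= prob (({om : space M. Y om > ?x} \<union> {om : space M. Q om : {?x<..?x + ?h}}) \<union> ?E)"
  by (rule order_trans[OF eq_refl[OF \<alpha>Q[symmetric]]], rule finite_measure_mono) auto
 also have "... <= prob {om : space M. Y om > ?x} + prob {om : space M. Q om : {?x<..?x + ?h}} + prob ?E"
  by (rule three) measurable
 also have "... <= prob {om : space M. Y om > ?x} + (4 * et + 5 * sqrt et) + prob ?E"
  by (rule add_mono[OF add_mono[OF order_refl anti] order_refl])
 finally have 2: "\<alpha> <= prob {om : space M. Y om > ?x} + (4 * et + 5 * sqrt et) + prob ?E" .
 show "\<bar>prob {om : space M. Y om > ?x} - \<alpha>\<bar> <= prob ?E + (4 * et + 5 * sqrt et)"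
  using 1 2 by (simp add: abs_le_iff)
qed simp

lemma chi2_tail_strict:
 assumes k: "k > 0" and x: "0 < x" "x < y"
 shows "measure (chi2 k) {y<..} < measure (chi2 k) {x<..}"
proof -
 interpret prob_space "chi2 k" by (rule prob_space_chi2)
 have "emeasure (chi2 k) {x<..y} ~= 0"
 proof
  assume "emeasure (chi2 k) {x<..y} = 0"
  then have "AE z in lborel. ennreal (chi_square_density (real k) z) * indicator {x<..y} z = 0"
  unfolding chi2_eq_chi_square[OF k] chi_square_def
  by (subst (asm) emeasure_density) (auto simp: nn_integral_0_iff_AE)
  then have "AE z in lborel. z \<notin> {x<..y}"
  proof eventually_elim
  case (elim z)
  show ?case
  proof
  assume z: "z : {x<..y}"
  with chi_square_density_pos[of "real k" z] k x elim show False by (auto simp: indicator_def)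
  qed
  qed
  then have "emeasure lborel {x<..y} = 0"
  by (subst AE_iff_measurable[symmetric, where P = "%z. z \<notin> {x<..y}"]) auto
  with x show False by simp
 qed
 then have "prob {x<..y} > 0" by (simp add: emeasure_eq_measure zero_less_measure_iff)
 moreover have "prob {x<..} = prob ({x<..y} \<union> {y<..})" using x by (intro arg_cong[where f = prob]) auto
 moreover have "... = prob {x<..y} + prob {y<..}" by (intro finite_measure_Union) auto
 ultimately show ?thesis by simp
qed

text \<open>The supremum runs over quantile levels only. A positive \<open>x\<close> is the quantile
  of its own tail probability, by strict monotonicity; for \<open>x <= 0\<close> the tail is 1 and
  is approached through small positive thresholds, where anticoncentration keeps the loss
  small.\<close>

lemma (in prob_space) ks_chi2_tail:
 assumes [measurable]: "Y : borel_measurable M" and k: "k > 0"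
 shows "\<bar>prob {om : space M. Y om > x} - measure (chi2 k) {x<..}\<bar> <= ks_chi2 M Y k"
proof -
 interpret C: prob_space "chi2 k" by (rule prob_space_chi2)
 have pos: "\<bar>prob {om : space M. Y om > x} - measure (chi2 k) {x<..}\<bar> <= ks_chi2 M Y k" if x: "x > 0" for x
 proof -
  define \<alpha> where "\<alpha> = measure (chi2 k) {x<..}"
  have "\<alpha> < measure (chi2 k) {x / 2<..}" unfolding \<alpha>_def using x by (intro chi2_tail_strict[OF k]) auto
  then have \<alpha>1: "\<alpha> < 1" using C.prob_le_1[of "{x / 2<..}"] by linarith
  have "measure (chi2 k) {2 * x<..} < \<alpha>" unfolding \<alpha>_def using x by (intro chi2_tail_strict[OF k]) auto
  then have \<alpha>0: "\<alpha> > 0" using measure_nonneg[of "chi2 k" "{2 * x<..}"] by linarith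
  let ?q = "chi_square_upper_quantile (real k) \<alpha>"
  have q: "measure (chi2 k) {?q<..} = \<alpha>"
  using chi_square_upper_quantile[of "real k" \<alpha>] \<alpha>0 \<alpha>1 k by (simp add: chi2_eq_chi_square)
  have "?q > 0"
  proof (rule ccontr)
  assume "\<not> ?q > 0"
  then have "measure (chi2 k) {x / 2<..} <= measure (chi2 k) {?q<..}" using x by (intro C.finite_measure_mono) auto
  with q \<open>\<alpha> < measure (chi2 k) {x / 2<..}\<close> show False by simp
  qed
  then have qx: "?q = x"
  using chi2_tail_strict[OF k, of ?q x] chi2_tail_strict[OF k x, of ?q] q \<alpha>_def[symmetric]
  by (metis less_irrefl linorder_less_linear)
  have "\<bar>prob {om : space M. Y om > ?q} - \<alpha>\<bar> <= ks_chi2 M Y k"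
  unfolding ks_chi2_def by (rule cSUP_upper[OF _ ks_chi2_bdd]) (use \<alpha>0 \<alpha>1 in simp)
  then show ?thesis unfolding qx by (simp only: \<alpha>_def)
 qed
 show ?thesis
 proof (cases "x > 0")
  case True then show ?thesis by (rule pos)
 next
  case False
  have "measure (chi2 k) {x<..} = 1"
  using AE_chi2_pos[OF k] False by (intro C.prob_eq_1[THEN iffD2]) (auto elim!: eventually_mono)
  moreover have "1 - ks_chi2 M Y k <= prob {om : space M. Y om > x}"
  proof (rule field_le_epsilon)
  fix e :: real assume e: "e > 0"
  \<comment> \<open>With \<open>et = r^2\<close> and \<open>r <= 1\<close> the quantity
    \<open>4 et + 5 sqrt et\<close> is at most \<open>9 r\<close>, hence at most
    \<open>e\<close>.\<close>
  define r where "r = min 1 (e / 9)"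
  have r: "0 < r" "r <= 1" "9 * r <= e" using e by (auto simp: r_def)
  define et where "et = r\<^sup>2"
  have et: "et > 0" using r by (simp add: et_def)
  have s: "sqrt et = r" using r by (simp add: et_def)
  have "et <= r" unfolding et_def using r by (simp add: power2_eq_square mult_left_le)
  then have small: "4 * et + 5 * sqrt et <= e" using s r by linarith
  let ?h = "et * sqrt (real k)"
  have h: "?h > 0" using et k by simp
  have "measure (chi2 k) {0<..} = 1"
  using AE_chi2_pos[OF k] by (intro C.prob_eq_1[THEN iffD2]) auto
  moreover have "measure (chi2 k) {0<..} = measure (chi2 k) ({0<..0 + ?h} \<union> {?h<..})"
  using h by (intro arg_cong[where f = "measure (chi2 k)"]) auto
  moreover have "... = measure (chi2 k) {0<..0 + ?h} + measure (chi2 k) {?h<..}"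
  by (intro C.finite_measure_Union) auto
  ultimately have "1 - e <= measure (chi2 k) {?h<..}"
  using chi2_anticoncentration[OF k et, of 0] small by linarith
  moreover have "prob {om : space M. Y om > ?h} <= prob {om : space M. Y om > x}"
  using h False by (intro finite_measure_mono) auto
  ultimately show "1 - ks_chi2 M Y k <= prob {om : space M. Y om > x} + e"
  using pos[OF h] by linarith
  qed
  ultimately show ?thesis
  using prob_le_1[of "{om : space M. Y om > x}"] ks_chi2_nonneg[of Y k] by (simp add: abs_le_iff)
 qed
qed

section \<open>Truncated means and the lower bound for the distance\<close>

definition clamp_at :: "real => real => real" where
 "clamp_at T u = min T (max (- T) u)"

lemma measurable_clamp_at [measurable]: "clamp_at T : borel_measurable borel"
 unfolding clamp_at_def[abs_def] by measurable

lemma clamp_at_bounds: "T > 0 ==> \<bar>clamp_at T u\<bar> <= T"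
 by (auto simp: clamp_at_def)

text \<open>Layer-cake formula: adding \<open>T\<close> makes the truncated variable nonnegative,
  and its mean becomes the integral of the tail over levels between \<open>- T\<close> and
  \<open>T\<close>.\<close>

lemma nn_integral_clamp:
 assumes M: "prob_space M" and [measurable]: "Y : borel_measurable M" and T: "T > 0"
 shows "(\<integral>\<^sup>+om. ennreal (clamp_at T (Y om - a) + T) \<partial>M)
  = (\<integral>\<^sup>+s. ennreal (measure M {om : space M. Y om > a + s}) * indicator {- T<..<T} s \<partial>lborel)"
proof -
 interpret prob_space M by fact
 interpret pair_sigma_finite M "lborel :: real measure" ..
 have "(\<integral>\<^sup>+s. ennreal (measure M {om : space M. Y om > a + s}) * indicator {- T<..<T} s \<partial>lborel)
  = (\<integral>\<^sup>+s. \<integral>\<^sup>+om. indicator {(s, om). Y om > a + s} (s, om) * indicator {- T<..<T} s \<partial>M \<partial>lborel)"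
 proof (rule nn_integral_cong)
  fix s :: real
  have "(\<integral>\<^sup>+om. indicator {(s, om). Y om > a + s} (s, om) * indicator {- T<..<T} s \<partial>M)
  = (\<integral>\<^sup>+om. indicator {om : space M. Y om > a + s} om * indicator {- T<..<T} s \<partial>M)"
  by (intro nn_integral_cong) (auto simp: indicator_def)
  also have "... = ennreal (measure M {om : space M. Y om > a + s}) * indicator {- T<..<T} s"
  by (subst nn_integral_multc) (auto simp: emeasure_eq_measure)
  finally show "ennreal (measure M {om : space M. Y om > a + s}) * indicator {- T<..<T} s
  = (\<integral>\<^sup>+om. indicator {(s, om). Y om > a + s} (s, om) * indicator {- T<..<T} s \<partial>M)" by simp
 qed
 also have "... = (\<integral>\<^sup>+om. \<integral>\<^sup>+s. indicator {(s, om). Y om > a + s} (s, om) * indicator {- T<..<T} s \<partial>lborel \<partial>M)"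
  by (rule Fubini') measurable
 also have "... = (\<integral>\<^sup>+om. ennreal (clamp_at T (Y om - a) + T) \<partial>M)"
 proof (rule nn_integral_cong)
  fix om
  have "(\<integral>\<^sup>+s. indicator {(s, om). Y om > a + s} (s, om) * indicator {- T<..<T} s \<partial>lborel)
  = (\<integral>\<^sup>+s. indicator {- T<..<clamp_at T (Y om - a)} s \<partial>lborel)"
  using T by (intro nn_integral_cong) (auto simp: indicator_def clamp_at_def)
  also have "... = ennreal (clamp_at T (Y om - a) + T)"
  using T by (simp add: clamp_at_def)
  finally show "(\<integral>\<^sup>+s. indicator {(s, om). Y om > a + s} (s, om) * indicator {- T<..<T} s \<partial>lborel)
  = ennreal (clamp_at T (Y om - a) + T)" .
 qed
 finally show ?thesis by simp
qed

text \<open>Tails within \<open>D\<close> of each other are integrated over a window of length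
  \<open>2 T\<close>. The one-sided form is applied in both directions.\<close>

lemma clamp_integral_le:
 assumes M: "prob_space M" "Y : borel_measurable M" and N: "prob_space N" "Q : borel_measurable N"
  and T: "T > 0" and D: "D >= 0"
  and le: "!!x. measure M {om : space M. Y om > x} <= measure N {om : space N. Q om > x} + D"
 shows "(\<integral>om. clamp_at T (Y om - a) \<partial>M) <= (\<integral>om. clamp_at T (Q om - a) \<partial>N) + 2 * T * D"
proof -
 have bnd: "\<bar>clamp_at T u\<bar> <= T" "clamp_at T u + T >= 0" for u using T by (auto simp: clamp_at_def)
 have int: "integrable M (%om. clamp_at T (Y om - a))" if "prob_space M" "Y : borel_measurable M" for M :: "'c measure" and Y
 proof -
  interpret prob_space M by fact
  note that(2)[measurable]
  show ?thesis by (rule integrable_const_bound[where B = T]) (auto simp: bnd)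
 qed
 have eq: "ennreal ((\<integral>om. clamp_at T (Y om - a) \<partial>M) + T) = (\<integral>\<^sup>+om. ennreal (clamp_at T (Y om - a) + T) \<partial>M)"
  if "prob_space M" "Y : borel_measurable M" for M :: "'c measure" and Y
 proof -
  interpret prob_space M by fact
  have "(\<integral>\<^sup>+om. ennreal (clamp_at T (Y om - a) + T) \<partial>M) = ennreal (\<integral>om. clamp_at T (Y om - a) + T \<partial>M)"
  using int[OF that] bnd by (intro nn_integral_eq_integral) auto
  then show ?thesis using int[OF that] by (simp add: prob_space)
 qed
 have eqN: "ennreal ((\<integral>om. clamp_at T (Y om - a) \<partial>M) + T) = (\<integral>\<^sup>+om. ennreal (clamp_at T (Y om - a) + T) \<partial>M)"
  if "prob_space M" "Y : borel_measurable M" for M :: "'d measure" and Y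
 proof -
  interpret prob_space M by fact
  note that(2)[measurable]
  have int: "integrable M (%om. clamp_at T (Y om - a))"
  by (rule integrable_const_bound[where B = T]) (auto simp: bnd)
  have "(\<integral>\<^sup>+om. ennreal (clamp_at T (Y om - a) + T) \<partial>M) = ennreal (\<integral>om. clamp_at T (Y om - a) + T \<partial>M)"
  using int bnd by (intro nn_integral_eq_integral) auto
  then show ?thesis using int by (simp add: prob_space)
 qed
 have nnN: "(\<integral>om. clamp_at T (Q om - a) \<partial>N) + T >= 0"
 proof -
  interpret prob_space N by fact
  have "(\<integral>om. clamp_at T (Q om - a) + T \<partial>N) >= 0" using bnd by (intro Bochner_Integration.integral_nonneg) auto
  moreover have "integrable N (%om. clamp_at T (Q om - a))"
  using N(2) by (intro integrable_const_bound[where B = T]) (auto simp: bnd)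
  ultimately show ?thesis by (simp add: prob_space)
 qed
 have "ennreal ((\<integral>om. clamp_at T (Y om - a) \<partial>M) + T)
  = (\<integral>\<^sup>+s. ennreal (measure M {om : space M. Y om > a + s}) * indicator {- T<..<T} s \<partial>lborel)"
  unfolding eq[OF M] by (rule nn_integral_clamp[OF M T])
 also have "... <= (\<integral>\<^sup>+s. ennreal (measure N {om : space N. Q om > a + s}) * indicator {- T<..<T} s + ennreal D * indicator {- T<..<T} s \<partial>lborel)"
  by (intro nn_integral_mono) (auto simp: indicator_def ennreal_plus[symmetric] D simp del: ennreal_plus intro!: ennreal_leI le)
 also have "... = (\<integral>\<^sup>+s. ennreal (measure N {om : space N. Q om > a + s}) * indicator {- T<..<T} s \<partial>lborel) + (\<integral>\<^sup>+s. ennreal D * indicator {- T<..<T} s \<partial>lborel)"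
 proof (rule nn_integral_add)
  interpret prob_space N by fact
  note N(2)[measurable]
  have "(%s. emeasure N {om : space N. (s, om) : {(s, om) : space (borel \<Otimes>\<^sub>M N). Q om > a + s}}) : borel_measurable borel"
  by measurable
  then show "(%s. ennreal (measure N {om : space N. Q om > a + s}) * indicator {- T<..<T} s) : borel_measurable lborel"
  by (simp add: emeasure_eq_measure space_pair_measure cong: conj_cong)
 qed auto
 also have "... = ennreal ((\<integral>om. clamp_at T (Q om - a) \<partial>N) + T) + ennreal (D * (2 * T))"
  unfolding eqN[OF N] nn_integral_clamp[OF N T, symmetric] using T D by (simp add: ennreal_mult nn_integral_cmult_indicator)
 also have "... = ennreal ((\<integral>om. clamp_at T (Q om - a) \<partial>N) + T + D * (2 * T))"
  by (rule ennreal_plus[symmetric]) (use nnN D T in simp_all)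
 finally have "ennreal ((\<integral>om. clamp_at T (Y om - a) \<partial>M) + T) <= ennreal ((\<integral>om. clamp_at T (Q om - a) \<partial>N) + T + D * (2 * T))" .
 moreover have "(\<integral>om. clamp_at T (Q om - a) \<partial>N) + T + D * (2 * T) >= 0"
 proof -
  have "D * (2 * T) >= 0" using D T by simp
  then show ?thesis using nnN by linarith
 qed
 ultimately have "(\<integral>om. clamp_at T (Y om - a) \<partial>M) + T <= (\<integral>om. clamp_at T (Q om - a) \<partial>N) + T + D * (2 * T)"
  by (simp only: ennreal_le_iff)
 then show ?thesis by (simp add: mult_ac)
qed

text \<open>Truncation changes \<open>u\<close> only where \<open>|u| > T\<close>, and there by at
  most \<open>|u| <= u^2 / T\<close>.\<close>

lemma (in prob_space) clamp_integral_close: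
 assumes [measurable]: "Y : borel_measurable M" and i: "integrable M (%om. (Y om - a)\<^sup>2)" and T: "T > 0"
 shows "\<bar>(\<integral>om. Y om - a \<partial>M) - (\<integral>om. clamp_at T (Y om - a) \<partial>M)\<bar> <= (\<integral>om. (Y om - a)\<^sup>2 \<partial>M) / T"
proof -
 have "integrable M (%om. Y om - a)"
  by (rule square_integrable_imp_integrable[OF _ i]) simp
 moreover have "integrable M (%om. clamp_at T (Y om - a))"
  by (intro integrable_const_bound[where B = T]) (auto simp: clamp_at_bounds[OF T])
 ultimately have c0: "\<bar>(\<integral>om. Y om - a \<partial>M) - (\<integral>om. clamp_at T (Y om - a) \<partial>M)\<bar> = \<bar>\<integral>om. (Y om - a) - clamp_at T (Y om - a) \<partial>M\<bar>"
  and d: "integrable M (%om. (Y om - a) - clamp_at T (Y om - a))" by simp_all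
 have "\<bar>\<integral>om. (Y om - a) - clamp_at T (Y om - a) \<partial>M\<bar> <= (\<integral>om. \<bar>(Y om - a) - clamp_at T (Y om - a)\<bar> \<partial>M)" by (rule integral_abs_bound)
 also have "... <= (\<integral>om. (Y om - a)\<^sup>2 / T \<partial>M)"
 proof (rule integral_mono)
  fix om
  define u where "u = Y om - a"
  have "\<bar>u - clamp_at T u\<bar> <= u\<^sup>2 / T"
  proof (cases "\<bar>u\<bar> <= T")
  case True then show ?thesis using T by (auto simp: clamp_at_def abs_le_iff)
  next
  case False
  then have "\<bar>u\<bar> * T <= \<bar>u\<bar> * \<bar>u\<bar>" by (intro mult_left_mono) auto
  then have "\<bar>u\<bar> <= u\<^sup>2 / T" using T by (simp add: field_simps power2_eq_square)
  moreover have "\<bar>u - clamp_at T u\<bar> <= \<bar>u\<bar>" using False T by (auto simp: clamp_at_def)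
  ultimately show ?thesis by linarith
  qed
  then show "\<bar>(Y om - a) - clamp_at T (Y om - a)\<bar> <= (Y om - a)\<^sup>2 / T" by (simp add: u_def)
 qed (use d i in auto)
 finally show ?thesis unfolding c0 by simp
qed

text \<open>Closeness in Kolmogorov distance forces the means to be close on the scale of the standard
  deviations: compare truncated means, and choose the truncation level optimally.\<close>

lemma (in prob_space) mean_shift_le_ks_chi2:
 assumes [measurable]: "Y : borel_measurable M" and k: "k > 0"
  and i: "integrable M Y" "integrable M (%om. (Y om - expectation Y)\<^sup>2)"
  and V: "expectation (%om. (Y om - expectation Y)\<^sup>2) <= V"
 shows "(expectation Y - real k)\<^sup>2 <= 8 * ks_chi2 M Y k * (V + 2 * real k + (expectation Y - real k)\<^sup>2)"
proof (cases "expectation Y = real k")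
 case True
 have "V >= 0" using V by (rule order_trans[rotated]) simp
 then show ?thesis using True ks_chi2_nonneg[of Y k] by simp
next
 case False
 define D where "D = ks_chi2 M Y k"
 define Dl where "Dl = expectation Y - real k"
 define W where "W = V + 2 * real k + Dl\<^sup>2"
 \<comment> \<open>The truncation error is at most \<open>W / T\<close>; at this level it equals
   half of \<open>|Dl|\<close> and is absorbed on the left-hand side.\<close>
 define T where "T = 2 * W / \<bar>Dl\<bar>"
 interpret C: prob_space "chi2 k" by (rule prob_space_chi2)
 have D: "D >= 0" unfolding D_def by (rule ks_chi2_nonneg)
 have Dl: "\<bar>Dl\<bar> > 0" using False by (simp add: Dl_def)
 have V0: "V >= 0" using V by (rule order_trans[rotated]) simp
 have W: "W > 0" unfolding W_def using V0 k by (simp add: add_nonneg_pos add_pos_nonneg)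
 have T: "T > 0" using W Dl by (simp add: T_def)
 have sq: "(%om. (Y om - real k)\<^sup>2) = (%om. (Y om - expectation Y)\<^sup>2 + 2 * Dl * (Y om - expectation Y) + Dl\<^sup>2)"
  by (auto simp: Dl_def power2_eq_square algebra_simps)
 have i2: "integrable M (%om. (Y om - real k)\<^sup>2)" unfolding sq using i by auto
 have "expectation (%om. (Y om - real k)\<^sup>2) = expectation (%om. (Y om - expectation Y)\<^sup>2) + Dl\<^sup>2"
  unfolding sq using i by (simp add: prob_space)
 then have e2: "expectation (%om. (Y om - real k)\<^sup>2) <= V + Dl\<^sup>2" using V by simp
 have e1: "expectation (%om. Y om - real k) = Dl" using i by (simp add: prob_space Dl_def)
 have Q: "integrable (chi2 k) (%x. (x - real k)\<^sup>2)" "(\<integral>x. (x - real k)\<^sup>2 \<partial>chi2 k) = 2 * real k"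
  using chi2_variance[OF k] by (auto simp: has_bochner_integral_iff)
 have Q1: "(\<integral>x. x - real k \<partial>chi2 k) = 0"
  using hbi_chi2_powers(1)[OF k] C.prob_space by (simp add: has_bochner_integral_iff)
 have tail: "\<bar>prob {om : space M. Y om > x} - measure (chi2 k) {y : space (chi2 k). y > x}\<bar> <= D" for x
  using ks_chi2_tail[OF _ k, of Y x] by (simp add: D_def greaterThan_def)
 have c1: "(\<integral>om. clamp_at T (Y om - real k) \<partial>M) <= (\<integral>x. clamp_at T (x - real k) \<partial>chi2 k) + 2 * T * D"
  by (rule clamp_integral_le[OF prob_space_axioms _ C.prob_space_axioms _ T D]) (use tail in \<open>auto simp: abs_le_iff algebra_simps\<close>)
 have c2: "(\<integral>x. clamp_at T (x - real k) \<partial>chi2 k) <= (\<integral>om. clamp_at T (Y om - real k) \<partial>M) + 2 * T * D"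
  by (rule clamp_integral_le[OF C.prob_space_axioms _ prob_space_axioms _ T D]) (use tail in \<open>auto simp: abs_le_iff algebra_simps\<close>)
 have "\<bar>Dl\<bar> <= 2 * T * D + (V + Dl\<^sup>2) / T + 2 * real k / T"
 proof -
  have "\<bar>Dl - (\<integral>om. clamp_at T (Y om - real k) \<partial>M)\<bar> <= (V + Dl\<^sup>2) / T"
  using clamp_integral_close[OF _ i2 T] divide_right_mono[OF e2, of T] T by (simp add: e1)
  moreover have "\<bar>0 - (\<integral>x. clamp_at T (x - real k) \<partial>chi2 k)\<bar> <= 2 * real k / T"
  using C.clamp_integral_close[of "%x. x", OF _ Q(1) T] by (simp add: Q Q1)
  ultimately show ?thesis using c1 c2 by linarith
 qed
 also have "... = 2 * T * D + W / T" by (simp add: W_def add_divide_distrib)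
 also have "W / T = \<bar>Dl\<bar> / 2" using W Dl by (simp add: T_def)
 also have "2 * T * D = 4 * W * D / \<bar>Dl\<bar>" by (simp add: T_def)
 finally have "\<bar>Dl\<bar> / 2 <= 4 * W * D / \<bar>Dl\<bar>" by simp
 then have "\<bar>Dl\<bar> * \<bar>Dl\<bar> <= 8 * W * D" using Dl by (simp add: field_simps)
 then show ?thesis by (simp add: D_def W_def Dl_def power2_eq_square mult_ac)
qed

section \<open>A calculus of second moment bounds\<close>

definition L2_le :: "'a measure => ('a => real) => real => bool" where
 "L2_le M Z v \<longleftrightarrow>
  Z : borel_measurable M & integrable M (%om. (Z om)\<^sup>2) & (\<integral>om. (Z om)\<^sup>2 \<partial>M) <= v"

lemma L2_leD:
 assumes "L2_le M Z v"
 shows "Z : borel_measurable M" "integrable M (%om. (Z om)\<^sup>2)" "(\<integral>om. (Z om)\<^sup>2 \<partial>M) <= v"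
 using assms by (auto simp: L2_le_def)

lemma L2_le_nonneg: "L2_le M Z v ==> v >= 0"
 by (rule order_trans[OF _ L2_leD(3)]) simp

lemma L2_le_mono: "L2_le M Z v ==> v <= v' ==> L2_le M Z v'"
 by (auto simp: L2_le_def)

lemma L2_le_dominated:
 assumes v: "L2_le M Z v" and [measurable]: "Z' : borel_measurable M"
  and le: "AE om in M. \<bar>Z' om\<bar> <= \<bar>Z om\<bar>"
 shows "L2_le M Z' v"
proof -
 have le2: "AE om in M. (Z' om)\<^sup>2 <= (Z om)\<^sup>2" using le by eventually_elim (rule abs_le_square_iff[THEN iffD1])
 have i: "integrable M (%om. (Z' om)\<^sup>2)"
  by (rule Bochner_Integration.integrable_bound[OF L2_leD(2)[OF v]]) (use le2 in auto)
 have "(\<integral>om. (Z' om)\<^sup>2 \<partial>M) <= (\<integral>om. (Z om)\<^sup>2 \<partial>M)"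
  by (rule integral_mono_AE[OF i L2_leD(2)[OF v] le2])
 with L2_leD(3)[OF v] i show ?thesis by (simp add: L2_le_def)
qed

lemma L2_le_cong_AE:
 assumes "L2_le M Z v" "Z' : borel_measurable M" "AE om in M. Z' om = Z om"
 shows "L2_le M Z' v"
 using assms by (intro L2_le_dominated[OF assms(1,2)]) (auto elim: eventually_mono)

lemma L2_le_scale:
 assumes "L2_le M Z v"
 shows "L2_le M (%om. c * Z om) (c\<^sup>2 * v)"
 using L2_leD[OF assms] by (auto simp: L2_le_def power_mult_distrib intro!: mult_left_mono)

lemma L2_le_add:
 assumes "L2_le M Z v" "L2_le M Z' v'"
 shows "L2_le M (%om. Z om + Z' om) (2 * v + 2 * v')"
proof -
 note D = L2_leD[OF assms(1)] L2_leD[OF assms(2)]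
 note [measurable] = D(1,4)
 have le: "(Z om + Z' om)\<^sup>2 <= 2 * (Z om)\<^sup>2 + 2 * (Z' om)\<^sup>2" for om
  using sum_squares_bound[of "Z om" "Z' om"] by (simp add: power2_sum)
 have b: "integrable M (%om. 2 * (Z om)\<^sup>2 + 2 * (Z' om)\<^sup>2)" using D by auto
 have i: "integrable M (%om. (Z om + Z' om)\<^sup>2)"
  by (rule Bochner_Integration.integrable_bound[OF b]) (use le in auto)
 have "(\<integral>om. (Z om + Z' om)\<^sup>2 \<partial>M) <= (\<integral>om. 2 * (Z om)\<^sup>2 + 2 * (Z' om)\<^sup>2 \<partial>M)" by (rule integral_mono[OF i b le])
 also have "... <= 2 * v + 2 * v'" using D by simp
 finally show ?thesis using i by (simp add: L2_le_def)
qed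

lemma L2_le_diff:
 assumes "L2_le M Z v" "L2_le M Z' v'"
 shows "L2_le M (%om. Z om - Z' om) (2 * v + 2 * v')"
 using L2_le_add[OF assms(1) L2_le_scale[OF assms(2), of "- 1"]] by simp

lemma (in prob_space) L2_le_const: "L2_le M (%_. c) (c\<^sup>2)"
 by (simp add: L2_le_def prob_space)

lemma (in finite_measure) L2_le_integrable: "L2_le M Z v ==> integrable M Z"
 by (rule square_integrable_imp_integrable) (auto simp: L2_le_def)

lemma hbi_law:
 assumes "X : borel_measurable M" "distr M borel X = L" "has_bochner_integral L f v" "f : borel_measurable borel"
 shows "has_bochner_integral M (%om. f (X om)) (v :: real)"
 using assms(3) unfolding assms(2)[symmetric] by (simp add: has_bochner_integral_iff integrable_distr_eq[OF assms(1,4)] integral_distr[OF assms(1,4)])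

lemma L2_le_law:
 assumes "X : borel_measurable M" "distr M borel X = L" "f : borel_measurable borel" "L2_le L f v"
 shows "L2_le M (%om. f (X om)) v"
proof -
 have "has_bochner_integral M (%om. (f (X om))\<^sup>2) (\<integral>x. (f x)\<^sup>2 \<partial>L)"
  using hbi_law[OF assms(1,2), of "%x. (f x)\<^sup>2"] L2_leD[OF assms(4)] assms(3)
  by (auto simp: has_bochner_integral_iff)
 with assms show ?thesis by (auto simp: L2_le_def has_bochner_integral_iff)
qed

lemma AE_law:
 assumes "X : borel_measurable M" "distr M borel X = L" "AE x in L. P x"
 shows "AE om in M. P (X om)"
 using assms by (intro AE_distrD[of X M borel P]) auto

lemma (in finite_measure) L2_le_tail:
 assumes "L2_le M Z v" and t: "t > 0"
 shows "measure M {om : space M. \<bar>Z om\<bar> >= t} <= v / t\<^sup>2"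
proof -
 note D = L2_leD[OF assms(1)]
 have "measure M {om : space M. (Z om)\<^sup>2 >= t\<^sup>2} <= (\<integral>om. (Z om)\<^sup>2 \<partial>M) / t\<^sup>2"
  by (rule integral_Markov_inequality_measure[where A = "{}"]) (use D t in auto)
 also have "... <= v / t\<^sup>2" using D t by (intro divide_right_mono) auto
 also have "{om : space M. (Z om)\<^sup>2 >= t\<^sup>2} = {om : space M. \<bar>Z om\<bar> >= t}"
  using t by (auto simp: abs_le_square_iff[symmetric])
 finally show ?thesis .
qed

text \<open>Centring and independence kill the cross terms, so the bounds add without the factor 2
  of \<open>L2_le_add\<close>. This is indispensable for sums over \<open>p\<close>
  coordinates.\<close>

lemma (in prob_space) L2_le_indep_sum:
 assumes I: "finite I" and ind: "indep_vars (%_. borel) X I"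
  and i: "!!i. i : I ==> L2_le M (X i) (v i)" and z: "!!i. i : I ==> expectation (X i) = 0"
 shows "L2_le M (%om. \<Sum>i\<in>I. X i om) (\<Sum>i\<in>I. v i)"
proof -
 have [measurable]: "X i : borel_measurable M" if "i : I" for i using L2_leD(1)[OF i[OF that]] .
 have cross: "has_bochner_integral M (%om. X j om * X l om) (if j = l then expectation (%om. (X j om)\<^sup>2) else 0)"
  if "j : I" "l : I" for j l
 proof (cases "j = l")
  case True
  then show ?thesis using L2_leD(2)[OF i[OF \<open>j \<in> I\<close>]] by (simp add: has_bochner_integral_iff power2_eq_square)
 next
  case False
  have ind2: "indep_vars (%_. borel) X {j, l}" by (rule indep_vars_subset[OF ind]) (use that in auto)
  have int: "integrable M (X m)" if "m : {j, l}" for m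
  using that \<open>j \<in> I\<close> \<open>l \<in> I\<close> L2_le_integrable i by auto
  have "integrable M (%om. \<Prod>m\<in>{j, l}. X m om)" by (rule indep_vars_integrable[OF _ ind2 int]) auto
  moreover have "expectation (%om. \<Prod>m\<in>{j, l}. X m om) = (\<Prod>m\<in>{j, l}. expectation (X m))"
  by (rule indep_vars_lebesgue_integral[OF _ ind2 int]) auto
  ultimately show ?thesis using False z that by (simp add: has_bochner_integral_iff)
 qed
 have sq: "(%om. (\<Sum>i\<in>I. X i om)\<^sup>2) = (%om. \<Sum>j\<in>I. \<Sum>l\<in>I. X j om * X l om)"
  by (simp add: power2_eq_square sum_product)
 have "has_bochner_integral M (%om. (\<Sum>i\<in>I. X i om)\<^sup>2) (\<Sum>j\<in>I. \<Sum>l\<in>I. if j = l then expectation (%om. (X j om)\<^sup>2) else 0)"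
  unfolding sq by (intro has_bochner_integral_sum cross)
 moreover have "(\<Sum>j\<in>I. \<Sum>l\<in>I. if j = l then expectation (%om. (X j om)\<^sup>2) else 0) = (\<Sum>j\<in>I. expectation (%om. (X j om)\<^sup>2))"
  using I by simp
 moreover have "... <= (\<Sum>i\<in>I. v i)" by (intro sum_mono L2_leD(3) i)
 ultimately show ?thesis by (auto simp: L2_le_def has_bochner_integral_iff)
qed

text \<open>The errors differ in kind: \<open>A\<close> will be a quadratic remainder with only a
  first moment at hand and is treated by Markov's inequality, \<open>B\<close> by Chebyshev's. Each
  is allowed half of the window.\<close>

lemma (in prob_space) ks_chi2_le_two_errors:
 assumes [measurable]: "Y : borel_measurable M" "Q : borel_measurable M" and Q: "distr M borel Q = chi2 k" and k: "k > 0"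
  and A: "integrable M A" and B: "L2_le M B v" and et: "et > 0"
  and le: "AE om in M. \<bar>Y om - Q om\<bar> <= \<bar>A om\<bar> + \<bar>B om\<bar>"
 shows "ks_chi2 M Y k <= 2 * expectation (%om. \<bar>A om\<bar>) / (et * sqrt (real k)) + 4 * v / (et\<^sup>2 * real k) + (4 * et + 5 * sqrt et)"
proof -
 note [measurable] = borel_measurable_integrable[OF A] L2_leD(1)[OF B]
 let ?h = "et * sqrt (real k)"
 have h: "?h / 2 > 0" using et k by simp
 let ?A = "{om : space M. \<bar>A om\<bar> >= ?h / 2}" and ?B = "{om : space M. \<bar>B om\<bar> >= ?h / 2}"
 have "prob {om : space M. \<bar>Y om - Q om\<bar> >= ?h} <= prob (?A \<union> ?B)"
  by (rule finite_measure_mono_AE) (use le in \<open>auto elim!: eventually_mono\<close>)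
 also have "... <= prob ?A + prob ?B" by (intro measure_Un_le) measurable
 also have "prob ?A <= expectation (%om. \<bar>A om\<bar>) / (?h / 2)"
  by (rule integral_Markov_inequality_measure[where A = "{}"]) (use A h in auto)
 also have "prob ?B <= v / (?h / 2)\<^sup>2" by (rule L2_le_tail[OF B h])
 also have "v / (?h / 2)\<^sup>2 = 4 * v / (et\<^sup>2 * real k)" by (simp add: power_mult_distrib power_divide)
 also have "expectation (%om. \<bar>A om\<bar>) / (?h / 2) = 2 * expectation (%om. \<bar>A om\<bar>) / ?h" by simp
 finally have "prob {om : space M. \<bar>Y om - Q om\<bar> >= ?h} <= 2 * expectation (%om. \<bar>A om\<bar>) / ?h + 4 * v / (et\<^sup>2 * real k)"
  by simp
 then show ?thesis using ks_chi2_coupling[OF assms(1-4) et] by linarith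
qed

lemma (in prob_space) ks_chi2_le_second_moment:
 assumes "Y : borel_measurable M" "Q : borel_measurable M" and Q: "distr M borel Q = chi2 k" and k: "k > 0"
  and B: "L2_le M (%om. Y om - Q om) v" and et: "et > 0"
 shows "ks_chi2 M Y k <= v / (et\<^sup>2 * real k) + (4 * et + 5 * sqrt et)"
proof -
 have "prob {om : space M. \<bar>Y om - Q om\<bar> >= et * sqrt (real k)} <= v / (et * sqrt (real k))\<^sup>2"
  by (rule L2_le_tail[OF B]) (use et k in simp)
 then show ?thesis using ks_chi2_coupling[OF assms(1-4) et] by (simp add: power_mult_distrib)
qed

text \<open>The variance is the smallest second moment about any point, so a bound about a
  convenient centre \<open>a\<close> suffices and the exact mean need not be known.\<close>

lemma (in prob_space) mean_shift_le_ks_chi2_second_moment: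
 assumes k: "k > 0" and B: "L2_le M (%om. Y om - a) V"
 shows "integrable M Y" "(expectation Y - real k)\<^sup>2 <= 8 * ks_chi2 M Y k * (V + 2 * real k + (expectation Y - real k)\<^sup>2)"
proof -
 note D = L2_leD[OF B]
 have Ym [measurable]: "Y : borel_measurable M" using borel_measurable_add[OF D(1), of "%_. a"] by simp
 have "integrable M (%om. (Y om - a) + a)" using L2_le_integrable[OF B] by (intro Bochner_Integration.integrable_add) auto
 then show Yi: "integrable M Y" by simp
 have sq: "(%om. (Y om - expectation Y)\<^sup>2) = (%om. (Y om - a)\<^sup>2 - 2 * (expectation Y - a) * (Y om - a) + (expectation Y - a)\<^sup>2)"
  by (auto simp: power2_eq_square algebra_simps)
 have i: "integrable M (%om. (Y om - expectation Y)\<^sup>2)" unfolding sq using Yi D(2) by auto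
 have "expectation (%om. (Y om - expectation Y)\<^sup>2) = expectation (%om. (Y om - a)\<^sup>2) - (expectation Y - a)\<^sup>2"
  unfolding sq using Yi D(2) by (simp add: prob_space power2_eq_square)
 also have "... <= V" using D(3) zero_le_power2[of "expectation Y - a"] by linarith
 finally show "(expectation Y - real k)\<^sup>2 <= 8 * ks_chi2 M Y k * (V + 2 * real k + (expectation Y - real k)\<^sup>2)"
  by (rule mean_shift_le_ks_chi2[OF Ym k Yi i])
qed

lemma ks_chi2_distr:
 assumes [measurable]: "f : measurable M N" "Y : borel_measurable N"
 shows "ks_chi2 (distr M N f) Y k = ks_chi2 M (%om. Y (f om)) k"
proof -
 have "measure (distr M N f) {om : space (distr M N f). Y om > x} = measure M {om : space M. Y (f om) > x}" for x
  by (subst measure_distr) (auto intro!: arg_cong[where f = "measure M"] dest: measurable_space[OF assms(1)])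
 then show ?thesis unfolding ks_chi2_def by simp
qed

section \<open>Laws and independence of the coordinates of the reference space\<close>

lemma distr_ref_fst: "distr (ref_space T n p) borel fst = chi2 (ref_df T p)"
proof -
 interpret B: prob_space "bdiag p (n - 1 - p)" by (rule prob_space_bdiag)
 have "distr (ref_space T n p) borel fst = distr (ref_space T n p) (chi2 (ref_df T p)) fst"
  by (rule distr_cong) auto
 then show ?thesis unfolding ref_space_def by (simp only: B.distr_pair_fst)
qed

lemma distr_ref_snd:
 "distr (ref_space T n p) (PiM {..<p} (%_. borel)) snd = bdiag p (n - 1 - p)"
proof (rule measure_eqI)
 interpret A: prob_space "chi2 (ref_df T p)" by (rule prob_space_chi2)
 fix X assume "X : sets (distr (ref_space T n p) (PiM {..<p} (%_. borel)) snd)"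
 then have [measurable]: "X : sets (PiM {..<p} (%_. borel))" by simp
 have "emeasure (distr (ref_space T n p) (PiM {..<p} (%_. borel)) snd) X
  = (\<integral>\<^sup>+y. indicator X (snd y) \<partial>ref_space T n p)"
  by (subst nn_integral_indicator[symmetric], simp, subst nn_integral_distr) auto
 also have "... = (\<integral>\<^sup>+w. \<integral>\<^sup>+x. indicator X x \<partial>bdiag p (n - 1 - p) \<partial>chi2 (ref_df T p))"
 proof -
  interpret B: prob_space "bdiag p (n - 1 - p)" by (rule prob_space_bdiag)
  show ?thesis unfolding ref_space_def by (subst B.nn_integral_fst[symmetric]) auto
 qed
 also have "... = emeasure (bdiag p (n - 1 - p)) X" using A.emeasure_space_1 by simp
 finally show "emeasure (distr (ref_space T n p) (PiM {..<p} (%_. borel)) snd) X = emeasure (bdiag p (n - 1 - p)) X" .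
qed simp

lemma measurable_ref_coord [measurable]: "(%y. snd y j) : borel_measurable (ref_space T n p)"
proof -
 have "(%y. snd y j) : borel_measurable (borel \<Otimes>\<^sub>M PiM {..<p} (%_. borel :: real measure))"
  by (rule measurable_compose[OF measurable_snd measurable_component_any])
 then show ?thesis by (simp add: measurable_cong_sets[OF sets_ref_space refl])
qed

lemma distr_ref_coord:
 assumes "j < p" "p < n"
 shows "distr (ref_space T n p) borel (%y. snd y j) = chi2 (n - p + j)"
proof -
 have "distr (ref_space T n p) borel (%y. snd y j)
  = distr (distr (ref_space T n p) (PiM {..<p} (%_. borel)) snd) borel (%x. x j)"
  by (subst distr_distr) (auto simp: comp_def measurable_component_any)
 also have "... = distr (bdiag p (n - 1 - p)) (chi2 (n - 1 - p + 1 + j)) (%x. x j)"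
  unfolding distr_ref_snd by (rule distr_cong) auto
 also have "... = chi2 (n - 1 - p + 1 + j)"
  unfolding bdiag_def by (rule distr_PiM_component) (use assms in \<open>auto intro: prob_space_chi2\<close>)
 also have "n - 1 - p + 1 + j = n - p + j" using assms by simp
 finally show ?thesis .
qed

lemma indep_ref_coords:
 assumes p: "p > 0" "p < n"
 shows "prob_space.indep_vars (ref_space T n p) (%_. borel) (%j y. snd y j) {..<p}"
proof -
 interpret prob_space "ref_space T n p" by (rule prob_space_reference)
 have "distr (ref_space T n p) (PiM {..<p} (%_. borel)) (%y. \<lambda>j\<in>{..<p}. snd y j)
  = distr (ref_space T n p) (PiM {..<p} (%_. borel)) snd"
 proof (rule distr_cong)
  fix y assume "y : space (ref_space T n p)"
  then have "snd y : space (PiM {..<p} (%_. borel :: real measure))"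
  by (auto simp: sets_eq_imp_space_eq[OF sets_ref_space] space_pair_measure)
  then show "(\<lambda>j\<in>{..<p}. snd y j) = snd y" by (auto simp: space_PiM PiE_iff extensional_def restrict_def)
 qed auto
 also have "... = PiM {..<p} (%j. distr (ref_space T n p) borel (%y. snd y j))"
  unfolding distr_ref_snd bdiag_def
  by (rule PiM_cong) (use p distr_ref_coord in \<open>auto intro!: arg_cong[where f = chi2]\<close>)
 finally show ?thesis using p by (subst indep_vars_iff_distr_eq_PiM') auto
qed

lemma nn_integral_bdiag_sum:
 assumes [measurable]: "f : borel_measurable borel"
 shows "(\<integral>\<^sup>+x. f (SUM j<p. x j) \<partial>bdiag p q) = (\<integral>\<^sup>+s. f s \<partial>chi2 (SUM j<p. q + 1 + j))"
 using assms
proof (induction p arbitrary: f)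
 case 0
 interpret B: prob_space "bdiag 0 q" by (rule prob_space_bdiag)
 show ?case using 0 B.emeasure_space_1 by (simp add: chi2_def nn_integral_return)
next
 case (Suc p)
 note [measurable] = Suc.prems
 have [measurable]: "(%x. x j) : borel_measurable (PiM {..<p} (%_. borel :: real measure))" for j p by (rule measurable_component_any)
 interpret C: prob_space "chi2 (q + 1 + p)" by (rule prob_space_chi2)
 have m: "(%s. \<integral>\<^sup>+c. f (s + c) \<partial>chi2 (q + 1 + p)) : borel_measurable borel" by measurable
 have upd: "(SUM j<Suc p. (x(p := c)) j) = (SUM j<p. x j) + c" for x :: "nat => real" and c
 proof -
  have "(SUM j<p. (x(p := c)) j) = (SUM j<p. x j)" by (rule sum.cong) auto
  then show ?thesis by simp
 qed
 have "(\<integral>\<^sup>+x. f (SUM j<Suc p. x j) \<partial>bdiag (Suc p) q)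
  = (\<integral>\<^sup>+x. \<integral>\<^sup>+c. f (SUM j<Suc p. (x(p := c)) j) \<partial>chi2 (q + 1 + p) \<partial>bdiag p q)"
  by (rule nn_integral_bdiag_Suc) measurable
 also have "... = (\<integral>\<^sup>+x. (%s. \<integral>\<^sup>+c. f (s + c) \<partial>chi2 (q + 1 + p)) (SUM j<p. x j) \<partial>bdiag p q)"
  unfolding upd ..
 also have "... = (\<integral>\<^sup>+s. \<integral>\<^sup>+c. f (s + c) \<partial>chi2 (q + 1 + p) \<partial>chi2 (SUM j<p. q + 1 + j))" by (rule Suc.IH[OF m])
 also have "... = (\<integral>\<^sup>+s. f s \<partial>chi2 ((SUM j<p. q + 1 + j) + (q + 1 + p)))" by (rule nn_integral_chi2_add) fact
 finally show ?case by (simp add: add.commute)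
qed

text \<open>Additivity of chi-squared laws, coordinate by coordinate. For sphericity the sum is the
  trace of the scatter matrix, whose logarithm is part of the statistic.\<close>

lemma distr_ref_sum:
 "distr (ref_space T n p) borel (%y. (SUM j<p. snd y j) + fst y)
  = chi2 ((SUM j<p. n - 1 - p + 1 + j) + ref_df T p)"
proof (rule measure_eqI)
 interpret B: prob_space "bdiag p (n - 1 - p)" by (rule prob_space_bdiag)
 fix A :: "real set" assume "A : sets (distr (ref_space T n p) borel (%y. (SUM j<p. snd y j) + fst y))"
 then have [measurable]: "A : sets borel" by simp
 have [measurable]: "(%x. x j) : borel_measurable (PiM {..<p} (%_. borel :: real measure))" for j p by (rule measurable_component_any)
 have [measurable]: "(%y. snd y j) : borel_measurable (borel \<Otimes>\<^sub>M PiM {..<p} (%_. borel :: real measure))" for j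
  by (rule measurable_compose[OF measurable_snd measurable_component_any])
 have "emeasure (distr (ref_space T n p) borel (%y. (SUM j<p. snd y j) + fst y)) A
  = (\<integral>\<^sup>+y. indicator A ((SUM j<p. snd y j) + fst y) \<partial>ref_space T n p)"
  by (subst nn_integral_indicator[symmetric], simp, subst nn_integral_distr) auto
 also have "... = (\<integral>\<^sup>+w. \<integral>\<^sup>+x. indicator A ((SUM j<p. x j) + w) \<partial>bdiag p (n - 1 - p) \<partial>chi2 (ref_df T p))"
  unfolding ref_space_def by (subst B.nn_integral_fst[symmetric]) auto
 also have "... = (\<integral>\<^sup>+w. \<integral>\<^sup>+s. indicator A (w + s) \<partial>chi2 (SUM j<p. n - 1 - p + 1 + j) \<partial>chi2 (ref_df T p))"
  by (intro nn_integral_cong, subst nn_integral_bdiag_sum[of "%s. indicator A (s + w)" for w]) (auto simp: add.commute)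
 also have "... = (\<integral>\<^sup>+s. indicator A s \<partial>chi2 (ref_df T p + (SUM j<p. n - 1 - p + 1 + j)))"
  by (rule nn_integral_chi2_add) simp
 finally show "emeasure (distr (ref_space T n p) borel (%y. (SUM j<p. snd y j) + fst y)) A
  = emeasure (chi2 ((SUM j<p. n - 1 - p + 1 + j) + ref_df T p)) A" by (simp add: add.commute)
qed simp

lemma indep_ref_fst_coord:
 assumes p: "0 < p" "p < n"
 shows "prob_space.indep_var (ref_space T n p) borel fst borel (%y. snd y 0)"
proof -
 interpret prob_space "ref_space T n p" by (rule prob_space_reference)
 interpret A: prob_space "chi2 (ref_df T p)" by (rule prob_space_chi2)
 interpret B: prob_space "bdiag p (n - 1 - p)" by (rule prob_space_bdiag)
 have c: "(%x. x 0) : borel_measurable (PiM {..<p} (%_. borel :: real measure))" by (rule measurable_component_any)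
 have f: "fst : borel_measurable (ref_space T n p)" by measurable
 have c': "(%x. x 0) : borel_measurable (bdiag p (n - 1 - p))"
  using c by (simp add: measurable_cong_sets[OF sets_bdiag refl])
 have "sigma_finite_measure (distr (bdiag p (n - 1 - p)) borel (%x. x 0))"
  by (intro prob_space_imp_sigma_finite B.prob_space_distr c')
 then have "distr (chi2 (ref_df T p)) borel (%w. w) \<Otimes>\<^sub>M distr (bdiag p (n - 1 - p)) borel (%x. x 0)
  = distr (chi2 (ref_df T p) \<Otimes>\<^sub>M bdiag p (n - 1 - p)) (borel \<Otimes>\<^sub>M borel) (%(w, x). (w, x 0))"
  by (intro pair_measure_distr c') auto
 moreover have "distr (chi2 (ref_df T p)) borel (%w. w) = distr (ref_space T n p) borel fst"
  unfolding distr_ref_fst by (rule distr_id2) simp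
 moreover have "distr (bdiag p (n - 1 - p)) borel (%x. x 0) = distr (ref_space T n p) borel (%y. snd y 0)"
  unfolding distr_ref_snd[of T, symmetric] by (subst distr_distr) (auto simp: comp_def c)
 ultimately have "distr (ref_space T n p) borel fst \<Otimes>\<^sub>M distr (ref_space T n p) borel (%y. snd y 0)
  = distr (ref_space T n p) (borel \<Otimes>\<^sub>M borel) (%y. (fst y, snd y 0))"
  by (simp add: ref_space_def case_prod_unfold)
 then show ?thesis using f by (subst indep_var_distribution_eq) auto
qed

lemma (in prob_space) L2_le_indep_mult:
 assumes ind: "indep_var borel X borel Z" and [measurable]: "f : borel_measurable borel" "g : borel_measurable borel"
  and f: "L2_le M (%om. f (X om)) u" and g: "L2_le M (%om. g (Z om)) v"
 shows "L2_le M (%om. f (X om) * g (Z om)) (u * v)"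
proof -
 note D = L2_leD[OF f] L2_leD[OF g]
 have i: "indep_var borel ((%x. (f x)\<^sup>2) \<circ> X) borel ((%x. (g x)\<^sup>2) \<circ> Z)"
  by (rule indep_var_compose[OF ind]) measurable
 have "integrable M (%om. (f (X om) * g (Z om))\<^sup>2)"
  using indep_var_integrable[OF i] D by (simp add: comp_def power_mult_distrib)
 moreover have "expectation (%om. (f (X om) * g (Z om))\<^sup>2) = expectation (%om. (f (X om))\<^sup>2) * expectation (%om. (g (Z om))\<^sup>2)"
  using indep_var_lebesgue_integral[OF i] D by (simp add: comp_def power_mult_distrib)
 moreover have "... <= u * v" using D L2_le_nonneg[OF f] by (intro mult_mono) auto
 ultimately show ?thesis using D by (auto simp: L2_le_def)
qed

text \<open>The abstract necessity argument. \<open>D\<close> is the distance, \<open>s\<close> the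
  squared scale, \<open>Dl\<close> the shift of the mean and \<open>u\<close> its order in units of
  the scale. While \<open>u >= dl\<close>, the lower bound for \<open>Dl\<close> forces
  \<open>D\<close> above a positive constant. That lower bound is demanded only for
  \<open>u >= dl\<close> because additive errors swamp smaller shifts, and the factor
  \<open>1 + u^2\<close> leaves room for the larger variance when \<open>p\<close> is close to
  \<open>n\<close>.\<close>

lemma tendsto_zero_of_small_distance:
 fixes D Dl B s u :: "nat \<Rightarrow> real"
 assumes D: "D \<longlonglongrightarrow> 0" and c: "c > 0" and C: "C > 0"
  and shift: "\<forall>\<^sub>F n in sequentially. (Dl n)\<^sup>2 \<le> 8 * D n * (B n + (Dl n)\<^sup>2)"
  and B: "\<forall>\<^sub>F n in sequentially. B n \<le> C * s n * (1 + (u n)\<^sup>2)"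
  and s: "\<forall>\<^sub>F n in sequentially. s n > 0" and u: "\<forall>\<^sub>F n in sequentially. u n \<ge> 0"
  and D0: "\<forall>\<^sub>F n in sequentially. D n \<ge> 0"
  and lower: "\<And>dl. dl > 0 \<Longrightarrow> \<forall>\<^sub>F n in sequentially. u n \<ge> dl \<longrightarrow> Dl n \<ge> c * sqrt (s n) * u n"
 shows "u ~~> 0"
proof (rule LIMSEQ_I)
 fix dl :: real assume dl: "dl > 0"
 \<comment> \<open>For \<open>u >= dl\<close> one has \<open>1 + u^2 <= u^2 (1 + 1 / dl^2)\<close>,
   so the term \<open>16 D B\<close> is at most \<open>D L s u^2\<close>.\<close>
 define L where "L = 16 * C * (1 + 1 / dl\<^sup>2)"
 have L: "L > 0" unfolding L_def using C dl by (intro mult_pos_pos add_pos_pos) auto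
 have "EV n. D n < 1 / 16" "EV n. D n < c\<^sup>2 / L"
  by (rule order_tendstoD(2)[OF D], use c L in simp)+
 then have "EV n. u n < dl & u n >= 0"
  using shift B s u D0 lower[OF dl]
 proof eventually_elim
  case (elim n)
  have "u n < dl"
  proof (rule ccontr)
  assume "\<not> u n < dl"
  then have ud: "u n >= dl" by simp
  then have low: "Dl n >= c * sqrt (s n) * u n" and u0: "u n > 0" using elim dl by auto
  \<comment> \<open>A distance below \<open>1 / 16\<close> lets the term with \<open>Dl\<close> on
    the right be absorbed.\<close>
  have "8 * D n * (Dl n)\<^sup>2 <= 1 / 2 * (Dl n)\<^sup>2" using elim(1) by (intro mult_right_mono) auto
  then have "(Dl n)\<^sup>2 <= 16 * D n * B n" using elim(3) by (simp add: distrib_left)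
  also have "... <= 16 * D n * (C * s n * (1 + (u n)\<^sup>2))" using elim by (intro mult_left_mono) auto
  finally have up: "(Dl n)\<^sup>2 <= 16 * D n * (C * s n * (1 + (u n)\<^sup>2))" .
  have "(c * sqrt (s n) * u n)\<^sup>2 <= (Dl n)\<^sup>2" using low c elim u0 by (intro power_mono) auto
  then have low2: "c\<^sup>2 * s n * (u n)\<^sup>2 <= (Dl n)\<^sup>2" using elim by (simp add: power_mult_distrib)
  have "dl\<^sup>2 <= (u n)\<^sup>2" using ud dl by (intro power_mono) auto
  then have "1 + (u n)\<^sup>2 <= (u n)\<^sup>2 * (1 + 1 / dl\<^sup>2)" using dl by (simp add: field_simps)
  then have "16 * D n * (C * s n * (1 + (u n)\<^sup>2)) <= 16 * D n * (C * s n * ((u n)\<^sup>2 * (1 + 1 / dl\<^sup>2)))"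
  using elim C by (intro mult_left_mono) auto
  also have "... = D n * L * (s n * (u n)\<^sup>2)" by (simp add: L_def)
  finally have "c\<^sup>2 * (s n * (u n)\<^sup>2) <= D n * L * (s n * (u n)\<^sup>2)" using up low2 by simp
  then have "c\<^sup>2 <= D n * L" using elim u0 by simp
  moreover have "D n * L < c\<^sup>2" using elim(2) L by (simp add: pos_less_divide_eq)
  ultimately show False by simp
  qed
  with elim show ?case by simp
 qed
 then have "\<forall>\<^sub>F n in sequentially. norm (u n - 0) < dl" by eventually_elim simp
 then show "\<exists>no. \<forall>n\<ge>no. norm (u n - 0) < dl" by (simp only: eventually_sequentially)
qed

text \<open>The window size is fixed first, as a square \<open>r^2\<close> with
  \<open>9 r <= e / 2\<close>; only then does \<open>n\<close> grow.\<close>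

lemma tendsto_zero_of_coupling_bounds:
 fixes D a :: "nat \<Rightarrow> real"
 assumes a: "a \<longlonglongrightarrow> 0" and D0: "\<forall>\<^sub>F n in sequentially. D n \<ge> 0"
  and le: "\<And>et. 0 < et \<Longrightarrow> et \<le> 1 \<Longrightarrow> \<forall>\<^sub>F n in sequentially. D n \<le> a n / et\<^sup>2 + (4 * et + 5 * sqrt et)"
 shows "D \<longlonglongrightarrow> 0"
proof (rule LIMSEQ_I)
 fix e :: real assume e: "e > 0"
 define r where "r = min 1 (e / 18)"
 have r: "0 < r" "r <= 1" "9 * r <= e / 2" using e by (auto simp: r_def)
 have sm: "4 * r\<^sup>2 + 5 * sqrt (r\<^sup>2) <= e / 2"
  using r mult_left_le[of r r] real_sqrt_abs[of r] unfolding power2_eq_square by linarith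
 have r2: "0 < r\<^sup>2" "r\<^sup>2 <= 1" using r by (auto simp: power_le_one)
 have "(%n. a n / (r\<^sup>2)\<^sup>2) ~~> 0 / (r\<^sup>2)\<^sup>2" by (intro tendsto_divide a tendsto_const) (use r in auto)
 then have "EV n. a n / (r\<^sup>2)\<^sup>2 < e / 2" using e by (intro order_tendstoD(2)[of _ 0]) auto
 then have "EV n. norm (D n - 0) < e"
  using D0 le[OF r2]
 proof eventually_elim
  case (elim n)
  then have "D n < e" using sm by linarith
  with elim show ?case by simp
 qed
 then show "\<exists>no. \<forall>n\<ge>no. norm (D n - 0) < e" by (auto simp: eventually_sequentially)
qed

lemma tendsto_zero_power_iff:
 fixes q :: "nat \<Rightarrow> real"
 assumes m: "m > 0" and q: "\<forall>\<^sub>F n in sequentially. q n \<ge> 0"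
 shows "(\<lambda>n. q n ^ m) \<longlonglongrightarrow> 0 \<longleftrightarrow> q \<longlonglongrightarrow> 0"
proof
 assume "(%n. q n ^ m) ~~> 0"
 then have "(%n. root m (q n ^ m)) ~~> root m 0" by (intro tendsto_real_root)
 then show "q ~~> 0"
  unfolding real_root_zero
  by (rule Lim_transform_eventually) (use m q in \<open>auto elim!: eventually_mono simp: real_root_power_cancel\<close>)
next
 assume "q ~~> 0"
 then have "(%n. q n ^ m) ~~> 0 ^ m" by (intro tendsto_power)
 then show "(%n. q n ^ m) ~~> 0" using m by (simp add: zero_power)
qed

text \<open>Fourth order is needed because Bartlett's factor cancels the quadratic contribution and
  the cubic one has to be kept exactly. The derivatives of the differences are
  \<open>x^4 / (1 - x)\<close> and \<open>x^3 (1 - 2 x) / (1 - x)\<close>; the sign of the latter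
  explains the restriction to \<open>y <= 1 / 2\<close>.\<close>

lemma neg_ln_one_minus_bounds:
 fixes y :: real
 assumes y: "0 <= y" "y < 1"
 shows "y + y\<^sup>2 / 2 + y ^ 3 / 3 + y ^ 4 / 4 <= - ln (1 - y)"
  and "y <= 1 / 2 ==> - ln (1 - y) <= y + y\<^sup>2 / 2 + y ^ 3 / 3 + y ^ 4 / 2"
proof -
 have "0 - (0 + 0\<^sup>2 / 2 + 0 ^ 3 / 3 + 0 ^ 4 / 4) - ln (1 - 0) <= 0 - (y + y\<^sup>2 / 2 + y ^ 3 / 3 + y ^ 4 / 4) - ln (1 - y)"
 proof (rule DERIV_nonneg_imp_nondecreasing[OF y(1)])
  fix x assume x: "0 <= x" "x <= y"
  show "\<exists>d. ((%y. 0 - (y + y\<^sup>2 / 2 + y ^ 3 / 3 + y ^ 4 / 4) - ln (1 - y)) has_real_derivative d) (at x) & 0 <= d"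
  proof (intro exI conjI)
  show "((%y. 0 - (y + y\<^sup>2 / 2 + y ^ 3 / 3 + y ^ 4 / 4) - ln (1 - y)) has_real_derivative x ^ 4 / (1 - x)) (at x)"
  using x y by (auto intro!: derivative_eq_intros simp: field_simps power2_eq_square power3_eq_cube power4_eq_xxxx)
  qed (use x y in auto)
 qed
 then show "y + y\<^sup>2 / 2 + y ^ 3 / 3 + y ^ 4 / 4 <= - ln (1 - y)" by simp
next
 assume y2: "y <= 1 / 2"
 have "(0 + 0\<^sup>2 / 2 + 0 ^ 3 / 3 + 0 ^ 4 / 2) + ln (1 - 0) <= (y + y\<^sup>2 / 2 + y ^ 3 / 3 + y ^ 4 / 2) + ln (1 - y)"
 proof (rule DERIV_nonneg_imp_nondecreasing[OF y(1)])
  fix x assume x: "0 <= x" "x <= y"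
  show "\<exists>d. ((%y. (y + y\<^sup>2 / 2 + y ^ 3 / 3 + y ^ 4 / 2) + ln (1 - y)) has_real_derivative d) (at x) & 0 <= d"
  proof (intro exI conjI)
  show "((%y. (y + y\<^sup>2 / 2 + y ^ 3 / 3 + y ^ 4 / 2) + ln (1 - y)) has_real_derivative x ^ 3 * (1 - 2 * x) / (1 - x)) (at x)"
  using x y by (auto intro!: derivative_eq_intros simp: field_simps power2_eq_square power3_eq_cube power4_eq_xxxx)
  qed (use x y y2 in auto)
 qed
 then show "- ln (1 - y) <= y + y\<^sup>2 / 2 + y ^ 3 / 3 + y ^ 4 / 2" by simp
qed

lemma L2_le_chi2:
 assumes k: "k > 4"
 shows "L2_le (chi2 k) (%x. ln (x / real k)) (55 / real k)"
  "L2_le (chi2 k) (%x. real k / x - 1) (30 / real k)"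
  "L2_le (chi2 k) (%x. 1 / x) (25 / (3 * (real k)\<^sup>2))"
  "L2_le (chi2 k) (%x. x / real k - 1 - ln (x / real k)) (127 / (real k)\<^sup>2)"
proof -
 show "L2_le (chi2 k) (%x. ln (x / real k)) (55 / real k)"
  "L2_le (chi2 k) (%x. x / real k - 1 - ln (x / real k)) (127 / (real k)\<^sup>2)"
  using chi2_log_square[OF k] chi2_entropy_square[OF k] by (auto simp: L2_le_def)
 show "L2_le (chi2 k) (%x. real k / x - 1) (30 / real k)"
  using chi2_inverse_variance[OF k] rational_bounds(2)[OF k] by (auto simp: L2_le_def has_bochner_integral_iff)
 define K where "K = real k"
 have K: "K >= 5" using k by (simp add: K_def)
 have "(K - 5) * (22 * K - 40) >= 0" using K by (intro mult_nonneg_nonneg) auto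
 then have "(K - 2) * (K - 4) >= 3 * K\<^sup>2 / 25" by (simp add: algebra_simps power2_eq_square)
 then have "1 / ((K - 2) * (K - 4)) <= 1 / (3 * K\<^sup>2 / 25)" using K by (intro divide_left_mono) auto
 then show "L2_le (chi2 k) (%x. 1 / x) (25 / (3 * (real k)\<^sup>2))"
  using hbi_chi2_inverse_square[OF k]
  by (auto simp: L2_le_def has_bochner_integral_iff power_divide K_def)
qed

lemma L2_le_chi2_centered:
 assumes "k > 0"
 shows "L2_le (chi2 k) (%x. x - real k) (2 * real k)"
  "L2_le (chi2 k) (%x. x) (real k * (real k + 2))"
 using chi2_variance[OF assms] hbi_chi2_powers(2)[OF assms]
 by (auto simp: L2_le_def has_bochner_integral_iff)

section \<open>Test (I): the statistic as a function of two independent chi-squared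
  variables\<close>

context
 fixes n p k :: nat and M :: "(real \<times> (nat => real)) measure" and Y W C :: "real \<times> (nat => real) => real"
 assumes p: "p > 0" and k: "k > 4" and n: "n = k + p"
 defines "M \<equiv> ref_space Mean_Test n p" and "Y \<equiv> ref_stat Mean_Test n p"
  and "W \<equiv> fst" and "C \<equiv> (%y. snd y 0)"
begin

interpretation prob_space M unfolding M_def by (rule prob_space_reference)

lemma mean_vars [measurable]: "W : borel_measurable M" "C : borel_measurable M" "Y : borel_measurable M"
proof -
 show "Y : borel_measurable M" unfolding Y_def M_def
  using measurable_ref_stat by (simp add: measurable_cong_sets[OF sets_ref_space refl])
qed (simp_all add: W_def C_def M_def)

lemma mean_laws: "distr M borel W = chi2 p" "distr M borel C = chi2 k"
 using distr_ref_fst[of Mean_Test n p] distr_ref_coord[of 0 p n Mean_Test] p n k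
 by (auto simp: M_def W_def C_def)

lemma mean_indep: "indep_var borel W borel C"
 using indep_ref_fst_coord[of p n Mean_Test] p n k by (simp add: M_def W_def C_def)

text \<open>With this the statistic becomes a difference of logarithms of two variables, each of
  known chi-squared law, so that its mean is found from one-dimensional integrals although
  \<open>C\<close> and \<open>C + W\<close> are dependent.\<close>

lemma mean_sum_law: "distr M borel (%y. C y + W y) = chi2 n"
proof (rule measure_eqI)
 interpret A: prob_space "chi2 p" by (rule prob_space_chi2)
 interpret B: prob_space "chi2 k" by (rule prob_space_chi2)
 fix X assume "X : sets (distr M borel (%y. C y + W y))"
 then have [measurable]: "X : sets borel" by simp
 have j: "distr M (borel \<Otimes>\<^sub>M borel) (%y. (W y, C y)) = chi2 p \<Otimes>\<^sub>M chi2 k"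
  using mean_indep unfolding indep_var_distribution_eq mean_laws by simp
 have "emeasure (distr M borel (%y. C y + W y)) X = (\<integral>\<^sup>+y. indicator X (C y + W y) \<partial>M)"
  by (subst nn_integral_indicator[symmetric], simp, subst nn_integral_distr) auto
 also have "... = (\<integral>\<^sup>+z. indicator X (snd z + fst z) \<partial>distr M (borel \<Otimes>\<^sub>M borel) (%y. (W y, C y)))"
  by (subst nn_integral_distr) auto
 also have "... = (\<integral>\<^sup>+w. \<integral>\<^sup>+c. indicator X (w + c) \<partial>chi2 k \<partial>chi2 p)"
  unfolding j by (subst B.nn_integral_fst[symmetric]) (auto simp: add.commute)
 also have "... = (\<integral>\<^sup>+s. indicator X s \<partial>chi2 (p + k))" by (rule nn_integral_chi2_add) simp
 finally show "emeasure (distr M borel (%y. C y + W y)) X = emeasure (chi2 n) X" by (simp add: n add.commute)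
qed simp

lemma mean_AE_pos: "AE y in M. C y > 0 & W y > 0"
 using AE_law[OF mean_vars(2) mean_laws(2) AE_chi2_pos] AE_law[OF mean_vars(1) mean_laws(1) AE_chi2_pos] p k by auto

lemma mean_stat: "Y y = real n * (ln (C y + W y) - ln (C y))"
 by (cases y) (simp add: Y_def C_def W_def)

lemma mean_stat_centered:
 "AE y in M. Y y - real n * ln (real n / real k) = real n * ln ((C y + W y) / real n) - real n * ln (C y / real k)"
 using mean_AE_pos
proof eventually_elim
 case (elim y)
 then show ?case using k n by (simp add: mean_stat ln_div algebra_simps)
qed

text \<open>Each logarithm is bounded by itself, which works for \<open>p\<close> close to
  \<open>n\<close> as well; the price is order \<open>n^2\<close> instead of order
  \<open>p\<close>.\<close>

lemma mean_stat_second_moment_crude: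
 "L2_le M (%y. Y y - real n * ln (real n / real k)) (220 * (real n)\<^sup>2)"
proof -
 have "L2_le M (%y. real n * ln ((C y + W y) / real n) - real n * ln (C y / real k))
  (2 * ((real n)\<^sup>2 * (55 / real n)) + 2 * ((real n)\<^sup>2 * (55 / real k)))"
  by (intro L2_le_diff L2_le_scale
  L2_le_law[OF _ mean_sum_law _ L2_le_chi2(1)] L2_le_law[OF _ mean_laws(2) _ L2_le_chi2(1)])
  (use k n in auto)
 then have "L2_le M (%y. Y y - real n * ln (real n / real k)) (2 * ((real n)\<^sup>2 * (55 / real n)) + 2 * ((real n)\<^sup>2 * (55 / real k)))"
  by (rule L2_le_cong_AE[OF _ _ mean_stat_centered]) simp
 then show ?thesis
 proof (rule L2_le_mono)
  have "(real n)\<^sup>2 * (55 / real n) <= (real n)\<^sup>2 * 55" "(real n)\<^sup>2 * (55 / real k) <= (real n)\<^sup>2 * 55"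
  using k n by (intro mult_left_mono; simp add: divide_le_eq)+
  then show "2 * ((real n)\<^sup>2 * (55 / real n)) + 2 * ((real n)\<^sup>2 * (55 / real k)) <= 220 * (real n)\<^sup>2" by simp
 qed
qed

text \<open>The logarithm of \<open>C\<close> enters with a minus sign and has nonpositive mean, so
  it can only help. The numerator loses \<open>1 + 38 / n\<close>, at most 39.\<close>

lemma mean_stat_expectation_ge: "expectation Y >= real n * ln (real n / real k) - 39"
proof -
 have "has_bochner_integral M (%y. ln ((C y + W y) / real n)) (\<integral>x. ln (x / real n) \<partial>chi2 n)"
  by (rule hbi_law[OF _ mean_sum_law]) (use k n chi2_log_integrable[of n] in \<open>auto simp: has_bochner_integral_iff\<close>)
 moreover have "has_bochner_integral M (%y. ln (C y / real k)) (\<integral>x. ln (x / real k) \<partial>chi2 k)"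
  by (rule hbi_law[OF _ mean_laws(2)]) (use k chi2_log_integrable[of k] in \<open>auto simp: has_bochner_integral_iff\<close>)
 ultimately have i: "has_bochner_integral M (%y. real n * ln ((C y + W y) / real n) - real n * ln (C y / real k))
  (real n * (\<integral>x. ln (x / real n) \<partial>chi2 n) - real n * (\<integral>x. ln (x / real k) \<partial>chi2 k))"
  by (intro has_bochner_integral_diff has_bochner_integral_mult_right) auto
 have "integrable M Y"
  using L2_le_integrable[OF mean_stat_second_moment_crude] integrable_const[of "real n * ln (real n / real k)"]
  by (metis (no_types, lifting) Bochner_Integration.integrable_add Bochner_Integration.integrable_cong diff_add_cancel)
 then have "expectation Y - real n * ln (real n / real k) = expectation (%y. Y y - real n * ln (real n / real k))"
  by (simp add: prob_space)
 also have "... = real n * (\<integral>x. ln (x / real n) \<partial>chi2 n) - real n * (\<integral>x. ln (x / real k) \<partial>chi2 k)"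
  using has_bochner_integral_integral_eq[OF i] by (subst integral_cong_AE[OF _ _ mean_stat_centered]) auto
 also have "... >= real n * (- 1 / real n - 38 / (real n)\<^sup>2) - real n * 0"
  using chi2_log_mean(3)[of n] chi2_log_mean(1)[of k] k n by (intro diff_mono mult_left_mono) auto
 moreover have "real n * (- 1 / real n - 38 / (real n)\<^sup>2) - real n * 0 >= - 39"
 proof -
  have "real n * (- 1 / real n - 38 / (real n)\<^sup>2) = - 1 - 38 / real n"
  proof -
  have "real n > 0" using k n by simp
  then show ?thesis by (simp add: field_simps power2_eq_square del: of_nat_0_less_iff)
  qed
  moreover have "38 / real n <= 38" using k n by (simp add: divide_le_eq)
  ultimately show ?thesis by simp
 qed
 ultimately show ?thesis by linarith
qed

text \<open>\<open>W / C - p / k\<close> is \<open>(W - p) / C\<close> plus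
  \<open>(p / k) (k / C - 1)\<close>. In the first term the factors are independent, so second
  moments multiply; the second involves \<open>C\<close> only. For \<open>2 p <= n\<close> both are
  of order \<open>p / n^2\<close>.\<close>

lemma mean_ratio_second_moment:
 assumes half: "2 * p <= n"
 shows "L2_le M (%y. W y / C y - real p / real k) (376 * real p / (real n)\<^sup>2)"
proof -
 have "L2_le M (%y. (W y - real p) * (1 / C y)) (2 * real p * (25 / (3 * (real k)\<^sup>2)))"
  by (rule L2_le_indep_mult[OF mean_indep, where f = "%w. w - real p" and g = "%c. 1 / c"])
  (use p k in \<open>auto intro!: L2_le_law[OF _ mean_laws(1)] L2_le_law[OF _ mean_laws(2) _ L2_le_chi2(3)] L2_le_chi2_centered\<close>)
 moreover have "L2_le M (%y. real p / real k * (real k / C y - 1)) ((real p / real k)\<^sup>2 * (30 / real k))"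
  by (intro L2_le_scale L2_le_law[OF _ mean_laws(2) _ L2_le_chi2(2)]) (use k in auto)
 ultimately have "L2_le M (%y. (W y - real p) * (1 / C y) + real p / real k * (real k / C y - 1))
  (2 * (2 * real p * (25 / (3 * (real k)\<^sup>2))) + 2 * ((real p / real k)\<^sup>2 * (30 / real k)))" by (rule L2_le_add)
 then have "L2_le M (%y. W y / C y - real p / real k)
  (2 * (2 * real p * (25 / (3 * (real k)\<^sup>2))) + 2 * ((real p / real k)\<^sup>2 * (30 / real k)))"
  by (rule L2_le_cong_AE) (use mean_AE_pos k in \<open>auto elim!: eventually_mono simp: field_simps\<close>)
 then show ?thesis
 proof (rule L2_le_mono)
  have kn: "real n <= 2 * real k" "real p <= real k" "real n > 0" "real k > 0" using half n k by auto
  have "2 * (2 * real p * (25 / (3 * (real k)\<^sup>2))) + 2 * ((real p / real k)\<^sup>2 * (30 / real k))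
  = real p / (real k)\<^sup>2 * (100 / 3 + 60 * (real p / real k))"
  using kn by (simp add: field_simps power2_eq_square)
  also have "... <= real p / (real k)\<^sup>2 * 94" using kn by (intro mult_left_mono) (auto simp: field_simps)
  also have "... <= 376 * real p / (real n)\<^sup>2"
  proof -
  have "(real n)\<^sup>2 <= (2 * real k)\<^sup>2" using kn by (intro power_mono) auto
  then have "real p * (real n)\<^sup>2 <= real p * (4 * (real k)\<^sup>2)" by (intro mult_left_mono) (auto simp: power_mult_distrib)
  then show ?thesis using kn by (simp add: field_simps)
  qed
  finally show "2 * (2 * real p * (25 / (3 * (real k)\<^sup>2))) + 2 * ((real p / real k)\<^sup>2 * (30 / real k)) <= 376 * real p / (real n)\<^sup>2" .
 qed
qed

text \<open>With \<open>a = 1 + W / C\<close> and \<open>b = n / k\<close> the centred statistic is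
  \<open>n ln (a / b)\<close>, and \<open>1 - b / a <= ln (a / b) <= a / b - 1\<close> places it
  between \<open>n R / a\<close> and \<open>n R / b\<close>. The gap is
  \<open>n R^2 / (a b)\<close>, where \<open>a\<close> and \<open>b\<close> exceed 1.\<close>

lemma mean_stat_linearisation:
 assumes "C y > 0" "W y > 0"
 defines "R \<equiv> W y / C y - real p / real k"
 shows "\<bar>Y y - real n * ln (real n / real k)\<bar> <= \<bar>real n * R\<bar>"
  and "\<bar>Y y - real n * ln (real n / real k) - real k * R\<bar> <= real n * R\<^sup>2"
proof -
 have pos: "real n > 0" "real k > 0" using k n by auto
 define a b where "a = 1 + W y / C y" and "b = real n / real k"
 have ab: "a > 1" "b > 1" "R = a - b" using assms pos p n by (auto simp: a_def b_def R_def add_divide_distrib)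
 have Y: "Y y - real n * ln (real n / real k) = real n * ln (a / b)"
 proof -
  have "a = (C y + W y) / C y" using assms by (simp add: a_def add_divide_distrib)
  then have "ln a = ln (C y + W y) - ln (C y)" using assms by (simp add: ln_div)
  moreover have "ln (a / b) = ln a - ln b" using ab by (simp add: ln_div)
  ultimately show ?thesis by (simp only: mean_stat b_def right_diff_distrib)
 qed
 have u: "ln (a / b) <= R / b" using ln_le_minus_one[of "a / b"] ab by (simp add: diff_divide_distrib)
 have l: "ln (a / b) >= R / a" using ln_ge_one_minus_inverse[of "a / b"] ab by (simp add: diff_divide_distrib)
 have "R / b <= \<bar>R\<bar>" "- \<bar>R\<bar> <= R / a"
 proof -
  have "R / b <= \<bar>R\<bar> / b" "(- \<bar>R\<bar>) / a <= R / a" using ab(1,2) by (intro divide_right_mono; simp)+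
  moreover have "\<bar>R\<bar> / b <= \<bar>R\<bar> / 1" "\<bar>R\<bar> / a <= \<bar>R\<bar> / 1" using ab(1,2) by (intro divide_left_mono; simp)+
  ultimately show "R / b <= \<bar>R\<bar>" "- \<bar>R\<bar> <= R / a" by linarith+
 qed
 then have "\<bar>ln (a / b)\<bar> <= \<bar>R\<bar>" using u l by (simp add: abs_le_iff)
 then show "\<bar>Y y - real n * ln (real n / real k)\<bar> <= \<bar>real n * R\<bar>"
  unfolding Y abs_mult using pos by (intro mult_left_mono) auto
 have kb: "real k = real n / b" using pos by (simp add: b_def)
 have "R / b - R / a = R\<^sup>2 / (a * b)" unfolding ab(3) using ab(1,2) by (simp add: field_simps power2_eq_square)
 also have "... <= R\<^sup>2 / 1" using ab mult_strict_mono[of 1 a 1 b] by (intro divide_left_mono) auto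
 finally have "\<bar>ln (a / b) - R / b\<bar> <= R\<^sup>2" using u l by (simp add: abs_le_iff)
 then have "real n * \<bar>ln (a / b) - R / b\<bar> <= real n * R\<^sup>2" using pos by (intro mult_left_mono) auto
 moreover have "real n * \<bar>ln (a / b) - R / b\<bar> = \<bar>Y y - real n * ln (real n / real k) - real k * R\<bar>"
 proof -
  have "real k * R = real n * (R / b)" by (subst kb) simp
  then have "Y y - real n * ln (real n / real k) - real k * R = real n * (ln (a / b) - R / b)"
  unfolding Y by (simp only: right_diff_distrib)
  then show ?thesis by (simp only: abs_mult abs_of_nat)
 qed
 ultimately show "\<bar>Y y - real n * ln (real n / real k) - real k * R\<bar> <= real n * R\<^sup>2" by simp
qed

lemma mean_stat_second_moment:
 assumes half: "2 * p <= n"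
 shows "L2_le M (%y. Y y - real n * ln (real n / real k)) (376 * real p)"
proof -
 have "L2_le M (%y. real n * (W y / C y - real p / real k)) ((real n)\<^sup>2 * (376 * real p / (real n)\<^sup>2))"
  by (rule L2_le_scale[OF mean_ratio_second_moment[OF half]])
 then have "L2_le M (%y. real n * (W y / C y - real p / real k)) (376 * real p)" using k n by simp
 then show ?thesis
  by (rule L2_le_dominated) (auto intro!: eventually_mono[OF mean_AE_pos] mean_stat_linearisation(1))
qed

text \<open>\<open>W\<close> itself has law \<open>chi2 p\<close> and serves as the coupled
  variable. The difference consists of the linearisation remainder, controlled in the first moment,
  and of the shift \<open>s\<close>, the term \<open>W (k / C - 1)\<close> and
  \<open>(1 - r) (W - p)\<close>, controlled in the second.\<close>

lemma mean_ks_le: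
 assumes half: "2 * p <= n" and r: "0 <= r" "r <= 1" and et: "0 < et" "et <= 1"
 defines "s \<equiv> r * real n * ln (real n / real k) - real p"
 shows "ks_chi2 M (%y. r * Y y) p <= (16 * (s\<^sup>2 / real p) + 3632 * (real p / real n) + 16 * (1 - r)\<^sup>2) / et\<^sup>2 + (4 * et + 5 * sqrt et)"
proof -
 let ?R = "%y. W y / C y - real p / real k"
 let ?A = "%y. real n * (?R y)\<^sup>2"
 let ?B = "%y. (s + r * (W y * (real k / C y - 1))) - (1 - r) * (W y - real p)"
 note R = L2_leD[OF mean_ratio_second_moment[OF half]]
 have kn: "real n <= 2 * real k" "real p <= real k" "real n > 0" "real k > 0" "real p >= 1" using half n k p by auto
 have A: "integrable M ?A" using R by auto
 have EA: "expectation (%y. \<bar>?A y\<bar>) <= 376 * real p / real n"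
 proof -
  have "expectation (%y. \<bar>?A y\<bar>) = real n * expectation (%y. (?R y)\<^sup>2)" by (simp add: abs_mult)
  also have "... <= real n * (376 * real p / (real n)\<^sup>2)" using R(3) by (intro mult_left_mono) auto
  also have "... = 376 * real p / real n" using kn by (simp add: power2_eq_square)
  finally show ?thesis .
 qed
 have "L2_le M (%y. W y * (real k / C y - 1)) (real p * (real p + 2) * (30 / real k))"
  by (rule L2_le_indep_mult[OF mean_indep, where f = "%w. w" and g = "%c. real k / c - 1"])
  (use p k in \<open>auto intro!: L2_le_law[OF _ mean_laws(1)] L2_le_law[OF _ mean_laws(2) _ L2_le_chi2(2)] L2_le_chi2_centered\<close>)
 then have "L2_le M ?B (2 * (2 * s\<^sup>2 + 2 * (r\<^sup>2 * (real p * (real p + 2) * (30 / real k)))) + 2 * ((1 - r)\<^sup>2 * (2 * real p)))"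
  by (intro L2_le_diff L2_le_add L2_le_const L2_le_scale
  L2_le_law[OF _ mean_laws(1)] L2_le_chi2_centered) (use p in auto)
 then have B: "L2_le M ?B (4 * s\<^sup>2 + 720 * ((real p)\<^sup>2 / real n) + 4 * (1 - r)\<^sup>2 * real p)"
 proof (rule L2_le_mono)
  have "r\<^sup>2 * (real p * (real p + 2) * (30 / real k)) <= 1 * (real p * (3 * real p) * (30 / (real n / 2)))"
  using r kn by (intro mult_mono divide_left_mono) (auto simp: power_le_one)
  then have "r\<^sup>2 * (real p * (real p + 2) * (30 / real k)) <= 180 * ((real p)\<^sup>2 / real n)" by (simp add: power2_eq_square)
  then show "2 * (2 * s\<^sup>2 + 2 * (r\<^sup>2 * (real p * (real p + 2) * (30 / real k)))) + 2 * ((1 - r)\<^sup>2 * (2 * real p))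
  <= 4 * s\<^sup>2 + 720 * ((real p)\<^sup>2 / real n) + 4 * (1 - r)\<^sup>2 * real p" by simp
 qed
 have le: "AE y in M. \<bar>r * Y y - W y\<bar> <= \<bar>?A y\<bar> + \<bar>?B y\<bar>"
  using mean_AE_pos
 proof eventually_elim
  case (elim y)
  define E where "E = Y y - real n * ln (real n / real k) - real k * ?R y"
  have "\<bar>E\<bar> <= ?A y" unfolding E_def by (rule mean_stat_linearisation(2)) (use elim in auto)
  then have "\<bar>r * E\<bar> <= 1 * ?A y" unfolding abs_mult using r by (intro mult_mono) auto
  then have rE: "\<bar>r * E\<bar> <= \<bar>?A y\<bar>" by simp
  \<comment> \<open>The linear part of the statistic reproduces \<open>W - p\<close> exactly, up to
    the relative fluctuation of \<open>C\<close>.\<close>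
  have "real k * ?R y = W y - real p + W y * (real k / C y - 1)" using kn elim by (simp add: field_simps)
  then have eq: "r * Y y - W y = r * E + ?B y" by (simp add: E_def s_def algebra_simps)
  show ?case unfolding eq by (rule order_trans[OF abs_triangle_ineq add_right_mono[OF rE]])
 qed
 have "ks_chi2 M (%y. r * Y y) p <= 2 * expectation (%y. \<bar>?A y\<bar>) / (et * sqrt (real p))
  + 4 * (4 * s\<^sup>2 + 720 * ((real p)\<^sup>2 / real n) + 4 * (1 - r)\<^sup>2 * real p) / (et\<^sup>2 * real p) + (4 * et + 5 * sqrt et)"
  by (rule ks_chi2_le_two_errors[OF _ _ mean_laws(1) p A B et(1) le]) measurable
 also have "2 * expectation (%y. \<bar>?A y\<bar>) / (et * sqrt (real p)) <= 752 * (real p / real n) / et\<^sup>2"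
 proof -
  have "et\<^sup>2 * 1 <= et * sqrt (real p)" using et kn by (intro mult_mono) (auto simp: power2_eq_square mult_left_le)
  then have "2 * expectation (%y. \<bar>?A y\<bar>) / (et * sqrt (real p)) <= (752 * (real p / real n)) / (et\<^sup>2 * 1)"
  using EA et by (intro frac_le) auto
  then show ?thesis by simp
 qed
 also have "4 * (4 * s\<^sup>2 + 720 * ((real p)\<^sup>2 / real n) + 4 * (1 - r)\<^sup>2 * real p) / (et\<^sup>2 * real p)
  = (16 * (s\<^sup>2 / real p) + 2880 * (real p / real n) + 16 * (1 - r)\<^sup>2) / et\<^sup>2"
  using kn et by (simp add: field_simps power2_eq_square)
 finally show ?thesis by (simp add: add_divide_distrib)
qed

text \<open>\<open>V\<close> switches between the sharp and the crude second moment at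
  \<open>p = n / 2\<close>. The factor \<open>r <= 1\<close> never increases either the variance or
  the additive error 39.\<close>

lemma mean_shift_le:
 assumes r: "0 <= r" "r <= 1"
 defines "V \<equiv> if 2 * p <= n then 376 * real p else 220 * (real n)\<^sup>2"
 defines "Dl \<equiv> expectation (%y. r * Y y) - real p"
 shows "Dl\<^sup>2 <= 8 * ks_chi2 M (%y. r * Y y) p * (V + 2 * real p + Dl\<^sup>2)"
  and "Dl >= r * real n * ln (real n / real k) - real p - 39"
proof -
 have V: "L2_le M (%y. Y y - real n * ln (real n / real k)) V"
  using mean_stat_second_moment mean_stat_second_moment_crude by (auto simp: V_def)
 have "L2_le M (%y. r * (Y y - real n * ln (real n / real k))) (r\<^sup>2 * V)" by (rule L2_le_scale[OF V])
 then have "L2_le M (%y. r * Y y - r * (real n * ln (real n / real k))) V"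
  unfolding right_diff_distrib
  by (rule L2_le_mono) (use r L2_le_nonneg[OF V] in \<open>auto intro!: mult_left_le_one_le simp: power_le_one\<close>)
 from mean_shift_le_ks_chi2_second_moment(2)[OF p this]
 show "Dl\<^sup>2 <= 8 * ks_chi2 M (%y. r * Y y) p * (V + 2 * real p + Dl\<^sup>2)" by (simp add: Dl_def)
 have "r * (real n * ln (real n / real k) - 39) <= r * expectation Y" using mean_stat_expectation_ge r by (intro mult_left_mono) auto
 moreover have "r * 39 <= 39" using r by simp
 ultimately show "Dl >= r * real n * ln (real n / real k) - real p - 39" by (simp add: Dl_def algebra_simps)
qed

end

text \<open>Common skeleton for the plain and the corrected statistic. \<open>S\<close> is the shift
  of the mean and \<open>sqrt p * u\<close> its order. \<open>lower\<close> says that the shift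
  outweighs the additive error 39 as long as \<open>u\<close> stays away from 0, \<open>big\<close>
  pays for the crude variance when \<open>p > n / 2\<close>, and \<open>small\<close> gathers the
  coupling errors. The constant \<open>1 / 48\<close> is half of the smaller leading coefficient,
  \<open>1 / 24\<close>.\<close>

lemma mean_criterion:
 fixes p :: "nat => nat" and r u S :: "nat => real"
 assumes p: "EV n. 1 <= p n"
  and lim: "filterlim (%n. real n - real (p n)) at_top sequentially"
  and r: "EV n. 0 <= r n & r n <= 1" and u: "EV n. u n >= 0"
  and S: "S = (%n. r n * real n * ln (real n / (real n - real (p n))) - real (p n))"
  and lower: "!!dl. dl > 0 ==> EV n. u n >= dl --> S n - 39 >= 1 / 48 * sqrt (real (p n)) * u n"
  and big: "EV n. n < 2 * p n --> (real n)\<^sup>2 <= 64 * real (p n) * (u n)\<^sup>2"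
  and half: "u ~~> 0 ==> EV n. 2 * p n <= n"
  and small: "u ~~> 0 ==> (%n. 16 * ((S n)\<^sup>2 / real (p n)) + 3632 * (real (p n) / real n) + 16 * (1 - r n)\<^sup>2) ~~> 0"
 shows "(%n. ks_chi2 (ref_space Mean_Test n (p n)) (%y. r n * ref_stat Mean_Test n (p n) y) (p n)) ~~> 0
  \<longleftrightarrow> u ~~> 0"
  (is "?D ~~> 0 \<longleftrightarrow> _")
proof -
 define k where "k n = n - p n" for n
 have "EV n. real n - real (p n) >= 5" using lim by (simp add: filterlim_at_top)
 with p have k: "EV n. 0 < p n & 4 < k n & n = k n + p n & real (k n) = real n - real (p n)"
  by eventually_elim (auto simp: k_def of_nat_diff)
 have D0: "EV n. ?D n >= 0"
  using k
 proof eventually_elim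
  case (elim n)
  interpret prob_space "ref_space Mean_Test n (p n)" by (rule prob_space_reference)
  show ?case by (rule ks_chi2_nonneg)
 qed
 have suff: "?D ~~> 0" if u0: "u ~~> 0"
 proof (rule tendsto_zero_of_coupling_bounds[OF small[OF u0] D0])
  fix et :: real assume et: "0 < et" "et <= 1"
  show "EV n. ?D n <= (16 * ((S n)\<^sup>2 / real (p n)) + 3632 * (real (p n) / real n) + 16 * (1 - r n)\<^sup>2) / et\<^sup>2 + (4 * et + 5 * sqrt et)"
  using k r half[OF u0]
  proof eventually_elim
  case (elim n)
  then show ?case using mean_ks_le[of "p n" "k n" n "r n" et] et by (simp add: S)
  qed
 qed
 define Dl where "Dl n = (\<integral>y. r n * ref_stat Mean_Test n (p n) y \<partial>ref_space Mean_Test n (p n)) - real (p n)" for n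
 define B where "B n = (if 2 * p n <= n then 376 * real (p n) else 220 * (real n)\<^sup>2) + 2 * real (p n)" for n
 have sh: "EV n. (Dl n)\<^sup>2 <= 8 * ?D n * (B n + (Dl n)\<^sup>2) & Dl n >= S n - 39"
  using k r
 proof eventually_elim
  case (elim n)
  then have *: "0 < p n" "4 < k n" "n = k n + p n" "0 <= r n" "r n <= 1" and kr: "real (k n) = real n - real (p n)" by auto
  show ?case using mean_shift_le[OF *] unfolding S Dl_def B_def kr by simp
 qed
 have nec: "u ~~> 0" if D: "?D ~~> 0"
 \<comment> \<open>\<open>14082 = 220 * 64 + 2\<close>: the crude variance \<open>220 n^2\<close>
   under \<open>n^2 <= 64 p u^2\<close>, together with \<open>2 p\<close>.\<close>
 proof (rule tendsto_zero_of_small_distance[OF D, where c = "1 / 48" and C = 14082 and Dl = Dl and B = B and s = "%n. real (p n)"])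
  show "EV n. B n <= 14082 * real (p n) * (1 + (u n)\<^sup>2)"
  using big
  proof eventually_elim
  case (elim n)
  have nn: "0 <= real (p n) * (u n)\<^sup>2" "0 <= real (p n)" by auto
  have e: "14082 * real (p n) * (1 + (u n)\<^sup>2) = 14082 * real (p n) + 14082 * (real (p n) * (u n)\<^sup>2)" by (simp add: algebra_simps)
  show ?case
  proof (cases "2 * p n <= n")
  case True
  then have "B n = 378 * real (p n)" by (simp add: B_def)
  then show ?thesis using nn unfolding e by linarith
  next
  case False
  then have "(real n)\<^sup>2 <= 64 * (real (p n) * (u n)\<^sup>2)" "B n = 220 * (real n)\<^sup>2 + 2 * real (p n)"
  using elim by (simp_all add: B_def mult.assoc)
  then show ?thesis using nn unfolding e by linarith
  qed
  qed
  show "EV n. dl <= u n --> 1 / 48 * sqrt (real (p n)) * u n <= Dl n" if "dl > 0" for dl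
  using lower[OF that] sh by eventually_elim auto
  show "EV n. (Dl n)\<^sup>2 <= 8 * ?D n * (B n + (Dl n)\<^sup>2)"
  using sh by eventually_elim simp
  show "EV n. 0 < real (p n)" using p by eventually_elim simp
 qed (use u D0 in auto)
 show ?thesis using suff nec by blast
qed

section \<open>Size of the shift in test (I), without and with Bartlett's factor\<close>

lemma cubic_quotient_identities:
 fixes x n :: real
 assumes "x > 0" "n > 0"
 shows "sqrt x * (sqrt (x ^ 3) / n) = x\<^sup>2 / n" "(sqrt (x ^ 3) / n)\<^sup>2 = x ^ 3 / n\<^sup>2"
  "sqrt x * (sqrt (x ^ 5) / n\<^sup>2) = x ^ 3 / n\<^sup>2" "(sqrt (x ^ 5) / n\<^sup>2)\<^sup>2 = x ^ 5 / n ^ 4"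
proof -
 have "sqrt x * sqrt (x ^ 3) = x\<^sup>2" "sqrt x * sqrt (x ^ 5) = x ^ 3"
  unfolding real_sqrt_mult[symmetric] using assms by (intro real_sqrt_unique; simp flip: power_Suc power_mult)+
 then show "sqrt x * (sqrt (x ^ 3) / n) = x\<^sup>2 / n" "sqrt x * (sqrt (x ^ 5) / n\<^sup>2) = x ^ 3 / n\<^sup>2" by simp_all
 show "(sqrt (x ^ 3) / n)\<^sup>2 = x ^ 3 / n\<^sup>2" "(sqrt (x ^ 5) / n\<^sup>2)\<^sup>2 = x ^ 5 / n ^ 4"
  using assms by (simp_all add: power_divide flip: power_mult)
qed

lemma tendsto_zero_le_power:
 fixes q v :: "nat => real"
 assumes "v ~~> 0" "m > 0" "EV n. 0 <= q n & q n ^ m <= v n"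
 shows "q ~~> 0"
proof -
 have "(%n. q n ^ m) ~~> 0"
  by (rule Lim_null_comparison[OF _ assms(1)]) (use assms(3) in \<open>auto elim!: eventually_mono\<close>)
 then show ?thesis
  by (subst (asm) tendsto_zero_power_iff[OF assms(2)]) (use assms(3) in \<open>auto elim!: eventually_mono\<close>)
qed

lemma ln_ratio_eq:
 assumes "0 < x" "x < (n::real)"
 shows "ln (n / (n - x)) = - ln (1 - x / n)"
proof -
 have "1 - x / n = (n - x) / n" using assms by (simp add: field_simps)
 then show ?thesis using assms by (simp add: ln_div)
qed

lemma mean_shift_plain_bounds:
 fixes x n :: real
 assumes x: "0 < x" "x < n"
 defines "S \<equiv> n * ln (n / (n - x)) - x"
 shows "S >= x\<^sup>2 / (2 * n)" "2 * x <= n ==> S <= x\<^sup>2 / n"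
proof -
 define y where "y = x / n"
 have y: "0 < y" "y < 1" "x = n * y" "n > 0" using x by (auto simp: y_def)
 have S: "S = n * (- ln (1 - y) - y)" unfolding S_def ln_ratio_eq[OF x] y_def[symmetric] using y(3) by (simp add: right_diff_distrib)
 have "- ln (1 - y) - y >= y\<^sup>2 / 2" using neg_ln_one_minus_bounds(1)[of y] y zero_le_power[of y 3] zero_le_power[of y 4] by linarith
 then have "n * (y\<^sup>2 / 2) <= S" unfolding S using y by (intro mult_left_mono) auto
 then show "S >= x\<^sup>2 / (2 * n)" using y by (simp add: power2_eq_square mult_ac)
 assume "2 * x <= n"
 then have y2: "y <= 1 / 2" using x by (simp add: y_def field_simps)
 have "y ^ 3 <= y\<^sup>2" "y ^ 4 <= y ^ 3" using y by (auto simp: power3_eq_cube power2_eq_square power4_eq_xxxx mult_left_le)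
 moreover have "y ^ 3 = y\<^sup>2 * y" by (simp add: power3_eq_cube power2_eq_square)
 moreover have "y\<^sup>2 * y <= y\<^sup>2 * (1 / 2)" using y2 by (intro mult_left_mono) auto
 ultimately have "- ln (1 - y) - y <= y\<^sup>2"
  using neg_ln_one_minus_bounds(2)[of y] y y2 by linarith
 then have "S <= n * y\<^sup>2" unfolding S using y by (intro mult_left_mono) auto
 then show "S <= x\<^sup>2 / n" using y by (simp add: power2_eq_square mult_ac)
qed

text \<open>Multiplying \<open>y + y^2/2 + y^3/3 + ...\<close> by \<open>1 - y/2\<close> removes the
  quadratic term and leaves \<open>y + y^3/12\<close> to leading order; this is the purpose of the
  factor. In the lower bound \<open>1/12\<close> is halved to absorb the fifth-order term, and the
  remaining \<open>1/n\<close> in the factor costs at most \<open>3 y / n\<close> before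
  multiplication by \<open>n\<close>.\<close>

lemma mean_shift_bartlett_bounds:
 fixes x n :: real
 assumes x: "1 <= x" "x + 1 <= n"
 defines "S \<equiv> (1 - (1 + x / 2) / n) * n * ln (n / (n - x)) - x"
 shows "S >= x ^ 3 / (24 * n\<^sup>2) - 3 * (x / n)" "2 * x <= n ==> S <= x ^ 3 / (4 * n\<^sup>2)"
proof -
 define y where "y = x / n"
 have y: "0 < y" "y < 1" "x = n * y" "n >= 2" using x by (auto simp: y_def)
 define \<rho> where "\<rho> = 1 - y / 2 - 1 / n"
 have \<rho>: "\<rho> >= 0"
 proof -
  have "1 / n <= 1 / 2" using y by simp
  then show ?thesis using y(2) unfolding \<rho>_def by linarith
 qed
 have r: "1 - (1 + x / 2) / n = \<rho>" using y(4) by (simp add: \<rho>_def y_def add_divide_distrib)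
 have S: "S = n * (\<rho> * (- ln (1 - y)) - y)"
 proof -
  have "ln (n / (n - x)) = - ln (1 - y)" unfolding y_def by (rule ln_ratio_eq) (use x in auto)
  then have "S = \<rho> * n * - ln (1 - y) - n * y" unfolding S_def r using y(3) by simp
  then show ?thesis by (simp add: algebra_simps)
 qed
 have py: "y ^ 5 <= y ^ 4" "y ^ 4 <= y ^ 3" "y ^ 3 <= y\<^sup>2" "y\<^sup>2 <= y" "0 <= y ^ 5" "0 <= y ^ 4" "0 <= y ^ 3" "0 <= y\<^sup>2"
  using y power_decreasing[of 4 5 y] power_decreasing[of 3 4 y] power_decreasing[of 2 3 y] power_decreasing[of 1 2 y] by auto
 have "y + y ^ 3 / 24 - 3 * y / n <= \<rho> * (y + y\<^sup>2 / 2 + y ^ 3 / 3 + y ^ 4 / 4)"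
 proof -
  define T where "T = y + y\<^sup>2 / 2 + y ^ 3 / 3 + y ^ 4 / 4"
  have "T <= 3 * y" unfolding T_def using py y by linarith
  then have "T / n <= 3 * y / n" using y by (intro divide_right_mono) auto
  moreover have "(1 - y / 2) * T = y + y ^ 3 / 12 + y ^ 4 / 12 - y ^ 5 / 8"
  unfolding T_def by (simp add: field_simps eval_nat_numeral)
  moreover have "\<rho> * T = (1 - y / 2) * T - T / n" by (simp add: \<rho>_def left_diff_distrib)
  ultimately have "y + y ^ 3 / 24 - 3 * y / n <= \<rho> * T" using py by linarith
  then show ?thesis by (simp only: T_def)
 qed
 also have "... <= \<rho> * (- ln (1 - y))" using neg_ln_one_minus_bounds(1)[of y] y \<rho> by (intro mult_left_mono) auto
 finally have "n * (y ^ 3 / 24 - 3 * y / n) <= S" unfolding S using y by (intro mult_left_mono) auto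
 moreover have "n * (y ^ 3 / 24 - 3 * y / n) = x ^ 3 / (24 * n\<^sup>2) - 3 * (x / n)"
  using y by (simp add: right_diff_distrib power_mult_distrib, simp add: power2_eq_square power3_eq_cube mult_ac)
 ultimately show "S >= x ^ 3 / (24 * n\<^sup>2) - 3 * (x / n)" by simp
 assume "2 * x <= n"
 then have y2: "y <= 1 / 2" using x by (simp add: y_def field_simps)
 have "\<rho> * (- ln (1 - y)) <= \<rho> * (y + y\<^sup>2 / 2 + y ^ 3 / 3 + y ^ 4 / 2)"
  using neg_ln_one_minus_bounds(2)[of y] y y2 \<rho> by (intro mult_left_mono) auto
 also have "... <= (1 - y / 2) * (y + y\<^sup>2 / 2 + y ^ 3 / 3 + y ^ 4 / 2)"
 proof (rule mult_right_mono)
  show "\<rho> <= 1 - y / 2" using y(4) by (simp add: \<rho>_def)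
  show "0 <= y + y\<^sup>2 / 2 + y ^ 3 / 3 + y ^ 4 / 2" using py y(1) by linarith
 qed
 also have "... = y + y ^ 3 / 12 + y ^ 4 / 3 - y ^ 5 / 4" by (simp add: field_simps eval_nat_numeral)
 also have "... <= y + y ^ 3 / 4"
 proof -
  have "y ^ 4 = y ^ 3 * y" by (simp add: eval_nat_numeral)
  moreover have "y ^ 3 * y <= y ^ 3 * (1 / 2)" using y2 y(1) by (intro mult_left_mono) auto
  ultimately show ?thesis using py by linarith
 qed
 finally have "S <= n * (y ^ 3 / 4)" unfolding S using y by (intro mult_left_mono) auto
 then show "S <= x ^ 3 / (4 * n\<^sup>2)" using y by (simp add: power_mult_distrib, simp add: power2_eq_square power3_eq_cube mult_ac)
qed

text \<open>The hypothesis makes \<open>x\<close> at least of order \<open>n\<close> to the power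
  \<open>d / a\<close>, the conclusion asks only for \<open>c / b\<close>. The strict inequality
  between the exponents leaves a spare factor \<open>n\<close>, which beats every constant. In use
  it turns a main term bounded away from 0 in normalised form into one exceeding a prescribed
  number.\<close>

lemma power_ratio_dichotomy:
 fixes dl m :: real and x :: "nat => nat"
 assumes dl: "dl > 0" and m: "m > 0" and ab: "a > 0" "b > 0" "c * a < d * b"
 shows "EV n. real (x n) ^ a >= dl * real n ^ d --> real (x n) ^ b >= m * real n ^ c"
proof -
 have "filterlim (%n::nat. real n) at_top sequentially" by (rule filterlim_real_sequentially)
 then have "EV n. real n > m ^ a / dl ^ b" by (simp add: filterlim_at_top_dense)
 moreover have "EV n. (n::nat) >= 1" by (rule eventually_ge_at_top)
 ultimately show ?thesis
 proof eventually_elim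
  case (elim n)
  show ?case
  proof (rule impI, rule ccontr)
  assume h: "dl * real n ^ d <= real (x n) ^ a" and "\<not> m * real n ^ c <= real (x n) ^ b"
  then have "(real (x n) ^ b) ^ a < (m * real n ^ c) ^ a" using ab by (intro power_strict_mono) auto
  moreover have "(dl * real n ^ d) ^ b <= (real (x n) ^ a) ^ b" using h dl by (intro power_mono) auto
  moreover have "(real (x n) ^ a) ^ b = (real (x n) ^ b) ^ a" by (simp add: mult.commute flip: power_mult)
  ultimately have "dl ^ b * real n ^ (d * b) < m ^ a * real n ^ (c * a)" by (simp add: power_mult_distrib flip: power_mult)
  moreover have "m ^ a < dl ^ b * real n" using elim dl by (simp add: pos_divide_less_eq mult.commute)
  then have "m ^ a * real n ^ (c * a) <= dl ^ b * real n * real n ^ (c * a)" by (intro mult_right_mono) auto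
  moreover have "dl ^ b * real n * real n ^ (c * a) = dl ^ b * real n ^ Suc (c * a)" by simp
  moreover have "dl ^ b * real n ^ Suc (c * a) <= dl ^ b * real n ^ (d * b)"
  using elim ab dl by (intro mult_left_mono power_increasing) auto
  ultimately show False by linarith
  qed
 qed
qed

theorem mean_wilks:
 assumes p: "EV n. 1 <= p n & p n + 1 < n"
  and lim: "filterlim (%n. real n - real (p n)) at_top sequentially"
 shows "(%n. ks_chi2 (ref_space Mean_Test n (p n)) (%y. 1 * ref_stat Mean_Test n (p n) y) (p n)) ~~> 0
  \<longleftrightarrow> (%n. real (p n) / real n powr (2 / 3)) ~~> 0"
proof -
 define u where "u n = sqrt (real (p n) ^ 3) / real n" for n
 have u2: "EV n. 1 <= p n & p n + 1 < n & (u n)\<^sup>2 = real (p n) ^ 3 / (real n)\<^sup>2 & sqrt (real (p n)) * u n = (real (p n))\<^sup>2 / real n"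
  using p
 proof eventually_elim
  case (elim n)
  then show ?case using cubic_quotient_identities[of "real (p n)" "real n"] by (simp add: u_def del: times_divide_eq_right)
 qed
 have u0: "EV n. u n >= 0" by (simp add: u_def)
 have sq0: "(%n. (u n)\<^sup>2) ~~> 0 \<longleftrightarrow> u ~~> 0" by (rule tendsto_zero_power_iff[OF _ u0]) simp
 have "(%n. ks_chi2 (ref_space Mean_Test n (p n)) (%y. 1 * ref_stat Mean_Test n (p n) y) (p n)) ~~> 0 \<longleftrightarrow> u ~~> 0"
 proof (rule mean_criterion[where S = "%n. 1 * real n * ln (real n / (real n - real (p n))) - real (p n)", OF _ lim _ u0 refl])
  fix dl :: real assume dl: "dl > 0"
  \<comment> \<open>\<open>156 = 4 * 39\<close>: the additive error then takes at most a quarter of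
    \<open>p^2 / n\<close>, out of the available half.\<close>
  have "EV n. real (p n) ^ 3 >= dl\<^sup>2 * real n ^ 2 --> real (p n) ^ 2 >= 156 * real n ^ 1"
  by (rule power_ratio_dichotomy) (use dl in auto)
  then show "EV n. dl <= u n --> 1 / 48 * sqrt (real (p n)) * u n <= 1 * real n * ln (real n / (real n - real (p n))) - real (p n) - 39"
  using u2
  proof eventually_elim
  case (elim n)
  show ?case
  proof
  assume "dl <= u n"
  then have "dl\<^sup>2 <= real (p n) ^ 3 / (real n)\<^sup>2" using elim(2) dl power_mono[of dl "u n" 2] by simp
  then have "(real (p n))\<^sup>2 / real n >= 156" using elim by (simp add: pos_le_divide_eq)
  moreover have "(real (p n))\<^sup>2 / (2 * real n) = (real (p n))\<^sup>2 / real n / 2" by simp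
  moreover have "1 / 48 * sqrt (real (p n)) * u n = 1 / 48 * ((real (p n))\<^sup>2 / real n)" using elim by simp
  moreover have "(real (p n))\<^sup>2 / (2 * real n) <= real n * ln (real n / (real n - real (p n))) - real (p n)"
  by (rule mean_shift_plain_bounds) (use elim in auto)
  ultimately show "1 / 48 * sqrt (real (p n)) * u n <= 1 * real n * ln (real n / (real n - real (p n))) - real (p n) - 39" by linarith
  qed
  qed
 next
  show "EV n. n < 2 * p n --> (real n)\<^sup>2 <= 64 * real (p n) * (u n)\<^sup>2"
  using u2
  proof eventually_elim
  case (elim n)
  show ?case
  proof
  assume "n < 2 * p n"
  then have "real n ^ 4 <= (2 * real (p n)) ^ 4" by (intro power_mono) auto
  moreover have "(2 * real (p n)) ^ 4 = 16 * real (p n) ^ 4" "0 <= real (p n) ^ 4" "(real n)\<^sup>2 * (real n)\<^sup>2 = real n ^ 4"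
  by (simp_all add: power_mult_distrib flip: power_add)
  ultimately have "(real n)\<^sup>2 * (real n)\<^sup>2 <= 64 * real (p n) ^ 4" by linarith
  then have "(real n)\<^sup>2 <= 64 * real (p n) ^ 4 / (real n)\<^sup>2" using elim by (simp add: pos_le_divide_eq)
  also have "... = 64 * real (p n) * (u n)\<^sup>2" using elim by (simp add: power4_eq_xxxx power3_eq_cube)
  finally show "(real n)\<^sup>2 <= 64 * real (p n) * (u n)\<^sup>2" .
  qed
  qed
 next
  assume "u ~~> 0"
  then have v0: "(%n. (u n)\<^sup>2) ~~> 0" using sq0 by simp
  have "EV n. (u n)\<^sup>2 < 1 / 8" by (rule order_tendstoD(2)[OF v0]) simp
  then show half: "EV n. 2 * p n <= n"
  using u2
  proof eventually_elim
  case (elim n)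
  show ?case
  proof (rule ccontr)
  assume "\<not> 2 * p n <= n"
  then have "real n ^ 3 <= (2 * real (p n)) ^ 3" by (intro power_mono) auto
  moreover have "8 * real (p n) ^ 3 < (real n)\<^sup>2" using elim by (simp add: pos_divide_less_eq)
  moreover have "(real n)\<^sup>2 <= real n ^ 3" using elim by (intro power_increasing) auto
  ultimately show False by (simp add: power_mult_distrib)
  qed
  qed
  have pn: "(%n. real (p n) / real n) ~~> 0"
  proof (rule tendsto_zero_le_power[OF v0, where m = 3])
  show "EV n. 0 <= real (p n) / real n & (real (p n) / real n) ^ 3 <= (u n)\<^sup>2"
  using u2
  proof eventually_elim
  case (elim n)
  have "(real n)\<^sup>2 <= real n ^ 3" using elim by (intro power_increasing) auto
  then show ?case using elim by (auto simp: power_divide intro!: divide_left_mono)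
  qed
  qed simp
  have "(%n. 16 * (u n)\<^sup>2 + 3632 * (real (p n) / real n)) ~~> 16 * 0 + 3632 * 0" by (intro tendsto_intros v0 pn)
  then have g: "(%n. 16 * (u n)\<^sup>2 + 3632 * (real (p n) / real n)) ~~> 0" by simp
  show "(%n. 16 * ((1 * real n * ln (real n / (real n - real (p n))) - real (p n))\<^sup>2 / real (p n)) + 3632 * (real (p n) / real n) + 16 * (1 - 1)\<^sup>2) ~~> 0"
  proof (rule Lim_null_comparison[OF _ g])
  show "EV n. norm (16 * ((1 * real n * ln (real n / (real n - real (p n))) - real (p n))\<^sup>2 / real (p n)) + 3632 * (real (p n) / real n) + 16 * (1 - 1)\<^sup>2)
  <= 16 * (u n)\<^sup>2 + 3632 * (real (p n) / real n)"
  using u2 half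
  proof eventually_elim
  case (elim n)
  define S where "S = real n * ln (real n / (real n - real (p n))) - real (p n)"
  have S: "S >= (real (p n))\<^sup>2 / (2 * real n)" "S <= (real (p n))\<^sup>2 / real n"
  unfolding S_def by (rule mean_shift_plain_bounds; use elim in simp)+
  have "S >= 0" by (rule order_trans[OF _ S(1)]) simp
  then have "S\<^sup>2 <= ((real (p n))\<^sup>2 / real n)\<^sup>2" using S by (intro power_mono) auto
  then have "S\<^sup>2 / real (p n) <= ((real (p n))\<^sup>2 / real n)\<^sup>2 / real (p n)" by (rule divide_right_mono) simp
  also have "... = (u n)\<^sup>2" using elim by (simp add: power_divide power3_eq_cube power2_eq_square)
  finally have "S\<^sup>2 / real (p n) <= (u n)\<^sup>2" .
  then show ?case by (simp add: S_def[symmetric])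
  qed
  qed
 qed (rule eventually_mono[OF p], simp, simp)
 also have "... \<longleftrightarrow> (%n. (real (p n) / real n powr (2 / 3)) ^ 3) ~~> 0"
  unfolding sq0[symmetric]
 proof (rule tendsto_cong)
  show "EV n. (u n)\<^sup>2 = (real (p n) / real n powr (2 / 3)) ^ 3"
  using u2
  proof eventually_elim
  case (elim n)
  have "(real n powr (2 / 3)) ^ 3 = (real n)\<^sup>2" using elim by (simp add: powr_power)
  then show ?case using elim by (simp add: power_divide)
  qed
 qed
 also have "... \<longleftrightarrow> (%n. real (p n) / real n powr (2 / 3)) ~~> 0" by (rule tendsto_zero_power_iff) auto
 finally show ?thesis .
qed

theorem mean_bartlett:
 assumes p: "EV n. 1 <= p n & p n + 1 < n"
  and lim: "filterlim (%n. real n - real (p n)) at_top sequentially"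
 shows "(%n. ks_chi2 (ref_space Mean_Test n (p n)) (%y. bartlett_factor Mean_Test n (p n) * ref_stat Mean_Test n (p n) y) (p n)) ~~> 0
  \<longleftrightarrow> (%n. real (p n) / real n powr (4 / 5)) ~~> 0"
proof -
 define u where "u n = sqrt (real (p n) ^ 5) / (real n)\<^sup>2" for n
 define r where "r n = 1 - (1 + real (p n) / 2) / real n" for n
 have u2: "EV n. 1 <= p n & p n + 1 < n & (u n)\<^sup>2 = real (p n) ^ 5 / real n ^ 4 & sqrt (real (p n)) * u n = real (p n) ^ 3 / (real n)\<^sup>2"
  using p
 proof eventually_elim
  case (elim n)
  then show ?case using cubic_quotient_identities[of "real (p n)" "real n"] by (simp add: u_def del: times_divide_eq_right)
 qed
 have u0: "EV n. u n >= 0" by (simp add: u_def)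
 have sq0: "(%n. (u n)\<^sup>2) ~~> 0 \<longleftrightarrow> u ~~> 0" by (rule tendsto_zero_power_iff[OF _ u0]) simp
 have "(%n. ks_chi2 (ref_space Mean_Test n (p n)) (%y. r n * ref_stat Mean_Test n (p n) y) (p n)) ~~> 0 \<longleftrightarrow> u ~~> 0"
 proof (rule mean_criterion[where S = "%n. r n * real n * ln (real n / (real n - real (p n))) - real (p n)", OF _ lim _ u0 refl])
  show "EV n. 0 <= r n & r n <= 1"
  using p by eventually_elim (auto simp: r_def divide_le_eq)
 next
  fix dl :: real assume dl: "dl > 0"
  \<comment> \<open>\<open>2016 = 48 * 42\<close>: with \<open>p^3 / n^2\<close> at least this
    large, the additive errors \<open>39 + 3\<close> take at most \<open>1 / 48\<close> of it, which
    is half of \<open>1 / 24\<close>.\<close>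
  have "EV n. real (p n) ^ 5 >= dl\<^sup>2 * real n ^ 4 --> real (p n) ^ 3 >= 2016 * real n ^ 2"
  by (rule power_ratio_dichotomy) (use dl in auto)
  then show "EV n. dl <= u n --> 1 / 48 * sqrt (real (p n)) * u n <= r n * real n * ln (real n / (real n - real (p n))) - real (p n) - 39"
  using u2
  proof eventually_elim
  case (elim n)
  show ?case
  proof
  assume "dl <= u n"
  then have "dl\<^sup>2 <= real (p n) ^ 5 / real n ^ 4" using elim(2) dl power_mono[of dl "u n" 2] by simp
  then have "real (p n) ^ 3 / (real n)\<^sup>2 >= 2016" using elim by (simp add: pos_le_divide_eq)
  moreover have "real (p n) ^ 3 / (24 * (real n)\<^sup>2) = real (p n) ^ 3 / (real n)\<^sup>2 / 24" by simp
  moreover have "1 / 48 * sqrt (real (p n)) * u n = 1 / 48 * (real (p n) ^ 3 / (real n)\<^sup>2)" using elim by simp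
  moreover have "real (p n) ^ 3 / (24 * (real n)\<^sup>2) - 3 * (real (p n) / real n) <= r n * real n * ln (real n / (real n - real (p n))) - real (p n)"
  unfolding r_def by (rule mean_shift_bartlett_bounds) (use elim in auto)
  moreover have "real (p n) / real n <= 1" using elim by simp
  ultimately show "1 / 48 * sqrt (real (p n)) * u n <= r n * real n * ln (real n / (real n - real (p n))) - real (p n) - 39" by linarith
  qed
  qed
 next
  show "EV n. n < 2 * p n --> (real n)\<^sup>2 <= 64 * real (p n) * (u n)\<^sup>2"
  using u2
  proof eventually_elim
  case (elim n)
  show ?case
  proof
  assume "n < 2 * p n"
  then have "real n ^ 6 <= (2 * real (p n)) ^ 6" by (intro power_mono) auto
  then have "(real n)\<^sup>2 * real n ^ 4 <= 64 * real (p n) ^ 6" by (simp add: power_mult_distrib flip: power_add)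
  then have "(real n)\<^sup>2 <= 64 * real (p n) ^ 6 / real n ^ 4" using elim by (simp add: pos_le_divide_eq)
  also have "... = 64 * real (p n) * (u n)\<^sup>2" using elim by (simp add: eval_nat_numeral)
  finally show "(real n)\<^sup>2 <= 64 * real (p n) * (u n)\<^sup>2" .
  qed
  qed
 next
  assume "u ~~> 0"
  then have v0: "(%n. (u n)\<^sup>2) ~~> 0" using sq0 by simp
  have "EV n. (u n)\<^sup>2 < 1 / 32" by (rule order_tendstoD(2)[OF v0]) simp
  then show half: "EV n. 2 * p n <= n"
  using u2
  proof eventually_elim
  case (elim n)
  show ?case
  proof (rule ccontr)
  assume "\<not> 2 * p n <= n"
  then have "real n ^ 5 <= (2 * real (p n)) ^ 5" by (intro power_mono) auto
  moreover have "32 * real (p n) ^ 5 < real n ^ 4" using elim by (simp add: pos_divide_less_eq)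
  moreover have "real n ^ 4 <= real n ^ 5" using elim by (intro power_increasing) auto
  ultimately show False by (simp add: power_mult_distrib)
  qed
  qed
  have pn: "(%n. real (p n) / real n) ~~> 0"
  proof (rule tendsto_zero_le_power[OF v0, where m = 5])
  show "EV n. 0 <= real (p n) / real n & (real (p n) / real n) ^ 5 <= (u n)\<^sup>2"
  using u2
  proof eventually_elim
  case (elim n)
  have "real n ^ 4 <= real n ^ 5" using elim by (intro power_increasing) auto
  then show ?case using elim by (auto simp: power_divide intro!: divide_left_mono)
  qed
  qed simp
  let ?g = "%n. 16 * ((u n)\<^sup>2 / 8 + 18 * (real (p n) / real n)) + 3632 * (real (p n) / real n) + 16 * (1 / real n + real (p n) / real n / 2)\<^sup>2"
  have "?g ~~> 16 * (0 / 8 + 18 * 0) + 3632 * 0 + 16 * (0 + 0 / 2)\<^sup>2" by (intro tendsto_intros v0 pn lim_1_over_n) auto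
  then have g: "?g ~~> 0" by simp
  show "(%n. 16 * ((r n * real n * ln (real n / (real n - real (p n))) - real (p n))\<^sup>2 / real (p n)) + 3632 * (real (p n) / real n) + 16 * (1 - r n)\<^sup>2) ~~> 0"
  proof (rule Lim_null_comparison[OF _ g])
  show "EV n. norm (16 * ((r n * real n * ln (real n / (real n - real (p n))) - real (p n))\<^sup>2 / real (p n)) + 3632 * (real (p n) / real n) + 16 * (1 - r n)\<^sup>2) <= ?g n"
  using u2 half
  proof eventually_elim
  case (elim n)
  define S where "S = r n * real n * ln (real n / (real n - real (p n))) - real (p n)"
  define q a where "q = real (p n) ^ 3 / (4 * (real n)\<^sup>2)" and "a = 3 * (real (p n) / real n)"
  have "S >= real (p n) ^ 3 / (24 * (real n)\<^sup>2) - 3 * (real (p n) / real n)" "S <= q"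
  unfolding S_def r_def q_def by (rule mean_shift_bartlett_bounds; use elim in simp)+
  moreover have "real (p n) ^ 3 / (24 * (real n)\<^sup>2) >= 0" "q >= 0" "a >= 0" by (auto simp: q_def a_def)
  ultimately have "\<bar>S\<bar> <= \<bar>q + a\<bar>" unfolding a_def by linarith
  then have "S\<^sup>2 <= (q + a)\<^sup>2" by (simp add: abs_le_square_iff)
  also have "... <= 2 * q\<^sup>2 + 2 * a\<^sup>2" using sum_squares_bound[of q a] by (simp add: power2_sum)
  finally have "S\<^sup>2 / real (p n) <= (2 * q\<^sup>2 + 2 * a\<^sup>2) / real (p n)" by (rule divide_right_mono) simp
  also have "... = (u n)\<^sup>2 / 8 + 18 * (real (p n) / (real n)\<^sup>2)"
  using elim unfolding q_def a_def by (simp add: field_simps eval_nat_numeral)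
  also have "real (p n) / (real n)\<^sup>2 <= real (p n) / real n"
  using elim by (intro divide_left_mono) (auto simp: power2_eq_square)
  finally have "S\<^sup>2 / real (p n) <= (u n)\<^sup>2 / 8 + 18 * (real (p n) / real n)" by simp
  moreover have "1 - r n = 1 / real n + real (p n) / real n / 2" by (simp add: r_def add_divide_distrib)
  ultimately show ?case by (simp add: S_def[symmetric])
  qed
  qed
 qed (rule eventually_mono[OF p], simp)
 also have "... \<longleftrightarrow> (%n. (real (p n) / real n powr (4 / 5)) ^ 5) ~~> 0"
  unfolding sq0[symmetric]
 proof (rule tendsto_cong)
  show "EV n. (u n)\<^sup>2 = (real (p n) / real n powr (4 / 5)) ^ 5"
  using u2
  proof eventually_elim
  case (elim n)
  have "(real n powr (4 / 5)) ^ 5 = real n ^ 4" using elim by (simp add: powr_power)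
  then show ?case using elim by (simp add: power_divide)
  qed
 qed
 also have "... \<longleftrightarrow> (%n. real (p n) / real n powr (4 / 5)) ~~> 0" by (rule tendsto_zero_power_iff) auto
 finally show ?thesis by (simp add: r_def)
qed

section \<open>Preparations for the two covariance tests\<close>

lemma (in prob_space) L2_le_centered:
 assumes "L2_le M Z v"
 shows "L2_le M (%om. Z om - expectation Z) v"
proof -
 note D = L2_leD[OF assms] L2_le_integrable[OF assms]
 have sq: "(%om. (Z om - expectation Z)\<^sup>2) = (%om. (Z om)\<^sup>2 - 2 * expectation Z * Z om + (expectation Z)\<^sup>2)"
  by (auto simp: power2_eq_square algebra_simps)
 have i: "integrable M (%om. (Z om - expectation Z)\<^sup>2)" unfolding sq using D by auto
 have "expectation (%om. (Z om - expectation Z)\<^sup>2) = expectation (%om. (Z om)\<^sup>2) - (expectation Z)\<^sup>2"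
  unfolding sq using D by (simp add: prob_space power2_eq_square)
 also have "... <= v" using D(3) zero_le_power2[of "expectation Z"] by linarith
 finally show ?thesis using i D(1) by (simp add: L2_le_def)
qed

lemma L2_le_distr:
 assumes "f : measurable M N" "L2_le (distr M N f) Z v"
 shows "L2_le M (%om. Z (f om)) v"
proof -
 note D = L2_leD[OF assms(2)]
 have Z: "Z : borel_measurable N" using D(1) by simp
 then have Z2: "(%x. (Z x)\<^sup>2) : borel_measurable N" by simp
 have "integrable M (%om. (Z (f om))\<^sup>2)" using D(2) integrable_distr_eq[OF assms(1) Z2] by simp
 moreover have "(\<integral>om. (Z (f om))\<^sup>2 \<partial>M) <= v" using D(3) integral_distr[OF assms(1) Z2] by simp
 ultimately show ?thesis using measurable_compose[OF assms(1) Z] by (simp add: L2_le_def)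
qed

lemma power_sum_bounds:
 "real p ^ 3 / 3 - real p ^ 2 / 2 <= (SUM i<p. real i ^ 2)"
 "real p ^ 4 / 4 - real p ^ 3 / 2 <= (SUM i<p. real i ^ 3)"
 "real p ^ 5 / 5 - real p ^ 4 / 2 <= (SUM i<p. real i ^ 4)"
 "(SUM i<p. (real i + 1) ^ 2) <= real p ^ 3 / 3 + real p ^ 2"
proof -
 show "real p ^ 3 / 3 - real p ^ 2 / 2 <= (SUM i<p. real i ^ 2)"
 proof (induction p)
  case (Suc p)
  have "real (Suc p) ^ 3 / 3 - real (Suc p) ^ 2 / 2 = real p ^ 3 / 3 - real p ^ 2 / 2 + real p ^ 2 - 1 / 6"
  by (simp add: field_simps eval_nat_numeral)
  with Suc show ?case by simp
 qed simp
 show "real p ^ 4 / 4 - real p ^ 3 / 2 <= (SUM i<p. real i ^ 3)"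
 proof (induction p)
  case (Suc p)
  have "real (Suc p) ^ 4 / 4 - real (Suc p) ^ 3 / 2 = real p ^ 4 / 4 - real p ^ 3 / 2 + real p ^ 3 - real p / 2 - 1 / 4"
  by (simp add: field_simps eval_nat_numeral)
  with Suc show ?case by simp
 qed simp
 show "real p ^ 5 / 5 - real p ^ 4 / 2 <= (SUM i<p. real i ^ 4)"
 proof (induction p)
  case (Suc p)
  have "real (Suc p) ^ 5 / 5 - real (Suc p) ^ 4 / 2 = real p ^ 5 / 5 - real p ^ 4 / 2 + real p ^ 4 - real p ^ 2 - real p - 3 / 10"
  by (simp add: field_simps eval_nat_numeral)
  moreover have "0 <= real p ^ 2" by simp
  ultimately have "real (Suc p) ^ 5 / 5 - real (Suc p) ^ 4 / 2 <= real p ^ 5 / 5 - real p ^ 4 / 2 + real p ^ 4" by linarith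
  with Suc show ?case by simp
 qed simp
 show "(SUM i<p. (real i + 1) ^ 2) <= real p ^ 3 / 3 + real p ^ 2"
 proof (induction p)
  case (Suc p)
  have "real (Suc p) ^ 3 / 3 + real (Suc p) ^ 2 = real p ^ 3 / 3 + real p ^ 2 + (real p + 1) ^ 2 + real p + 1 / 3"
  by (simp add: field_simps eval_nat_numeral)
  with Suc show ?case by simp
 qed simp
qed

text \<open>The part of the limiting degrees of freedom that \<open>w\<close> does not supply. It
  comes from the fluctuations of the \<open>p\<close> diagonal variables, one direction being lost
  for sphericity because the statistic ignores overall scale.\<close>

definition excess_df :: "lrt => nat => nat" where
 "excess_df T p = (if T = Sphericity_Test then p - 1 else p)"

text \<open>All that the asymptotic argument needs to know about one pair \<open>(n, p)\<close>.
  \<open>s\<close> approximates the shift of the mean; the exact shift \<open>Dl\<close> and a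
  second moment bound \<open>B\<close> are hidden behind the quantifier, since only their
  inequalities matter. The bounds on \<open>B\<close> cover \<open>2 p <= n\<close> sharply and all
  \<open>p\<close> crudely; the last clause is the coupling estimate.\<close>

definition cov_data :: "lrt => nat => nat => real => real => bool" where
 "cov_data T n p r s \<longleftrightarrow>
  (let D = ks_chi2 (ref_space T n p) (%y. r * ref_stat T n p y) (ref_df T p + excess_df T p) in
  D >= 0
  & (\<exists>Dl B. Dl\<^sup>2 <= 8 * D * (B + Dl\<^sup>2) & Dl >= s - 39
  & (2 * p <= n --> B <= 4400 * (real p)\<^sup>2) & B <= 300 * (real p)\<^sup>2 + 32 * real n ^ 3)
  & (2 * p <= n --> (\<forall>et>0. D <= (32 * (s / real p)\<^sup>2 + 32 * (1 - r)\<^sup>2 + 256 * (real p / real n) + 17280 / real p) / et\<^sup>2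
  + (4 * et + 5 * sqrt et))))"

text \<open>This is \<open>R (y - 1 - ln y)\<close> at \<open>y = c / R\<close>: nonnegative for
  positive arguments, and close to \<open>(c - R)^2 / (2 R)\<close> near \<open>R\<close>.\<close>

definition entr :: "real => real => real" where
 "entr R c = c - R - R * ln (c / R)"

text \<open>Both covariance tests share one normal form: with \<open>N = n - 1 + d\<close>, where \<open>d = 0\<close> for sphericity and
  \<open>d = 1\<close> for the joint test, the statistic is \<open>w + (\<Sum>j. h (x j)) - H\<close> for \<open>h = entropy_term N\<close>,
  where \<open>H\<close>, present for sphericity only, is the entropy term of the total \<open>w + (\<Sum>j. x j)\<close>.\<close>

context
 fixes T :: lrt and n p N d :: nat
 assumes T: "T = Sphericity_Test & d = 0 \<or> T = Mean_Cov_Test & d = 1"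
  and p0: "p > 0" and n6: "n >= p + 6" and N: "N = n - 1 + d"
begin

lemma N_pos: "real N > 0" "real N >= 6" "real p <= real N" "real N <= real n" "real n <= 2 * real N"
 using T n6 N p0 by auto

text \<open>For sphericity the linear terms and the terms in \<open>ln N\<close> cancel between the
  coordinates and the total, which leaves only logarithms. For the joint test the identity is a
  rearrangement with \<open>N = n\<close>.\<close>

lemma scaled_stat_decomposition:
 assumes x: "!!j. j < p ==> x j > 0" and w: "w >= 0"
 shows "ref_stat T n p (w, x) = w + (SUM j<p. entr (real N) (x j))
  - (if d = 0 then entr (real p * real N) ((SUM j<p. x j) + w) else 0)"
proof -
 define R where "R = real N"
 have R: "R > 0" using N_pos by (simp add: R_def)
 have S: "(SUM j<p. x j) > 0" using x p0 by (intro sum_pos) auto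
 have "(SUM j<p. entr R (x j)) = (SUM j<p. x j - R - R * ln (x j) + R * ln R)"
 proof (rule sum.cong)
  fix j assume "j : {..<p}"
  then have "x j > 0" using x by simp
  then show "entr R (x j) = x j - R - R * ln (x j) + R * ln R"
  using R by (simp add: entr_def ln_div right_diff_distrib)
 qed simp
 also have "... = (SUM j<p. x j) - real p * R - R * (SUM j<p. ln (x j)) + real p * (R * ln R)"
  by (simp add: sum.distrib sum_subtractf sum_distrib_left)
 finally have h: "(SUM j<p. entr R (x j)) = (SUM j<p. x j) - real p * R - R * (SUM j<p. ln (x j)) + real p * (R * ln R)" .
 from T show ?thesis
 proof
  assume t: "T = Mean_Cov_Test & d = 1"
  then have "R = real n" using N n6 by (simp add: R_def)
  then show ?thesis using h t by (simp add: R_def[symmetric])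
 next
  assume t: "T = Sphericity_Test & d = 0"
  then have Rn: "real n - 1 = R" using N n6 by (simp add: R_def of_nat_diff)
  define s where "s = (SUM j<p. x j) + w"
  have s: "s > 0" using S w by (simp add: s_def)
  have l: "ln (s / (real p * R)) = ln s - ln (real p) - ln R" "ln (s / real p) = ln s - ln (real p)"
  using s R p0 by (simp_all add: ln_div ln_mult)
  have E: "entr (real p * R) s = s - real p * R - real p * R * (ln s - ln (real p) - ln R)"
  by (simp only: entr_def l)
  have "ref_stat T n p (w, x) = R * (real p * ln (s / real p) - (SUM j<p. ln (x j)))"
  using t by (simp add: Rn s_def)
  also have "... = w + (SUM j<p. entr R (x j)) - entr (real p * R) s"
  unfolding h E l(2) by (simp add: algebra_simps s_def)
  finally show ?thesis using t by (simp add: R_def s_def)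
 qed
qed

private definition K where "K j = n - p + j"

text \<open>Degrees of freedom by which \<open>x j\<close> falls short of \<open>N\<close>. It takes
  the values \<open>d, ..., p - 1 + d\<close>, the largest at \<open>j = 0\<close>.\<close>

private definition off where "off j = real N - real (K j)"

private definition M where "M = ref_space T n p"

private definition Y where "Y = ref_stat T n p"

private definition W where "W = (fst :: real \<times> (nat => real) => real)"

private definition \<epsilon> where "\<epsilon> k = (\<integral>x. ln (x / real k) \<partial>chi2 k)"

text \<open>Equals \<open>entr N (K j)\<close>, the entropy term evaluated at the mean of
  \<open>x j\<close>. The sum of these values is the systematic shift of the statistic.\<close>

private definition \<phi> where "\<phi> j = - off j - real N * ln (real (K j) / real N)"

text \<open>Mean of the sum of the entropy terms. Each \<open>- N * \<epsilon> (K j)\<close> is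
  close to 1 for \<open>K j\<close> close to \<open>N\<close>, so these terms make up the missing
  degrees of freedom, about \<open>p\<close>.\<close>

private definition m where "m = (SUM j<p. - real N * \<epsilon> (K j) + \<phi> j)"

private definition a where "a = ref_df T p"

private definition H where "H y = (if d = 0 then entr (real p * real N) ((SUM j<p. snd y j) + W y) else 0)"
 for y :: "real \<times> (nat => real)"

text \<open>What remains of \<open>entr N (x j)\<close> after its mean is removed: a centred entropy
  fluctuation around the proper mean \<open>K j\<close>, and a linear term accounting for the
  distance of \<open>K j\<close> from \<open>N\<close>.\<close>

private definition g where
 "g j c = real N * ((c / real (K j) - 1 - ln (c / real (K j))) + \<epsilon> (K j)) - off j / real (K j) * (c - real (K j))"

private definition VH where "VH = (SUM j<p. 254 * ((real N)\<^sup>2 / (real (K j))\<^sup>2) + 4 * ((off j)\<^sup>2 / real (K j)))"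

interpretation prob_space M unfolding M_def by (rule prob_space_reference)

lemma K6: "K j >= 6" "K j > 4" "real (K j) >= 6" using n6 by (auto simp: K_def)

lemma off_eq: "j < p ==> off j = real (p - Suc j) + real d"
 unfolding off_def K_def using T n6 N by (auto simp: of_nat_diff)

lemma off_bounds: assumes "j < p" shows "0 <= off j" "off j <= real p" "real (K j) = real N - off j"
proof -
 show "0 <= off j" using off_eq[OF assms] by simp
 show "off j <= real p" using off_eq[OF assms] assms T by (auto simp: of_nat_diff)
qed (simp add: off_def)

lemma df_eq: "real a = real p * (real p - 1) / 2 + real d * real p" "real (excess_df T p) = real p - 1 + real d"
proof -
 have g: "real (\<Sum>{..<p}) = real p * (real p - 1) / 2" for p :: nat
  by (induction p) (simp_all add: lessThan_Suc field_simps)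
 show "real a = real p * (real p - 1) / 2 + real d * real p" using T g[of p] by (auto simp: a_def)
 show "real (excess_df T p) = real p - 1 + real d" using T p0 by (auto simp: excess_df_def of_nat_diff)
qed

lemma vars_measurable [measurable]: "W : borel_measurable M" "(%y. snd y j) : borel_measurable M" "Y : borel_measurable M"
 "entr R : borel_measurable borel" "H : borel_measurable M" "g j : borel_measurable borel"
proof -
 show W: "W : borel_measurable M" by (simp add: W_def M_def)
 show x: "(%y. snd y j) : borel_measurable M" for j by (simp add: M_def)
 show "Y : borel_measurable M" unfolding Y_def M_def
  using measurable_ref_stat by (simp add: measurable_cong_sets[OF sets_ref_space refl])
 show e: "entr R : borel_measurable borel" for R unfolding entr_def[abs_def] by measurable
 have "(%y. entr (real p * real N) ((SUM j<p. snd y j) + W y)) : borel_measurable M"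
  by (rule measurable_compose[OF _ e]) (use W x in measurable)
 then show "H : borel_measurable M" unfolding H_def[abs_def] by (cases "d = 0") simp_all
 show "g j : borel_measurable borel" unfolding g_def[abs_def] by measurable
qed

lemma vars_laws: "distr M borel W = chi2 a" "j < p ==> distr M borel (%y. snd y j) = chi2 (K j)"
 using distr_ref_fst[of T n p] distr_ref_coord[of j p n T] n6
 by (auto simp: M_def W_def a_def K_def)

lemma total_law: "d = 0 ==> distr M borel (%y. (SUM j<p. snd y j) + W y) = chi2 (p * N)"
proof -
 assume d: "d = 0"
 then have t: "T = Sphericity_Test" using T by auto
 have "real ((SUM j<p. n - 1 - p + 1 + j) + ref_df T p) = real (p * N)"
 proof -
  have "real (SUM j<p. n - 1 - p + 1 + j) = (SUM j<p. (real n - real p) + real j)"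
  unfolding of_nat_sum using n6 by (intro sum.cong) (auto simp: of_nat_diff)
  also have "... = real p * (real n - real p) + real p * (real p - 1) / 2"
  proof -
  have "(SUM j<p. real j) = real p * (real p - 1) / 2" for p :: nat by (induction p) (simp_all add: field_simps)
  then show ?thesis by (simp add: sum.distrib)
  qed
  finally have "real ((SUM j<p. n - 1 - p + 1 + j) + ref_df T p) = real p * (real n - real p) + real p * (real p - 1) / 2 + real p * (real p - 1) / 2"
  using df_eq(1) d by (simp add: a_def)
  also have "... = real (p * N)" using N d n6 by (simp add: of_nat_diff field_simps)
  finally show ?thesis .
 qed
 then have "(SUM j<p. n - 1 - p + 1 + j) + ref_df T p = p * N" by (simp only: of_nat_eq_iff)
 then show ?thesis using distr_ref_sum[of T n p] by (simp add: M_def W_def)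
qed

lemma AE_vars: "AE y in M. W y >= 0 & (\<forall>j<p. snd y j > 0)"
proof -
 have "AE y in M. \<forall>j\<in>{..<p}. snd y j > 0"
 proof (rule AE_finite_allI)
  fix j assume "j : {..<p}"
  then have j: "j < p" by simp
  have "K j > 0" using K6(1)[of j] by linarith
  from AE_law[OF _ vars_laws(2)[OF j] AE_chi2_pos[OF this]] show "AE y in M. snd y j > 0" by simp
 qed simp
 moreover have "AE y in M. W y >= 0" by (rule AE_law[OF _ vars_laws(1) AE_chi2_nonneg]) simp
 ultimately show ?thesis by auto
qed

text \<open>Exact because \<open>N = K j + off j\<close>: the coefficient of \<open>c\<close> on the
  right is \<open>N / K j - off j / K j = 1\<close>.\<close>

lemma entr_split:
 assumes j: "j < p" and c: "c > 0"
 shows "entr (real N) c = g j c + (- real N * \<epsilon> (K j) + \<phi> j)"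
proof -
 define k where "k = real (K j)"
 have k: "k > 0" using K6[of j] by (simp add: k_def)
 have NN: "real N = k + off j" using off_bounds(3)[OF j] by (simp add: k_def)
 have l: "ln (c / real N) = ln c - ln (real N)" "ln (c / k) = ln c - ln k" "ln (k / real N) = ln k - ln (real N)"
  using c k N_pos by (simp_all add: ln_div)
 have "off j / k * (c - k) = off j * (c / k) - off j" using k by (simp add: field_simps)
 then have "g j c + (- real N * \<epsilon> (K j) + \<phi> j)
  = (real N * (c / k) - off j * (c / k)) - real N * ln c + real N * ln (real N) - real N"
  unfolding g_def \<phi>_def k_def[symmetric] l by (simp add: algebra_simps)
 also have "real N * (c / k) - off j * (c / k) = c" using k by (simp add: NN field_simps)
 finally show ?thesis unfolding entr_def l by (simp add: algebra_simps)
qed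

lemma stat_split: "AE y in M. Y y = (real a + m) + ((W y - real a) + (SUM j<p. g j (snd y j)) - H y)"
 using AE_vars
proof eventually_elim
 case (elim y)
 have "(SUM j<p. entr (real N) (snd y j)) = (SUM j<p. g j (snd y j) + (- real N * \<epsilon> (K j) + \<phi> j))"
  using elim by (intro sum.cong entr_split) auto
 also have "... = (SUM j<p. g j (snd y j)) + m" unfolding m_def by (rule sum.distrib)
 finally have e: "(SUM j<p. entr (real N) (snd y j)) = (SUM j<p. g j (snd y j)) + m" .
 have "Y y = W y + (SUM j<p. entr (real N) (snd y j)) - H y"
  using scaled_stat_decomposition[of "snd y" "W y"] elim by (simp add: Y_def H_def W_def)
 then show ?case unfolding e by simp
qed

lemma g_moments:
 "L2_le (chi2 (K j)) (g j) (254 * ((real N)\<^sup>2 / (real (K j))\<^sup>2) + 4 * ((off j)\<^sup>2 / real (K j)))"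
 "has_bochner_integral (chi2 (K j)) (g j) 0"
proof -
 interpret C: prob_space "chi2 (K j)" by (rule prob_space_chi2)
 let ?k = "real (K j)" and ?e = "%c. c / real (K j) - 1 - ln (c / real (K j))"
 have k: "?k > 0" using K6[of j] by simp
 have e: "has_bochner_integral (chi2 (K j)) ?e (0 - \<epsilon> (K j))"
  using chi2_log_integrable[OF K6(2)] unfolding \<epsilon>_def
  by (intro has_bochner_integral_diff chi2_centered_moments(1)[OF K6(2)]) (simp add: has_bochner_integral_iff)
 then have Ee: "C.expectation ?e = - \<epsilon> (K j)" by (simp add: has_bochner_integral_iff)
 have lin: "has_bochner_integral (chi2 (K j)) (%c. c - ?k) (?k - ?k)"
  using hbi_chi2_powers(1)[of "K j"] K6[of j] by (intro has_bochner_integral_diff hbi_chi2_const) auto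
 have "has_bochner_integral (chi2 (K j)) (g j) (real N * ((0 - \<epsilon> (K j)) + \<epsilon> (K j)) - off j / ?k * (?k - ?k))"
  unfolding g_def[abs_def]
  by (intro has_bochner_integral_diff has_bochner_integral_mult_right has_bochner_integral_add e lin hbi_chi2_const)
 then show "has_bochner_integral (chi2 (K j)) (g j) 0" by simp
 have "L2_le (chi2 (K j)) (%c. ?e c - C.expectation ?e) (127 / ?k\<^sup>2)"
  by (rule C.L2_le_centered[OF L2_le_chi2(4)[OF K6(2)]])
 then have "L2_le (chi2 (K j)) (%c. ?e c + \<epsilon> (K j)) (127 / ?k\<^sup>2)" unfolding Ee by simp
 then have "L2_le (chi2 (K j)) (g j) (2 * ((real N)\<^sup>2 * (127 / ?k\<^sup>2)) + 2 * ((off j / ?k)\<^sup>2 * (2 * ?k)))"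
  unfolding g_def[abs_def] using K6[of j]
  by (intro L2_le_diff L2_le_scale L2_le_chi2_centered) auto
 also have "2 * ((real N)\<^sup>2 * (127 / ?k\<^sup>2)) + 2 * ((off j / ?k)\<^sup>2 * (2 * ?k)) = 254 * ((real N)\<^sup>2 / ?k\<^sup>2) + 4 * ((off j)\<^sup>2 / ?k)"
  using k by (simp add: field_simps power2_eq_square)
 finally show "L2_le (chi2 (K j)) (g j) (254 * ((real N)\<^sup>2 / ?k\<^sup>2) + 4 * ((off j)\<^sup>2 / ?k))" .
qed

lemma g_sum_moments:
 "L2_le M (%y. SUM j<p. g j (snd y j)) VH" "has_bochner_integral M (%y. SUM j<p. g j (snd y j)) 0"
proof -
 have e: "has_bochner_integral M (%y. g j (snd y j)) 0" if "j < p" for j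
  by (rule hbi_law[OF _ vars_laws(2)[OF that] g_moments(2)]) simp_all
 have "has_bochner_integral M (%y. SUM j<p. g j (snd y j)) (SUM j<p. 0)"
  by (intro has_bochner_integral_sum e) simp
 then show "has_bochner_integral M (%y. SUM j<p. g j (snd y j)) 0" by simp
 have "indep_vars (%_. borel) (%j y. snd y j) {..<p}"
  using indep_ref_coords[of p n T] p0 n6 by (simp add: M_def)
 then have ind: "indep_vars (%_. borel) (%j y. g j (snd y j)) {..<p}" by (rule indep_vars_compose2) simp
 show "L2_le M (%y. SUM j<p. g j (snd y j)) VH" unfolding VH_def
 proof (rule L2_le_indep_sum[OF _ ind])
  fix j assume "j : {..<p}"
  then have j: "j < p" by simp
  show "L2_le M (%y. g j (snd y j)) (254 * ((real N)\<^sup>2 / (real (K j))\<^sup>2) + 4 * ((off j)\<^sup>2 / real (K j)))"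
  by (rule L2_le_law[OF _ vars_laws(2)[OF j] _ g_moments(1)]) simp_all
  show "expectation (%y. g j (snd y j)) = 0" using e[OF j] by (simp add: has_bochner_integral_iff)
 qed simp
qed

text \<open>The term of the total is bounded in second moment and in mean by absolute constants,
  whatever \<open>n\<close> and \<open>p\<close> are; for large \<open>p\<close> it disappears on
  the scale \<open>sqrt f\<close>. Being subtracted, it costs at most 39 in the lower bound for the
  mean.\<close>

lemma H_moments: "L2_le M H 127" "0 <= expectation H" "expectation H <= 39"
proof -
 have "L2_le M H 127 & 0 <= expectation H & expectation H <= 39"
 proof (cases "d = 0")
  case False
  then have "H = (%_. 0)" by (auto simp: H_def)
  then show ?thesis using L2_le_mono[OF L2_le_const[of 0], of 127] by simp
 next
  case True
  define q where "q = p * N"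
  have q4: "q > 4" using p0 N_pos(2) unfolding q_def by (cases p) auto
  have q: "real q > 0" "real q = real p * real N" using p0 N_pos(1) by (simp_all add: q_def)
  let ?S = "%y. (SUM j<p. snd y j) + W y"
  have law: "distr M borel ?S = chi2 q" using total_law[OF True] by (simp add: q_def)
  have e: "entr (real q) c = real q * (c / real q - 1 - ln (c / real q))" for c
  using q(1) by (simp add: entr_def right_diff_distrib)
  have H: "H = (%y. entr (real q) (?S y))" unfolding H_def[abs_def] q(2) using True by simp
  have "L2_le (chi2 q) (entr (real q)) ((real q)\<^sup>2 * (127 / (real q)\<^sup>2))"
  unfolding e[abs_def] by (rule L2_le_scale[OF L2_le_chi2(4)[OF q4]])
  then have "L2_le (chi2 q) (entr (real q)) 127" using q(1) by simp
  then have 1: "L2_le M H 127" unfolding H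
  by (rule L2_le_law[OF _ law, rotated 2]) simp_all
  have "has_bochner_integral (chi2 q) (%c. c / real q - 1 - ln (c / real q)) (0 - \<epsilon> q)"
  using chi2_log_integrable[OF q4] unfolding \<epsilon>_def
  by (intro has_bochner_integral_diff chi2_centered_moments(1)[OF q4]) (simp add: has_bochner_integral_iff)
  then have "has_bochner_integral (chi2 q) (entr (real q)) (real q * (0 - \<epsilon> q))"
  unfolding e[abs_def] by (rule has_bochner_integral_mult_right)
  then have "has_bochner_integral M H (real q * (0 - \<epsilon> q))" unfolding H
  by (rule hbi_law[OF _ law, rotated]) simp_all
  then have E: "expectation H = - (real q * \<epsilon> q)" by (simp add: has_bochner_integral_iff)
  have "\<epsilon> q <= 0" using chi2_log_mean(1)[OF q4] by (simp add: \<epsilon>_def)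
  then have 2: "0 <= expectation H" unfolding E using q by (simp add: mult_nonneg_nonpos)
  have "real q * (- 1 / real q - 38 / (real q)\<^sup>2) <= real q * \<epsilon> q"
  unfolding \<epsilon>_def using chi2_log_mean(3)[OF q4] q by (intro mult_left_mono) auto
  moreover have "real q * (- 1 / real q - 38 / (real q)\<^sup>2) = - 1 - 38 / real q"
  using q(1) by (simp add: right_diff_distrib power2_eq_square del: of_nat_0_less_iff)
  moreover have "38 / real q <= 38" using q4 by (simp add: divide_le_eq)
  ultimately have "expectation H <= 39" unfolding E by linarith
  with 1 2 show ?thesis by blast
 qed
 then show "L2_le M H 127" "0 <= expectation H" "expectation H <= 39" by auto
qed

lemma W_moments:
 assumes "a > 0"
 shows "L2_le M (%y. W y - real a) (2 * real a)" "has_bochner_integral M (%y. W y - real a) 0"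
proof -
 show "L2_le M (%y. W y - real a) (2 * real a)"
  by (rule L2_le_law[OF _ vars_laws(1) _ L2_le_chi2_centered(1)[OF assms]]) simp_all
 have "has_bochner_integral (chi2 a) (%x. x - real a) (real a - real a)"
  using hbi_chi2_powers(1)[OF assms] by (intro has_bochner_integral_diff hbi_chi2_const) auto
 then have "has_bochner_integral (chi2 a) (%x. x - real a) 0" by simp
 from hbi_law[OF _ vars_laws(1) this] show "has_bochner_integral M (%y. W y - real a) 0" by simp
qed

text \<open>The centred parts of \<open>stat_split\<close> have mean 0, so the mean of the statistic
  is \<open>a + m\<close> less the mean of \<open>H\<close>; multiplication by \<open>r <= 1\<close>
  enlarges neither the variance bound nor the loss of 39.\<close>

lemma cov_shift_le:
 fixes r :: real
 assumes a0: "a > 0" and r: "0 <= r" "r <= 1"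
 defines "f \<equiv> a + excess_df T p" and "Dl \<equiv> expectation (%y. r * Y y) - real (a + excess_df T p)"
 shows "Dl\<^sup>2 <= 8 * ks_chi2 M (%y. r * Y y) f * ((8 * real a + 4 * VH + 254) + 2 * real f + Dl\<^sup>2)"
  and "Dl >= r * (real a + m) - real f - 39"
proof -
 have "L2_le M (%y. (W y - real a) + (SUM j<p. g j (snd y j)) - H y) (2 * (2 * (2 * real a) + 2 * VH) + 2 * 127)"
  by (intro L2_le_diff L2_le_add W_moments[OF a0] g_sum_moments H_moments)
 then have Z: "L2_le M (%y. Y y - (real a + m)) (8 * real a + 4 * VH + 254)"
 proof (rule L2_le_mono[OF L2_le_cong_AE])
  show "AE y in M. Y y - (real a + m) = (W y - real a) + (SUM j<p. g j (snd y j)) - H y"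
  using stat_split by eventually_elim simp
 qed (simp_all, measurable)
 have "L2_le M (%y. r * (Y y - (real a + m))) (r\<^sup>2 * (8 * real a + 4 * VH + 254))" by (rule L2_le_scale[OF Z])
 then have rZ: "L2_le M (%y. r * Y y - r * (real a + m)) (8 * real a + 4 * VH + 254)"
  unfolding right_diff_distrib[of r]
  by (rule L2_le_mono) (use r L2_le_nonneg[OF Z] in \<open>auto intro!: mult_left_le_one_le simp: power_le_one\<close>)
 have f: "f > 0" using a0 by (simp add: f_def)
 from mean_shift_le_ks_chi2_second_moment(2)[OF f rZ]
 show "Dl\<^sup>2 <= 8 * ks_chi2 M (%y. r * Y y) f * ((8 * real a + 4 * VH + 254) + 2 * real f + Dl\<^sup>2)"
  by (simp add: Dl_def f_def)
 have "has_bochner_integral M H (expectation H)"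
  using L2_le_integrable[OF H_moments(1)] by (simp add: has_bochner_integral_iff)
 moreover have "has_bochner_integral M (%_. real a + m) (real a + m)" by (simp add: has_bochner_integral_iff prob_space)
 ultimately have "has_bochner_integral M (%y. (real a + m) + ((W y - real a) + (SUM j<p. g j (snd y j)) - H y)) ((real a + m) + (0 + 0 - expectation H))"
  by (intro has_bochner_integral_add[OF _ has_bochner_integral_diff[OF has_bochner_integral_add[OF W_moments(2)[OF a0] g_sum_moments(2)]]])
 then have "expectation Y = (real a + m) + (0 + 0 - expectation H)"
  using stat_split by (subst integral_cong_AE[OF _ _ stat_split]) (auto simp: has_bochner_integral_iff)
 then have "expectation Y >= (real a + m) - 39" using H_moments by simp
 then have "r * ((real a + m) - 39) <= r * expectation Y" using r by (intro mult_left_mono) auto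
 moreover have "r * 39 <= 39" using r by simp
 ultimately show "Dl >= r * (real a + m) - real f - 39" by (simp add: Dl_def f_def algebra_simps)
qed

text \<open>\<open>W\<close> supplies only \<open>a\<close> of the \<open>f\<close> degrees of
  freedom. An independent chi-squared variable with the missing ones is adjoined on a product space;
  its fluctuation costs \<open>2 b\<close> in second moment, with \<open>b\<close> of order
  \<open>p\<close>, which is small against \<open>f\<close> when \<open>p\<close> is large.\<close>

lemma cov_ks_le:
 fixes r :: real
 assumes a0: "a > 0" and b0: "excess_df T p > 0" and r: "0 <= r" "r <= 1" and et: "et > 0"
 defines "f \<equiv> a + excess_df T p"
 defines "s \<equiv> r * (real a + m) - real f"
 shows "ks_chi2 M (%y. r * Y y) f
  <= (16 * s\<^sup>2 + 32 * (1 - r)\<^sup>2 * real a + 8 * VH + 508 + 4 * real (excess_df T p)) / (et\<^sup>2 * real f) + (4 * et + 5 * sqrt et)"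
proof -
 define b where "b = excess_df T p"
 define P where "P = M \<Otimes>\<^sub>M chi2 b"
 interpret B: prob_space "chi2 b" by (rule prob_space_chi2)
 interpret MB: pair_prob_space M "chi2 b" ..
 interpret P: prob_space P unfolding P_def by (rule MB.prob_space_axioms)
 have fstP: "distr P M fst = M" unfolding P_def by (rule B.distr_pair_fst)
 have fm [measurable]: "fst : measurable P M" by (simp add: P_def)
 have sm [measurable]: "snd : borel_measurable P" unfolding P_def by measurable
 have lift: "L2_le P (%om. Z (fst om)) v" if "L2_le M Z v" for Z v
  using L2_le_distr[OF fm, of Z v] that by (simp add: fstP)
 have [measurable]: "(%om. W (fst om)) : borel_measurable P" "(%om. Y (fst om)) : borel_measurable P"
  by (rule measurable_compose[OF fm vars_measurable(1)], rule measurable_compose[OF fm vars_measurable(3)])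
 let ?Q = "%om. W (fst om) + snd om"
 have lawQ: "distr P borel ?Q = chi2 f"
 proof (rule measure_eqI)
  fix X assume "X : sets (distr P borel ?Q)"
  then have [measurable]: "X : sets borel" by simp
  have "emeasure (distr P borel ?Q) X = (\<integral>\<^sup>+om. indicator X (?Q om) \<partial>P)"
  by (subst nn_integral_indicator[symmetric], simp, subst nn_integral_distr) auto
  also have "... = (\<integral>\<^sup>+y. \<integral>\<^sup>+t. indicator X (W y + t) \<partial>chi2 b \<partial>M)"
  proof -
  have "(%om. indicator X (?Q om) :: ennreal) : borel_measurable (M \<Otimes>\<^sub>M chi2 b)" unfolding P_def[symmetric] by measurable
  then show ?thesis unfolding P_def by (subst B.nn_integral_fst[symmetric]) auto
  qed
  also have "... = (\<integral>\<^sup>+w. \<integral>\<^sup>+t. indicator X (w + t) \<partial>chi2 b \<partial>distr M borel W)"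
  by (subst nn_integral_distr) auto
  also have "... = (\<integral>\<^sup>+s. indicator X s \<partial>chi2 (a + b))" unfolding vars_laws(1) by (rule nn_integral_chi2_add) simp
  finally show "emeasure (distr P borel ?Q) X = emeasure (chi2 f) X" by (simp add: f_def b_def)
 qed simp
 have t: "L2_le P (%om. snd om - real b) (2 * real b)"
 proof (rule L2_le_law[OF sm _ _ L2_le_chi2_centered(1)])
  have "distr P borel snd = distr (M \<Otimes>\<^sub>M chi2 b) (chi2 b) snd" unfolding P_def by (rule distr_cong) auto
  also have "... = chi2 b"
  proof (rule measure_eqI)
  fix X assume "X : sets (distr (M \<Otimes>\<^sub>M chi2 b) (chi2 b) snd)"
  then have X: "X : sets (chi2 b)" by simp
  have "emeasure (distr (M \<Otimes>\<^sub>M chi2 b) (chi2 b) snd) X = emeasure (M \<Otimes>\<^sub>M chi2 b) (space M \<times> X)"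
  using X sets.sets_into_space[OF X] by (subst emeasure_distr) (auto intro!: arg_cong[where f = "emeasure (M \<Otimes>\<^sub>M chi2 b)"] simp: space_pair_measure)
  then show "emeasure (distr (M \<Otimes>\<^sub>M chi2 b) (chi2 b) snd) X = emeasure (chi2 b) X"
  using X emeasure_space_1 by (simp add: B.emeasure_pair_measure_Times)
  qed simp
  finally show "distr P borel snd = chi2 b" .
 qed (use b0 in \<open>simp_all add: b_def\<close>)
 \<comment> \<open>The difference between \<open>r Y\<close> and the coupled variable: the shift
   \<open>s\<close>, the loss \<open>1 - r\<close> on the fluctuation of \<open>W\<close>, the
   entropy fluctuations, \<open>H\<close>, and the adjoined variable about its mean.\<close>
 let ?Z = "%om. (((s - (1 - r) * (W (fst om) - real a)) + r * (SUM j<p. g j (snd (fst om) j))) - r * H (fst om)) - (snd om - real b)"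
 have "L2_le P ?Z (2 * (2 * (2 * (2 * s\<^sup>2 + 2 * ((1 - r)\<^sup>2 * (2 * real a))) + 2 * (r\<^sup>2 * VH)) + 2 * (r\<^sup>2 * 127)) + 2 * (2 * real b))"
  by (intro L2_le_diff L2_le_add L2_le_scale P.L2_le_const t
  lift[OF W_moments(1)[OF a0]] lift[OF g_sum_moments(1)] lift[OF H_moments(1)])
 then have Z: "L2_le P ?Z (16 * s\<^sup>2 + 32 * (1 - r)\<^sup>2 * real a + 8 * VH + 508 + 4 * real b)"
 proof (rule L2_le_mono)
  have r2: "r\<^sup>2 <= 1" using r by (simp add: power_le_one)
  have "r\<^sup>2 * VH <= 1 * VH" by (rule mult_right_mono[OF r2 L2_le_nonneg[OF g_sum_moments(1)]])
  moreover have "r\<^sup>2 * 127 <= 127" using r2 by simp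
  moreover define A B1 B2 where "A = (1 - r)\<^sup>2 * real a" and "B1 = r\<^sup>2 * VH" and "B2 = r\<^sup>2 * 127"
  moreover have "(1 - r)\<^sup>2 * (2 * real a) = 2 * A" "32 * (1 - r)\<^sup>2 * real a = 32 * A" by (simp_all add: A_def)
  ultimately have B: "B1 <= VH" "B2 <= 127" and e: "(1 - r)\<^sup>2 * (2 * real a) = 2 * A" "32 * (1 - r)\<^sup>2 * real a = 32 * A" by simp_all
  have "2 * (2 * (2 * (2 * s\<^sup>2 + 2 * (2 * A)) + 2 * B1) + 2 * B2) + 2 * (2 * real b) <= 16 * s\<^sup>2 + 32 * A + 8 * VH + 508 + 4 * real b"
  using B by (simp add: algebra_simps)
  then show "2 * (2 * (2 * (2 * s\<^sup>2 + 2 * ((1 - r)\<^sup>2 * (2 * real a))) + 2 * (r\<^sup>2 * VH)) + 2 * (r\<^sup>2 * 127)) + 2 * (2 * real b)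
  <= 16 * s\<^sup>2 + 32 * (1 - r)\<^sup>2 * real a + 8 * VH + 508 + 4 * real b" by (simp only: e B1_def B2_def)
 qed
 have split: "AE om in P. Y (fst om) = (real a + m) + ((W (fst om) - real a) + (SUM j<p. g j (snd (fst om) j)) - H (fst om))"
  by (rule AE_distrD[OF fm], unfold fstP, rule stat_split)
 have "L2_le P (%om. r * Y (fst om) - ?Q om) (16 * s\<^sup>2 + 32 * (1 - r)\<^sup>2 * real a + 8 * VH + 508 + 4 * real b)"
 proof (rule L2_le_cong_AE[OF Z])
  show "AE om in P. r * Y (fst om) - ?Q om = ?Z om"
  using split
  proof eventually_elim
  case (elim om)
  show ?case unfolding elim s_def f_def b_def by (simp add: algebra_simps)
  qed
 qed simp
 then have "ks_chi2 P (%om. r * Y (fst om)) f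
  <= (16 * s\<^sup>2 + 32 * (1 - r)\<^sup>2 * real a + 8 * VH + 508 + 4 * real b) / (et\<^sup>2 * real f) + (4 * et + 5 * sqrt et)"
  using a0 et by (intro P.ks_chi2_le_second_moment[OF _ _ lawQ]) (auto simp: f_def)
 moreover have "ks_chi2 (distr P M fst) (%y. r * Y y) f = ks_chi2 P (%om. r * Y (fst om)) f"
  by (rule ks_chi2_distr[OF fm]) simp
 ultimately show ?thesis by (simp add: fstP b_def)
qed

lemma phi_sum:
 fixes \<Psi> :: "real => real"
 shows "(SUM j<p. \<Psi> (off j)) = (SUM i<p. \<Psi> (real i + real d))"
proof -
 have "(SUM j<p. \<Psi> (off j)) = (SUM j<p. \<Psi> (real (p - Suc j) + real d))" by (rule sum.cong) (auto simp: off_eq)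
 also have "... = (SUM i<p. \<Psi> (real i + real d))" by (rule sum.nat_diff_reindex)
 finally show ?thesis .
qed

lemma \<phi>_eq: "j < p ==> \<phi> j = real N * (- ln (1 - off j / real N) - off j / real N)"
proof -
 assume j: "j < p"
 have "real (K j) / real N = 1 - off j / real N" using N_pos off_bounds(3)[OF j] by (simp add: field_simps)
 then show ?thesis unfolding \<phi>_def using N_pos by (simp only:) (simp add: right_diff_distrib)
qed

lemma off_ratio: assumes "j < p" shows "0 <= off j / real N" "off j / real N < 1"
 using off_bounds[OF assms] K6(3)[of j] N_pos by (auto simp: divide_less_eq)

lemma \<Phi>_nonneg: "0 <= (SUM j<p. \<phi> j)"
proof (rule sum_nonneg)
 fix j assume "j : {..<p}"
 then have j: "j < p" by simp
 define y where "y = off j / real N"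
 have y: "0 <= y" "y < 1" using off_ratio[OF j] by (auto simp: y_def)
 have "0 <= - ln (1 - y) - y"
  using neg_ln_one_minus_bounds(1)[OF y] zero_le_power[OF y(1), of 2] zero_le_power[OF y(1), of 3] zero_le_power[OF y(1), of 4] by linarith
 then show "0 <= \<phi> j" unfolding \<phi>_eq[OF j] y_def[symmetric] using N_pos by (intro mult_nonneg_nonneg) auto
qed

text \<open>The coefficients are \<open>1 / (i (i + 1))\<close> for \<open>i = 2, 3, 4\<close>, from
  summing the Taylor terms \<open>off^i / (i N^(i-1))\<close>. Bartlett's factor will cancel the
  first, the second decides the corrected shift, and the third outweighs the higher cross terms of
  that correction.\<close>

lemma \<Phi>_lower:
 defines "z \<equiv> real p / real N"
 shows "(SUM j<p. \<phi> j) >= (real p)\<^sup>2 * (z / 6 + z\<^sup>2 / 12 + z ^ 3 / 20) - (real p)\<^sup>2 / real N"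
proof -
 define R where "R = real N"
 have R: "R > 0" "R >= real p" "R >= 1" using N_pos by (auto simp: R_def)
 let ?F = "%x. x\<^sup>2 / (2 * R) + x ^ 3 / (3 * R\<^sup>2) + x ^ 4 / (4 * R ^ 3)"
 have "?F (off j) <= \<phi> j" if j: "j < p" for j
 proof -
  define y where "y = off j / R"
  have y: "0 <= y" "y < 1" "off j = R * y" using off_ratio[OF j] R by (auto simp: y_def R_def)
  have "R * (y\<^sup>2 / 2 + y ^ 3 / 3 + y ^ 4 / 4) <= R * (- ln (1 - y) - y)"
  using neg_ln_one_minus_bounds(1)[OF y(1,2)] R by (intro mult_left_mono) auto
  also have "R * (- ln (1 - y) - y) = \<phi> j" unfolding \<phi>_eq[OF j] y_def R_def ..
  also have "R * (y\<^sup>2 / 2 + y ^ 3 / 3 + y ^ 4 / 4) = ?F (R * y)"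
  using R by (simp add: field_simps eval_nat_numeral)
  finally show ?thesis by (simp only: y(3))
 qed
 then have "(SUM j<p. ?F (off j)) <= (SUM j<p. \<phi> j)" by (intro sum_mono) auto
 moreover have "(SUM i<p. ?F (real i)) <= (SUM i<p. ?F (real i + real d))"
  using R by (intro sum_mono add_mono divide_right_mono power_mono) auto
 moreover have "(SUM i<p. ?F (real i)) = (SUM i<p. real i ^ 2) / (2 * R) + (SUM i<p. real i ^ 3) / (3 * R\<^sup>2) + (SUM i<p. real i ^ 4) / (4 * R ^ 3)"
  by (simp add: sum.distrib sum_divide_distrib)
 moreover have "(real p ^ 3 / 3 - real p ^ 2 / 2) / (2 * R) + (real p ^ 4 / 4 - real p ^ 3 / 2) / (3 * R\<^sup>2) + (real p ^ 5 / 5 - real p ^ 4 / 2) / (4 * R ^ 3)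
  <= (SUM i<p. real i ^ 2) / (2 * R) + (SUM i<p. real i ^ 3) / (3 * R\<^sup>2) + (SUM i<p. real i ^ 4) / (4 * R ^ 3)"
  using power_sum_bounds[of p] R by (intro add_mono divide_right_mono) auto
 moreover have "(real p ^ 3 / 3 - real p ^ 2 / 2) / (2 * R) + (real p ^ 4 / 4 - real p ^ 3 / 2) / (3 * R\<^sup>2) + (real p ^ 5 / 5 - real p ^ 4 / 2) / (4 * R ^ 3)
  = (real p)\<^sup>2 * (z / 6 + z\<^sup>2 / 12 + z ^ 3 / 20) - (real p)\<^sup>2 / R * (1 / 4 + z / 6 + z\<^sup>2 / 8)"
  unfolding z_def R_def[symmetric] using R by (simp add: field_simps eval_nat_numeral)
 moreover have "(real p)\<^sup>2 / R * (1 / 4 + z / 6 + z\<^sup>2 / 8) <= (real p)\<^sup>2 / R * 1"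
 proof (rule mult_left_mono)
  have z: "0 <= z" "z <= 1" using R by (auto simp: z_def R_def[symmetric])
  then have "z\<^sup>2 <= 1" by (simp add: power_le_one)
  then show "1 / 4 + z / 6 + z\<^sup>2 / 8 <= 1" using z by linarith
 qed (use R in simp)
 ultimately show ?thesis using phi_sum[of ?F] by (simp add: R_def[symmetric])
qed

lemma \<Phi>_upper:
 assumes half: "2 * p <= n"
 shows "(SUM j<p. \<phi> j) <= real p ^ 3 / (6 * real N) + (real p)\<^sup>2 / real N + real p ^ 4 / (real N)\<^sup>2"
proof -
 define R where "R = real N"
 have R: "R > 0" "R >= real p" "R >= 1" using N_pos by (auto simp: R_def)
 let ?c = "real p ^ 3 / (3 * R\<^sup>2) + real p ^ 3 / (2 * R\<^sup>2)"
 have b: "\<phi> j <= (off j)\<^sup>2 / (2 * R) + ?c" if j: "j < p" for j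
 proof -
  define y where "y = off j / R"
  have y: "0 <= y" "y < 1" "off j = R * y" using off_ratio[OF j] R by (auto simp: y_def R_def)
  have "2 * off j <= R" unfolding R_def off_eq[OF j] using T N half n6 j by (auto simp: of_nat_diff)
  then have y2: "y <= 1 / 2" using R by (simp add: y_def field_simps)
  have yp: "y <= real p / R" using off_bounds(2)[OF j] R by (simp add: y_def divide_right_mono)
  have y3: "y ^ 3 <= (real p / R) ^ 3" using yp y by (intro power_mono) auto
  have y4: "y ^ 4 <= y ^ 3" using y power_decreasing[of 3 4 y] by simp
  have "- ln (1 - y) - y <= y\<^sup>2 / 2 + (real p / R) ^ 3 / 3 + (real p / R) ^ 3 / 2"
  using neg_ln_one_minus_bounds(2)[OF y(1,2) y2] y3 y4 by linarith
  then have "R * (- ln (1 - y) - y) <= R * (y\<^sup>2 / 2 + (real p / R) ^ 3 / 3 + (real p / R) ^ 3 / 2)"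
  using R by (intro mult_left_mono) auto
  also have "... = (R * y)\<^sup>2 / (2 * R) + ?c" using R by (simp add: field_simps eval_nat_numeral)
  finally show ?thesis unfolding \<phi>_eq[OF j] y(3)[symmetric] by (simp add: y_def R_def)
 qed
 have "(SUM j<p. \<phi> j) <= (SUM j<p. (off j)\<^sup>2 / (2 * R) + ?c)" using b by (intro sum_mono) auto
 also have "... = (SUM i<p. (real i + real d)\<^sup>2) / (2 * R) + real p * ?c"
  using phi_sum[of "%x. x\<^sup>2"] by (simp add: sum.distrib sum_divide_distrib[symmetric] distrib_left)
 also have "(SUM i<p. (real i + real d)\<^sup>2) <= (SUM i<p. (real i + 1)\<^sup>2)" using T by (intro sum_mono power_mono) auto
 also note power_sum_bounds(4)
 finally have "(SUM j<p. \<phi> j) <= (real p ^ 3 / 3 + real p ^ 2) / (2 * R) + real p * ?c" using R by (simp add: divide_right_mono)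
 also have "... = real p ^ 3 / (6 * R) + (real p)\<^sup>2 / R / 2 + 5 / 6 * (real p ^ 4 / R\<^sup>2)"
  using R by (simp add: field_simps eval_nat_numeral)
 also have "... <= real p ^ 3 / (6 * R) + (real p)\<^sup>2 / R + real p ^ 4 / R\<^sup>2"
 proof -
  have "A + B / 2 + 5 / 6 * C <= A + B + C" if "0 <= B" "0 <= C" for A B C :: real using that by linarith
  note this[of "(real p)\<^sup>2 / R" "real p ^ 4 / R\<^sup>2" "real p ^ 3 / (6 * R)"]
  then show ?thesis using R by (meson divide_nonneg_nonneg less_imp_le zero_le_power of_nat_0_le_iff)
 qed
 finally show ?thesis by (simp add: R_def)
qed

text \<open>Close to \<open>p = n\<close> only \<open>K j >= 6\<close> is at hand, which gives cubic
  growth. For \<open>2 p <= n\<close> every \<open>K j\<close> is at least \<open>N / 2\<close>, and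
  the bound divided by \<open>p^2\<close> is of order \<open>1 / p + p / n\<close>.\<close>

lemma VH_bounds:
 "VH <= 8 * real N ^ 3" "2 * p <= n ==> VH <= 1016 * real p + 8 * real p ^ 3 / real N"
proof -
 define R where "R = real N"
 have R: "R > 0" "R >= real p" "R >= 1" using N_pos by (auto simp: R_def)
 have "254 * (R\<^sup>2 / (real (K j))\<^sup>2) + 4 * ((off j)\<^sup>2 / real (K j)) <= 8 * R\<^sup>2" if j: "j < p" for j
 proof -
  have k2: "(real (K j))\<^sup>2 >= 6\<^sup>2" using K6(3)[of j] by (intro power_mono) auto
  have "R\<^sup>2 / (real (K j))\<^sup>2 <= R\<^sup>2 / 6\<^sup>2" using k2 K6(3)[of j] by (intro divide_left_mono mult_pos_pos zero_less_power) auto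
  moreover have "(off j)\<^sup>2 <= R\<^sup>2" using off_bounds[OF j] R by (intro power_mono) auto
  then have "(off j)\<^sup>2 / real (K j) <= R\<^sup>2 / 6" using K6(3)[of j] by (intro frac_le) auto
  moreover have "254 * X + 4 * Z <= 8 * Q" if "X <= Q / 6\<^sup>2" "Z <= Q / 6" "0 <= Q" for X Z Q :: real using that by simp
  moreover have "0 <= R\<^sup>2" by simp
  ultimately show ?thesis by meson
 qed
 then have "VH <= (SUM j<p. 8 * R\<^sup>2)" unfolding VH_def R_def[symmetric] by (intro sum_mono) auto
 also have "... = real p * (8 * R\<^sup>2)" by simp
 also have "... <= R * (8 * R\<^sup>2)" using R by (intro mult_right_mono) auto
 finally show "VH <= 8 * real N ^ 3" by (simp add: R_def power3_eq_cube power2_eq_square)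
 assume half: "2 * p <= n"
 have "254 * (R\<^sup>2 / (real (K j))\<^sup>2) + 4 * ((off j)\<^sup>2 / real (K j)) <= 1016 + 8 * (real p)\<^sup>2 / R" if j: "j < p" for j
 proof -
  have k: "R <= 2 * real (K j)" using half N_pos n6 by (auto simp: K_def R_def of_nat_diff)
  then have "R\<^sup>2 <= (2 * real (K j))\<^sup>2" using R by (intro power_mono) auto
  then have "R\<^sup>2 / (real (K j))\<^sup>2 <= 4" using K6(3)[of j] by (simp add: divide_le_eq power_mult_distrib)
  moreover have "(off j)\<^sup>2 <= (real p)\<^sup>2" using off_bounds[OF j] by (intro power_mono) auto
  then have "(off j)\<^sup>2 / real (K j) <= (real p)\<^sup>2 / (R / 2)" using k R by (intro frac_le) auto
  ultimately show ?thesis by simp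
 qed
 then have "VH <= (SUM j<p. 1016 + 8 * (real p)\<^sup>2 / R)" unfolding VH_def R_def[symmetric] by (intro sum_mono) auto
 also have "... = 1016 * real p + 8 * real p ^ 3 / R" using R by (simp add: field_simps power3_eq_cube power2_eq_square)
 finally show "VH <= 1016 * real p + 8 * real p ^ 3 / real N" by (simp add: R_def)
qed

text \<open>Each mean \<open>- N * \<epsilon> (K j)\<close> is compared with 1. The lower bound is
  uniform because \<open>K j <= N\<close> makes the leading term \<open>N / K j\<close> at least 1;
  the upper bound needs \<open>K j >= N / 2\<close>. Summing over \<open>p <= N\<close> coordinates
  keeps the errors of order \<open>1 / N\<close> bounded by constants.\<close>

lemma m_bounds:
 "m >= real p - 3 + (SUM j<p. \<phi> j)"
 "2 * p <= n ==> m <= real p + 152 + 2 * (real p)\<^sup>2 / real N + (SUM j<p. \<phi> j)"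
proof -
 define R where "R = real N"
 have R: "R >= 6" "R >= real p" "R > 0" using N_pos by (auto simp: R_def)
 have "1 - 3 / R <= - R * \<epsilon> (K j)" if j: "j < p" for j
 proof -
  define k where "k = real (K j)"
  have k: "k >= 6" "k <= R" using K6(3)[of j] off_bounds[OF j] by (auto simp: k_def R_def)
  have "\<epsilon> (K j) <= - 1 / k + 8 / (3 * k\<^sup>2)" using chi2_log_mean(2)[OF K6(2)[of j]] by (simp add: \<epsilon>_def k_def)
  then have "R * \<epsilon> (K j) <= R * (- 1 / k + 8 / (3 * k\<^sup>2))" using R by (intro mult_left_mono) auto
  moreover have "1 - 8 / (3 * R) <= R * (1 / k - 8 / (3 * k\<^sup>2))"
  proof -
  \<comment> \<open>At \<open>k = R\<close> the two sides to be compared agree. Their difference has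
    the factor \<open>R - k\<close>, and the cofactor is nonnegative because \<open>k\<close> and
    \<open>R\<close> are at least 6.\<close>
  have "(R - k) * (3 * R * k - 8 * (R + k)) >= 0"
  proof (rule mult_nonneg_nonneg)
  have "6 * R + 6 * k <= k * R + R * k" using k R by (intro add_mono mult_mono mult_right_mono) auto
  then have "8 * (R + k) <= 3 * (R * k)" using k R by (simp add: algebra_simps)
  then show "3 * R * k - 8 * (R + k) >= 0" by simp
  qed (use k in simp)
  moreover have "R * (1 / k - 8 / (3 * k\<^sup>2)) - (1 - 8 / (3 * R)) = (R - k) * (3 * R * k - 8 * (R + k)) / (3 * R * k\<^sup>2)"
  using k R by (simp add: field_simps power2_eq_square)
  moreover have "0 < 3 * R * k\<^sup>2" using k R by simp
  ultimately have "0 <= R * (1 / k - 8 / (3 * k\<^sup>2)) - (1 - 8 / (3 * R))" by (metis divide_nonneg_pos)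
  then show ?thesis by simp
  qed
  moreover have "R * (- 1 / k + 8 / (3 * k\<^sup>2)) = - (R * (1 / k - 8 / (3 * k\<^sup>2)))" by (simp add: algebra_simps)
  moreover have "8 / (3 * R) <= 3 / R" using R by (simp add: field_simps)
  ultimately show ?thesis by linarith
 qed
 then have "(SUM j<p. 1 - 3 / R) + (SUM j<p. \<phi> j) <= (SUM j<p. - R * \<epsilon> (K j)) + (SUM j<p. \<phi> j)" by (intro add_mono sum_mono) auto
 moreover have "(SUM j<p. - R * \<epsilon> (K j)) + (SUM j<p. \<phi> j) = m" unfolding m_def R_def by (rule sum.distrib[symmetric])
 moreover have "(SUM j<p. 1 - 3 / R) = real p - 3 * (real p / R)" by (simp add: right_diff_distrib)
 moreover have "real p / R <= 1" using R by simp
 ultimately show "m >= real p - 3 + (SUM j<p. \<phi> j)" by linarith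
 assume half: "2 * p <= n"
 have "- R * \<epsilon> (K j) <= 1 + 2 * real p / R + 152 / R" if j: "j < p" for j
 proof -
  define k where "k = real (K j)"
  have k: "k >= 6" "R <= 2 * k" "R <= k + real p"
  using K6(3)[of j] off_bounds[OF j] half N_pos n6 by (auto simp: k_def R_def K_def of_nat_diff)
  have "\<epsilon> (K j) >= - 1 / k - 38 / k\<^sup>2" using chi2_log_mean(3)[OF K6(2)[of j]] by (simp add: \<epsilon>_def k_def)
  then have "R * (- 1 / k - 38 / k\<^sup>2) <= R * \<epsilon> (K j)" using R by (intro mult_left_mono) auto
  then have "- R * \<epsilon> (K j) <= R / k + 38 * R / k\<^sup>2" by (simp add: algebra_simps)
  also have "R / k <= (k + real p) / k" using k by (intro divide_right_mono) auto
  also have "(k + real p) / k = 1 + real p / k" using k by (simp add: add_divide_distrib)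
  also have "real p / k <= real p / (R / 2)" using k R by (intro divide_left_mono) auto
  also have "38 * R / k\<^sup>2 <= 38 * R / (R / 2)\<^sup>2" using k R by (intro divide_left_mono power_mono mult_pos_pos zero_less_power) auto
  also have "38 * R / (R / 2)\<^sup>2 = 152 / R" using R by (simp add: field_simps power2_eq_square)
  finally show ?thesis by (simp add: mult.commute)
 qed
 then have "(SUM j<p. - R * \<epsilon> (K j)) + (SUM j<p. \<phi> j) <= (SUM j<p. 1 + 2 * real p / R + 152 / R) + (SUM j<p. \<phi> j)" by (intro add_mono sum_mono) auto
 moreover have "(SUM j<p. - R * \<epsilon> (K j)) + (SUM j<p. \<phi> j) = m" unfolding m_def R_def by (rule sum.distrib[symmetric])
 moreover have "(SUM j<p. 1 + 2 * real p / R + 152 / R) = real p + 2 * (real p)\<^sup>2 / R + 152 * (real p / R)"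
  by (simp add: algebra_simps power2_eq_square)
 moreover have "real p / R <= 1" using R by simp
 ultimately show "m <= real p + 152 + 2 * (real p)\<^sup>2 / real N + (SUM j<p. \<phi> j)" unfolding R_def by linarith
qed

lemma total_df_bounds:
 assumes "d = 0 --> p >= 2"
 shows "(real p)\<^sup>2 / 2 <= real (a + excess_df T p)" "real (a + excess_df T p) <= (real p)\<^sup>2 / 2 + 3 * real p / 2"
  "real (a + excess_df T p) <= 2 * (real p)\<^sup>2" "a > 0" "excess_df T p > 0"
  "real p - 1 <= real (excess_df T p)" "real (excess_df T p) <= real p"
proof -
 have f: "real (a + excess_df T p) = real p * (real p - 1) / 2 + real d * real p + (real p - 1 + real d)"
  using df_eq by simp
 have p1: "real p >= 1" "real p * real p >= 1 * real p" using p0 by (auto intro: mult_right_mono)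
 have p2: "d = 0 ==> real p >= 2" using assms by simp
 define F q where "F = real (a + excess_df T p)" and "q = (real p)\<^sup>2"
 have q: "q >= 1" "real p <= q" using p1 by (simp_all only: q_def one_le_power) (simp add: power2_eq_square)
 have "real p * (real p - 1) / 2 = q / 2 - real p / 2" by (simp add: q_def field_simps power2_eq_square)
 then have Fq: "F = q / 2 - real p / 2 + real d * real p + (real p - 1 + real d)" using f by (simp only: F_def)
 from T have "F = q / 2 + real p / 2 - 1 & real p >= 2 \<or> F = q / 2 + 3 * real p / 2"
 proof (elim disjE conjE)
  assume "d = 0"
  then have "real d = 0" "real p >= 2" using p2 by simp_all
  then have "F = q / 2 - real p / 2 + (real p - 1)" "real p >= 2" using Fq by simp_all
  then show ?thesis by (intro disjI1 conjI; linarith)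
 next
  assume "d = 1"
  then show ?thesis using Fq by simp
 qed
 then have "q / 2 <= F & F <= q / 2 + 3 * real p / 2 & F <= 2 * q"
  by (elim disjE conjE; intro conjI; use q p1(1) in linarith)
 then show "(real p)\<^sup>2 / 2 <= real (a + excess_df T p)"
  "real (a + excess_df T p) <= (real p)\<^sup>2 / 2 + 3 * real p / 2" "real (a + excess_df T p) <= 2 * (real p)\<^sup>2"
  unfolding F_def q_def by auto
 have "real a > 0"
 proof (cases "d = 0")
  case True
  then have "real p * (real p - 1) > 0" using p2 by (intro mult_pos_pos) auto
  then show ?thesis unfolding df_eq True by simp
 next
  case False
  then have "real d * real p > 0" "real p * (real p - 1) / 2 >= 0" using p1 by auto
  then show ?thesis unfolding df_eq by linarith
 qed
 then show "a > 0" by simp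
 show "real p - 1 <= real (excess_df T p)" "real (excess_df T p) <= real p" using df_eq T by auto
 show "excess_df T p > 0" using assms T p0 by (auto simp: excess_df_def)
qed

lemma cov_dataI:
 fixes r :: real
 assumes p2: "d = 0 --> p >= 2" and r: "0 <= r" "r <= 1"
 shows "cov_data T n p r (r * (real a + m) - real (a + excess_df T p))"
proof -
 note F = total_df_bounds[OF p2]
 define f where "f = real (a + excess_df T p)"
 define s where "s = r * (real a + m) - f"
 define D where "D = ks_chi2 M (%y. r * Y y) (a + excess_df T p)"
 define Dl where "Dl = expectation (%y. r * Y y) - f"
 define B where "B = (8 * real a + 4 * VH + 254) + 2 * f"
 have D: "D >= 0" unfolding D_def by (rule ks_chi2_nonneg)
 have p1: "real p >= 1" using p0 by simp
 then have p1: "real p >= 1" "(real p)\<^sup>2 >= 1" "real p <= (real p)\<^sup>2" by (simp_all only: one_le_power) (simp add: power2_eq_square)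
 have af: "real a <= f" by (simp add: f_def)
 have 1: "Dl\<^sup>2 <= 8 * D * (B + Dl\<^sup>2)" "Dl >= s - 39"
  using cov_shift_le[OF F(4) r] unfolding Dl_def D_def B_def s_def f_def by simp_all
 have "B <= 20 * (real p)\<^sup>2 + 254 * (real p)\<^sup>2 + 4 * VH" unfolding B_def using af F(3)[folded f_def] p1(2) by linarith
 note B = this
 have 2: "B <= 300 * (real p)\<^sup>2 + 32 * real n ^ 3"
 proof -
  have "real N ^ 3 <= real n ^ 3" using N_pos by (intro power_mono) auto
  then show ?thesis using B VH_bounds(1) p1 by linarith
 qed
 \<comment> \<open>The constants add up to \<open>274 + 4 * (1016 + 8) = 4370\<close>.\<close>
 have 3: "B <= 4400 * (real p)\<^sup>2" if half: "2 * p <= n"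
 proof -
  have "real p ^ 3 / real N = (real p)\<^sup>2 * (real p / real N)" by (simp add: power3_eq_cube power2_eq_square)
  moreover have "(real p)\<^sup>2 * (real p / real N) <= (real p)\<^sup>2 * 1" using N_pos by (intro mult_left_mono) auto
  ultimately have "real p ^ 3 / real N <= (real p)\<^sup>2" by (simp only: mult_1_right)
  moreover have "VH <= 1016 * real p + 8 * (real p ^ 3 / real N)" using VH_bounds(2)[OF half] by simp
  ultimately show ?thesis using B p1(2,3) by linarith
 qed
 have 4: "D <= (32 * (s / real p)\<^sup>2 + 32 * (1 - r)\<^sup>2 + 256 * (real p / real n) + 17280 / real p) / et\<^sup>2 + (4 * et + 5 * sqrt et)"
  if half: "2 * p <= n" and et: "et > 0" for et
 proof -
  define E where "E = 32 * (s / real p)\<^sup>2 + 32 * (1 - r)\<^sup>2 + 256 * (real p / real n) + 17280 / real p"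
  have x: "real p > 0" "f >= (real p)\<^sup>2 / 2" "f > 0" using p1 F(1,4) by (auto simp: f_def)
  have e1: "16 * s\<^sup>2 <= 32 * (s / real p)\<^sup>2 * f"
  proof -
  have "32 * (s / real p)\<^sup>2 * ((real p)\<^sup>2 / 2) <= 32 * (s / real p)\<^sup>2 * f" using x by (intro mult_left_mono) auto
  then show ?thesis using x by (simp add: power_divide)
  qed
  have e2: "32 * (1 - r)\<^sup>2 * real a <= 32 * (1 - r)\<^sup>2 * f" using af by (intro mult_left_mono) auto
  have e3: "8 * VH + 508 + 4 * real (excess_df T p) <= (256 * (real p / real n) + 17280 / real p) * f"
  proof -
  have "real p ^ 3 / real N <= 2 * (real p ^ 3 / real n)"
  proof -
  have "real p ^ 3 / real N <= real p ^ 3 / (real n / 2)" using N_pos by (intro divide_left_mono) auto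
  then show ?thesis by (simp add: mult.commute)
  qed
  then have "8 * VH + 508 + 4 * real (excess_df T p) <= 128 * (real p ^ 3 / real n) + 8128 * real p + 508 * real p + 4 * real p"
  using VH_bounds(2)[OF half] F(7) p1 by simp
  \<comment> \<open>\<open>256 = 2 * 128\<close> and \<open>17280 = 2 * (8128 + 508 + 4)\<close>;
    the doubling stems from \<open>f >= p^2 / 2\<close>.\<close>
  also have "... = (256 * (real p / real n) + 17280 / real p) * ((real p)\<^sup>2 / 2)"
  using x by (simp add: field_simps power2_eq_square power3_eq_cube)
  also have "... <= (256 * (real p / real n) + 17280 / real p) * f" using x by (intro mult_left_mono) auto
  finally show ?thesis .
  qed
  have num: "16 * s\<^sup>2 + 32 * (1 - r)\<^sup>2 * real a + 8 * VH + 508 + 4 * real (excess_df T p) <= E * f"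
  unfolding E_def distrib_right[of _ _ f] using e1 e2 e3[unfolded distrib_right[of _ _ f]] by linarith
  have "D <= (16 * s\<^sup>2 + 32 * (1 - r)\<^sup>2 * real a + 8 * VH + 508 + 4 * real (excess_df T p)) / (et\<^sup>2 * f) + (4 * et + 5 * sqrt et)"
  using cov_ks_le[OF F(4,5) r et] by (simp only: D_def s_def f_def)
  also have "... <= (E * f) / (et\<^sup>2 * f) + (4 * et + 5 * sqrt et)"
  using num x et by (intro add_right_mono divide_right_mono) auto
  also have "(E * f) / (et\<^sup>2 * f) = E / et\<^sup>2" using x by simp
  finally show ?thesis by (simp only: E_def)
 qed
 show ?thesis
  unfolding cov_data_def Let_def M_def[symmetric] Y_def[symmetric] a_def[symmetric] f_def[symmetric] s_def[symmetric] D_def[symmetric]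
  using D 1 2 3 4 by blast
qed

lemma mean_plus_bounds:
 assumes p2: "d = 0 --> p >= 2"
 defines "f \<equiv> real (a + excess_df T p)"
 shows "real a + m >= f - 3 + (SUM j<p. \<phi> j)"
  "2 * p <= n ==> real a + m <= f + 153 + 2 * ((real p)\<^sup>2 / real N) + (SUM j<p. \<phi> j)"
 using m_bounds total_df_bounds(6,7)[OF p2] by (simp_all add: f_def)

lemma ratio_N_n: "c >= 0 ==> c / real n <= c / real N" "c >= 0 ==> c / real N <= 2 * (c / real n)"
 "c >= 0 ==> c / (real n)\<^sup>2 <= c / (real N)\<^sup>2" "c >= 0 ==> c / (real N)\<^sup>2 <= 4 * (c / (real n)\<^sup>2)" for c :: real
proof -
 assume c: "c >= 0"
 have n: "real n > 0" using N_pos by linarith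
 show "c / real n <= c / real N" using N_pos n c by (intro divide_left_mono) auto
 have "c / real N <= c / (real n / 2)" using N_pos n c by (intro divide_left_mono) auto
 also have "c / (real n / 2) = 2 * (c / real n)" by (simp add: field_simps)
 finally show "c / real N <= 2 * (c / real n)" .
 show "c / (real n)\<^sup>2 <= c / (real N)\<^sup>2" using N_pos n c by (intro divide_left_mono power_mono mult_pos_pos zero_less_power) auto
 have "c / (real N)\<^sup>2 <= c / (real n / 2)\<^sup>2" using N_pos n c by (intro divide_left_mono power_mono mult_pos_pos zero_less_power) auto
 also have "c / (real n / 2)\<^sup>2 = 4 * (c / (real n)\<^sup>2)" using n by (simp add: field_simps power2_eq_square)
 finally show "c / (real N)\<^sup>2 <= 4 * (c / (real n)\<^sup>2)" .
qed

text \<open>Without correction the first Taylor term \<open>p^2 z / 6 = p^3 / (6 N)\<close> governs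
  the shift. The constants 2, 4 and 10 make room for the passage from \<open>N\<close> to
  \<open>n\<close>, where \<open>n <= 2 N\<close>.\<close>

lemma cov_wilks_data:
 assumes p2: "d = 0 --> p >= 2"
 shows "\<exists>s. cov_data T n p 1 s & s >= real p ^ 3 / real n / 6 - 2 * ((real p)\<^sup>2 / real n) - 3
  & (2 * p <= n --> \<bar>s\<bar> <= 4 * (real p ^ 3 / real n) + 10 * ((real p)\<^sup>2 / real n) + 154)"
proof (intro exI conjI impI)
 let ?s = "1 * (real a + m) - real (a + excess_df T p)"
 define x z where "x = (real p)\<^sup>2" and "z = real p / real N"
 have z: "0 <= z" "z <= 1" and x: "x >= 0" using N_pos by (auto simp: z_def x_def)
 have xz: "x * z = real p ^ 3 / real N" by (simp add: x_def z_def power2_eq_square power3_eq_cube)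
 show "cov_data T n p 1 ?s" by (rule cov_dataI[OF p2]) auto
 have "x * (z / 6) <= x * (z / 6 + z\<^sup>2 / 12 + z ^ 3 / 20)" using z x by (intro mult_left_mono) auto
 moreover have "(SUM j<p. \<phi> j) >= x * (z / 6 + z\<^sup>2 / 12 + z ^ 3 / 20) - x / real N" using \<Phi>_lower unfolding x_def z_def .
 moreover have "x * (z / 6) = real p ^ 3 / real N / 6" by (simp add: xz[symmetric])
 ultimately have "(SUM j<p. \<phi> j) >= real p ^ 3 / real N / 6 - x / real N" by linarith
 then show low: "?s >= real p ^ 3 / real n / 6 - 2 * ((real p)\<^sup>2 / real n) - 3"
  using mean_plus_bounds(1)[OF p2] ratio_N_n(1)[of "real p ^ 3"] ratio_N_n(2)[of x] x by (simp add: x_def)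
 assume half: "2 * p <= n"
 have "real p ^ 4 / (real N)\<^sup>2 = real p ^ 3 / real N * z" by (simp add: z_def eval_nat_numeral)
 also have "... <= real p ^ 3 / real N * 1" using z by (intro mult_left_mono) auto
 finally have "(SUM j<p. \<phi> j) <= real p ^ 3 / real N / 6 + x / real N + real p ^ 3 / real N"
  using \<Phi>_upper[OF half] by (simp add: x_def)
 then have "?s <= 153 + 3 * (x / real N) + 7 / 6 * (real p ^ 3 / real N)"
  using mean_plus_bounds(2)[OF p2 half] by (simp add: x_def)
 moreover have "x / real N <= 2 * (x / real n)" "real p ^ 3 / real N <= 2 * (real p ^ 3 / real n)" by (rule ratio_N_n(2); simp add: x)+
 moreover have "0 <= real p ^ 3 / real n" "0 <= x / real n" using x by auto
 moreover have "\<bar>S\<bar> <= 4 * E + 10 * D + 154"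
  if "S <= 153 + 3 * X + 7 / 6 * Y" "X <= 2 * D" "Y <= 2 * E" "0 <= E" "0 <= D" "E / 6 - 2 * D - 3 <= S" for S X Y D E :: real
  using that by (intro abs_leI; linarith)
 ultimately show "\<bar>?s\<bar> <= 4 * (real p ^ 3 / real n) + 10 * ((real p)\<^sup>2 / real n) + 154"
  using low unfolding x_def[symmetric] by blast
qed

text \<open>Both correction factors share the leading part \<open>p / (3 N)\<close>; they differ
  only in a remainder \<open>\<theta>\<close> between 0 and 1, so one computation serves both
  tests.\<close>

lemma bartlett_factor_cov:
 "\<exists>\<theta>. 0 <= \<theta> & \<theta> <= 1 & 1 - bartlett_factor T n p = (real p / 3 + \<theta>) / real N"
 using T
proof
 assume t: "T = Sphericity_Test & d = 0"
 then have Nn: "real N = real n - 1" using N n6 by (simp add: of_nat_diff)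
 have p1: "real p >= 1" using p0 by simp
 show ?thesis
 proof (intro exI conjI)
  show "0 <= 1 / 6 + 1 / (3 * real p)" "1 / 6 + 1 / (3 * real p) <= 1" using p1 by (auto simp: field_simps)
  show "1 - bartlett_factor T n p = (real p / 3 + (1 / 6 + 1 / (3 * real p))) / real N"
  using t p1 N_pos unfolding Nn by (simp add: field_simps power2_eq_square)
 qed
next
 assume t: "T = Mean_Cov_Test & d = 1"
 then have Nn: "real N = real n" using N n6 by simp
 have p1: "real p >= 1" using p0 by simp
 show ?thesis
 proof (intro exI conjI)
  show "0 <= (3 * real p + 11) / (6 * (real p + 3))" "(3 * real p + 11) / (6 * (real p + 3)) <= 1" using p1 by (auto simp: field_simps)
  have "real p / 3 + (3 * real p + 11) / (6 * (real p + 3)) = (2 * (real p)\<^sup>2 + 9 * real p + 11) / (6 * (real p + 3))"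
  using p1 by (simp add: field_simps power2_eq_square)
  then show "1 - bartlett_factor T n p = (real p / 3 + (3 * real p + 11) / (6 * (real p + 3))) / real N"
  using t unfolding Nn by (simp add: mult_ac)
 qed
qed

lemma bartlett_factor_cov_bounds: "0 <= bartlett_factor T n p" "bartlett_factor T n p <= 1"
 "1 - bartlett_factor T n p <= real p / real n + 2 / real n"
proof -
 obtain \<theta> where \<theta>: "0 <= \<theta>" "\<theta> <= 1" "1 - bartlett_factor T n p = (real p / 3 + \<theta>) / real N" using bartlett_factor_cov by blast
 have "0 <= (real p / 3 + \<theta>) / real N" using \<theta> N_pos by simp
 then show "bartlett_factor T n p <= 1" using \<theta>(3) by linarith
 have "(real p / 3 + \<theta>) / real N <= 1" using \<theta> N_pos by (simp add: divide_le_eq)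
 then show "0 <= bartlett_factor T n p" using \<theta>(3) by linarith
 have "(real p / 3 + \<theta>) / real N <= 2 * ((real p / 3 + \<theta>) / real n)" by (rule ratio_N_n(2)) (use \<theta> in simp)
 also have "... <= (real p + 2) / real n" using \<theta> by (simp add: divide_right_mono)
 finally show "1 - bartlett_factor T n p <= real p / real n + 2 / real n" using \<theta>(3) by (simp add: add_divide_distrib)
qed

text \<open>With \<open>z = p / N\<close>, the loss \<open>(1 - r) f\<close> is about
  \<open>(z / 3) (p^2 / 2)\<close> and cancels the leading term \<open>p^2 z / 6\<close>. At the
  next order \<open>z^2 / 12\<close> is reduced by \<open>(z / 3) (z / 6)\<close>, leaving
  \<open>p^2 z^2 / 36\<close>.\<close>

lemma cov_bartlett_data:
 assumes p2: "d = 0 --> p >= 2"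
 shows "\<exists>s. cov_data T n p (bartlett_factor T n p) s & s >= real p ^ 4 / (real n)\<^sup>2 / 36 - 10 * ((real p)\<^sup>2 / real n) - 3
  & (2 * p <= n --> \<bar>s\<bar> <= 4 * (real p ^ 4 / (real n)\<^sup>2) + 10 * ((real p)\<^sup>2 / real n) + 154)"
proof (intro exI conjI impI)
 define r where "r = bartlett_factor T n p"
 define f where "f = real (a + excess_df T p)"
 define \<Phi> where "\<Phi> = (SUM j<p. \<phi> j)"
 define x z e where "x = (real p)\<^sup>2" and "z = real p / real N" and "e = x / real N"
 obtain \<theta> where \<theta>: "0 <= \<theta>" "\<theta> <= 1" "1 - r = (real p / 3 + \<theta>) / real N" using bartlett_factor_cov by (auto simp: r_def)
 note r = bartlett_factor_cov_bounds(1,2)[folded r_def]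
 have z: "0 <= z" "z <= 1" and x: "x >= 0" "real p <= x" and e0: "e >= 0" and p1: "real p >= 1"
  using N_pos p0 by (auto simp: z_def x_def e_def power2_eq_square)
 have r': "1 - r = z / 3 + \<theta> / real N" using \<theta>(3) by (simp add: z_def add_divide_distrib)
 have xz2: "x * z\<^sup>2 = real p ^ 4 / (real N)\<^sup>2" by (simp add: x_def z_def power2_eq_square power4_eq_xxxx)
 have xz: "x * z = real p ^ 3 / real N" by (simp add: x_def z_def power2_eq_square power3_eq_cube)
 let ?s = "bartlett_factor T n p * (real a + m) - real (a + excess_df T p)"
 have s: "?s = r * (real a + m) - f" by (simp only: r_def f_def)
 show "cov_data T n p (bartlett_factor T n p) ?s" by (rule cov_dataI[OF p2 bartlett_factor_cov_bounds(1,2)])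
 have low': "?s >= x * z\<^sup>2 / 36 - 5 * e - 3"
 proof -
  define G where "G = z / 6 + z\<^sup>2 / 12 + z ^ 3 / 20"
  have zz: "z\<^sup>2 <= 1" "z ^ 3 <= 1" "z ^ 4 <= z ^ 3" "0 <= z ^ 3" "0 <= z ^ 4" "0 <= z\<^sup>2"
  using z by (auto simp: power_le_one intro!: power_decreasing)
  have G: "0 <= G" "G <= 1" unfolding G_def using zz z by (auto simp: G_def)
  have "\<Phi> >= x * G - e" using \<Phi>_lower by (simp add: \<Phi>_def x_def G_def z_def e_def)
  then have "r * (x * G - e) <= r * \<Phi>" using r by (intro mult_left_mono)
  moreover have "r * e <= e" using r e0 by (simp add: mult_left_le_one_le)
  moreover have "r * (x * G - e) = r * (x * G) - r * e" by (simp add: right_diff_distrib)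
  moreover have "r * (x * G) = x * (G - z / 3 * G) - \<theta> / real N * (x * G)"
  proof -
  have re: "r = 1 - (z / 3 + \<theta> / real N)" using r' by simp
  have "(1 - (A + B)) * (x * G) = x * (G - A * G) - B * (x * G)" for A B by (simp add: algebra_simps)
  then show ?thesis by (simp only: re)
  qed
  moreover have "\<theta> / real N * (x * G) <= 1 / real N * (x * 1)"
  using \<theta> G x N_pos by (intro mult_mono divide_right_mono) auto
  moreover have "1 / real N * (x * 1) = e" by (simp add: e_def)
  \<comment> \<open>The terms beyond second order may be dropped: \<open>1 / 20\<close> is larger
    than \<open>1 / 36 + 1 / 60\<close>, and \<open>z^4 <= z^3\<close>.\<close>
  moreover have "x * (z / 6 + z\<^sup>2 / 36) <= x * (G - z / 3 * G)"
  proof (rule mult_left_mono)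
  have "z / 3 * G = z\<^sup>2 / 18 + z ^ 3 / 36 + z ^ 4 / 60" unfolding G_def by (simp add: field_simps eval_nat_numeral)
  then show "z / 6 + z\<^sup>2 / 36 <= G - z / 3 * G" unfolding G_def using zz by linarith
  qed (rule x)
  ultimately have rPhi: "r * \<Phi> >= x * (z / 6 + z\<^sup>2 / 36) - 2 * e" by linarith
  have "(1 - r) * f <= (z / 3 + 1 / real N) * (x / 2 + 3 * real p / 2)"
  unfolding r' using total_df_bounds(2)[OF p2] \<theta> z N_pos x
  by (intro mult_mono add_mono divide_right_mono) (auto simp: f_def x_def)
  also have "... = x * (z / 6) + e / 2 + e / 2 + 3 / 2 * (real p / real N)"
  using N_pos by (simp add: x_def z_def e_def field_simps power2_eq_square)
  also have "real p / real N <= e" unfolding e_def using x N_pos by (intro divide_right_mono) auto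
  finally have rf: "(1 - r) * f <= x * (z / 6) + 5 / 2 * e" by simp
  have "r * (f - 3 + \<Phi>) <= r * (real a + m)"
  using mean_plus_bounds(1)[OF p2] r by (intro mult_left_mono) (auto simp: f_def \<Phi>_def)
  moreover have "r * (f - 3 + \<Phi>) - f = r * \<Phi> - (1 - r) * f - 3 * r" by (simp add: algebra_simps)
  moreover have "x * (z / 6 + z\<^sup>2 / 36) = x * (z / 6) + x * z\<^sup>2 / 36" by (simp add: distrib_left)
  ultimately show ?thesis unfolding s using rPhi rf r e0 by linarith
 qed
 have en: "e <= 2 * (x / real n)" unfolding e_def by (rule ratio_N_n(2)[OF x(1)])
 have q0: "real p ^ 4 >= 0" "0 <= real p ^ 4 / (real n)\<^sup>2" "0 <= x / real n" using x by auto
 show low: "?s >= real p ^ 4 / (real n)\<^sup>2 / 36 - 10 * ((real p)\<^sup>2 / real n) - 3"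
 proof -
  have "C / 36 - 10 * D - 3 <= S" if "B / 36 - 5 * e - 3 <= S" "e <= 2 * D" "C <= B" for B C D S :: real using that by linarith
  from this[OF low'[unfolded xz2] en ratio_N_n(3)[OF q0(1)]] show ?thesis by (simp only: x_def)
 qed
 assume half: "2 * p <= n"
 have "r * (real a + m) <= r * (f + 153 + 2 * e + \<Phi>)"
  using mean_plus_bounds(2)[OF p2 half] r by (intro mult_left_mono) (auto simp: f_def \<Phi>_def e_def x_def)
 also have "... = f - (1 - r) * f + r * (153 + 2 * e + \<Phi>)" by (simp add: algebra_simps)
 also have "r * (153 + 2 * e + \<Phi>) <= 153 + 2 * e + \<Phi>"
  using r e0 \<Phi>_nonneg by (intro mult_left_le_one_le) (auto simp: \<Phi>_def)
 also have "\<Phi> <= x * z / 6 + e + x * z\<^sup>2" using \<Phi>_upper[OF half] unfolding xz xz2 by (simp add: \<Phi>_def e_def x_def)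
 finally have up: "?s <= - ((1 - r) * f) + 153 + 3 * e + x * z / 6 + x * z\<^sup>2" unfolding s by simp
 have "z / 3 * (x / 2) <= (1 - r) * f" unfolding r'
  using total_df_bounds(1)[OF p2] \<theta> z N_pos x by (intro mult_mono) (auto simp: f_def x_def)
 then have "?s <= 153 + 3 * e + real p ^ 4 / (real N)\<^sup>2" using up xz2 by (simp add: mult.commute)
 then show "\<bar>?s\<bar> <= 4 * (real p ^ 4 / (real n)\<^sup>2) + 10 * ((real p)\<^sup>2 / real n) + 154"
 proof -
  assume up: "?s <= 153 + 3 * e + real p ^ 4 / (real N)\<^sup>2"
  have "\<bar>S\<bar> <= 4 * E + 10 * D + 154"
  if "S <= 153 + 3 * e + B" "e <= 2 * D" "B <= 4 * E" "0 <= E" "0 <= D" "E / 36 - 10 * D - 3 <= S" for B D E S :: real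
  using that by (intro abs_leI; linarith)
  from this[OF up en ratio_N_n(4)[OF q0(1)] q0(2,3) low[folded x_def]] show ?thesis by (simp only: x_def)
 qed
qed

end

section \<open>Fixed dimension: the limit law of the covariance statistics\<close>

lemma tendsto_zero_of_coupling_probs:
 fixes D :: "nat \<Rightarrow> real" and b :: "real \<Rightarrow> nat \<Rightarrow> real"
 assumes D0: "\<forall>\<^sub>F n in sequentially. D n \<ge> 0"
  and b: "\<And>et. 0 < et \<Longrightarrow> b et \<longlonglongrightarrow> 0"
  and le: "\<And>et. 0 < et \<Longrightarrow> \<forall>\<^sub>F n in sequentially. D n \<le> b et n + (4 * et + 5 * sqrt et)"
 shows "D \<longlonglongrightarrow> 0"
proof (rule LIMSEQ_I)
 fix e :: real assume e: "e > 0"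
 define r where "r = min 1 (e / 18)"
 have r: "0 < r" "r <= 1" "9 * r <= e / 2" using e by (auto simp: r_def)
 have sm: "4 * r\<^sup>2 + 5 * sqrt (r\<^sup>2) <= e / 2"
  using r mult_left_le[of r r] real_sqrt_abs[of r] unfolding power2_eq_square by linarith
 have r2: "0 < r\<^sup>2" using r by simp
 have "EV n. b (r\<^sup>2) n < e / 2" by (rule order_tendstoD(2)[OF b[OF r2]]) (use e in simp)
 then have "EV n. norm (D n - 0) < e"
  using D0 le[OF r2]
 proof eventually_elim
  case (elim n)
  then have "D n < e" using sm by linarith
  with elim show ?case by simp
 qed
 then show "\<exists>no. \<forall>n\<ge>no. norm (D n - 0) < e" by (simp only: eventually_sequentially)
qed

lemma (in prob_space) prob_tail_tendsto_zero:
 fixes Z :: "nat \<Rightarrow> 'a \<Rightarrow> real"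
 assumes [measurable]: "\<And>n. Z n \<in> borel_measurable M" and lim: "AE om in M. (\<lambda>n. Z n om) \<longlonglongrightarrow> 0" and h: "h > 0"
 shows "(\<lambda>n. prob {om \<in> space M. \<bar>Z n om\<bar> \<ge> h}) \<longlonglongrightarrow> 0"
proof -
 have "(%n. expectation (indicator {om : space M. \<bar>Z n om\<bar> >= h})) ~~> expectation (%_. 0 :: real)"
 proof (rule integral_dominated_convergence[where w = "%_. 1"])
  show "AE om in M. (%n. indicator {om : space M. \<bar>Z n om\<bar> >= h} om) ~~> (0 :: real)"
  using lim
  proof eventually_elim
  case (elim om)
  have "(%n. \<bar>Z n om\<bar>) ~~> \<bar>0\<bar>" by (rule tendsto_rabs[OF elim])
  then have "EV n. \<bar>Z n om\<bar> < h" by (rule order_tendstoD(2)) (use h in simp)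
  then show ?case by (rule tendsto_eventually[OF eventually_mono]) (auto simp: indicator_def)
  qed
 qed auto
 then show ?thesis by simp
qed

text \<open>Deterministic, so that it can be applied pointwise to coupled variables. With
  \<open>u = v / sqrt R\<close> the cubic bounds for \<open>ln (1 + u)\<close> squeeze the value
  between \<open>v^2 / 2\<close> plus terms that vanish with \<open>u\<close>.\<close>

lemma entr_limit:
 fixes R v :: "nat => real"
 assumes R: "filterlim R at_top sequentially" and v: "v ~~> V"
 shows "(%n. entr (R n) (R n + sqrt (R n) * v n)) ~~> V\<^sup>2 / 2"
  and "EV n. R n + sqrt (R n) * v n > 0"
proof -
 define u where "u n = v n / sqrt (R n)" for n
 have "filterlim (%n. sqrt (R n)) at_top sequentially" by (rule filterlim_compose[OF sqrt_at_top R])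
 then have u: "u ~~> 0" unfolding u_def[abs_def]
  by (intro tendsto_divide_0[OF v] filterlim_at_top_imp_at_infinity)
 have R0: "EV n. R n > 0" using R by (simp add: filterlim_at_top_dense)
 have u1: "EV n. u n > - 1" by (rule order_tendstoD(1)[OF u]) simp
 let ?lo = "%n. (v n)\<^sup>2 / 2 - (v n)\<^sup>2 * u n / 3"
 let ?hi = "%n. (v n)\<^sup>2 / 2 - (v n)\<^sup>2 * u n / 3 + ((v n)\<^sup>2 * (u n)\<^sup>2 + (v n)\<^sup>2 * (u n)\<^sup>2 / (1 + u n)\<^sup>2) / 4"
 have ev: "EV n. R n + sqrt (R n) * v n > 0 & ?lo n <= entr (R n) (R n + sqrt (R n) * v n)
  & entr (R n) (R n + sqrt (R n) * v n) <= ?hi n"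
  using R0 u1
 proof eventually_elim
  case (elim n)
  have s: "sqrt (R n) * sqrt (R n) = R n" "sqrt (R n) > 0" using elim by simp_all
  have vu: "v n = sqrt (R n) * u n" using s(2) by (simp add: u_def)
  have c: "R n + sqrt (R n) * v n = R n * (1 + u n)" unfolding vu mult.assoc[symmetric] s(1) by (simp add: distrib_left)
  have E: "entr (R n) (R n * (1 + u n)) = R n * (u n - ln (1 + u n))"
  proof -
  have "R n * (1 + u n) / R n = 1 + u n" using elim by simp
  then show ?thesis unfolding entr_def by (simp only:) (simp add: algebra_simps)
  qed
  have v2: "(v n)\<^sup>2 = R n * (u n)\<^sup>2" unfolding vu power_mult_distrib using elim by simp
  have y: "1 + u n > 0" using elim by simp
  have "ln (1 + u n) <= u n - (u n)\<^sup>2 / 2 + u n ^ 3 / 3" using ln_le_cubic[OF y] by simp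
  then have "R n * ((u n)\<^sup>2 / 2 - u n ^ 3 / 3) <= R n * (u n - ln (1 + u n))" using elim by (intro mult_left_mono) auto
  then have lo: "?lo n <= R n * (u n - ln (1 + u n))" unfolding v2 by (simp add: algebra_simps power3_eq_cube power2_eq_square)
  have "u n - (u n)\<^sup>2 / 2 + u n ^ 3 / 3 - (u n ^ 4 + u n ^ 4 / (1 + u n)\<^sup>2) / 4 <= ln (1 + u n)" using ln_ge_cubic[OF y] by simp
  then have "R n * (u n - ln (1 + u n)) <= R n * ((u n)\<^sup>2 / 2 - u n ^ 3 / 3 + (u n ^ 4 + u n ^ 4 / (1 + u n)\<^sup>2) / 4)"
  using elim by (intro mult_left_mono) auto
  also have "... = ?hi n" unfolding v2 by (simp add: algebra_simps power4_eq_xxxx power3_eq_cube power2_eq_square)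
  finally show ?case using lo elim y unfolding c E by simp
 qed
 then show "EV n. R n + sqrt (R n) * v n > 0" by eventually_elim simp
 have lo: "?lo ~~> V\<^sup>2 / 2 - V\<^sup>2 * 0 / 3" by (intro tendsto_intros v u) simp_all
 have hi: "?hi ~~> V\<^sup>2 / 2 - V\<^sup>2 * 0 / 3 + (V\<^sup>2 * 0\<^sup>2 + V\<^sup>2 * 0\<^sup>2 / (1 + 0)\<^sup>2) / 4" by (intro tendsto_intros v u) simp_all
 show "(%n. entr (R n) (R n + sqrt (R n) * v n)) ~~> V\<^sup>2 / 2"
  by (rule tendsto_sandwich[of ?lo _ _ ?hi]) (use ev lo hi in \<open>auto elim!: eventually_mono\<close>)
qed

text \<open>Skorohod's representation turns the central limit theorem into pointwise convergence on
  one space. A chi-squared variable is an affine image of its normalised sum, so for each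
  \<open>k\<close> the law is exactly \<open>chi2 k\<close>, and limits of statistics reduce to
  calculus.\<close>

lemma chi2_normal_coupling:
 "\<exists>(\<Omega> :: real measure) G Gl. prob_space \<Omega> & (\<forall>k. G k : borel_measurable \<Omega>) & Gl : borel_measurable \<Omega>
  & distr \<Omega> borel Gl = std_normal_distribution
  & (\<forall>k>0. distr \<Omega> borel (%om. real k + sqrt (2 * real k) * G k om) = chi2 k)
  & (\<forall>x\<in>space \<Omega>. (%k. G k x) ~~> Gl x)"
proof -
 define C where "C = gauss (UNIV :: nat set)"
 interpret C: prob_space C unfolding C_def by (rule prob_space_gauss)
 have [measurable]: "(%om. om i) : borel_measurable C" for i
  unfolding C_def measurable_cong_sets[OF sets_gauss refl] by (rule measurable_component_singleton) simp
 define X where "X i om = (om i)\<^sup>2" for i :: nat and om :: "nat => real"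
 have X [measurable]: "X i : borel_measurable C" for i unfolding X_def[abs_def] by measurable
 have law: "distr C borel (%om. \<Sum>i\<in>I. X i om) = chi2 (card I)" if I: "finite I" for I
 proof -
  have m: "(%om. \<lambda>i\<in>I. om i) : measurable C (PiM I (%_. borel))" by (rule measurable_restrict) measurable
  have "distr C (gauss I) (%om. \<lambda>i\<in>I. om i) = gauss I"
  unfolding C_def gauss_def using distr_PiM_reindex[of UNIV "%_. std_normal_distribution" "%i. i" I] prob_space_std_normal by simp
  then have g: "distr C (PiM I (%_. borel)) (%om. \<lambda>i\<in>I. om i) = gauss I"
  by (metis distr_cong sets_gauss)
  have [measurable]: "(%x. \<Sum>i\<in>I. (x i)\<^sup>2) : borel_measurable (PiM I (%_. borel :: real measure))" by measurable
  have "chi2 (card I) = distr (gauss I) borel (%x. \<Sum>i\<in>I. (x i)\<^sup>2)" by (rule distr_gauss_sq_sum[OF I, symmetric])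
  also have "... = distr C borel (%om. \<Sum>i\<in>I. X i om)"
  unfolding g[symmetric] by (subst distr_distr[OF _ m]) (auto simp: comp_def X_def intro!: distr_cong sum.cong)
  finally show ?thesis by simp
 qed
 have coordlaw: "distr C borel (%om. om i) = std_normal_distribution" for i
 proof -
  have "distr C borel (%om. om i) = distr C std_normal_distribution (%om. om i)" by (rule distr_cong) auto
  also have "... = std_normal_distribution"
  unfolding C_def gauss_def by (rule distr_PiM_component) (auto intro: prob_space_std_normal)
  finally show ?thesis .
 qed
 have "C.indep_vars (%_. borel) (%i om. om i) UNIV"
 proof (subst C.indep_vars_iff_distr_eq_PiM')
  have "distr C (PiM UNIV (%_. borel)) (%x. \<lambda>i\<in>UNIV. x i) = distr C C (%x. x)"
  by (rule distr_cong) (auto simp: C_def)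
  also have "... = C" by (rule distr_id2) simp
  finally show "distr C (PiM UNIV (%_. borel)) (%x. \<lambda>i\<in>UNIV. x i) = PiM UNIV (%i. distr C borel (%om. om i))"
  unfolding coordlaw by (simp add: C_def gauss_def)
 qed auto
 then have ind: "C.indep_vars (%_. borel) X UNIV" unfolding X_def by (rule C.indep_vars_compose2) simp
 have law1: "distr C borel (X i) = chi2 1" for i using law[of "{i}"] by simp
 have one: "(1 :: nat) > 0" by simp
 note P1 = hbi_chi2_powers[OF one]
 have E1: "has_bochner_integral C (X i) 1" for i using hbi_law[OF X law1 P1(1)] by simp
 have E2: "has_bochner_integral C (%om. (X i om - 1)\<^sup>2) 2" for i
  using hbi_law[OF X law1 chi2_variance[OF one]] by simp
 have E3: "integrable C (%om. (X i om)\<^sup>2)" for i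
  using hbi_law[OF X law1 P1(2)] by (simp add: has_bochner_integral_iff)
 \<comment> \<open>The variance of a squared standard normal variable is 2, written as a square to
   match the form of the central limit theorem; then \<open>k + sqrt (2 k) * Z k\<close> is the sum
   of \<open>k\<close> squares.\<close>
 define Z where "Z k om = (SUM i<k. X i om - 1) / sqrt (real k * (sqrt 2)\<^sup>2)" for k om
 have Zm [measurable]: "Z k : borel_measurable C" for k unfolding Z_def[abs_def] by measurable
 have wc: "weak_conv_m (%k. distr C borel (Z k)) std_normal_distribution"
  unfolding Z_def[abs_def]
  by (rule C.central_limit_theorem[OF ind, where m = 1 and \<mu> = "chi2 1"])
  (use E1 E2 E3 law1 in \<open>auto simp: has_bochner_integral_iff\<close>)
 have rd: "real_distribution (distr C borel (Z k))" for k by (rule C.real_distribution_distr) simp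
 obtain \<Omega> :: "real measure" and G Gl where G: "prob_space \<Omega>" "!!k. G k : borel_measurable \<Omega>"
  "!!k. distr \<Omega> borel (G k) = distr C borel (Z k)" "Gl : measurable \<Omega> lborel" "distr \<Omega> borel Gl = std_normal_distribution"
  "!!x. x : space \<Omega> ==> (%k. G k x) ~~> Gl x"
  using Skorohod[OF rd real_dist_normal_dist wc] by blast
 have "distr \<Omega> borel (%om. real k + sqrt (2 * real k) * G k om) = chi2 k" if k: "k > 0" for k
 proof -
  note G(2)[measurable]
  let ?f = "%g. real k + sqrt (2 * real k) * g"
  have "distr \<Omega> borel (%om. ?f (G k om)) = distr (distr \<Omega> borel (G k)) borel ?f"
  by (subst distr_distr) (auto simp: comp_def)
  also have "... = distr C borel (%om. ?f (Z k om))" unfolding G(3) by (subst distr_distr) (auto simp: comp_def)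
  also have "(%om. ?f (Z k om)) = (%om. \<Sum>i\<in>{..<k}. X i om)"
  using k by (auto simp: Z_def sum_subtractf mult.commute)
  finally show ?thesis using law[of "{..<k}"] by simp
 qed
 then show ?thesis using G by (intro exI[of _ \<Omega>] exI[of _ G] exI[of _ Gl]) auto
qed

text \<open>A reflection moves the all-ones vector to the first axis; the squared sum divided by
  \<open>p\<close> becomes the square of the first coordinate, and the other \<open>p - 1\<close>
  squares remain.\<close>

lemma nn_integral_gauss_centered_sq_sum:
 assumes p: "p > 0" and [measurable]: "f : borel_measurable borel"
 shows "(\<integral>\<^sup>+x. f ((SUM j<p. (x j)\<^sup>2) - (SUM j<p. x j)\<^sup>2 / real p) \<partial>gauss {..<p}) = (\<integral>\<^sup>+s. f s \<partial>chi2 (p - 1))"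
proof -
 define v where "v = (%i::nat. 1 :: real)"
 define r where "r = sqrt (ip {..<p} v v)"
 define a where "a = (%i. v i - (if i = 0 then r else 0))"
 let ?H = "householder {..<p} a" and ?J = "{1..<p}"
 have r: "r = sqrt (real p)" by (simp add: r_def ip_def v_def)
 have IJ: "{0} \<inter> ?J = {}" "{0} \<union> ?J = {..<p}" using p by auto
 have Hm: "?H : measurable (PiM {..<p} (%_. borel)) (PiM {..<p} (%_. borel))"
  unfolding householder_def[abs_def] ip_def by (intro measurable_restrict) measurable
 have key: "(SUM j<p. (x j)\<^sup>2) - (SUM j<p. x j)\<^sup>2 / real p = (\<Sum>j\<in>?J. (?H x j)\<^sup>2)" for x
 proof -
  have "ip {..<p} x v = ip {..<p} (?H x) (?H v)" by (rule ip_householder[symmetric])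
  also have "... = (SUM i<p. ?H x i * (if i = 0 then r else 0))"
  unfolding ip_def using p by (intro sum.cong arg_cong2[where f = "(*)"] householder_maps[OF _ _ r_def a_def]) auto
  also have "... = (SUM i<p. if i = 0 then ?H x i * r else 0)" by (intro sum.cong) auto
  also have "... = ?H x 0 * r" using p by simp
  finally have "(SUM j<p. x j)\<^sup>2 = (?H x 0)\<^sup>2 * r\<^sup>2" by (simp add: ip_def v_def power_mult_distrib)
  then have 1: "(SUM j<p. x j)\<^sup>2 / real p = (?H x 0)\<^sup>2" using p by (simp add: r)
  have "(SUM j<p. (x j)\<^sup>2) = (SUM j<p. (?H x j)\<^sup>2)"
  using ip_householder[of "{..<p}" a x x] by (simp add: ip_def power2_eq_square)
  also have "... = (?H x 0)\<^sup>2 + (\<Sum>j\<in>?J. (?H x j)\<^sup>2)" unfolding IJ(2)[symmetric] by (subst sum.union_disjoint) auto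
  finally show ?thesis using 1 by simp
 qed
 have m: "(\<Sum>j\<in>?J. (merge {0} ?J (x, y) j)\<^sup>2) = (\<Sum>j\<in>?J. (y j)\<^sup>2)" for x y :: "nat => real"
  by (rule sum.cong) (auto simp: merge_def)
 have fm: "(%x. f (\<Sum>j\<in>?J. (x j)\<^sup>2)) : borel_measurable (PiM {..<p} (%_. borel))" by measurable
 have "(\<integral>\<^sup>+x. f ((SUM j<p. (x j)\<^sup>2) - (SUM j<p. x j)\<^sup>2 / real p) \<partial>gauss {..<p}) = (\<integral>\<^sup>+x. (%x. f (\<Sum>j\<in>?J. (x j)\<^sup>2)) (?H x) \<partial>gauss {..<p})"
  unfolding key ..
 also have "... = (\<integral>\<^sup>+x. f (\<Sum>j\<in>?J. (x j)\<^sup>2) \<partial>gauss {..<p})"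
 proof (rule nn_integral_gauss_isometry[OF _ Hm _ _ _ fm])
  fix x :: "nat => real"
  show "(\<Sum>i\<in>{..<p}. (?H x i)\<^sup>2) = (\<Sum>i\<in>{..<p}. (x i)\<^sup>2)"
  using ip_householder[of "{..<p}" a x x] by (simp add: ip_def power2_eq_square)
 qed (auto simp: householder_vadd householder_involution)
 also have "... = (\<integral>\<^sup>+x. f (\<Sum>j\<in>?J. (x j)\<^sup>2) \<partial>gauss ({0} \<union> ?J))" by (simp only: IJ(2))
 also have "... = (\<integral>\<^sup>+x. \<integral>\<^sup>+y. f (\<Sum>j\<in>?J. (merge {0} ?J (x, y) j)\<^sup>2) \<partial>gauss ?J \<partial>gauss {0 :: nat})"
  by (rule nn_integral_gauss_split) (use IJ fm in auto)
 also have "... = (\<integral>\<^sup>+x. \<integral>\<^sup>+y. f (\<Sum>j\<in>?J. (y j)\<^sup>2) \<partial>gauss ?J \<partial>gauss {0 :: nat})"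
  unfolding m ..
 also have "... = (\<integral>\<^sup>+y. f (\<Sum>j\<in>?J. (y j)\<^sup>2) \<partial>gauss ?J)" using prob_space.emeasure_space_1[OF prob_space_gauss[of "{0 :: nat}"]] by simp
 also have "... = (\<integral>\<^sup>+s. f s \<partial>chi2 (card ?J))" by (rule nn_integral_gauss_sq_sum) auto
 finally show ?thesis by simp
qed

text \<open>The reference space is realised for all \<open>n\<close> at once on \<open>P\<close>,
  the product of the law of \<open>w\<close> and \<open>p\<close> copies of the Skorohod space.
  There the statistic converges almost surely to a variable \<open>Q\<close> with the right
  chi-squared law, and the coupling bound applies with \<open>Q\<close>.\<close>

theorem fixed_dimension_limit:
 fixes r :: "nat => real"
 assumes T: "T ~= Mean_Test" and p: "p > 0" and r: "r ~~> 1" and df: "T = Sphericity_Test --> p >= 2"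
 shows "(%n. ks_chi2 (ref_space T n p) (%y. r n * ref_stat T n p y) (ref_df T p + excess_df T p)) ~~> 0"
proof -
 define d :: nat where "d = (if T = Sphericity_Test then 0 else 1)"
 have Td: "T = Sphericity_Test & d = 0 \<or> T = Mean_Cov_Test & d = 1" using T by (cases T) (auto simp: d_def)
 define a where "a = ref_df T p"
 define k where "k n j = n - p + j" for n j
 define N where "N n = n - 1 + d" for n :: nat
 obtain \<Omega> :: "real measure" and G Gl where G: "prob_space \<Omega>" "!!k. G k : borel_measurable \<Omega>" "Gl : borel_measurable \<Omega>"
  "distr \<Omega> borel Gl = std_normal_distribution"
  "!!k. k > 0 ==> distr \<Omega> borel (%om. real k + sqrt (2 * real k) * G k om) = chi2 k"
  "!!x. x : space \<Omega> ==> (%k. G k x) ~~> Gl x"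
  using chi2_normal_coupling by blast
 note G(2)[measurable] G(3)[measurable]
 interpret \<Omega>: prob_space \<Omega> by fact
 define B where "B = PiM {..<p} (%_. \<Omega>)"
 interpret B: prob_space B unfolding B_def by (rule prob_space_PiM) (rule G(1))
 interpret A: prob_space "chi2 a" by (rule prob_space_chi2)
 interpret AB: pair_prob_space "chi2 a" B ..
 define P where "P = chi2 a \<Otimes>\<^sub>M B"
 interpret P: prob_space P unfolding P_def by (rule AB.prob_space_axioms)
 have ps\<Omega>: "product_sigma_finite (%_::nat. \<Omega>)"
  by (simp add: product_sigma_finite_def prob_space_imp_sigma_finite[OF G(1)])
 \<comment> \<open>Exact chi-squared variables for every \<open>n\<close>, driven by the same point
   \<open>z\<close>; using one copy of \<open>\<Omega>\<close> for each coordinate makes them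
   independent.\<close>
 define X where "X n j z = real (k n j) + sqrt (2 * real (k n j)) * G (k n j) z" for n j z
 have [measurable]: "X n j : borel_measurable \<Omega>" for n j unfolding X_def[abs_def] by measurable
 define F where "F n = (%(w :: real, om). (w, \<lambda>j\<in>{..<p}. X n j (om j)))" for n
 \<comment> \<open>The candidate limit: every entropy term becomes the square of a standard normal
   variable, and for sphericity the term of the total removes the component along the all-ones
   direction.\<close>
 define Q where "Q = (%(w :: real, om). w + ((SUM j<p. (Gl (om j))\<^sup>2) - (if d = 0 then (SUM j<p. Gl (om j))\<^sup>2 / real p else 0)))"
 have Bc: "(%om. f (om j)) : borel_measurable B" if "f : borel_measurable \<Omega>" "j < p" for f :: "real => real" and j
  unfolding B_def using that by (intro measurable_compose[OF measurable_component_singleton]) auto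
 have Xr [measurable]: "(%om. \<lambda>j\<in>{..<p}. X n j (om j)) : measurable B (PiM {..<p} (%_. borel))" for n
  by (intro measurable_restrict Bc) auto
 have Gr [measurable]: "(%om. \<lambda>j\<in>{..<p}. Gl (om j)) : measurable B (PiM {..<p} (%_. borel))"
  by (intro measurable_restrict Bc) auto
 have Fm: "F n : measurable P (borel \<Otimes>\<^sub>M PiM {..<p} (%_. borel))" for n unfolding F_def P_def by measurable
 have Fm': "F n : measurable P (ref_space T n p)" for n
  using Fm by (simp add: measurable_cong_sets[OF refl sets_ref_space])
 define q where "q g = (SUM j<p. (g j)\<^sup>2) - (if d = 0 then (SUM j<p. g j)\<^sup>2 / real p else 0)" for g :: "nat => real"
 have qm [measurable]: "q : borel_measurable (PiM {..<p} (%_. borel))" unfolding q_def[abs_def] by measurable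
 have Qq: "Q y = fst y + q (\<lambda>j\<in>{..<p}. Gl (snd y j))" for y by (cases y) (simp add: Q_def q_def)
 have Qm [measurable]: "Q : borel_measurable P" unfolding Qq[abs_def] P_def by measurable
 have lawF: "distr P (ref_space T n p) (F n) = ref_space T n p" if n: "n > p" for n
 proof -
  define D where "D = bdiag p (n - 1 - p)"
  interpret D: prob_space D unfolding D_def by (rule prob_space_bdiag)
  have "distr B (PiM {..<p} (%j. chi2 (n - 1 - p + 1 + j))) (%om. \<lambda>j\<in>{..<p}. X n j (om j)) = PiM {..<p} (%j. chi2 (n - 1 - p + 1 + j))"
  unfolding B_def
  proof (rule distr_PiM_componentwise[OF _ ps\<Omega>])
  show "product_sigma_finite (%j. chi2 (n - 1 - p + 1 + j))"
  by (simp add: product_sigma_finite_def prob_space_imp_sigma_finite[OF prob_space_chi2])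
  fix j assume "j : {..<p}"
  show "X n j : measurable \<Omega> (chi2 (n - 1 - p + 1 + j))" by measurable
  have kk: "k n j = n - 1 - p + 1 + j" using n by (simp add: k_def)
  have "distr \<Omega> (chi2 (n - 1 - p + 1 + j)) (X n j) = distr \<Omega> borel (X n j)" by (rule distr_cong) auto
  also have "... = chi2 (k n j)" unfolding X_def[abs_def] by (rule G(5)) (simp add: kk)
  finally show "distr \<Omega> (chi2 (n - 1 - p + 1 + j)) (X n j) = chi2 (n - 1 - p + 1 + j)" by (simp only: kk)
  qed simp
  then have D1: "distr B D (%om. \<lambda>j\<in>{..<p}. X n j (om j)) = D" by (simp only: D_def bdiag_def)
  have Xr': "(%om. \<lambda>j\<in>{..<p}. X n j (om j)) : measurable B D"
  using Xr by (simp add: D_def measurable_cong_sets[OF refl sets_bdiag])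
  have i: "distr (chi2 a) (chi2 a) (%w. w) = chi2 a" by (rule distr_id2) simp
  have "sigma_finite_measure (distr B D (%om. \<lambda>j\<in>{..<p}. X n j (om j)))"
  unfolding D1 by (rule prob_space_imp_sigma_finite[OF D.prob_space_axioms])
  from pair_measure_distr[OF _ Xr' this, of "%w. w" "chi2 a" "chi2 a"]
  have "chi2 a \<Otimes>\<^sub>M D = distr P (chi2 a \<Otimes>\<^sub>M D) (F n)" unfolding D1 i F_def P_def by simp
  then show ?thesis by (simp only: ref_space_def a_def D_def)
 qed
 have lawQ: "distr P borel Q = chi2 (a + excess_df T p)"
 proof (rule measure_eqI)
  fix S assume "S : sets (distr P borel Q)"
  then have [measurable]: "S : sets borel" by simp
  have gl: "distr B (gauss {..<p}) (%om. \<lambda>j\<in>{..<p}. Gl (om j)) = gauss {..<p}"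
  unfolding B_def gauss_def
  proof (rule distr_PiM_componentwise[OF _ ps\<Omega>])
  show "product_sigma_finite (%_::nat. std_normal_distribution)"
  by (simp add: product_sigma_finite_def prob_space_imp_sigma_finite[OF prob_space_std_normal])
  have "distr \<Omega> std_normal_distribution Gl = distr \<Omega> borel Gl" by (rule distr_cong) auto
  then show "distr \<Omega> std_normal_distribution Gl = std_normal_distribution" using G(4) by simp
  qed simp_all
  have "emeasure (distr P borel Q) S = (\<integral>\<^sup>+y. indicator S (Q y) \<partial>P)"
  by (subst nn_integral_indicator[symmetric], simp, subst nn_integral_distr) auto
  also have "... = (\<integral>\<^sup>+w. \<integral>\<^sup>+om. indicator S (w + q (\<lambda>j\<in>{..<p}. Gl (om j))) \<partial>B \<partial>chi2 a)"
  unfolding P_def Qq by (subst B.nn_integral_fst[symmetric]) (auto, measurable)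
  also have "... = (\<integral>\<^sup>+w. \<integral>\<^sup>+g. indicator S (w + q g) \<partial>gauss {..<p} \<partial>chi2 a)"
  proof (rule nn_integral_cong)
  fix w :: real
  have m2: "(%g. indicator S (w + q g) :: ennreal) : borel_measurable (gauss {..<p})"
  unfolding measurable_cong_sets[OF sets_gauss refl] by measurable
  have m1: "(%om. \<lambda>j\<in>{..<p}. Gl (om j)) : measurable B (gauss {..<p})"
  using Gr by (simp add: measurable_cong_sets[OF refl sets_gauss])
  show "(\<integral>\<^sup>+om. indicator S (w + q (\<lambda>j\<in>{..<p}. Gl (om j))) \<partial>B) = (\<integral>\<^sup>+g. indicator S (w + q g) \<partial>gauss {..<p})"
  by (rule nn_integral_distr_eq[OF gl m1 m2])
  qed
  also have "... = (\<integral>\<^sup>+w. \<integral>\<^sup>+s. indicator S (w + s) \<partial>chi2 (excess_df T p) \<partial>chi2 a)"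
  proof (rule nn_integral_cong)
  fix w :: real
  have m: "(%s. indicator S (w + s) :: ennreal) : borel_measurable borel" by measurable
  show "(\<integral>\<^sup>+g. indicator S (w + q g) \<partial>gauss {..<p}) = (\<integral>\<^sup>+s. indicator S (w + s) \<partial>chi2 (excess_df T p))"
  proof (cases "d = 0")
  case True
  then have "T = Sphericity_Test" using Td by auto
  then show ?thesis using nn_integral_gauss_centered_sq_sum[OF p m] True by (simp add: q_def excess_df_def)
  next
  case False
  then have "T ~= Sphericity_Test" using Td by auto
  then show ?thesis using nn_integral_gauss_sq_sum[OF _ m, of "{..<p}"] False by (simp add: q_def excess_df_def)
  qed
  qed
  also have "... = (\<integral>\<^sup>+s. indicator S s \<partial>chi2 (a + excess_df T p))" by (rule nn_integral_chi2_add) simp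
  finally show "emeasure (distr P borel Q) S = emeasure (chi2 (a + excess_df T p)) S" by simp
 qed simp
 have Nlim: "filterlim (%n. real (N n)) at_top sequentially"
 proof (rule filterlim_at_top_mono[OF filterlim_tendsto_add_at_top[OF tendsto_const[of "- 1"] filterlim_real_sequentially]])
  show "EV n. - 1 + real n <= real (N n)" by (rule always_eventually) (auto simp: N_def)
 qed
 have klim: "filterlim (%n. k n j) at_top sequentially" for j
  unfolding filterlim_at_top
 proof
  fix Z
  show "EV n. Z <= k n j" using eventually_ge_at_top[of "Z + p"] by eventually_elim (simp add: k_def)
 qed
 have conv: "(%n. ref_stat T n p (F n (w, om))) ~~> Q (w, om)"
  if w: "w >= 0" and om: "!!j. j < p ==> om j : space \<Omega>" for w om
 proof -
  define g where "g j = Gl (om j)" for j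
  \<comment> \<open>Normalised by \<open>N\<close> instead of the mean \<open>k n j\<close>; these
    differ by an amount independent of \<open>n\<close>, which disappears after division by
    \<open>sqrt N\<close>. The limit carries a factor \<open>sqrt 2\<close>, whose square cancels
    the \<open>1 / 2\<close> of \<open>entr_limit\<close>.\<close>
  define v where "v j n = (X n j (om j) - real (N n)) / sqrt (real (N n))" for j n
  have N0: "EV n. real (N n) > 0" using Nlim unfolding filterlim_at_top_dense by blast
  have sN: "filterlim (%n. sqrt (real (N n))) at_infinity sequentially"
  by (intro filterlim_at_top_imp_at_infinity filterlim_compose[OF sqrt_at_top Nlim])
  have Ninf: "filterlim (%n. real (N n)) at_infinity sequentially" by (intro filterlim_at_top_imp_at_infinity Nlim)
  have v: "v j ~~> sqrt 2 * g j" if j: "j < p" for j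
  proof -
  define i where "i = real p - 1 - real j + real d"
  have kN: "EV n. real (N n) > 0 & real (k n j) = real (N n) - i"
  using N0 eventually_ge_at_top[of "p + 1"] by eventually_elim (auto simp: k_def N_def i_def of_nat_diff)
  have "(%n. - (i / sqrt (real (N n))) + sqrt 2 * sqrt (1 - i / real (N n)) * G (k n j) (om j)) ~~> - 0 + sqrt 2 * sqrt (1 - 0) * Gl (om j)"
  by (intro tendsto_intros tendsto_divide_0[OF tendsto_const sN] tendsto_divide_0[OF tendsto_const Ninf] filterlim_compose[OF G(6)[OF om[OF j]] klim])
  then have "(%n. - (i / sqrt (real (N n))) + sqrt 2 * sqrt (1 - i / real (N n)) * G (k n j) (om j)) ~~> sqrt 2 * g j"
  by (simp add: g_def)
  moreover have "EV n. - (i / sqrt (real (N n))) + sqrt 2 * sqrt (1 - i / real (N n)) * G (k n j) (om j) = v j n"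
  using kN
  proof eventually_elim
  case (elim n)
  have "1 - i / real (N n) = real (k n j) / real (N n)" using elim by (simp add: field_simps)
  then have "sqrt 2 * sqrt (1 - i / real (N n)) = sqrt (2 * real (k n j)) / sqrt (real (N n))"
  by (simp add: real_sqrt_mult real_sqrt_divide)
  moreover have "v j n = (- i + sqrt (2 * real (k n j)) * G (k n j) (om j)) / sqrt (real (N n))"
  using elim by (simp add: v_def X_def)
  ultimately show ?case by (simp add: add_divide_distrib diff_divide_distrib)
  qed
  ultimately show ?thesis by (rule Lim_transform_eventually)
  qed
  have Xv: "EV n. \<forall>j\<in>{..<p}. X n j (om j) = real (N n) + sqrt (real (N n)) * v j n"
  using N0 by eventually_elim (auto simp: v_def)
  have ent: "(%n. entr (real (N n)) (real (N n) + sqrt (real (N n)) * v j n)) ~~> (g j)\<^sup>2" if "j < p" for j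
  using entr_limit(1)[OF Nlim v[OF that]] by (simp add: power_mult_distrib)
  have pos: "EV n. \<forall>j\<in>{..<p}. real (N n) + sqrt (real (N n)) * v j n > 0"
  by (rule eventually_ball_finite) (use entr_limit(2)[OF Nlim v] in auto)
  \<comment> \<open>The total in the same normalisation around \<open>p N\<close>; the contribution
    of \<open>w\<close> vanishes in the limit.\<close>
  define V where "V n = ((SUM j<p. v j n) + w / sqrt (real (N n))) / sqrt (real p)" for n
  have Vlim: "V ~~> ((SUM j<p. sqrt 2 * g j) + 0) / sqrt (real p)" unfolding V_def[abs_def]
  by (intro tendsto_intros v tendsto_divide_0[OF tendsto_const sN]) (use p in auto)
  have pN: "filterlim (%n. real p * real (N n)) at_top sequentially"
  by (rule filterlim_tendsto_pos_mult_at_top[OF tendsto_const _ Nlim]) (use p in simp)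
  have "(((SUM j<p. sqrt 2 * g j) + 0) / sqrt (real p))\<^sup>2 / 2 = (SUM j<p. g j)\<^sup>2 / real p"
  using p by (simp add: power_divide power_mult_distrib flip: sum_distrib_left)
  then have entH: "(%n. entr (real p * real (N n)) (real p * real (N n) + sqrt (real p * real (N n)) * V n)) ~~> (SUM j<p. g j)\<^sup>2 / real p"
  using entr_limit(1)[OF pN Vlim] by simp
  have lim: "(%n. w + (SUM j<p. entr (real (N n)) (real (N n) + sqrt (real (N n)) * v j n))
  - (if d = 0 then entr (real p * real (N n)) (real p * real (N n) + sqrt (real p * real (N n)) * V n) else 0))
  ~~> w + (SUM j<p. (g j)\<^sup>2) - (if d = 0 then (SUM j<p. g j)\<^sup>2 / real p else 0)"
  by (cases "d = 0") (simp_all, (intro tendsto_intros ent entH; simp)+)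
  have "EV n. w + (SUM j<p. entr (real (N n)) (real (N n) + sqrt (real (N n)) * v j n))
  - (if d = 0 then entr (real p * real (N n)) (real p * real (N n) + sqrt (real p * real (N n)) * V n) else 0)
  = ref_stat T n p (F n (w, om))"
  using N0 Xv pos eventually_ge_at_top[of "p + 6"]
  proof eventually_elim
  case (elim n)
  let ?x = "\<lambda>j\<in>{..<p}. X n j (om j)"
  have x: "?x j = real (N n) + sqrt (real (N n)) * v j n" if "j < p" for j using elim that by simp
  have st: "ref_stat T n p (w, ?x) = w + (SUM j<p. entr (real (N n)) (?x j))
  - (if d = 0 then entr (real p * real (N n)) ((SUM j<p. ?x j) + w) else 0)"
  by (rule scaled_stat_decomposition[OF Td p _ N_def _ w]) (use elim x in auto)
  have s1: "(SUM j<p. entr (real (N n)) (?x j)) = (SUM j<p. entr (real (N n)) (real (N n) + sqrt (real (N n)) * v j n))"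
  using x by (intro sum.cong) auto
  have "(SUM j<p. ?x j) = (SUM j<p. real (N n) + sqrt (real (N n)) * v j n)" using x by (intro sum.cong) auto
  also have "... = real p * real (N n) + sqrt (real (N n)) * (SUM j<p. v j n)" by (simp add: sum.distrib sum_distrib_left)
  finally have "(SUM j<p. ?x j) + w = real p * real (N n) + (sqrt (real (N n)) * (SUM j<p. v j n) + w)" by simp
  also have "sqrt (real (N n)) * (SUM j<p. v j n) + w = sqrt (real p * real (N n)) * V n"
  proof -
  have "sqrt (real p * real (N n)) * V n = sqrt (real (N n)) * (sqrt (real p) * V n)" by (simp add: real_sqrt_mult)
  also have "sqrt (real p) * V n = (SUM j<p. v j n) + w / sqrt (real (N n))" using p by (simp add: V_def)
  finally show ?thesis using elim(1) by (simp add: distrib_left)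
  qed
  finally have s2: "(SUM j<p. ?x j) + w = real p * real (N n) + sqrt (real p * real (N n)) * V n" .
  show ?case unfolding F_def prod.case st s1 s2 ..
  qed
  then have "(%n. ref_stat T n p (F n (w, om))) ~~> w + (SUM j<p. (g j)\<^sup>2) - (if d = 0 then (SUM j<p. g j)\<^sup>2 / real p else 0)"
  by (rule Lim_transform_eventually[OF lim])
  then show ?thesis by (simp add: Q_def g_def[abs_def] add_diff_eq split: if_splits)
 qed
 define Z where "Z n y = r n * ref_stat T n p (F n y) - Q y" for n y
 have Ym [measurable]: "(%y. r n * ref_stat T n p (F n y)) : borel_measurable P" for n
  by (intro borel_measurable_times measurable_compose[OF Fm measurable_ref_stat]) simp
 have Zm [measurable]: "Z n : borel_measurable P" for n unfolding Z_def[abs_def] by measurable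
 have wpos: "AE y in P. fst y >= 0"
 proof (rule AE_distrD[of fst P "chi2 a"])
  show "fst : measurable P (chi2 a)" unfolding P_def by measurable
  show "AE x in distr P (chi2 a) fst. 0 <= x" unfolding P_def B.distr_pair_fst by (rule AE_chi2_nonneg)
 qed
 have "AE y in P. (%n. Z n y) ~~> 0"
  using wpos AE_space
 proof eventually_elim
  case (elim y)
  obtain w om where y: "y = (w, om)" by (cases y)
  have "om j : space \<Omega>" if "j < p" for j using elim that by (auto simp: y P_def B_def space_pair_measure space_PiM PiE_iff)
  then have c: "(%n. ref_stat T n p (F n y)) ~~> Q y" using conv[of w om] elim by (simp add: y)
  have "(%n. Z n y) ~~> 1 * Q y - Q y" unfolding Z_def by (intro tendsto_intros c r)
  then show ?case by simp
 qed
 note Z0 = P.prob_tail_tendsto_zero[OF Zm this]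
 have f0: "a + excess_df T p > 0" using p df by (auto simp: excess_df_def)
 have s0: "sqrt (real (a + excess_df T p)) > 0" using f0 by (simp only: real_sqrt_gt_0_iff of_nat_0_less_iff)
 define K where "K n = ks_chi2 (ref_space T n p) (%y. r n * ref_stat T n p y) (a + excess_df T p)" for n
 have "K ~~> 0"
 proof (rule tendsto_zero_of_coupling_probs[where b = "%et n. P.prob {y : space P. \<bar>Z n y\<bar> >= et * sqrt (real (a + excess_df T p))}"])
  show "EV n. K n >= 0"
  unfolding K_def by (intro always_eventually allI prob_space.ks_chi2_nonneg prob_space_reference)
  show "(%n. P.prob {y : space P. \<bar>Z n y\<bar> >= et * sqrt (real (a + excess_df T p))}) ~~> 0" if "et > 0" for et
  by (rule Z0[OF mult_pos_pos[OF that s0]])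
  show "EV n. K n <= P.prob {y : space P. \<bar>Z n y\<bar> >= et * sqrt (real (a + excess_df T p))} + (4 * et + 5 * sqrt et)" if et: "et > 0" for et
  using eventually_gt_at_top[of p]
  proof eventually_elim
  case (elim n)
  have rm: "(%y. r n * ref_stat T n p y) : borel_measurable (ref_space T n p)"
  unfolding measurable_cong_sets[OF sets_ref_space refl] by measurable
  have "K n = ks_chi2 P (%y. r n * ref_stat T n p (F n y)) (a + excess_df T p)"
  unfolding K_def using ks_chi2_distr[OF Fm' rm] by (simp only: lawF[OF elim])
  also have "... <= P.prob {y : space P. \<bar>r n * ref_stat T n p (F n y) - Q y\<bar> >= et * sqrt (real (a + excess_df T p))} + (4 * et + 5 * sqrt et)"
  by (rule P.ks_chi2_coupling[OF Ym Qm lawQ f0 et])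
  finally show ?case by (simp only: Z_def)
  qed
 qed
 then show ?thesis by (simp only: K_def[abs_def] a_def)
qed

text \<open>The dimension may keep returning to small values. For given \<open>e\<close> a threshold
  \<open>P1\<close> is fixed beyond which \<open>K / p\<close> is harmless; below it there are only
  finitely many dimensions, each with its own limit, so one \<open>n\<close> works for all of
  them.\<close>

lemma tendsto_zero_of_large_and_fixed:
 fixes p :: "nat \<Rightarrow> nat" and E :: "nat \<Rightarrow> nat \<Rightarrow> real" and g :: "nat \<Rightarrow> real"
 assumes g: "g \<longlonglongrightarrow> 0" and K: "K \<ge> 0" and p: "\<forall>\<^sub>F n in sequentially. P\<^sub>0 \<le> p n"
  and D0: "\<forall>\<^sub>F n in sequentially. E (p n) n \<ge> 0"
  and le: "\<And>et. 0 < et \<Longrightarrow> \<forall>\<^sub>F n in sequentially. E (p n) n \<le> (g n + K / real (p n)) / et\<^sup>2 + (4 * et + 5 * sqrt et)"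
  and fixed: "\<And>P. P \<ge> P\<^sub>0 \<Longrightarrow> E P \<longlonglongrightarrow> 0"
 shows "(\<lambda>n. E (p n) n) \<longlonglongrightarrow> 0"
proof (rule LIMSEQ_I)
 fix e :: real assume e: "e > 0"
 define r where "r = min 1 (e / 18)"
 have r: "0 < r" "r <= 1" "9 * r <= e / 2" using e by (auto simp: r_def)
 have sm: "4 * r\<^sup>2 + 5 * sqrt (r\<^sup>2) <= e / 2"
  using r mult_left_le[of r r] real_sqrt_abs[of r] unfolding power2_eq_square by linarith
 have r2: "0 < r\<^sup>2" using r by simp
 define h where "h = e * (r\<^sup>2)\<^sup>2 / 4"
 have h: "h > 0" using e r by (simp add: h_def)
 obtain P1 :: nat where P1: "K / h < real P1" using reals_Archimedean2 by blast
 have "0 <= K / h" using K h by simp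
 then have P1': "real P1 > 0" using P1 by linarith
 have "EV n. \<forall>P\<in>{P\<^sub>0..<P1}. E P n < e"
  by (rule eventually_ball_finite) (use order_tendstoD(2)[OF fixed] e in auto)
 moreover have "EV n. g n < h" by (rule order_tendstoD(2)[OF g h])
 ultimately have "EV n. norm (E (p n) n - 0) < e"
  using p D0 le[OF r2]
 proof eventually_elim
  case (elim n)
  have "E (p n) n < e"
  proof (cases "p n < P1")
  case True
  then show ?thesis using elim by simp
  next
  case False
  have "K / real (p n) <= K / real P1" using False P1' K by (intro divide_left_mono) auto
  also have "... < h" using P1 P1' h by (simp add: divide_less_eq mult.commute)
  finally have "g n + K / real (p n) < 2 * h" using elim by linarith
  then have "(g n + K / real (p n)) / (r\<^sup>2)\<^sup>2 < 2 * h / (r\<^sup>2)\<^sup>2" using r2 by (intro divide_strict_right_mono) auto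
  also have "2 * h / (r\<^sup>2)\<^sup>2 = e / 2" using r2 by (simp add: h_def)
  finally show ?thesis using elim(5) sm by linarith
  qed
  with elim show ?case by simp
 qed
 then show "\<exists>no. \<forall>n\<ge>no. norm (E (p n) n - 0) < e" by (simp only: eventually_sequentially)
qed

text \<open>Counterpart of \<open>mean_criterion\<close> on the scale \<open>p\<close>. The
  correction \<open>rr\<close> depends on both \<open>n\<close> and the dimension, because
  sufficiency also considers it along constant dimensions. The constant \<open>1 / 72\<close> is
  half of \<open>1 / 36\<close>, the smaller of the two leading coefficients.\<close>

lemma cov_criterion:
 fixes p :: "nat \<Rightarrow> nat" and rr :: "nat \<Rightarrow> nat \<Rightarrow> real" and u s :: "nat \<Rightarrow> real"
 assumes T: "T \<noteq> Mean_Test" and pm: "\<forall>\<^sub>F n in sequentially. P\<^sub>0 \<le> p n" "P\<^sub>0 > 0" "T = Sphericity_Test \<Longrightarrow> P\<^sub>0 \<ge> 2"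
  and data: "\<forall>\<^sub>F n in sequentially. cov_data T n (p n) (rr n (p n)) (s n)
  \<and> (2 * p n \<le> n \<longrightarrow> \<bar>s n\<bar> \<le> real (p n) * (4 * u n + 10 * (real (p n) / real n)) + 154)"
  and u: "EV n. u n >= 0"
  and lower: "!!dl. dl > 0 ==> EV n. u n >= dl --> s n - 39 >= 1 / 72 * real (p n) * u n"
  and big: "EV n. n < 2 * p n --> real n ^ 3 <= 256 * (real (p n))\<^sup>2 * (u n)\<^sup>2"
  and half: "u ~~> 0 ==> EV n. 2 * p n <= n"
  and pn: "u ~~> 0 ==> (%n. real (p n) / real n) ~~> 0"
  and r1: "u ~~> 0 ==> (%n. rr n (p n)) ~~> 1"
  and rfix: "!!P. P >= P\<^sub>0 ==> (%n. rr n P) ~~> 1"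
 shows "(%n. ks_chi2 (ref_space T n (p n)) (%y. rr n (p n) * ref_stat T n (p n) y) (ref_df T (p n) + excess_df T (p n))) ~~> 0
  \<longleftrightarrow> u ~~> 0"
proof -
 define E where "E P n = ks_chi2 (ref_space T n P) (%y. rr n P * ref_stat T n P y) (ref_df T P + excess_df T P)" for P n
 have D0: "EV n. E (p n) n >= 0"
  unfolding E_def by (intro always_eventually allI prob_space.ks_chi2_nonneg prob_space_reference)
 have fixed: "E P ~~> 0" if "P >= P\<^sub>0" for P
  unfolding E_def[abs_def] by (rule fixed_dimension_limit[OF T _ rfix[OF that]]) (use that pm in auto)
 have suff: "(%n. E (p n) n) ~~> 0" if u0: "u ~~> 0"
 proof -
  define A where "A n = 4 * u n + 10 * (real (p n) / real n)" for n
  define g where "g n = 64 * (A n)\<^sup>2 + 32 * (1 - rr n (p n))\<^sup>2 + 256 * (real (p n) / real n)" for n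
  have "g ~~> 64 * (4 * 0 + 10 * 0)\<^sup>2 + 32 * (1 - 1)\<^sup>2 + 256 * 0"
  unfolding g_def[abs_def] A_def by (intro tendsto_intros u0 pn[OF u0] r1[OF u0])
  then have g: "g ~~> 0" by simp
  show ?thesis
  \<comment> \<open>\<open>1535104 = 17280 + 64 * 154^2\<close>: the constant part of the shift
    bound, squared, doubled and multiplied by 32, joins the variance term, all over
    \<open>p\<close>.\<close>
  proof (rule tendsto_zero_of_large_and_fixed[OF g, where K = 1535104, OF _ pm(1) D0 _ fixed])
  fix et :: real assume et: "et > 0"
  show "EV n. E (p n) n <= (g n + 1535104 / real (p n)) / et\<^sup>2 + (4 * et + 5 * sqrt et)"
  using data half[OF u0] pm(1)
  proof eventually_elim
  case (elim n)
  define x where "x = real (p n)"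
  have x: "x >= 1" using elim(3) pm(2) by (simp add: x_def)
  have s: "\<bar>s n\<bar> <= x * A n + 154" using elim by (simp add: x_def A_def)
  have "\<bar>s n / x\<bar> = \<bar>s n\<bar> / x" using x by simp
  also have "... <= (x * A n + 154) / x" using s x by (intro divide_right_mono) auto
  also have "... = A n + 154 / x" using x by (simp add: add_divide_distrib)
  finally have "\<bar>s n / x\<bar> <= \<bar>A n + 154 / x\<bar>" by linarith
  then have "(s n / x)\<^sup>2 <= (A n + 154 / x)\<^sup>2" by (simp only: abs_le_square_iff)
  also have "... <= 2 * (A n)\<^sup>2 + 2 * (154 / x)\<^sup>2" using sum_squares_bound[of "A n" "154 / x"] by (simp add: power2_sum)
  also have "(154 / x)\<^sup>2 <= 23716 / x"
  using x by (simp add: power2_eq_square divide_le_eq)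
  finally have sx: "(s n / x)\<^sup>2 <= 2 * (A n)\<^sup>2 + 2 * (23716 / x)" by linarith
  have "E (p n) n <= (32 * (s n / x)\<^sup>2 + 32 * (1 - rr n (p n))\<^sup>2 + 256 * (real (p n) / real n) + 17280 / x) / et\<^sup>2 + (4 * et + 5 * sqrt et)"
  using elim et unfolding cov_data_def Let_def E_def x_def by blast
  also have "... <= (g n + 1535104 / x) / et\<^sup>2 + (4 * et + 5 * sqrt et)"
  proof (intro add_right_mono divide_right_mono)
  have "17280 / x + 64 * (23716 / x) = 1535104 / x" by (simp add: add_divide_distrib[symmetric])
  then show "32 * (s n / x)\<^sup>2 + 32 * (1 - rr n (p n))\<^sup>2 + 256 * (real (p n) / real n) + 17280 / x <= g n + 1535104 / x"
  unfolding g_def using sx by linarith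
  qed simp
  finally show ?case by (simp only: x_def)
  qed
  qed simp_all
 qed
 define good where "good n Dl B \<longleftrightarrow> Dl\<^sup>2 <= 8 * E (p n) n * (B + Dl\<^sup>2) & Dl >= s n - 39
  & (2 * p n <= n --> B <= 4400 * (real (p n))\<^sup>2) & B <= 300 * (real (p n))\<^sup>2 + 32 * real n ^ 3" for n Dl B
 have ex: "EV n. \<exists>z. good n (fst z) (snd z)"
  using data
 proof eventually_elim
  case (elim n)
  then obtain Dl B where "good n Dl B" unfolding cov_data_def Let_def good_def E_def by blast
  then show ?case by (intro exI[of _ "(Dl, B)"]) simp
 qed
 \<comment> \<open>The mean shifts and moment bounds exist for each \<open>n\<close> separately;
   choice assembles them into sequences.\<close>
 define Dl B where "Dl n = fst (SOME z. good n (fst z) (snd z))" and "B n = snd (SOME z. good n (fst z) (snd z))" for n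
 have good: "EV n. good n (Dl n) (B n)"
  using ex
 proof eventually_elim
  case (elim n)
  from someI_ex[OF elim] show ?case by (simp only: Dl_def B_def)
 qed
 have nec: "u ~~> 0" if D: "(%n. E (p n) n) ~~> 0"
 \<comment> \<open>Any constant from \<open>300 + 32 * 256 = 8492\<close> on would do; it covers the
   crude moment bound, and with it the sharp one.\<close>
 proof (rule tendsto_zero_of_small_distance[OF D, where c = "1 / 72" and C = 13000 and Dl = Dl and B = B and s = "%n. (real (p n))\<^sup>2"])
  show "EV n. B n <= 13000 * (real (p n))\<^sup>2 * (1 + (u n)\<^sup>2)"
  using big good
  proof eventually_elim
  case (elim n)
  have nn: "0 <= (real (p n))\<^sup>2 * (u n)\<^sup>2" "0 <= (real (p n))\<^sup>2" by auto
  have e: "13000 * (real (p n))\<^sup>2 * (1 + (u n)\<^sup>2) = 13000 * (real (p n))\<^sup>2 + 13000 * ((real (p n))\<^sup>2 * (u n)\<^sup>2)" by (simp add: algebra_simps)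
  show ?case
  proof (cases "2 * p n <= n")
  case True
  then have "B n <= 4400 * (real (p n))\<^sup>2" using elim by (simp add: good_def)
  then show ?thesis using nn unfolding e by linarith
  next
  case False
  then have "real n ^ 3 <= 256 * ((real (p n))\<^sup>2 * (u n)\<^sup>2)" "B n <= 300 * (real (p n))\<^sup>2 + 32 * real n ^ 3"
  using elim by (simp_all add: good_def mult.assoc)
  then show ?thesis using nn unfolding e by linarith
  qed
  qed
  show "EV n. dl <= u n --> 1 / 72 * sqrt ((real (p n))\<^sup>2) * u n <= Dl n" if "dl > 0" for dl
  using lower[OF that] good by eventually_elim (auto simp: good_def)
  show "EV n. (Dl n)\<^sup>2 <= 8 * E (p n) n * (B n + (Dl n)\<^sup>2)"
  using good by eventually_elim (simp add: good_def)
  show "EV n. 0 < (real (p n))\<^sup>2" using pm(1) by eventually_elim (use pm(2) in simp)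
 qed (use u D0 in auto)
 show ?thesis using suff nec unfolding E_def by blast
qed

lemma cov_test_cases:
 assumes "T ~= Mean_Test"
 shows "T = Sphericity_Test & (if T = Sphericity_Test then 0 else 1 :: nat) = 0
  \<or> T = Mean_Cov_Test & (if T = Sphericity_Test then 0 else 1 :: nat) = 1"
 using assms by (cases T) auto

theorem cov_wilks:
 assumes T: "T ~= Mean_Test" and p: "EV n. 1 <= p n & p n + 1 < n"
  and p2: "T = Sphericity_Test --> (EV n. 2 <= p n)"
  and lim: "filterlim (%n. real n - real (p n)) at_top sequentially"
 shows "(%n. ks_chi2 (ref_space T n (p n)) (%y. 1 * ref_stat T n (p n) y) (ref_df T (p n) + excess_df T (p n))) ~~> 0
  \<longleftrightarrow> (%n. real (p n) / real n powr (1 / 2)) ~~> 0"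
proof -
 define P\<^sub>0 :: nat where "P\<^sub>0 = (if T = Sphericity_Test then 2 else 1)"
 have pm: "EV n. P\<^sub>0 <= p n" using p p2 by (auto simp: P\<^sub>0_def elim!: eventually_mono)
 define u where "u n = (real (p n))\<^sup>2 / real n" for n
 have "EV n. real n - real (p n) >= 6" using lim by (simp add: filterlim_at_top)
 then have ev: "EV n. 1 <= p n & p n + 6 <= n & P\<^sub>0 <= p n" using p pm by eventually_elim auto
 define good where "good n s \<longleftrightarrow> cov_data T n (p n) 1 s & s >= real (p n) ^ 3 / real n / 6 - 2 * ((real (p n))\<^sup>2 / real n) - 3
  & (2 * p n <= n --> \<bar>s\<bar> <= 4 * (real (p n) ^ 3 / real n) + 10 * ((real (p n))\<^sup>2 / real n) + 154)" for n s
 have "EV n. \<exists>s. good n s"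
  using ev
 proof eventually_elim
  case (elim n)
  show ?case unfolding good_def
  by (rule cov_wilks_data[OF cov_test_cases[OF T] _ _ refl]) (use elim in \<open>auto simp: P\<^sub>0_def split: if_splits\<close>)
 qed
 then have good: "EV n. good n (SOME s. good n s)" by eventually_elim (rule someI_ex)
 define s where "s n = (SOME s. good n s)" for n
 have cubic: "real (p n) ^ 3 / real n = real (p n) * u n" for n by (simp add: u_def power3_eq_cube power2_eq_square)
 have "(%n. ks_chi2 (ref_space T n (p n)) (%y. 1 * ref_stat T n (p n) y) (ref_df T (p n) + excess_df T (p n))) ~~> 0
  \<longleftrightarrow> u ~~> 0"
 proof (rule cov_criterion[where rr = "%_ _. 1" and s = s, OF T pm])
  show "EV n. cov_data T n (p n) 1 (s n)
  & (2 * p n <= n --> \<bar>s n\<bar> <= real (p n) * (4 * u n + 10 * (real (p n) / real n)) + 154)"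
  using good
  proof eventually_elim
  case (elim n)
  have "4 * (real (p n) ^ 3 / real n) + 10 * ((real (p n))\<^sup>2 / real n) = real (p n) * (4 * u n + 10 * (real (p n) / real n))"
  unfolding cubic by (simp add: distrib_left power2_eq_square)
  then show ?case using elim unfolding good_def s_def by simp
  qed
  show "EV n. dl <= u n --> 1 / 72 * real (p n) * u n <= s n - 39" if dl: "dl > 0" for dl
  proof -
  \<comment> \<open>\<open>p >= 48\<close> bounds the loss \<open>2 u\<close> by
    \<open>p u / 24\<close>; \<open>p >= 1008 / dl\<close> with \<open>1008 = 24 * 42\<close> bounds
    the additive errors \<open>39 + 3\<close> by another \<open>p u / 24\<close>.\<close>
  have "EV n. real (p n) ^ 2 >= dl * real n ^ 1 --> real (p n) ^ 1 >= (1008 / dl + 48) * real n ^ 0"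
  by (rule power_ratio_dichotomy) (use dl in \<open>auto intro: add_pos_pos\<close>)
  then show ?thesis
  using good ev
  proof eventually_elim
  case (elim n)
  show ?case
  proof
  assume ud: "dl <= u n"
  then have "dl * real n <= (real (p n))\<^sup>2" using elim(3) by (simp add: u_def pos_le_divide_eq)
  then have pl: "real (p n) >= 1008 / dl + 48" using elim(1) by simp
  have "1008 / dl > 0" using dl by simp
  then have p48: "real (p n) >= 48" "real (p n) >= 1008 / dl" using pl dl by linarith+
  have "48 * u n <= real (p n) * u n" using p48 ud dl by (intro mult_right_mono) auto
  moreover have "1008 / dl * dl <= real (p n) * u n" using p48 ud dl by (intro mult_mono) auto
  then have "1008 <= real (p n) * u n" using dl by simp
  moreover have "s n >= real (p n) * u n / 6 - 2 * u n - 3"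
  using elim(2)[folded s_def] unfolding good_def cubic u_def[symmetric] by blast
  moreover have "1 / 72 * real (p n) * u n = 1 / 72 * (real (p n) * u n)" by simp
  ultimately show "1 / 72 * real (p n) * u n <= s n - 39" by linarith
  qed
  qed
  qed
  show "EV n. n < 2 * p n --> real n ^ 3 <= 256 * (real (p n))\<^sup>2 * (u n)\<^sup>2"
  using ev
  proof eventually_elim
  case (elim n)
  show ?case
  proof
  assume "n < 2 * p n"
  then have "real n ^ 6 <= (2 * real (p n)) ^ 6" by (intro power_mono) auto
  also have "... = 64 * real (p n) ^ 6" by (simp add: power_mult_distrib)
  finally have 1: "real n ^ 6 <= 64 * real (p n) ^ 6" .
  have "real n ^ 3 * (real n)\<^sup>2 = real n ^ 5" by (simp flip: power_add)
  also have "... <= real n ^ 6" using elim by (intro power_increasing) auto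
  also note 1
  also have "64 * real (p n) ^ 6 <= 256 * real (p n) ^ 6" by simp
  finally have "real n ^ 3 <= 256 * real (p n) ^ 6 / (real n)\<^sup>2" using elim by (simp add: pos_le_divide_eq)
  also have "... = 256 * (real (p n))\<^sup>2 * (u n)\<^sup>2" by (simp add: u_def eval_nat_numeral)
  finally show "real n ^ 3 <= 256 * (real (p n))\<^sup>2 * (u n)\<^sup>2" .
  qed
  qed
  show "EV n. 2 * p n <= n" if u0: "u ~~> 0"
  proof -
  have "EV n. u n < 1 / 4" by (rule order_tendstoD(2)[OF u0]) simp
  then show ?thesis
  using ev
  proof eventually_elim
  case (elim n)
  show ?case
  proof (rule ccontr)
  assume "\<not> 2 * p n <= n"
  then have "(real n)\<^sup>2 <= (2 * real (p n))\<^sup>2" by (intro power_mono) auto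
  moreover have "4 * (real (p n))\<^sup>2 < real n" using elim by (simp add: u_def pos_divide_less_eq)
  moreover have "real n <= (real n)\<^sup>2" using elim by (simp add: power2_eq_square)
  ultimately show False by (simp add: power_mult_distrib)
  qed
  qed
  qed
  show "(%n. real (p n) / real n) ~~> 0" if u0: "u ~~> 0"
  proof (rule tendsto_zero_le_power[OF u0, where m = 2])
  show "EV n. 0 <= real (p n) / real n & (real (p n) / real n)\<^sup>2 <= u n"
  using ev
  proof eventually_elim
  case (elim n)
  have "real n <= (real n)\<^sup>2" using elim by (simp add: power2_eq_square)
  then show ?case using elim unfolding u_def power_divide by (intro conjI divide_left_mono) auto
  qed
  qed simp
 qed (auto simp: P\<^sub>0_def u_def)
 also have "... \<longleftrightarrow> (%n. (real (p n) / real n powr (1 / 2)) ^ 2) ~~> 0"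
 proof (rule tendsto_cong)
  show "EV n. u n = (real (p n) / real n powr (1 / 2)) ^ 2"
  using ev
  proof eventually_elim
  case (elim n)
  have "(real n powr (1 / 2)) ^ 2 = real n" using elim by (simp add: powr_power)
  then show ?case by (simp add: power_divide u_def)
  qed
 qed
 also have "... \<longleftrightarrow> (%n. real (p n) / real n powr (1 / 2)) ~~> 0" by (rule tendsto_zero_power_iff) auto
 finally show ?thesis .
qed

theorem cov_bartlett:
 assumes T: "T ~= Mean_Test" and p: "EV n. 1 <= p n & p n + 1 < n"
  and p2: "T = Sphericity_Test --> (EV n. 2 <= p n)"
  and lim: "filterlim (%n. real n - real (p n)) at_top sequentially"
 shows "(%n. ks_chi2 (ref_space T n (p n)) (%y. bartlett_factor T n (p n) * ref_stat T n (p n) y) (ref_df T (p n) + excess_df T (p n))) ~~> 0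
  \<longleftrightarrow> (%n. real (p n) / real n powr (2 / 3)) ~~> 0"
proof -
 define P\<^sub>0 :: nat where "P\<^sub>0 = (if T = Sphericity_Test then 2 else 1)"
 have pm: "EV n. P\<^sub>0 <= p n" using p p2 by (auto simp: P\<^sub>0_def elim!: eventually_mono)
 define u where "u n = real (p n) ^ 3 / (real n)\<^sup>2" for n
 have "EV n. real n - real (p n) >= 6" using lim by (simp add: filterlim_at_top)
 then have ev: "EV n. 1 <= p n & p n + 6 <= n & P\<^sub>0 <= p n" using p pm by eventually_elim auto
 define good where "good n s \<longleftrightarrow> cov_data T n (p n) (bartlett_factor T n (p n)) s & s >= real (p n) ^ 4 / (real n)\<^sup>2 / 36 - 10 * ((real (p n))\<^sup>2 / real n) - 3
  & (2 * p n <= n --> \<bar>s\<bar> <= 4 * (real (p n) ^ 4 / (real n)\<^sup>2) + 10 * ((real (p n))\<^sup>2 / real n) + 154)" for n s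
 have "EV n. \<exists>s. good n s"
  using ev
 proof eventually_elim
  case (elim n)
  show ?case unfolding good_def
  by (rule cov_bartlett_data[OF cov_test_cases[OF T] _ _ refl]) (use elim in \<open>auto simp: P\<^sub>0_def split: if_splits\<close>)
 qed
 then have good: "EV n. good n (SOME s. good n s)" by eventually_elim (rule someI_ex)
 define s where "s n = (SOME s. good n s)" for n
 have quartic: "real (p n) ^ 4 / (real n)\<^sup>2 = real (p n) * u n" for n by (simp add: u_def power3_eq_cube power4_eq_xxxx)
 \<comment> \<open>Used twice: for the given dimensions when \<open>u\<close> tends to 0, and for
   constant ones.\<close>
 have factor_lim: "(%n. bartlett_factor T n (x n)) ~~> 1"
  if x: "EV n. 1 <= x n & x n + 6 <= n" and xn: "(%n. real (x n) / real n) ~~> 0" for x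
 proof -
  have "(%n. real (x n) / real n + 2 * (1 / real n)) ~~> 0 + 2 * 0" by (intro tendsto_intros xn lim_1_over_n)
  then have g: "(%n. real (x n) / real n + 2 * (1 / real n)) ~~> 0" by simp
  have "(%n. 1 - bartlett_factor T n (x n)) ~~> 0"
  proof (rule Lim_null_comparison[OF _ g])
  show "EV n. norm (1 - bartlett_factor T n (x n)) <= real (x n) / real n + 2 * (1 / real n)"
  using x
  proof eventually_elim
  case (elim n)
  then have x0: "x n > 0" and n6: "n >= x n + 6" by auto
  note b = bartlett_factor_cov_bounds[OF cov_test_cases[OF T] x0 n6 refl]
  then show ?case by simp
  qed
  qed
  then have "(%n. 1 - (1 - bartlett_factor T n (x n))) ~~> 1 - 0" by (intro tendsto_intros)
  then show ?thesis by simp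
 qed
 have "(%n. ks_chi2 (ref_space T n (p n)) (%y. bartlett_factor T n (p n) * ref_stat T n (p n) y) (ref_df T (p n) + excess_df T (p n))) ~~> 0
  \<longleftrightarrow> u ~~> 0"
 proof (rule cov_criterion[where rr = "bartlett_factor T" and s = s, OF T pm])
  have pn: "(%n. real (p n) / real n) ~~> 0" if u0: "u ~~> 0"
  proof (rule tendsto_zero_le_power[OF u0, where m = 3])
  show "EV n. 0 <= real (p n) / real n & (real (p n) / real n) ^ 3 <= u n"
  using ev
  proof eventually_elim
  case (elim n)
  have "(real n)\<^sup>2 <= real n ^ 3" using elim by (intro power_increasing) auto
  then show ?case using elim unfolding u_def power_divide by (intro conjI divide_left_mono) auto
  qed
  qed simp
  show "(%n. real (p n) / real n) ~~> 0" if "u ~~> 0" using pn[OF that] .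
  show "(%n. bartlett_factor T n (p n)) ~~> 1" if "u ~~> 0"
  by (rule factor_lim[OF eventually_mono[OF ev] pn[OF that]]) simp
  show "(%n. bartlett_factor T n P) ~~> 1" if P: "P\<^sub>0 <= P" for P
  proof (rule factor_lim)
  show "EV n. 1 <= P & P + 6 <= n"
  using eventually_ge_at_top[of "P + 6"] by eventually_elim (use P in \<open>auto simp: P\<^sub>0_def split: if_splits\<close>)
  show "(%n. real P / real n) ~~> 0" by (rule lim_const_over_n)
  qed
  show "EV n. cov_data T n (p n) (bartlett_factor T n (p n)) (s n)
  & (2 * p n <= n --> \<bar>s n\<bar> <= real (p n) * (4 * u n + 10 * (real (p n) / real n)) + 154)"
  using good
  proof eventually_elim
  case (elim n)
  have "4 * (real (p n) ^ 4 / (real n)\<^sup>2) + 10 * ((real (p n))\<^sup>2 / real n) = real (p n) * (4 * u n + 10 * (real (p n) / real n))"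
  unfolding quartic by (simp add: distrib_left power2_eq_square)
  then show ?case using elim unfolding good_def s_def by simp
  qed
  show "EV n. dl <= u n --> 1 / 72 * real (p n) * u n <= s n - 39" if dl: "dl > 0" for dl
  proof -
  \<comment> \<open>\<open>6048 = 144 * 42\<close> and \<open>1440 = 144 * 10\<close>: the additive
    errors \<open>39 + 3\<close> and the loss \<open>10 p^2 / n\<close> each take at most
    \<open>1 / 144\<close> of \<open>p u\<close>, together half of \<open>1 / 36\<close>.\<close>
  have d1: "EV n. real (p n) ^ 3 >= dl * real n ^ 2 --> real (p n) ^ 1 >= (6048 / dl) * real n ^ 0"
  by (rule power_ratio_dichotomy) (use dl in auto)
  have d2: "EV n. real (p n) ^ 3 >= dl * real n ^ 2 --> real (p n) ^ 2 >= 1440 * real n ^ 1"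
  by (rule power_ratio_dichotomy) (use dl in auto)
  show ?thesis
  using d1 d2 good ev
  proof eventually_elim
  case (elim n)
  show ?case
  proof
  assume ud: "dl <= u n"
  then have "dl * (real n)\<^sup>2 <= real (p n) ^ 3" using elim(4) by (simp add: u_def pos_le_divide_eq)
  then have pl: "real (p n) >= 6048 / dl" "(real (p n))\<^sup>2 >= 1440 * real n" using elim(1,2) by simp_all
  have "(real (p n))\<^sup>2 / real n >= 1440" using pl(2) elim(4) by (simp add: pos_le_divide_eq)
  \<comment> \<open>The square of \<open>p^2 / n\<close> is \<open>p u\<close>, so a large value of
    \<open>p^2 / n\<close> is itself small against \<open>p u\<close>.\<close>
  then have "1440 * ((real (p n))\<^sup>2 / real n) <= (real (p n))\<^sup>2 / real n * ((real (p n))\<^sup>2 / real n)" by (intro mult_right_mono) auto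
  also have "... = real (p n) * u n" unfolding quartic[symmetric] by (simp add: power4_eq_xxxx power2_eq_square)
  finally have "1440 * ((real (p n))\<^sup>2 / real n) <= real (p n) * u n" .
  moreover have "6048 / dl * dl <= real (p n) * u n" using pl ud dl by (intro mult_mono) auto
  then have "6048 <= real (p n) * u n" using dl by simp
  moreover have "s n >= real (p n) * u n / 36 - 10 * ((real (p n))\<^sup>2 / real n) - 3"
  using elim(3)[folded s_def] unfolding good_def quartic by blast
  moreover have "1 / 72 * real (p n) * u n = 1 / 72 * (real (p n) * u n)" by simp
  ultimately show "1 / 72 * real (p n) * u n <= s n - 39" by linarith
  qed
  qed
  qed
  show "EV n. n < 2 * p n --> real n ^ 3 <= 256 * (real (p n))\<^sup>2 * (u n)\<^sup>2"
  using ev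
  proof eventually_elim
  case (elim n)
  show ?case
  proof
  assume "n < 2 * p n"
  then have "real n ^ 8 <= (2 * real (p n)) ^ 8" by (intro power_mono) auto
  also have "... = 256 * real (p n) ^ 8" by (simp add: power_mult_distrib)
  finally have 1: "real n ^ 8 <= 256 * real (p n) ^ 8" .
  have "real n ^ 3 * real n ^ 4 = real n ^ 7" by (simp flip: power_add)
  also have "... <= real n ^ 8" using elim by (intro power_increasing) auto
  also note 1
  finally have "real n ^ 3 <= 256 * real (p n) ^ 8 / real n ^ 4" using elim by (simp add: pos_le_divide_eq)
  also have "... = 256 * (real (p n))\<^sup>2 * (u n)\<^sup>2" by (simp add: u_def eval_nat_numeral)
  finally show "real n ^ 3 <= 256 * (real (p n))\<^sup>2 * (u n)\<^sup>2" .
  qed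
  qed
  show "EV n. 2 * p n <= n" if u0: "u ~~> 0"
  proof -
  have "EV n. u n < 1 / 8" by (rule order_tendstoD(2)[OF u0]) simp
  then show ?thesis
  using ev
  proof eventually_elim
  case (elim n)
  show ?case
  proof (rule ccontr)
  assume "\<not> 2 * p n <= n"
  then have "real n ^ 3 <= (2 * real (p n)) ^ 3" by (intro power_mono) auto
  moreover have "8 * real (p n) ^ 3 < (real n)\<^sup>2" using elim by (simp add: u_def pos_divide_less_eq)
  moreover have "(real n)\<^sup>2 <= real n ^ 3" using elim by (intro power_increasing) auto
  ultimately show False by (simp add: power_mult_distrib)
  qed
  qed
  qed
 qed (auto simp: P\<^sub>0_def u_def)
 also have "... \<longleftrightarrow> (%n. (real (p n) / real n powr (2 / 3)) ^ 3) ~~> 0"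
 proof (rule tendsto_cong)
  show "EV n. u n = (real (p n) / real n powr (2 / 3)) ^ 3"
  using ev
  proof eventually_elim
  case (elim n)
  have "(real n powr (2 / 3)) ^ 3 = (real n)\<^sup>2" using elim by (simp add: powr_power)
  then show ?case by (simp add: power_divide u_def)
  qed
 qed
 also have "... \<longleftrightarrow> (%n. real (p n) / real n powr (2 / 3)) ~~> 0" by (rule tendsto_zero_power_iff) auto
 finally show ?thesis .
qed

section \<open>From the reference spaces back to the tests\<close>

lemma lrt_df_eq:
 assumes "p > 0"
 shows "lrt_df T p = real (if T = Mean_Test then p else ref_df T p + excess_df T p)"
proof -
 have g: "real (\<Sum>{..<p}) = real p * (real p - 1) / 2" for p :: nat
  by (induction p) (simp_all add: lessThan_Suc field_simps)
 show ?thesis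
  using g[of p] assms by (cases T) (simp_all add: excess_df_def of_nat_diff field_simps)
qed

lemma lrt_sup_eq:
 assumes "mvn_sample M n p \<mu> S X" "lrt_null T p \<mu> S" "p > 0" "n > p"
 shows "(SUP \<alpha>\<in>{0<..<1}. \<bar>\<P>(om in M. - 2 * r * ln (lrt_stat T n p (%i. X i om)) > chi_square_upper_quantile (lrt_df T p) \<alpha>) - \<alpha>\<bar>)
  = ks_chi2 (ref_space T n p) (%y. r * ref_stat T n p y) (if T = Mean_Test then p else ref_df T p + excess_df T p)"
 unfolding ks_chi2_def lrt_df_eq[OF assms(3)] using ref_tail[OF assms] by simp

theorem theorem1:
  fixes T :: lrt
    and p :: "nat \<Rightarrow> nat"
    and M :: "nat \<Rightarrow> 'w measure"
    and \<mu> :: "nat \<Rightarrow> real vec"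
    and S :: "nat \<Rightarrow> real mat"
    and X :: "nat \<Rightarrow> nat \<Rightarrow> 'w \<Rightarrow> nat \<Rightarrow> real"
  assumes "\<forall>n\<ge>3. 1 \<le> p n \<and> n > p n + 1"
    and "filterlim (\<lambda>n. real n - real (p n)) at_top sequentially"
    and "T = Sphericity_Test \<longrightarrow> (\<forall>\<^sub>F n in sequentially. 2 \<le> p n)"
    and "\<forall>n\<ge>3. mvn_sample (M n) n (p n) (\<mu> n) (S n) (X n)"
    and "\<forall>n\<ge>3. lrt_null T (p n) (\<mu> n) (S n)"
  shows
    "((\<lambda>n. SUP \<alpha>\<in>{0<..<1}.
        \<bar>\<P>(\<omega> in M n. - 2 * ln (lrt_stat T n (p n) (\<lambda>i. X n i \<omega>))
            > chi_square_upper_quantile (lrt_df T (p n)) \<alpha>) - \<alpha>\<bar>) \<longlonglongrightarrow> 0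
      \<longleftrightarrow> (\<lambda>n. real (p n) / real n powr wilks_exponent T) \<longlonglongrightarrow> 0)
   \<and> ((\<lambda>n. SUP \<alpha>\<in>{0<..<1}.
        \<bar>\<P>(\<omega> in M n. - 2 * bartlett_factor T n (p n) * ln (lrt_stat T n (p n) (\<lambda>i. X n i \<omega>))
            > chi_square_upper_quantile (lrt_df T (p n)) \<alpha>) - \<alpha>\<bar>) \<longlonglongrightarrow> 0
      \<longleftrightarrow> (\<lambda>n. real (p n) / real n powr bartlett_exponent T) \<longlonglongrightarrow> 0)"
proof -
 let ?df = "%n. if T = Mean_Test then p n else ref_df T (p n) + excess_df T (p n)"
 have ev3: "EV n. 3 <= n" by (rule eventually_ge_at_top)
 have p: "EV n. 1 <= p n & p n + 1 < n"
  using ev3 by eventually_elim (use assms(1) in auto)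
 \<comment> \<open>Left open in the sequence \<open>r\<close>, so that one reduction serves both
   \<open>r = 1\<close> and Bartlett's factor.\<close>
 have sup: "EV n. (SUP \<alpha>\<in>{0<..<1}.
  \<bar>\<P>(om in M n. - 2 * r n * ln (lrt_stat T n (p n) (%i. X n i om))
  > chi_square_upper_quantile (lrt_df T (p n)) \<alpha>) - \<alpha>\<bar>)
  = ks_chi2 (ref_space T n (p n)) (%y. r n * ref_stat T n (p n) y) (?df n)" for r
  using ev3 p
 proof eventually_elim
  case (elim n)
  show ?case by (rule lrt_sup_eq[where \<mu> = "\<mu> n" and S = "S n"]) (use assms(4,5) elim in auto)
 qed
 have wilks: "(%n. ks_chi2 (ref_space T n (p n)) (%y. 1 * ref_stat T n (p n) y) (?df n)) ~~> 0
  \<longleftrightarrow> (%n. real (p n) / real n powr wilks_exponent T) ~~> 0"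
 proof (cases "T = Mean_Test")
  case True
  then show ?thesis using mean_wilks[OF p assms(2)] by simp
 next
  case False
  then have e: "wilks_exponent T = 1 / 2" by (cases T) auto
  show ?thesis unfolding e using cov_wilks[OF False p assms(3,2)] False by (simp only: if_False)
 qed
 have bartlett: "(%n. ks_chi2 (ref_space T n (p n)) (%y. bartlett_factor T n (p n) * ref_stat T n (p n) y) (?df n)) ~~> 0
  \<longleftrightarrow> (%n. real (p n) / real n powr bartlett_exponent T) ~~> 0"
 proof (cases "T = Mean_Test")
  case True
  then show ?thesis using mean_bartlett[OF p assms(2)] by simp
 next
  case False
  then have e: "bartlett_exponent T = 2 / 3" by (cases T) auto
  show ?thesis unfolding e using cov_bartlett[OF False p assms(3,2)] False by (simp only: if_False)
 qed
 show ?thesis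
  using tendsto_cong[OF sup[of "%_. 1"], of 0] tendsto_cong[OF sup[of "%n. bartlett_factor T n (p n)"], of 0] wilks bartlett
  by simp
qed

end
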